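(* Let $\mathcal H(E)$ be a de Branges space whose phase function $\phi$ satisfies $\phi'\in L^\infty(\mathbb R)$, $$\sup_{x\in\mathbb R}\frac{|\phi(2x)|}{|\phi(x)|+1}<\infty,$$ and, for some constant $c>0$, $\left|\frac{\phi'(a)}{\phi'(b)}\right|\le c$ whenever $\frac12\le\frac{\phi(a)}{\phi(b)}\le 2$. Let $\Lambda\subset\mathbb R$ be such that $\{K_\lambda\}_{\lambda\in\Lambda}$ is exact in $\mathcal H(E)$, with biorthogonal system $\{g_\lambda\}_{\lambda\in\Lambda}$, and let $\Lambda=\Lambda_1\cup\Lambda_2$ be a partition with $$D_+^\phi(\Lambda_1)=\limsup_{r\to\infty}\frac{n_r(\Lambda_1)}{\phi(r)-\phi(-r)}>0,$$ where $n_r(\Lambda_1)=\operatorname{card}\{\lambda\in\Lambda_1:|\lambda|\le r\}$. Then $\{g_\lambda\}_{\lambda\in\Lambda_1}\cup\{K_\lambda\}_{\lambda\in\Lambda_2}$ is complete in $\mathcal H(E)$.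
   Context: An entire function $E$ is in the Hermite–Biehler class if it has no real zeros and $|E(z)|>|E^*(z)|$ for $\operatorname{Im}z>0$, where $F^*(z)=\overline{F(\bar z)}$. The de Branges space $\mathcal H(E)$ consists of entire $F$ such that $F/E$ and $F^*/E$ restricted to the upper half-plane belong to $H^2(\mathbb C_+)$, with inner product $(F,G)_E=\int_{\mathbb R}F\overline{G}|E|^{-2}dt$; its reproducing kernel is $K_w(z)=\frac{\overline{E(w)}E(z)-\overline{E^*(w)}E^*(z)}{2\pi i(\bar w-z)}$. The phase function $\phi$ is an increasing smooth function with $E(t)e^{i\phi(t)}\in\mathbb R$, $t\in\mathbb R$. A system is exact if complete and minimal. If $\{K_\lambda\}_{\lambda\in\Lambda}$ is exact, its biorthogonal system is $g_\lambda(z)=\frac{G(z)}{G'(\lambda)(z-\lambda)}$, where $G$ is an entire function with simple zeros exactly at $\Lambda$. *)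

theory Defs
  imports "HOL-Analysis.Analysis" "HOL-Library.Extended_Real"
begin

definition entire :: "(complex \<Rightarrow> complex) \<Rightarrow> bool" where
  "entire F \<longleftrightarrow> F holomorphic_on UNIV"

definition star :: "(complex \<Rightarrow> complex) \<Rightarrow> complex \<Rightarrow> complex" where
  "star F z = cnj (F (cnj z))"

definition hermite_biehler :: "(complex \<Rightarrow> complex) \<Rightarrow> bool" where
  "hermite_biehler E \<longleftrightarrow> entire E \<and> (\<forall>t::real. E (of_real t) \<noteq> 0) \<and>
     (\<forall>z. 0 < Im z \<longrightarrow> cmod (star E z) < cmod (E z))"

definition hardy2 :: "(complex \<Rightarrow> complex) \<Rightarrow> bool" where
  "hardy2 f \<longleftrightarrow> f holomorphic_on {z. 0 < Im z} \<and>
     (\<exists>C. \<forall>y>0. integrable lborel (\<lambda>x. (cmod (f (Complex x y)))\<^sup>2) \<and>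
                 (LINT x|lborel. (cmod (f (Complex x y)))\<^sup>2) \<le> C)"

definition deBranges :: "(complex \<Rightarrow> complex) \<Rightarrow> (complex \<Rightarrow> complex) set" where
  "deBranges E = {F. entire F \<and> hardy2 (\<lambda>z. F z / E z) \<and> hardy2 (\<lambda>z. star F z / E z)}"

definition dB_inner :: "(complex \<Rightarrow> complex) \<Rightarrow> (complex \<Rightarrow> complex) \<Rightarrow> (complex \<Rightarrow> complex) \<Rightarrow> complex" where
  "dB_inner E F G = (LINT t|lborel. F (of_real t) * cnj (G (of_real t)) / of_real ((cmod (E (of_real t)))\<^sup>2))"

definition dB_norm :: "(complex \<Rightarrow> complex) \<Rightarrow> (complex \<Rightarrow> complex) \<Rightarrow> real" where
  "dB_norm E F = sqrt (LINT t|lborel. (cmod (F (of_real t)) / cmod (E (of_real t)))\<^sup>2)"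

text \<open>Reproducing kernel K_w; at the removable point z = conj w the limit value is used.\<close>
definition repkernel :: "(complex \<Rightarrow> complex) \<Rightarrow> complex \<Rightarrow> complex \<Rightarrow> complex" where
  "repkernel E w z =
     (if z = cnj w then
        - (cnj (E w) * deriv E (cnj w) - cnj (star E w) * deriv (star E) (cnj w)) / (2 * of_real pi * \<i>)
      else (cnj (E w) * E z - cnj (star E w) * star E z) / (2 * of_real pi * \<i> * (cnj w - z)))"

definition lin_span :: "(complex \<Rightarrow> complex) set \<Rightarrow> (complex \<Rightarrow> complex) set" where
  "lin_span S = {(\<lambda>z. \<Sum>f\<in>A. c f * f z) | A c. finite A \<and> A \<subseteq> S}"

definition in_closed_span :: "(complex \<Rightarrow> complex) \<Rightarrow> (complex \<Rightarrow> complex) set \<Rightarrow> (complex \<Rightarrow> complex) \<Rightarrow> bool" where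
  "in_closed_span E S F \<longleftrightarrow> (\<forall>\<epsilon>>0. \<exists>G\<in>lin_span S. dB_norm E (\<lambda>z. F z - G z) < \<epsilon>)"

definition dB_complete :: "(complex \<Rightarrow> complex) \<Rightarrow> (complex \<Rightarrow> complex) set \<Rightarrow> bool" where
  "dB_complete E S \<longleftrightarrow> (\<forall>F\<in>deBranges E. in_closed_span E S F)"

definition kernels_exact :: "(complex \<Rightarrow> complex) \<Rightarrow> real set \<Rightarrow> bool" where
  "kernels_exact E L \<longleftrightarrow>
     dB_complete E ((\<lambda>l. repkernel E (of_real l)) ` L) \<and>
     (\<forall>l\<in>L. \<not> in_closed_span E ((\<lambda>\<mu>. repkernel E (of_real \<mu>)) ` (L - {l}))
                                   (repkernel E (of_real l)))"

definition phase_function :: "(complex \<Rightarrow> complex) \<Rightarrow> (real \<Rightarrow> real) \<Rightarrow> (real \<Rightarrow> real) \<Rightarrow> bool" where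
  "phase_function E \<phi> \<phi>' \<longleftrightarrow> mono \<phi> \<and> (\<forall>t. (\<phi> has_real_derivative \<phi>' t) (at t)) \<and>
     (\<forall>t. E (of_real t) * exp (\<i> * of_real (\<phi> t)) \<in> \<real>)"

definition counting :: "real set \<Rightarrow> real \<Rightarrow> ereal" where
  "counting L r = (let S = {l\<in>L. \<bar>l\<bar> \<le> r} in if finite S then ereal (real (card S)) else \<infinity>)"

definition upper_phi_density :: "(real \<Rightarrow> real) \<Rightarrow> real set \<Rightarrow> ereal" where
  "upper_phi_density \<phi> L = Limsup at_top (\<lambda>r. counting L r / ereal (\<phi> r - \<phi> (-r)))"

end

theory Submission
  imports Defs "HOL-Complex_Analysis.Complex_Analysis" "HOL-Probability.Sinc_Integral" "HOL-Real_Asymp.Real_Asymp"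
begin

text \<open>Suppose some nonzero $h$ is orthogonal to the mixed system; one may take $h$ real. Writing
  $g=g_{l_0}$, the Cauchy transforms of the measures $g\bar h|E|^{-2}dt$ and $|h|^2|E|^{-2}dt$ satisfy
  $h\,C_1=(c+C_2)\,g$. Hence all zeros of $h$ are real, and $h$ has besides $\Lambda_2$ a set of
  extra zeros $X$, at which $m=c+C_2$ vanishes. A Jensen-type inequality for $g/h$, whose size is
  controlled by $C_1/m$ off the real axis, shows that $X$ has to be about as dense as $\Lambda_1$.
  On the other hand $m=0$ on $X$ forces the tail of $|h|^2|E|^{-2}dt$ to have a large Cauchy
  transform near every point of $X$; the weak type bound together with the regularity of the phase
  gives that $X$ has zero density with respect to the phase.\<close>

section \<open>Poisson integrals and Hardy functions in the upper half plane\<close>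

text \<open>The identity for h comes from the entire function \<open>P\<close>, which is h C_1 - g
  C_2 off the real line: it lies in the space and vanishes at every node except l_0, so it is a real
  multiple c g. Since m is a real constant plus the Cauchy transform of a positive measure, |m(w)|
  is at least a constant times |Im w|/(1 + |w|)^2. This bound serves three times: h has no nonreal
  zeros, the extra zeros are simple, and g/h is controlled in the Jensen inequality. For the zero
  density, let phi' <= d near x in \<open>X\<close>. At height s of order 1/d the modulus of m(x + i
  s) is comparable with its imaginary part, while c and the central part of the measure together
  give an almost real term, at least of order 1/|x|. A tail of small mass can balance this at few
  points only, as these are spaced about 1/d apart. The obstacle is that phi may stay bounded at one
  end, where no bound of phi' by phi/t is derived; there the spacing of the extra zeros in terms of
  the phase leaves boundedly many points in each annulus.\<close>

lemma poisson_kernel: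
  fixes x y :: real
  assumes "0 < y"
  shows poisson_kernel_integrable: "integrable lborel (\<lambda>t. 1 / ((t - x)\<^sup>2 + y\<^sup>2))"
    and poisson_kernel_integral: "(LINT t|lborel. 1 / ((t - x)\<^sup>2 + y\<^sup>2)) = pi / y"
proof -
  have ei: "einterval (-\<infinity>) \<infinity> = (UNIV :: real set)"
    by (auto simp: einterval_def)
  have i0: "integrable lborel (\<lambda>t::real. inverse (1 + t\<^sup>2))"
    using integrable_inverse_1_plus_square by (simp add: set_integrable_def ei)
  have v0: "(LINT t|lborel. inverse (1 + t\<^sup>2)) = pi"
    using LBINT_inverse_1_plus_square
    by (simp add: interval_lebesgue_integral_def set_lebesgue_integral_def ei)
  have eq: "inverse (1 + (- x / y + 1 / y * t)\<^sup>2) = y\<^sup>2 * (1 / ((t - x)\<^sup>2 + y\<^sup>2))" for t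
  proof -
    have "1 + (- x / y + 1 / y * t)\<^sup>2 = ((t - x)\<^sup>2 + y\<^sup>2) / y\<^sup>2"
      using assms by (simp add: field_simps power2_eq_square)
    then show ?thesis by simp
  qed
  have i1: "integrable lborel (\<lambda>t. y\<^sup>2 * (1 / ((t - x)\<^sup>2 + y\<^sup>2)))"
    using lborel_integrable_real_affine[OF i0, of "1 / y" "- x / y"] assms by (simp only: eq) simp
  then show "integrable lborel (\<lambda>t. 1 / ((t - x)\<^sup>2 + y\<^sup>2))"
    using assms integrable_mult_right[OF i1, of "1 / y\<^sup>2"] by (simp add: field_simps)
  have "pi = \<bar>1 / y\<bar> *\<^sub>R (LINT t|lborel. inverse (1 + (- x / y + 1 / y * t)\<^sup>2))"
    using lborel_integral_real_affine[of "1 / y" "\<lambda>t. inverse (1 + t\<^sup>2)" "- x / y"] assms v0 by simp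
  also have "\<dots> = 1 / y * (y\<^sup>2 * (LINT t|lborel. 1 / ((t - x)\<^sup>2 + y\<^sup>2)))"
    using assms by (simp only: eq integral_mult_right_zero) simp
  finally show "(LINT t|lborel. 1 / ((t - x)\<^sup>2 + y\<^sup>2)) = pi / y"
    using assms by (simp add: field_simps power2_eq_square)
qed

lemma cmod_sq_of_real_diff: "(cmod (of_real t - w))\<^sup>2 = (t - Re w)\<^sup>2 + (Im w)\<^sup>2"
  by (simp add: cmod_def)

lemma integrable_norm_quadratic_decay:
  fixes k :: "real \<Rightarrow> complex"
  assumes m: "k \<in> borel_measurable lborel" and b: "\<And>t. cmod (k t) \<le> C / (1 + t\<^sup>2)"
  shows "integrable lborel k"
proof (rule Bochner_Integration.integrable_bound[OF _ m])
  show "integrable lborel (\<lambda>t::real. C * (1 / ((t - 0)\<^sup>2 + 1\<^sup>2)))"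
    by (intro integrable_mult_right poisson_kernel_integrable) auto
  have "0 \<le> C"
    using b[of 0] norm_ge_zero[of "k 0"] by (simp del: norm_ge_zero)
  then show "AE t in lborel. cmod (k t) \<le> norm (C * (1 / ((t - 0)\<^sup>2 + 1\<^sup>2)))"
    using b by (auto simp: add.commute)
qed

lemma LINT_symmetric_limit:
  fixes k :: "real \<Rightarrow> 'a::{banach, second_countable_topology}"
  assumes "integrable lborel k"
  shows "(\<lambda>n::nat. LINT t:{-real n..real n}|lborel. k t) \<longlonglongrightarrow> (LINT t|lborel. k t)"
  unfolding set_lebesgue_integral_def
proof (rule integral_dominated_convergence[where w = "\<lambda>t. norm (k t)"])
  show "AE t in lborel. (\<lambda>n. indicator {- real n..real n} t *\<^sub>R k t) \<longlonglongrightarrow> k t"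
  proof (intro AE_I2 tendsto_eventually)
    fix t :: real
    obtain N where "\<bar>t\<bar> \<le> real N" using real_arch_simple by blast
    then have "t \<in> {- real n..real n}" if "n \<ge> N" for n using that by (auto simp: abs_le_iff)
    then show "\<forall>\<^sub>F n in sequentially. indicator {- real n..real n} t *\<^sub>R k t = k t"
      unfolding eventually_sequentially by (intro exI[of _ N]) simp
  qed
qed (use assms in \<open>auto simp: indicator_def\<close>)

text \<open>Integrate over the boundary of the half disc of radius r: the arc has length pi r and
  the integrand there is at most C/(1 + r^2), so the arc contributes nothing in the limit. Cauchy's
  theorem on the convex half plane asks for differentiability only in the interior, so continuity on
  the real line is enough.\<close>

lemma upper_half_plane_Cauchy:
  fixes k :: "complex \<Rightarrow> complex"
  assumes cont: "continuous_on {z. 0 \<le> Im z} k" and hol: "k holomorphic_on {z. 0 < Im z}"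
    and bd: "\<And>z. 0 \<le> Im z \<Longrightarrow> cmod (k z) \<le> C / (1 + (cmod z)\<^sup>2)"
  shows "(LINT t|lborel. k (of_real t)) = 0"
proof -
  let ?S = "{z. 0 \<le> Im z}"
  have C0: "0 \<le> C" using bd[of 0] norm_ge_zero[of "k 0"] by (simp del: norm_ge_zero)
  have ct: "continuous_on A (\<lambda>t. k (complex_of_real t))" for A
    by (intro continuous_on_compose2[OF cont] continuous_intros) auto
  have int: "integrable lborel (\<lambda>t. k (of_real t))"
  proof (rule integrable_norm_quadratic_decay[where C=C])
    show "(\<lambda>t. k (of_real t)) \<in> borel_measurable lborel"
      using ct[of UNIV] by (simp add: borel_measurable_continuous_onI)
    show "cmod (k (of_real t)) \<le> C / (1 + t\<^sup>2)" for t
      using bd[of "of_real t"] by simp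
  qed
  have key: "cmod (LINT t:{-r..r}|lborel. k (of_real t)) \<le> C / (1 + r\<^sup>2) * r * pi" if r: "r > 0" for r
  proof -
    let ?l = "linepath (of_real (-r)) (of_real r)" and ?a = "part_circlepath 0 r 0 pi"
    have pl: "path_image ?l \<subseteq> ?S"
      by (auto simp: in_segment scaleR_conv_of_real)
    have pa: "path_image ?a \<subseteq> ?S"
      using r by (subst path_image_part_circlepath) (auto simp: Im_exp sin_ge_zero)
    have il: "k contour_integrable_on ?l"
      by (rule contour_integrable_continuous_linepath) (use cont pl continuous_on_subset in \<open>auto simp: path_image_linepath\<close>)
    have ia: "k contour_integrable_on ?a"
      by (rule contour_integrable_continuous_part_circlepath) (use cont pa continuous_on_subset in auto)
    have "(k has_contour_integral 0) (?l +++ ?a)"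
    proof (rule Cauchy_theorem_convex[OF cont, of "{}"])
      show "convex ?S" by (simp add: convex_halfspace_Im_ge)
      fix x assume "x \<in> interior ?S - {}"
      moreover have "interior ?S = {z. 0 < Im z}"
        using interior_halfspace_ge[of "\<i>" 0] by simp
      ultimately show "k field_differentiable at x"
        using hol by (auto simp: open_halfspace_Im_gt intro!: holomorphic_on_imp_differentiable_at)
    qed (use r pl pa in \<open>auto intro!: valid_path_join simp: path_image_join\<close>)
    then have "contour_integral ?l k + contour_integral ?a k = 0"
      using il ia by (metis contour_integral_join contour_integral_unique pathfinish_linepath
          pathstart_part_circlepath valid_path_linepath valid_path_part_circlepath
          add_0 exp_zero mult_1_right mult_zero_right of_real_0)
    then have "cmod (contour_integral ?l k) = cmod (contour_integral ?a k)"
      by (metis add_eq_0_iff norm_minus_cancel)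
    also have "\<dots> \<le> C / (1 + r\<^sup>2) * r * \<bar>pi - 0\<bar>"
    proof (rule contour_integral_bound_part_circlepath[OF ia])
      fix x assume x: "x \<in> path_image ?a"
      then have "cmod x = r" using in_path_image_part_circlepath[of x 0 r 0 pi] r by auto
      then show "cmod (k x) \<le> C / (1 + r\<^sup>2)" using bd[of x] pa x by auto
    qed (use r C0 in auto)
    finally have "cmod (contour_integral ?l k) \<le> C / (1 + r\<^sup>2) * r * pi" by simp
    moreover have "contour_integral ?l k = integral {-r..r} (\<lambda>x. k (of_real x))"
      using contour_integral_linepath_Reals_eq[of "of_real (-r)" "of_real r" k] r by simp
    moreover have "(LINT t:{-r..r}|lborel. k (of_real t)) = integral {-r..r} (\<lambda>x. k (of_real x))"
      by (rule set_borel_integral_eq_integral(2))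
         (use int in \<open>auto simp: set_integrable_def intro!: integrable_mult_indicator\<close>)
    ultimately show ?thesis by simp
  qed
  have "(\<lambda>n::nat. C / (1 + (real n)\<^sup>2) * real n * pi) \<longlonglongrightarrow> 0"
    by real_asymp
  moreover have "\<forall>\<^sub>F n::nat in sequentially. cmod (LINT t:{-real n..real n}|lborel. k (of_real t))
      \<le> C / (1 + (real n)\<^sup>2) * real n * pi"
    using eventually_gt_at_top[of 0] by eventually_elim (use key in auto)
  ultimately have "(\<lambda>n::nat. LINT t:{-real n..real n}|lborel. k (of_real t)) \<longlonglongrightarrow> 0"
    by (rule Lim_null_comparison[rotated])
  with LINT_symmetric_limit[OF int] show ?thesis
    using LIMSEQ_unique by blast
qed

text \<open>Makes the distance to a pole below the real line comparable with 1 + |z| on the closed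
  upper half plane, so that each such pole counts as one power of decay.\<close>

lemma one_plus_norm_le:
  assumes "Im a < 0" "0 \<le> Im z"
  shows "1 + cmod z \<le> (1 + (1 + cmod a) / \<bar>Im a\<bar>) * cmod (z - a)"
proof -
  have 1: "\<bar>Im a\<bar> \<le> cmod (z - a)"
    using abs_Im_le_cmod[of "z - a"] assms by simp
  have "cmod z \<le> cmod (z - a) + cmod a"
    using norm_triangle_ineq[of "z - a" a] by simp
  then have "1 + cmod z \<le> cmod (z - a) + (1 + cmod a) * 1" by simp
  also have "(1 + cmod a) * 1 \<le> (1 + cmod a) * (cmod (z - a) / \<bar>Im a\<bar>)"
    using 1 assms by (intro mult_left_mono) (auto simp: field_simps)
  finally show ?thesis by (simp add: algebra_simps)
qed

lemma inverse_two_poles_bound: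
  assumes "Im a < 0" "Im b < 0"
  obtains K where "0 < K"
    "\<And>z. 0 \<le> Im z \<Longrightarrow> 1 / (cmod (z - a) * cmod (z - b)) \<le> K / (1 + (cmod z)\<^sup>2)"
proof -
  define A where "A = 1 + (1 + cmod a) / \<bar>Im a\<bar>"
  define B where "B = 1 + (1 + cmod b) / \<bar>Im b\<bar>"
  have AB: "0 < A" "0 < B"
    unfolding A_def B_def
    by (rule add_pos_nonneg[OF zero_less_one divide_nonneg_nonneg[OF add_nonneg_nonneg[OF zero_le_one norm_ge_zero] abs_ge_zero]])+
  have "1 / (cmod (z - a) * cmod (z - b)) \<le> (A * B) / (1 + (cmod z)\<^sup>2)" if z: "0 \<le> Im z" for z
  proof -
    have nz: "0 < cmod (z - a)" "0 < cmod (z - b)" using assms z by auto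
    have "1 + (cmod z)\<^sup>2 \<le> (1 + cmod z) * (1 + cmod z)"
      by (simp add: algebra_simps power2_eq_square)
    also have "\<dots> \<le> (A * cmod (z - a)) * (B * cmod (z - b))"
      using one_plus_norm_le[OF assms(1) z] one_plus_norm_le[OF assms(2) z] AB
      unfolding A_def B_def by (intro mult_mono) auto
    finally have "1 + (cmod z)\<^sup>2 \<le> (A * B) * (cmod (z - a) * cmod (z - b))"
      by (simp add: algebra_simps)
    moreover have "0 < 1 + (cmod z)\<^sup>2" by (simp add: add_pos_nonneg)
    ultimately show ?thesis using nz by (simp add: field_simps)
  qed
  then show ?thesis using that[of "A * B"] AB by simp
qed

text \<open>A bounded function has no decay of its own; two poles in the lower half plane supply
  exactly the quadratic decay that the contour argument asks for.\<close>

lemma bounded_two_poles_integral: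
  assumes cont: "continuous_on {z. 0 \<le> Im z} f" and hol: "f holomorphic_on {z. 0 < Im z}"
    and bd: "\<And>z. 0 \<le> Im z \<Longrightarrow> cmod (f z) \<le> B" and ab: "Im a < 0" "Im b < 0"
  shows "(LINT t|lborel. f (of_real t) / ((of_real t - a) * (of_real t - b))) = 0"
proof -
  obtain K where K: "0 < K" 
    "\<And>z. 0 \<le> Im z \<Longrightarrow> 1 / (cmod (z - a) * cmod (z - b)) \<le> K / (1 + (cmod z)\<^sup>2)"
    using inverse_two_poles_bound[OF ab] by blast
  have B0: "0 \<le> B" using bd[of 0] norm_ge_zero[of "f 0"] by (simp del: norm_ge_zero)
  show ?thesis
  proof (rule upper_half_plane_Cauchy[where C = "B * K"])
    show "continuous_on {z. 0 \<le> Im z} (\<lambda>z. f z / ((z - a) * (z - b)))"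
      using ab by (intro continuous_intros cont) auto
    show "(\<lambda>z. f z / ((z - a) * (z - b))) holomorphic_on {z. 0 < Im z}"
      using ab by (intro holomorphic_intros hol) auto
    fix z assume z: "0 \<le> Im z"
    have "cmod (f z / ((z - a) * (z - b))) = cmod (f z) * (1 / (cmod (z - a) * cmod (z - b)))"
      by (simp add: norm_divide norm_mult)
    also have "\<dots> \<le> B * (K / (1 + (cmod z)\<^sup>2))"
      using K z bd[OF z] B0 by (intro mult_mono) auto
    finally show "cmod (f z / ((z - a) * (z - b))) \<le> B * K / (1 + (cmod z)\<^sup>2)" by simp
  qed
qed

text \<open>Subtracting f w removes the pole at w: \<open>q\<close> is regular in the half plane and
  decays like 1/|z|, and a pole at cnj w gives the second power. The vanishing integral of q(t)/(t -
  cnj w) is the Poisson integral of f minus f w times the mass of the kernel.\<close>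

lemma bounded_Poisson:
  assumes cont: "continuous_on {z. 0 \<le> Im z} f" and hol: "f holomorphic_on {z. 0 < Im z}"
    and bd: "\<And>z. 0 \<le> Im z \<Longrightarrow> cmod (f z) \<le> B" and w: "0 < Im w"
  shows "(LINT t|lborel. f (of_real t) / of_real ((t - Re w)\<^sup>2 + (Im w)\<^sup>2)) = of_real (pi / Im w) * f w"
proof -
  let ?H = "{z. 0 \<le> Im z}"
  have B0: "0 \<le> B" using bd[of 0] norm_ge_zero[of "f 0"] by (simp del: norm_ge_zero)
  define q where "q = (\<lambda>z. if z = w then deriv f w else (f z - f w) / (z - w))"
  have qhol: "q holomorphic_on {z. 0 < Im z}"
    unfolding q_def by (rule pole_lemma_open[OF hol open_halfspace_Im_gt])
  have qcont: "continuous_on ?H q"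
    unfolding continuous_on_eq_continuous_within
  proof
    fix z assume z: "z \<in> ?H"
    show "continuous (at z within ?H) q"
    proof (cases "z = w")
      case True
      have "q field_differentiable at w"
        using holomorphic_on_imp_differentiable_at[OF qhol open_halfspace_Im_gt] w by simp
      then show ?thesis
        unfolding True by (rule continuous_at_imp_continuous_at_within[OF field_differentiable_imp_continuous_at])
    next
      case False
      have "(f \<longlongrightarrow> f z) (at z within ?H)"
        using cont z by (auto simp: continuous_on_def)
      then have "((\<lambda>z. (f z - f w) / (z - w)) \<longlongrightarrow> (f z - f w) / (z - w)) (at z within ?H)"
        using False by (intro tendsto_intros) auto
      then have lim: "((\<lambda>z. (f z - f w) / (z - w)) \<longlongrightarrow> q z) (at z within ?H)"
        using False by (simp add: q_def)
      have "\<forall>\<^sub>F y in at z within ?H. (f y - f w) / (y - w) = q y"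
        unfolding q_def eventually_at
        by (intro exI[of _ "dist z w"]) (use False in \<open>auto simp: dist_commute\<close>)
      from Lim_transform_eventually[OF lim this] show ?thesis
        unfolding continuous_within .
    qed
  qed
  \<comment> \<open>Beyond this radius 1 + |z| <= 4 |z - w|, which gives the term 8 B in
    \<open>M\<close>; inside it \<open>q\<close> is bounded by compactness.\<close>
  define R where "R = 2 * cmod w + 1"
  have "compact (q ` (?H \<inter> cball 0 R))"
    by (intro compact_continuous_image continuous_on_subset[OF qcont] closed_Int_compact
        closed_halfspace_Im_ge) auto
  then obtain Q where Q: "\<And>z. 0 \<le> Im z \<Longrightarrow> cmod z \<le> R \<Longrightarrow> cmod (q z) \<le> Q"
    using compact_imp_bounded by (force simp: bounded_iff)
  have R0: "0 \<le> R" by (simp add: R_def)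
  then have "cmod (q 0) \<le> Q" using Q[of 0] by simp
  then have Q0: "0 \<le> Q" using norm_ge_zero order_trans by blast
  define M where "M = Q * (1 + R) + 8 * B"
  have qb: "cmod (q z) \<le> M / (1 + cmod z)" if z: "0 \<le> Im z" for z
  proof (cases "cmod z \<le> R")
    case True
    have "cmod (q z) * (1 + cmod z) \<le> Q * (1 + R)"
      using Q[OF z True] True Q0 by (intro mult_mono) auto
    then have "cmod (q z) * (1 + cmod z) \<le> M" using B0 by (simp add: M_def)
    then show ?thesis by (simp add: pos_le_divide_eq add_pos_nonneg)
  next
    case False
    then have ne: "z \<noteq> w" by (auto simp: R_def)
    have "cmod z \<le> cmod (z - w) + cmod w"
      using norm_triangle_ineq[of "z - w" w] by simp
    then have 1: "1 + cmod z \<le> 4 * cmod (z - w)" using False norm_ge_zero[of z] unfolding R_def by linarith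
    have "cmod (f z - f w) \<le> B + B"
      using bd[OF z] bd[of w] w norm_triangle_ineq4[of "f z" "f w"] by linarith
    then have "cmod (f z - f w) * (1 + cmod z) \<le> (2 * B) * (4 * cmod (z - w))"
      using 1 by (intro mult_mono) (use B0 in auto)
    then have "cmod (q z) * (1 + cmod z) \<le> 8 * B"
      using ne by (simp add: q_def norm_divide field_simps)
    moreover have "0 \<le> Q * (1 + R)" using Q0 R0 by simp
    ultimately have "cmod (q z) * (1 + cmod z) \<le> M" unfolding M_def by linarith
    then show ?thesis by (simp add: pos_le_divide_eq add_pos_nonneg)
  qed
  have M0: "0 \<le> M" using Q0 B0 R0 by (simp add: M_def)
  define A where "A = 1 + (1 + cmod (cnj w)) / \<bar>Im (cnj w)\<bar>"
  have A0: "0 < A" unfolding A_def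
    by (rule add_pos_nonneg[OF zero_less_one divide_nonneg_nonneg[OF add_nonneg_nonneg[OF zero_le_one norm_ge_zero] abs_ge_zero]])
  have "(LINT t|lborel. q (of_real t) / (of_real t - cnj w)) = 0"
  proof (rule upper_half_plane_Cauchy[where C = "M * A"])
    have nz: "z - cnj w \<noteq> 0" if "0 \<le> Im z" for z using w that by (auto simp: complex_eq_iff)
    show "continuous_on ?H (\<lambda>z. q z / (z - cnj w))"
      using nz by (intro continuous_intros qcont) auto
    show "(\<lambda>z. q z / (z - cnj w)) holomorphic_on {z. 0 < Im z}"
      using nz by (intro holomorphic_intros qhol) auto
    fix z assume z: "0 \<le> Im z"
    have 1: "1 + cmod z \<le> A * cmod (z - cnj w)"
      unfolding A_def by (rule one_plus_norm_le) (use w z in auto)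
    have 2: "cmod (q z) * (1 + cmod z) \<le> M"
      using qb[OF z] by (simp add: pos_le_divide_eq add_pos_nonneg)
    have "1 + (cmod z)\<^sup>2 \<le> (1 + cmod z) * (1 + cmod z)"
      by (simp add: algebra_simps power2_eq_square)
    then have "cmod (q z) * (1 + (cmod z)\<^sup>2) \<le> cmod (q z) * ((1 + cmod z) * (1 + cmod z))"
      by (intro mult_left_mono) auto
    also have "\<dots> = (cmod (q z) * (1 + cmod z)) * (1 + cmod z)" by simp
    also have "\<dots> \<le> M * (A * cmod (z - cnj w))"
      using 1 2 M0 by (intro mult_mono) auto
    finally show "cmod (q z / (z - cnj w)) \<le> M * A / (1 + (cmod z)\<^sup>2)"
      using nz[OF z] by (simp add: norm_divide field_simps add_pos_nonneg)
  qed
  moreover have "q (of_real t) / (of_real t - cnj w)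
      = f (of_real t) / of_real ((t - Re w)\<^sup>2 + (Im w)\<^sup>2) - f w * of_real (1 / ((t - Re w)\<^sup>2 + (Im w)\<^sup>2))" for t
  proof -
    have ne: "of_real t \<noteq> w" using w by auto
    have "(of_real t - w) * (of_real t - cnj w) = of_real ((t - Re w)\<^sup>2 + (Im w)\<^sup>2)"
      by (simp add: complex_eq_iff power2_eq_square algebra_simps)
    then show ?thesis
      using ne by (simp add: q_def diff_divide_distrib)
  qed
  ultimately have z0: "(LINT t|lborel. f (of_real t) / of_real ((t - Re w)\<^sup>2 + (Im w)\<^sup>2)
     - f w * of_real (1 / ((t - Re w)\<^sup>2 + (Im w)\<^sup>2))) = 0" by simp
  have pk: "integrable lborel (\<lambda>t. 1 / ((t - Re w)\<^sup>2 + (Im w)\<^sup>2))"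
    by (rule poisson_kernel_integrable[OF w])
  have i2: "integrable lborel (\<lambda>t. f w * of_real (1 / ((t - Re w)\<^sup>2 + (Im w)\<^sup>2)))"
    by (intro integrable_mult_right integrable_of_real pk)
  have i1: "integrable lborel (\<lambda>t. f (of_real t) / of_real ((t - Re w)\<^sup>2 + (Im w)\<^sup>2))"
  proof (rule Bochner_Integration.integrable_bound)
    show "integrable lborel (\<lambda>t. B * (1 / ((t - Re w)\<^sup>2 + (Im w)\<^sup>2)))"
      by (intro integrable_mult_right pk)
    have "continuous_on UNIV (\<lambda>t. f (complex_of_real t))"
      by (intro continuous_on_compose2[OF cont] continuous_intros) auto
    then have [measurable]: "(\<lambda>t. f (complex_of_real t)) \<in> borel_measurable borel"
      by (rule borel_measurable_continuous_onI)
    show "(\<lambda>t. f (of_real t) / of_real ((t - Re w)\<^sup>2 + (Im w)\<^sup>2)) \<in> borel_measurable lborel"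
      by simp
    have "cmod (f (of_real t) / of_real ((t - Re w)\<^sup>2 + (Im w)\<^sup>2)) \<le> norm (B * (1 / ((t - Re w)\<^sup>2 + (Im w)\<^sup>2)))" for t
      using bd[of "of_real t"] B0
      by (simp only: norm_divide norm_of_real) (simp add: divide_right_mono)
    then show "AE t in lborel. cmod (f (of_real t) / of_real ((t - Re w)\<^sup>2 + (Im w)\<^sup>2))
        \<le> norm (B * (1 / ((t - Re w)\<^sup>2 + (Im w)\<^sup>2)))" by simp
  qed
  have "(LINT t|lborel. f (of_real t) / of_real ((t - Re w)\<^sup>2 + (Im w)\<^sup>2))
      = f w * (LINT t|lborel. complex_of_real (1 / ((t - Re w)\<^sup>2 + (Im w)\<^sup>2)))"
    using z0 Bochner_Integration.integral_diff[OF i1 i2] by (simp only: integral_mult_right_zero) simp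
  also have "(LINT t|lborel. complex_of_real (1 / ((t - Re w)\<^sup>2 + (Im w)\<^sup>2))) = of_real (pi / Im w)"
    using poisson_kernel_integral[OF w] by (simp only: integral_complex_of_real)
  finally show ?thesis by (simp only: mult.commute)
qed

section \<open>Square integrable functions: Cauchy-Schwarz, Fatou and weak limits\<close>

definition L2 :: "'a measure \<Rightarrow> ('a \<Rightarrow> complex) \<Rightarrow> bool" where
  "L2 M f \<longleftrightarrow> f \<in> borel_measurable M \<and> integrable M (\<lambda>x. (cmod (f x))\<^sup>2)"

lemma L2_measurable [measurable_dest]: "L2 M f \<Longrightarrow> f \<in> borel_measurable M"
  by (simp add: L2_def)

lemma L2_bound:
  assumes g: "L2 M g" and f: "f \<in> borel_measurable M"
    and le: "\<And>x. x \<in> space M \<Longrightarrow> cmod (f x) \<le> C * cmod (g x)"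
  shows "L2 M f"
  unfolding L2_def
proof (intro conjI f)
  show "integrable M (\<lambda>x. (cmod (f x))\<^sup>2)"
  proof (rule Bochner_Integration.integrable_bound)
    show "integrable M (\<lambda>x. C\<^sup>2 * (cmod (g x))\<^sup>2)"
      using g by (auto simp: L2_def)
    show "AE x in M. norm ((cmod (f x))\<^sup>2) \<le> norm (C\<^sup>2 * (cmod (g x))\<^sup>2)"
    proof (rule AE_I2)
      fix x assume "x \<in> space M"
      then have "(cmod (f x))\<^sup>2 \<le> (C * cmod (g x))\<^sup>2"
        using le by (intro power_mono) auto
      then show "norm ((cmod (f x))\<^sup>2) \<le> norm (C\<^sup>2 * (cmod (g x))\<^sup>2)"
        by (simp add: power_mult_distrib)
    qed
  qed (use f in measurable)
qed

lemma L2_cmult: "L2 M f \<Longrightarrow> L2 M (\<lambda>x. c * f x)"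
  by (rule L2_bound[where C = "cmod c" and g = f]) (auto simp: norm_mult L2_def)

lemma borel_measurable_cnj [measurable]: "cnj \<in> borel_measurable borel"
  by (intro borel_measurable_continuous_onI continuous_intros)

lemma L2_cnj: "L2 M f \<Longrightarrow> L2 M (\<lambda>x. cnj (f x))"
  by (auto simp: L2_def)

lemma L2_add:
  assumes "L2 M f" "L2 M g" shows "L2 M (\<lambda>x. f x + g x)"
  unfolding L2_def
proof (intro conjI)
  show "integrable M (\<lambda>x. (cmod (f x + g x))\<^sup>2)"
  proof (rule Bochner_Integration.integrable_bound)
    show "integrable M (\<lambda>x. 2 * (cmod (f x))\<^sup>2 + 2 * (cmod (g x))\<^sup>2)"
      using assms by (auto simp: L2_def)
    show "AE x in M. norm ((cmod (f x + g x))\<^sup>2) \<le> norm (2 * (cmod (f x))\<^sup>2 + 2 * (cmod (g x))\<^sup>2)"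
    proof (rule AE_I2)
      fix x
      have "(cmod (f x + g x))\<^sup>2 \<le> (cmod (f x) + cmod (g x))\<^sup>2"
        by (intro power_mono norm_triangle_ineq) auto
      also have "\<dots> \<le> 2 * (cmod (f x))\<^sup>2 + 2 * (cmod (g x))\<^sup>2"
        using sum_squares_bound[of "cmod (f x)" "cmod (g x)"] by (simp add: power2_sum)
      finally show "norm ((cmod (f x + g x))\<^sup>2) \<le> norm (2 * (cmod (f x))\<^sup>2 + 2 * (cmod (g x))\<^sup>2)"
        by simp
    qed
  qed (use assms in \<open>auto simp: L2_def\<close>)
qed (use assms in \<open>auto simp: L2_def\<close>)

lemma L2_diff: "L2 M f \<Longrightarrow> L2 M g \<Longrightarrow> L2 M (\<lambda>x. f x - g x)"
  using L2_add[of M f "\<lambda>x. (-1) * g x"] L2_cmult[of M g "-1"] by simp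

lemma L2_mult_norm_integrable:
  assumes "L2 M f" "L2 M g" shows "integrable M (\<lambda>x. cmod (f x) * cmod (g x))"
proof (rule Bochner_Integration.integrable_bound)
  show "integrable M (\<lambda>x. (cmod (f x))\<^sup>2 + (cmod (g x))\<^sup>2)"
    using assms by (auto simp: L2_def)
  show "AE x in M. norm (cmod (f x) * cmod (g x)) \<le> norm ((cmod (f x))\<^sup>2 + (cmod (g x))\<^sup>2)"
  proof (rule AE_I2)
    fix x
    have "2 * (cmod (f x) * cmod (g x)) \<le> (cmod (f x))\<^sup>2 + (cmod (g x))\<^sup>2"
      using sum_squares_bound[of "cmod (f x)" "cmod (g x)"] by simp
    moreover have "0 \<le> cmod (f x) * cmod (g x)" by simp
    ultimately show "norm (cmod (f x) * cmod (g x)) \<le> norm ((cmod (f x))\<^sup>2 + (cmod (g x))\<^sup>2)"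
      unfolding real_norm_def by linarith
  qed
qed (use assms in \<open>auto simp: L2_def\<close>)

lemma L2_mult_integrable:
  assumes "L2 M f" "L2 M g" shows "integrable M (\<lambda>x. f x * g x)"
  by (rule Bochner_Integration.integrable_bound[OF L2_mult_norm_integrable[OF assms]])
     (use assms in \<open>auto simp: L2_def norm_mult\<close>)

text \<open>Expand the nonnegative integral of (s |f| - |g|)^2 as a quadratic polynomial in s and
  take its minimiser s = I/A. If A = 0 the polynomial is linear in s, and the value s = (B + 1)/(2
  I) would make it negative unless I = 0.\<close>

lemma L2_Cauchy_Schwarz_norm:
  assumes "L2 M f" "L2 M g"
  shows "(\<integral>x. cmod (f x) * cmod (g x) \<partial>M)\<^sup>2 \<le> (\<integral>x. (cmod (f x))\<^sup>2 \<partial>M) * (\<integral>x. (cmod (g x))\<^sup>2 \<partial>M)"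
proof -
  let ?I = "\<integral>x. cmod (f x) * cmod (g x) \<partial>M" and ?A = "\<integral>x. (cmod (f x))\<^sup>2 \<partial>M" and ?B = "\<integral>x. (cmod (g x))\<^sup>2 \<partial>M"
  have i: "integrable M (\<lambda>x. (cmod (f x))\<^sup>2)" "integrable M (\<lambda>x. (cmod (g x))\<^sup>2)"
    using assms by (auto simp: L2_def)
  have q: "0 \<le> s\<^sup>2 * ?A - 2 * s * ?I + ?B" for s
  proof -
    have "0 \<le> (\<integral>x. (s * cmod (f x) - cmod (g x))\<^sup>2 \<partial>M)" by simp
    also have "\<dots> = (\<integral>x. s\<^sup>2 * (cmod (f x))\<^sup>2 - 2 * s * (cmod (f x) * cmod (g x)) + (cmod (g x))\<^sup>2 \<partial>M)"
      by (intro Bochner_Integration.integral_cong) (auto simp: power2_diff power_mult_distrib)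
    also have "\<dots> = s\<^sup>2 * ?A - 2 * s * ?I + ?B"
      using i L2_mult_norm_integrable[OF assms] by simp
    finally show ?thesis .
  qed
  have A0: "0 \<le> ?A" by simp
  show ?thesis
  proof (cases "?A = 0")
    case True
    then have "2 * s * ?I \<le> ?B" for s using q[of s] by simp
    then have "2 * ((?B + 1) / (2 * ?I)) * ?I \<le> ?B" by blast
    moreover have "?I \<noteq> 0 \<Longrightarrow> 2 * ((?B + 1) / (2 * ?I)) * ?I = ?B + 1" by simp
    ultimately have "?I = 0" by linarith
    then show ?thesis using True by simp
  next
    case False
    then have "0 < ?A" using A0 by linarith
    then show ?thesis using q[of "?I / ?A"] by (simp add: field_simps power2_eq_square)
  qed
qed

lemma L2_Cauchy_Schwarz:
  assumes "L2 M f" "L2 M g"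
  shows "(cmod (\<integral>x. f x * g x \<partial>M))\<^sup>2 \<le> (\<integral>x. (cmod (f x))\<^sup>2 \<partial>M) * (\<integral>x. (cmod (g x))\<^sup>2 \<partial>M)"
proof -
  have "cmod (\<integral>x. f x * g x \<partial>M) \<le> (\<integral>x. cmod (f x * g x) \<partial>M)"
    by (rule integral_norm_bound)
  also have "\<dots> = (\<integral>x. cmod (f x) * cmod (g x) \<partial>M)" by (simp add: norm_mult)
  finally have "(cmod (\<integral>x. f x * g x \<partial>M))\<^sup>2 \<le> (\<integral>x. cmod (f x) * cmod (g x) \<partial>M)\<^sup>2"
    by (intro power_mono) auto
  also note L2_Cauchy_Schwarz_norm[OF assms]
  finally show ?thesis .
qed

text \<open>Norm bounds pass to pointwise limits without any norm convergence. This yields boundary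
  values on the real line and, later, the membership of limits in the space.\<close>

lemma L2_Fatou:
  fixes f :: "nat \<Rightarrow> 'a \<Rightarrow> complex"
  assumes L: "\<And>n. L2 M (f n)" and bd: "\<And>n. (\<integral>x. (cmod (f n x))\<^sup>2 \<partial>M) \<le> C"
    and lim: "\<And>x. x \<in> space M \<Longrightarrow> (\<lambda>n. f n x) \<longlonglongrightarrow> g x"
  shows "L2 M g" and "(\<integral>x. (cmod (g x))\<^sup>2 \<partial>M) \<le> C"
proof -
  have C0: "0 \<le> C" using order_trans[OF _ bd[of 0]] by simp
  have [measurable]: "f n \<in> borel_measurable M" for n using L by (simp add: L2_def)
  have gm [measurable]: "g \<in> borel_measurable M"
    by (rule borel_measurable_LIMSEQ_metric[OF _ lim]) auto
  have "(\<integral>\<^sup>+x. ennreal ((cmod (g x))\<^sup>2) \<partial>M) = (\<integral>\<^sup>+x. liminf (\<lambda>n. ennreal ((cmod (f n x))\<^sup>2)) \<partial>M)"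
  proof (intro nn_integral_cong)
    fix x assume "x \<in> space M"
    then have "(\<lambda>n. ennreal ((cmod (f n x))\<^sup>2)) \<longlonglongrightarrow> ennreal ((cmod (g x))\<^sup>2)"
      by (intro tendsto_ennrealI tendsto_intros lim)
    then show "ennreal ((cmod (g x))\<^sup>2) = liminf (\<lambda>n. ennreal ((cmod (f n x))\<^sup>2))"
      using lim_imp_Liminf trivial_limit_sequentially by metis
  qed
  also have "\<dots> \<le> liminf (\<lambda>n. \<integral>\<^sup>+x. ennreal ((cmod (f n x))\<^sup>2) \<partial>M)"
    by (rule nn_integral_liminf) simp
  also have "\<dots> \<le> liminf (\<lambda>n. ennreal C)"
  proof (intro Liminf_mono always_eventually allI)
    fix n
    have "(\<integral>\<^sup>+x. ennreal ((cmod (f n x))\<^sup>2) \<partial>M) = ennreal (\<integral>x. (cmod (f n x))\<^sup>2 \<partial>M)"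
      using L[of n] by (intro nn_integral_eq_integral) (auto simp: L2_def)
    also have "\<dots> \<le> ennreal C" using bd by (rule ennreal_leI)
    finally show "(\<integral>\<^sup>+x. ennreal ((cmod (f n x))\<^sup>2) \<partial>M) \<le> ennreal C" .
  qed
  finally have *: "(\<integral>\<^sup>+x. ennreal ((cmod (g x))\<^sup>2) \<partial>M) \<le> ennreal C"
    by (simp add: Liminf_const)
  then have i: "integrable M (\<lambda>x. (cmod (g x))\<^sup>2)"
    by (intro integrableI_nonneg) (auto intro: le_less_trans)
  then show "L2 M g" using gm by (simp add: L2_def)
  have "ennreal (\<integral>x. (cmod (g x))\<^sup>2 \<partial>M) \<le> ennreal C"
    using nn_integral_eq_integral[OF i] * by simp
  then show "(\<integral>x. (cmod (g x))\<^sup>2 \<partial>M) \<le> C" using C0 by (simp add: ennreal_le_iff)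
qed

text \<open>The elementary inequality
  \<open>e * \<bar>k\<bar> \<le> \<delta> * e\<^sup>2 + max 0 (e * \<bar>k\<bar> - \<delta> * e\<^sup>2)\<close>, whose last term is dominated by \<open>\<bar>k\<bar>\<^sup>2 / (4 * \<delta>)\<close>,
  lets dominated convergence replace weak compactness.\<close>

lemma L2_weak_limit:
  fixes f :: "nat \<Rightarrow> 'a \<Rightarrow> complex"
  assumes L: "\<And>n. L2 M (f n)" and bd: "\<And>n. (\<integral>x. (cmod (f n x))\<^sup>2 \<partial>M) \<le> C"
    and lim: "\<And>x. x \<in> space M \<Longrightarrow> (\<lambda>n. f n x) \<longlonglongrightarrow> g x" and k: "L2 M k"
  shows "(\<lambda>n. \<integral>x. f n x * k x \<partial>M) \<longlonglongrightarrow> (\<integral>x. g x * k x \<partial>M)"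
proof (rule LIMSEQ_I)
  fix r :: real assume r: "0 < r"
  have Lg: "L2 M g" and bg: "(\<integral>x. (cmod (g x))\<^sup>2 \<partial>M) \<le> C"
    using L2_Fatou[OF L bd lim] by blast+
  have C0: "0 \<le> C" using order_trans[OF _ bd[of 0]] by simp
  \<comment> \<open>The squared distance of f n and g integrates to at most 4 C, so this choice
    keeps the first term of the split below r/2.\<close>
  define \<delta> where "\<delta> = r / (8 * C + 8)"
  have d0: "0 < \<delta>" using r C0 by (auto simp: \<delta>_def)
  define e where "e = (\<lambda>n x. cmod (f n x - g x))"
  define h where "h = (\<lambda>n x. max 0 (e n x * cmod (k x) - \<delta> * (e n x)\<^sup>2))"
  have [measurable]: "f n \<in> borel_measurable M" "g \<in> borel_measurable M" "k \<in> borel_measurable M" for n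
    using L Lg k by (auto simp: L2_def)
  have hm [measurable]: "h n \<in> borel_measurable M" for n unfolding h_def e_def by measurable
  have hb: "h n x \<le> (cmod (k x))\<^sup>2 / (4 * \<delta>)" for n x
  proof -
    have "0 \<le> (2 * \<delta> * e n x - cmod (k x))\<^sup>2" by simp
    then have "4 * \<delta> * (e n x * cmod (k x) - \<delta> * (e n x)\<^sup>2) \<le> (cmod (k x))\<^sup>2"
      by (simp add: power2_eq_square algebra_simps)
    then show ?thesis unfolding h_def using d0 by (auto simp: field_simps)
  qed
  have ki: "integrable M (\<lambda>x. (cmod (k x))\<^sup>2 / (4 * \<delta>))" using k by (auto simp: L2_def)
  have hi: "integrable M (h n)" for n
  proof (rule Bochner_Integration.integrable_bound[OF ki hm], rule AE_I2)
    fix x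
    have "0 \<le> h n x" by (simp add: h_def)
    then show "norm (h n x) \<le> norm ((cmod (k x))\<^sup>2 / (4 * \<delta>))"
      using hb[of n x] d0 by simp
  qed
  have "(\<lambda>n. \<integral>x. h n x \<partial>M) \<longlonglongrightarrow> (\<integral>x. 0 \<partial>M)"
  proof (rule integral_dominated_convergence[OF _ _ ki])
    show "AE x in M. (\<lambda>n. h n x) \<longlonglongrightarrow> 0"
    proof (rule AE_I2)
      fix x assume "x \<in> space M"
      then have "(\<lambda>n. f n x - g x) \<longlonglongrightarrow> 0"
        using lim[of x] by (simp add: LIM_zero)
      then have e0: "(\<lambda>n. e n x) \<longlonglongrightarrow> 0"
        unfolding e_def by (rule tendsto_norm_zero)
      have "(\<lambda>n. h n x) \<longlonglongrightarrow> max 0 (0 * cmod (k x) - \<delta> * 0\<^sup>2)"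
        unfolding h_def by (intro tendsto_intros e0)
      then show "(\<lambda>n. h n x) \<longlonglongrightarrow> 0" by simp
    qed
    show "AE x in M. norm (h n x) \<le> (cmod (k x))\<^sup>2 / (4 * \<delta>)" for n
      using hb[of n] by (intro AE_I2) (simp add: h_def)
  qed auto
  then have "(\<lambda>n. \<integral>x. h n x \<partial>M) \<longlonglongrightarrow> 0" by simp
  from LIMSEQ_D[OF this, of "r / 2"] obtain N
    where N: "\<And>n. n \<ge> N \<Longrightarrow> \<bar>\<integral>x. h n x \<partial>M\<bar> < r / 2"
    using r by auto
  show "\<exists>no. \<forall>n\<ge>no. norm ((\<integral>x. f n x * k x \<partial>M) - (\<integral>x. g x * k x \<partial>M)) < r"
  proof (intro exI allI impI)
    fix n assume n: "n \<ge> N"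
    have Ld: "L2 M (\<lambda>x. f n x - g x)" by (rule L2_diff[OF L Lg])
    have ei: "integrable M (\<lambda>x. (e n x)\<^sup>2)" using Ld by (simp add: L2_def e_def)
    have eb: "(\<integral>x. (e n x)\<^sup>2 \<partial>M) \<le> 4 * C"
    proof -
      have "(\<integral>x. (e n x)\<^sup>2 \<partial>M) \<le> (\<integral>x. 2 * (cmod (f n x))\<^sup>2 + 2 * (cmod (g x))\<^sup>2 \<partial>M)"
      proof (rule integral_mono[OF ei])
        show "integrable M (\<lambda>x. 2 * (cmod (f n x))\<^sup>2 + 2 * (cmod (g x))\<^sup>2)"
          using L[of n] Lg by (auto simp: L2_def)
        fix x
        have "(e n x)\<^sup>2 \<le> (cmod (f n x) + cmod (g x))\<^sup>2"
          unfolding e_def by (intro power_mono norm_triangle_ineq4) auto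
        then show "(e n x)\<^sup>2 \<le> 2 * (cmod (f n x))\<^sup>2 + 2 * (cmod (g x))\<^sup>2"
          using sum_squares_bound[of "cmod (f n x)" "cmod (g x)"] by (simp add: power2_sum)
      qed
      also have "\<dots> = 2 * (\<integral>x. (cmod (f n x))\<^sup>2 \<partial>M) + 2 * (\<integral>x. (cmod (g x))\<^sup>2 \<partial>M)"
        using L[of n] Lg by (simp add: L2_def)
      finally show ?thesis using bd[of n] bg by linarith
    qed
    have "(\<integral>x. f n x * k x \<partial>M) - (\<integral>x. g x * k x \<partial>M) = (\<integral>x. (f n x - g x) * k x \<partial>M)"
      using L2_mult_integrable[OF L k, of n] L2_mult_integrable[OF Lg k]
      by (simp add: left_diff_distrib)
    then have "norm ((\<integral>x. f n x * k x \<partial>M) - (\<integral>x. g x * k x \<partial>M)) \<le> (\<integral>x. e n x * cmod (k x) \<partial>M)"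
      using integral_norm_bound[of M "\<lambda>x. (f n x - g x) * k x"] by (simp add: norm_mult e_def)
    also have "\<dots> \<le> (\<integral>x. \<delta> * (e n x)\<^sup>2 + h n x \<partial>M)"
    proof (rule integral_mono)
      show "integrable M (\<lambda>x. e n x * cmod (k x))"
        unfolding e_def by (rule L2_mult_norm_integrable[OF Ld k])
      show "integrable M (\<lambda>x. \<delta> * (e n x)\<^sup>2 + h n x)"
        using ei hi by auto
      show "e n x * cmod (k x) \<le> \<delta> * (e n x)\<^sup>2 + h n x" for x
        unfolding h_def by linarith
    qed
    also have "\<dots> = \<delta> * (\<integral>x. (e n x)\<^sup>2 \<partial>M) + (\<integral>x. h n x \<partial>M)"
      using ei hi by simp
    also have "\<dots> \<le> \<delta> * (4 * C) + \<bar>\<integral>x. h n x \<partial>M\<bar>"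
      using eb d0 by (intro add_mono mult_left_mono) auto
    also have "\<delta> * (4 * C) \<le> r / 2"
      using r C0 by (simp add: \<delta>_def field_simps)
    also note N[OF n]
    finally show "norm ((\<integral>x. f n x * k x \<partial>M) - (\<integral>x. g x * k x \<partial>M)) < r" by simp
  qed
qed

section \<open>Hardy functions that are continuous up to the real line\<close>

lemma closed_half_plane_line_measurable:
  assumes f: "continuous_on {z. 0 \<le> Im z} f" and y: "y \<ge> 0"
  shows "(\<lambda>t. f (Complex t y)) \<in> borel_measurable borel"
proof (rule borel_measurable_continuous_onI, rule continuous_on_compose2[OF f])
  show "continuous_on UNIV (\<lambda>t. Complex t y)"
    unfolding Complex_eq by (intro continuous_intros)
qed (use y in auto)

lemma L2_pole:
  assumes "Im a \<noteq> 0"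
  shows "L2 lborel (\<lambda>t. 1 / (of_real t - a))"
  unfolding L2_def
proof
  have "of_real t - a \<noteq> 0" for t using assms by (auto simp: complex_eq_iff)
  then have "continuous_on UNIV (\<lambda>t. 1 / (of_real t - a))"
    by (intro continuous_intros) auto
  then show "(\<lambda>t. 1 / (of_real t - a)) \<in> borel_measurable lborel"
    by (simp add: borel_measurable_continuous_onI)
  show "integrable lborel (\<lambda>t. (cmod (1 / (of_real t - a)))\<^sup>2)"
    using poisson_kernel_integrable[of "\<bar>Im a\<bar>" "Re a"] assms
    by (simp add: norm_divide power_divide cmod_sq_of_real_diff)
qed

lemma abs_Im_le_pole_dist: "\<bar>Im a\<bar> \<le> cmod (of_real t - a)"
  using abs_Im_le_cmod[of "of_real t - a"] by simp

lemma L2_two_poles: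
  assumes "Im a \<noteq> 0" "Im b \<noteq> 0"
  shows "L2 lborel (\<lambda>t. 1 / ((of_real t - a) * (of_real t - b)))"
proof (rule L2_bound[OF L2_pole[OF assms(2)], where C = "1 / \<bar>Im a\<bar>"])
  show "(\<lambda>t. 1 / ((of_real t - a) * (of_real t - b))) \<in> borel_measurable lborel"
    using L2_pole[OF assms(1)] L2_pole[OF assms(2)]
      borel_measurable_times[of "\<lambda>t. 1 / (of_real t - a)" lborel "\<lambda>t. 1 / (of_real t - b)"]
    by (simp add: L2_def)
  fix t :: real
  have "1 / cmod (of_real t - a) \<le> 1 / \<bar>Im a\<bar>"
    using abs_Im_le_pole_dist[of a t] assms by (intro divide_left_mono) (auto intro!: mult_pos_pos)
  then have "1 / cmod (of_real t - a) * (1 / cmod (of_real t - b)) \<le> 1 / \<bar>Im a\<bar> * (1 / cmod (of_real t - b))"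
    by (intro mult_right_mono) auto
  then show "cmod (1 / ((of_real t - a) * (of_real t - b))) \<le> 1 / \<bar>Im a\<bar> * cmod (1 / (of_real t - b))"
    by (simp add: norm_divide norm_mult)
qed

text \<open>The quotients F/E are of this kind because E has no zeros in the closed half plane.
  Boundary values are then plain values of the function, and no nontangential limits enter.\<close>

locale hardy_closed =
  fixes f :: "complex \<Rightarrow> complex"
  assumes cont: "continuous_on {z. 0 \<le> Im z} f" and hardy: "hardy2 f"
begin

lemma hol: "f holomorphic_on {z. 0 < Im z}"
  using hardy by (simp add: hardy2_def)

lemma line_measurable [measurable]: "y \<ge> 0 \<Longrightarrow> (\<lambda>t. f (Complex t y)) \<in> borel_measurable borel"
  by (rule closed_half_plane_line_measurable[OF cont])

text \<open>The heights y > 0 are covered by the definition of the Hardy class; height 0 is the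
  limit of the heights 1/(n+1) by Fatou.\<close>

lemma line_bound:
  obtains C where "0 \<le> C" "\<And>y. 0 \<le> y \<Longrightarrow> L2 lborel (\<lambda>t. f (Complex t y))"
    "\<And>y. 0 \<le> y \<Longrightarrow> (LINT t|lborel. (cmod (f (Complex t y)))\<^sup>2) \<le> C"
proof -
  obtain C where C: "\<And>y. y > 0 \<Longrightarrow> integrable lborel (\<lambda>x. (cmod (f (Complex x y)))\<^sup>2)"
     "\<And>y. y > 0 \<Longrightarrow> (LINT x|lborel. (cmod (f (Complex x y)))\<^sup>2) \<le> C"
    using hardy by (auto simp: hardy2_def)
  have L: "L2 lborel (\<lambda>t. f (Complex t y))" if "y > 0" for y
    using C(1)[OF that] line_measurable[of y] that by (simp add: L2_def)
  have lim: "(\<lambda>n. f (Complex t (1 / real (Suc n)))) \<longlonglongrightarrow> f (Complex t 0)" for t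
  proof (rule continuous_on_tendsto_compose[OF cont])
    show "(\<lambda>n. Complex t (1 / real (Suc n))) \<longlonglongrightarrow> Complex t 0"
      using LIMSEQ_inverse_real_of_nat by (intro tendsto_Complex tendsto_const) (simp add: inverse_eq_divide)
  qed auto
  have 0: "L2 lborel (\<lambda>t. f (Complex t 0))" "(LINT t|lborel. (cmod (f (Complex t 0)))\<^sup>2) \<le> C"
    using L2_Fatou[of lborel "\<lambda>n t. f (Complex t (1 / real (Suc n)))" C "\<lambda>t. f (Complex t 0)"] L C lim
    by auto
  have C0: "0 \<le> C" using order_trans[OF _ 0(2)] by simp
  show ?thesis
  proof (rule that[OF C0])
    fix y :: real assume "0 \<le> y"
    then show "L2 lborel (\<lambda>t. f (Complex t y))" "(LINT t|lborel. (cmod (f (Complex t y)))\<^sup>2) \<le> C"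
      using 0 L[of y] C(2)[of y] by (cases "y = 0"; simp)+
  qed
qed

lemma boundary_L2: "L2 lborel (\<lambda>t. f (of_real t))"
proof -
  obtain C where "\<And>y. 0 \<le> y \<Longrightarrow> L2 lborel (\<lambda>t. f (Complex t y))"
    using line_bound by blast
  from this[of 0] show ?thesis by (simp add: Complex_eq)
qed

text \<open>A primitive on the closed half plane turns horizontal averages into difference
  quotients: their continuity and holomorphy, and their convergence to \<open>f\<close> as the
  length shrinks, can be read off.\<close>

definition primitive :: "complex \<Rightarrow> complex" where
  "primitive = (SOME g. \<forall>x\<in>{z. 0 \<le> Im z}. (g has_field_derivative f x) (at x within {z. 0 \<le> Im z}))"

lemma primitive: "0 \<le> Im x \<Longrightarrow> (primitive has_field_derivative f x) (at x within {z. 0 \<le> Im z})"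
proof -
  have diff: "f field_differentiable at x" if "x \<in> interior {z. 0 \<le> Im z} - {}" for x
  proof -
    have "interior {z. 0 \<le> Im z} = {z. 0 < Im z}"
      using interior_halfspace_ge[of "\<i>" 0] by simp
    then show ?thesis
      using hol that by (auto simp: open_halfspace_Im_gt intro!: holomorphic_on_imp_differentiable_at)
  qed
  obtain g where "\<And>x. x \<in> {z. 0 \<le> Im z} \<Longrightarrow> (g has_field_derivative f x) (at x within {z. 0 \<le> Im z})"
    using holomorphic_convex_primitive[OF convex_halfspace_Im_ge finite.emptyI cont diff] by blast
  then have "\<exists>g. \<forall>x\<in>{z. 0 \<le> Im z}. (g has_field_derivative f x) (at x within {z. 0 \<le> Im z})"
    by blast
  from someI_ex[OF this] show "0 \<le> Im x \<Longrightarrow> (primitive has_field_derivative f x) (at x within {z. 0 \<le> Im z})"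
    unfolding primitive_def by blast
qed

text \<open>Averages of \<open>f\<close> over horizontal segments of length \<open>d\<close>. They are bounded, by Cauchy--Schwarz,
  so contour integration applies to them directly on the boundary line.\<close>

definition avg :: "real \<Rightarrow> complex \<Rightarrow> complex" where
  "avg d z = (primitive (z + of_real d) - primitive z) / of_real d"

lemma avg_continuous: "continuous_on {z. 0 \<le> Im z} (avg d)"
proof -
  have p: "continuous_on {z. 0 \<le> Im z} primitive"
    using primitive by (intro DERIV_continuous_on) auto
  have "continuous_on {z. 0 \<le> Im z} (\<lambda>z. primitive (z + of_real d))"
    by (rule continuous_on_compose2[OF p]) (auto intro!: continuous_intros)
  then show ?thesis
    unfolding avg_def divide_inverse by (intro continuous_intros p)
qed

lemma avg_holomorphic: "avg d holomorphic_on {z. 0 < Im z}"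
proof -
  have p: "primitive holomorphic_on {z. 0 < Im z}"
    unfolding holomorphic_on_def field_differentiable_def
    using primitive by (blast intro: DERIV_subset less_imp_le)
  have "(primitive \<circ> (\<lambda>z. z + of_real d)) holomorphic_on {z. 0 < Im z}"
    by (rule holomorphic_on_compose_gen[OF _ p]) (auto intro!: holomorphic_intros)
  then have "(\<lambda>z. primitive (z + of_real d)) holomorphic_on {z. 0 < Im z}"
    by (simp add: o_def)
  then show ?thesis
    unfolding avg_def divide_inverse by (intro holomorphic_intros p)
qed

lemma avg_eq_integral:
  assumes d: "0 < d" and z: "0 \<le> Im z"
  shows "avg d z = (LINT s:{0..1}|lborel. f (z + of_real (s * d)))"
    and "set_integrable lborel {0..1} (\<lambda>s. f (z + of_real (s * d)))"
proof -
  have c: "continuous_on {0..1} (\<lambda>s. f (z + of_real (s * d)))"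
    by (rule continuous_on_compose2[OF cont]) (use z in \<open>auto intro!: continuous_intros\<close>)
  then show si: "set_integrable lborel {0..1} (\<lambda>s. f (z + of_real (s * d)))"
    by (rule borel_integrable_atLeastAtMost')
  have "((\<lambda>s. of_real d * f (z + of_real (s * d))) has_integral
      primitive (z + of_real (1 * d)) - primitive (z + of_real (0 * d))) {0..1}"
  proof (rule fundamental_theorem_of_calculus)
    fix s :: real assume "s \<in> {0..1}"
    have v: "((\<lambda>s. z + of_real (s * d)) has_vector_derivative of_real d) (at s within {0..1})"
      by (auto intro!: derivative_eq_intros simp: has_vector_derivative_def scaleR_conv_of_real)
    have p: "(primitive has_field_derivative f (z + of_real (s * d)))
        (at (z + of_real (s * d)) within (\<lambda>s. z + of_real (s * d)) ` {0..1})"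
      by (rule DERIV_subset[OF primitive]) (use z in auto)
    show "((\<lambda>s. primitive (z + of_real (s * d))) has_vector_derivative
        of_real d * f (z + of_real (s * d))) (at s within {0..1})"
      using field_vector_diff_chain_within[OF v p]
      by (simp add: o_def mult.commute)
  qed simp
  from has_integral_mult_right[OF this, of "inverse (of_real d)"]
  have I: "((\<lambda>s. inverse (of_real d) * (of_real d * f (z + of_real (s * d)))) has_integral
      inverse (of_real d) * (primitive (z + of_real (1 * d)) - primitive (z + of_real (0 * d)))) {0..1}" .
  have "(\<lambda>s. inverse (of_real d) * (of_real d * f (z + of_real (s * d)))) = (\<lambda>s. f (z + of_real (s * d)))"
    using d by (intro ext) simp
  moreover have "inverse (of_real d) * (primitive (z + of_real (1 * d)) - primitive (z + of_real (0 * d))) = avg d z"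
    by (simp add: avg_def divide_inverse)
  ultimately have "((\<lambda>s. f (z + of_real (s * d))) has_integral avg d z) {0..1}"
    using I by (simp only:)
  then show "avg d z = (LINT s:{0..1}|lborel. f (z + of_real (s * d)))"
    using set_borel_integral_eq_integral(2)[OF si] by (simp add: integral_unique)
qed

lemma avg_sq_le:
  assumes d: "0 < d" and z: "0 \<le> Im z"
  shows "(cmod (avg d z))\<^sup>2 \<le> (LINT s:{0..1}|lborel. (cmod (f (z + of_real (s * d))))\<^sup>2)"
    and "set_integrable lborel {0..1} (\<lambda>s. (cmod (f (z + of_real (s * d))))\<^sup>2)"
proof -
  have c: "continuous_on {0..1} (\<lambda>s. f (z + of_real (s * d)))"
    by (rule continuous_on_compose2[OF cont]) (use z in \<open>auto intro!: continuous_intros\<close>)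
  have "continuous_on {0..1} (\<lambda>s. (cmod (f (z + of_real (s * d))))\<^sup>2)"
    by (intro continuous_intros c)
  then show si: "set_integrable lborel {0..1} (\<lambda>s. (cmod (f (z + of_real (s * d))))\<^sup>2)"
    by (rule borel_integrable_atLeastAtMost')
  let ?u = "\<lambda>s. indicator {0..1} s *\<^sub>R f (z + of_real (s * d))"
  have sq: "(cmod (?u s))\<^sup>2 = indicator {0..1} s *\<^sub>R (cmod (f (z + of_real (s * d))))\<^sup>2" for s
    by (auto simp: indicator_def)
  have Lu: "L2 lborel ?u"
    using si avg_eq_integral(2)[OF assms] unfolding L2_def sq by (auto simp: set_integrable_def)
  have sq1: "(cmod (indicator {0..1} s :: complex))\<^sup>2 = indicator {0..1} s *\<^sub>R (1::real)" for s :: real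
    by (auto simp: indicator_def)
  have L1: "L2 lborel (indicator {0..1} :: real \<Rightarrow> complex)"
    unfolding L2_def sq1 by auto
  have "avg d z = (LINT s|lborel. ?u s * indicator {0..1} s)"
    unfolding avg_eq_integral(1)[OF assms] set_lebesgue_integral_def
    by (intro Bochner_Integration.integral_cong) (auto simp: indicator_def)
  then have "(cmod (avg d z))\<^sup>2 \<le> (LINT s|lborel. (cmod (?u s))\<^sup>2) * (LINT s|lborel. (cmod (indicator {0..1} (s::real) :: complex))\<^sup>2)"
    using L2_Cauchy_Schwarz[OF Lu L1] by simp
  also have "(LINT s|lborel. (cmod (indicator {0..1} (s::real) :: complex))\<^sup>2) = 1"
    unfolding sq1 by simp
  finally show "(cmod (avg d z))\<^sup>2 \<le> (LINT s:{0..1}|lborel. (cmod (f (z + of_real (s * d))))\<^sup>2)"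
    unfolding sq set_lebesgue_integral_def by simp
qed

lemma avg_bounded:
  assumes "0 < d"
  obtains B where "\<And>z. 0 \<le> Im z \<Longrightarrow> cmod (avg d z) \<le> B"
proof -
  obtain C where C: "0 \<le> C" "\<And>y. 0 \<le> y \<Longrightarrow> L2 lborel (\<lambda>t. f (Complex t y))"
    "\<And>y. 0 \<le> y \<Longrightarrow> (LINT t|lborel. (cmod (f (Complex t y)))\<^sup>2) \<le> C"
    using line_bound by blast
  have "(cmod (avg d z))\<^sup>2 \<le> C / d" if z: "0 \<le> Im z" for z
  proof -
    have eq: "z + of_real (s * d) = Complex (Re z + d * s) (Im z)" for s
      by (simp add: complex_eq_iff mult.commute)
    have i: "integrable lborel (\<lambda>s. (cmod (f (Complex (Re z + d * s) (Im z))))\<^sup>2)"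
      using lborel_integrable_real_affine[of "\<lambda>t. (cmod (f (Complex t (Im z))))\<^sup>2" d "Re z"] C(2)[OF z] assms
      by (simp add: L2_def)
    have "(cmod (avg d z))\<^sup>2 \<le> (LINT s:{0..1}|lborel. (cmod (f (z + of_real (s * d))))\<^sup>2)"
      by (rule avg_sq_le[OF assms z])
    also have "\<dots> \<le> (LINT s|lborel. (cmod (f (Complex (Re z + d * s) (Im z))))\<^sup>2)"
      unfolding set_lebesgue_integral_def eq
      by (intro integral_mono i integrable_mult_indicator) (auto simp: indicator_def)
    also have "\<dots> = (LINT t|lborel. (cmod (f (Complex t (Im z))))\<^sup>2) / d"
      using lborel_integral_real_affine[of d "\<lambda>t. (cmod (f (Complex t (Im z))))\<^sup>2" "Re z"] assms
      by (simp add: field_simps)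
    also have "\<dots> \<le> C / d"
      using C(3)[OF z] assms by (intro divide_right_mono) auto
    finally show ?thesis .
  qed
  then have "cmod (avg d z) \<le> sqrt (C / d)" if "0 \<le> Im z" for z
    using that by (simp add: real_le_rsqrt)
  then show ?thesis using that by blast
qed

text \<open>Averaging is a contraction: |avg|^2 is at most the average of |f|^2
  (\<open>avg_sq_le\<close>), and after interchanging the integrals translation invariance gives the
  norm of f for every s.\<close>

lemma avg_L2:
  assumes d: "0 < d"
  shows "L2 lborel (\<lambda>t. avg d (of_real t))"
    and "(LINT t|lborel. (cmod (avg d (of_real t)))\<^sup>2) \<le> (LINT t|lborel. (cmod (f (of_real t)))\<^sup>2)"
proof -
  let ?K = "LINT t|lborel. (cmod (f (of_real t)))\<^sup>2"
  have fm: "(\<lambda>t. f (of_real t)) \<in> borel_measurable borel"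
    using boundary_L2 by (simp add: L2_def)
  have "continuous_on UNIV (\<lambda>t. avg d (of_real t))"
    by (rule continuous_on_compose2[OF avg_continuous]) (auto intro!: continuous_intros)
  then have am: "(\<lambda>t. avg d (of_real t)) \<in> borel_measurable borel"
    by (rule borel_measurable_continuous_onI)
  have "(\<integral>\<^sup>+t. ennreal ((cmod (avg d (of_real t)))\<^sup>2) \<partial>lborel)
      \<le> (\<integral>\<^sup>+t. \<integral>\<^sup>+s. ennreal (indicator {0..1} s *\<^sub>R (cmod (f (of_real (t + d * s))))\<^sup>2) \<partial>lborel \<partial>lborel)"
  proof (intro nn_integral_mono)
    fix t :: real
    have i: "integrable lborel (\<lambda>s. indicator {0..1} s *\<^sub>R (cmod (f (of_real (t + d * s))))\<^sup>2)"
      using avg_sq_le(2)[OF d, of "of_real t"] by (simp add: set_integrable_def mult.commute)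
    have "ennreal ((cmod (avg d (of_real t)))\<^sup>2) \<le> ennreal (LINT s|lborel. indicator {0..1} s *\<^sub>R (cmod (f (of_real (t + d * s))))\<^sup>2)"
      using avg_sq_le(1)[OF d, of "of_real t"] by (intro ennreal_leI) (simp add: set_lebesgue_integral_def mult.commute)
    then show "ennreal ((cmod (avg d (of_real t)))\<^sup>2) \<le> (\<integral>\<^sup>+s. ennreal (indicator {0..1} s *\<^sub>R (cmod (f (of_real (t + d * s))))\<^sup>2) \<partial>lborel)"
      using nn_integral_eq_integral[OF i] by simp
  qed
  also have "\<dots> = (\<integral>\<^sup>+s. \<integral>\<^sup>+t. ennreal (indicator {0..1} s *\<^sub>R (cmod (f (of_real (t + d * s))))\<^sup>2) \<partial>lborel \<partial>lborel)"
  proof (rule lborel_pair.Fubini')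
    define u where "u = (\<lambda>t. (cmod (f (of_real t)))\<^sup>2)"
    have [measurable]: "u \<in> borel_measurable borel"
      unfolding u_def by (intro borel_measurable_power measurable_compose[OF fm]) simp
    have "(\<lambda>p. ennreal (indicator {0..1} (fst p) *\<^sub>R u (snd p + d * fst p))) \<in> borel_measurable (lborel \<Otimes>\<^sub>M lborel)"
      by measurable
    then show "(\<lambda>(s, t). ennreal (indicator {0..1} s *\<^sub>R (cmod (f (of_real (t + d * s))))\<^sup>2)) \<in> borel_measurable (lborel \<Otimes>\<^sub>M lborel)"
      by (simp only: u_def case_prod_beta')
  qed
  also have "\<dots> = (\<integral>\<^sup>+(s::real). ennreal ?K * indicator {0..1} s \<partial>lborel)"
  proof (intro nn_integral_cong)
    fix s :: real
    have i: "integrable lborel (\<lambda>t. (cmod (f (of_real (d * s + 1 * t))))\<^sup>2)"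
      by (rule lborel_integrable_real_affine) (use boundary_L2 in \<open>auto simp: L2_def\<close>)
    have "(\<integral>\<^sup>+t. ennreal (indicator {0..1} s *\<^sub>R (cmod (f (of_real (t + d * s))))\<^sup>2) \<partial>lborel)
      = ennreal (LINT t|lborel. (cmod (f (of_real (d * s + 1 * t))))\<^sup>2) * indicator {0..1} s"
      using nn_integral_eq_integral[OF i] by (auto simp: indicator_def add.commute)
    also have "(LINT t|lborel. (cmod (f (of_real (d * s + 1 * t))))\<^sup>2) = ?K"
      using lborel_integral_real_affine[of 1 "\<lambda>t. (cmod (f (of_real t)))\<^sup>2" "d * s"] by simp
    finally show "(\<integral>\<^sup>+t. ennreal (indicator {0..1} s *\<^sub>R (cmod (f (of_real (t + d * s))))\<^sup>2) \<partial>lborel)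
        = ennreal ?K * indicator {0..1} s" .
  qed
  also have "\<dots> = ennreal ?K" by (simp add: nn_integral_cmult_indicator)
  finally have le: "(\<integral>\<^sup>+t. ennreal ((cmod (avg d (of_real t)))\<^sup>2) \<partial>lborel) \<le> ennreal ?K" .
  then have i: "integrable lborel (\<lambda>t. (cmod (avg d (of_real t)))\<^sup>2)"
    by (intro integrableI_nonneg) (use am in \<open>auto intro: le_less_trans\<close>)
  then show "L2 lborel (\<lambda>t. avg d (of_real t))" using am by (simp add: L2_def)
  show "(LINT t|lborel. (cmod (avg d (of_real t)))\<^sup>2) \<le> ?K"
    using le nn_integral_eq_integral[OF i] by (simp add: ennreal_le_iff)
qed

lemma avg_tendsto:
  assumes z: "0 \<le> Im z"
  shows "(\<lambda>n. avg (1 / real (Suc n)) z) \<longlonglongrightarrow> f z"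
proof -
  have "((\<lambda>y. (primitive y - primitive z) / (y - z)) \<longlongrightarrow> f z) (at z within {z. 0 \<le> Im z})"
    using primitive[OF z] by (simp add: has_field_derivative_iff)
  moreover have "filterlim (\<lambda>n. z + of_real (1 / real (Suc n))) (at z within {z. 0 \<le> Im z}) sequentially"
    unfolding filterlim_at
  proof
    have "(\<lambda>n. z + of_real (1 / real (Suc n))) \<longlonglongrightarrow> z + of_real 0"
      using LIMSEQ_inverse_real_of_nat by (intro tendsto_intros) (simp add: inverse_eq_divide)
    then show "(\<lambda>n. z + of_real (1 / real (Suc n))) \<longlonglongrightarrow> z" by simp
    have "complex_of_real (1 / real (Suc n)) \<noteq> 0" for n
      by (simp only: of_real_eq_0_iff) simp
    then show "\<forall>\<^sub>F n in sequentially. z + of_real (1 / real (Suc n)) \<in> {z. 0 \<le> Im z} \<and> z + of_real (1 / real (Suc n)) \<noteq> z"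
      using z by (intro always_eventually allI conjI) auto
  qed
  ultimately have "(\<lambda>n. (primitive (z + of_real (1 / real (Suc n))) - primitive z) / ((z + of_real (1 / real (Suc n))) - z)) \<longlonglongrightarrow> f z"
    by (rule filterlim_compose)
  then show ?thesis by (simp only: avg_def add_diff_cancel_left')
qed

text \<open>The passage from \<open>avg\<close> back to \<open>f\<close>: the identities below are
  tested against square integrable kernels, so weak convergence suffices.\<close>

lemma weak_limit:
  assumes "L2 lborel k"
  shows "(\<lambda>n. LINT t|lborel. avg (1 / real (Suc n)) (of_real t) * k t) \<longlonglongrightarrow> (LINT t|lborel. f (of_real t) * k t)"
proof (rule L2_weak_limit[OF _ _ _ assms])
  have d: "0 < 1 / real (Suc n)" for n by simp
  show "L2 lborel (\<lambda>t. avg (1 / real (Suc n)) (of_real t))" for n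
    by (rule avg_L2(1)[OF d])
  show "(LINT t|lborel. (cmod (avg (1 / real (Suc n)) (of_real t)))\<^sup>2) \<le> (LINT t|lborel. (cmod (f (of_real t)))\<^sup>2)" for n
    by (rule avg_L2(2)[OF d])
  show "(\<lambda>n. avg (1 / real (Suc n)) (of_real t)) \<longlonglongrightarrow> f (of_real t)" for t
    by (rule avg_tendsto) simp
qed

lemma Poisson:
  assumes w: "0 < Im w"
  shows "(LINT t|lborel. f (of_real t) / of_real ((t - Re w)\<^sup>2 + (Im w)\<^sup>2)) = of_real (pi / Im w) * f w"
proof -
  let ?k = "\<lambda>t. 1 / ((of_real t - w) * (of_real t - cnj w))"
  have eq: "g / of_real ((t - Re w)\<^sup>2 + (Im w)\<^sup>2) = g * ?k t" for g :: complex and t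
  proof -
    have "(of_real t - w) * (of_real t - cnj w) = of_real ((t - Re w)\<^sup>2 + (Im w)\<^sup>2)"
      by (simp add: complex_eq_iff power2_eq_square algebra_simps)
    then show ?thesis by simp
  qed
  have "(LINT t|lborel. avg (1 / real (Suc n)) (of_real t) * ?k t) = of_real (pi / Im w) * avg (1 / real (Suc n)) w" for n
  proof -
    have d: "0 < 1 / real (Suc n)" by simp
    obtain B where "\<And>z. 0 \<le> Im z \<Longrightarrow> cmod (avg (1 / real (Suc n)) z) \<le> B"
      using avg_bounded[OF d] by blast
    from bounded_Poisson[OF avg_continuous avg_holomorphic this w] show ?thesis
      by (simp only: eq)
  qed
  then have "(\<lambda>n. of_real (pi / Im w) * avg (1 / real (Suc n)) w) \<longlonglongrightarrow> (LINT t|lborel. f (of_real t) * ?k t)"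
    using weak_limit[OF L2_two_poles[of w "cnj w"]] w by (simp only: Im_complex_of_real) simp
  moreover have "(\<lambda>n. of_real (pi / Im w) * avg (1 / real (Suc n)) w) \<longlonglongrightarrow> of_real (pi / Im w) * f w"
    by (intro tendsto_intros avg_tendsto) (use w in simp)
  ultimately show ?thesis unfolding eq using LIMSEQ_unique by blast
qed

lemma two_poles_integral:
  assumes ab: "Im a < 0" "Im b < 0"
  shows "(LINT t|lborel. f (of_real t) / ((of_real t - a) * (of_real t - b))) = 0"
proof -
  define k where "k = (\<lambda>t. 1 / ((complex_of_real t - a) * (of_real t - b)))"
  have eq: "u / ((complex_of_real t - a) * (of_real t - b)) = u * k t" for u t
    by (simp add: k_def)
  have 0: "(LINT t|lborel. avg (1 / real (Suc n)) (of_real t) * k t) = 0" for n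
  proof -
    have d: "0 < 1 / real (Suc n)" by simp
    obtain B where "\<And>z. 0 \<le> Im z \<Longrightarrow> cmod (avg (1 / real (Suc n)) z) \<le> B"
      using avg_bounded[OF d] by blast
    from bounded_two_poles_integral[OF avg_continuous avg_holomorphic this ab, unfolded eq]
    show ?thesis .
  qed
  have "Im a \<noteq> 0" "Im b \<noteq> 0" using ab by auto
  then have kL: "L2 lborel k" unfolding k_def by (rule L2_two_poles)
  from weak_limit[OF kL, unfolded 0]
  have "(LINT t|lborel. f (of_real t) * k t) = 0"
    by (simp only: LIMSEQ_const_iff)
  then show ?thesis unfolding eq .
qed

text \<open>A single pole leaves too little decay. The extra factor -b/(t - b) with b = -i
  \<open>S n\<close> has modulus at most 1 and tends to 1 as \<open>S n\<close> grows; with it the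
  two-pole identity applies, and dominated convergence removes it.\<close>

lemma lower_pole_integral:
  assumes a: "Im a < 0"
  shows "(LINT t|lborel. f (of_real t) / (of_real t - a)) = 0"
proof -
  obtain S :: "nat \<Rightarrow> real" where S: "\<And>n. 0 < S n" "(\<lambda>n. inverse (S n)) \<longlonglongrightarrow> 0"
    using that[of "\<lambda>n. real (Suc n)"] LIMSEQ_inverse_real_of_nat by simp
  define b where "b = (\<lambda>n. - \<i> * complex_of_real (S n))"
  have Imb: "Im (b n) = - S n" and nb: "cmod (b n) = S n" for n
    using S(1)[of n] by (simp_all add: b_def norm_mult)
  have bneg: "Im (b n) < 0" for n using S(1)[of n] Imb by simp
  have m: "(\<lambda>t. f (of_real t)) \<in> borel_measurable borel" using boundary_L2 by (simp add: L2_def)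
  have Lp: "L2 lborel (\<lambda>t. 1 / (of_real t - c))" if "Im c < 0" for c
    using L2_pole[of c] that by simp
  have pm: "(\<lambda>t. 1 / (complex_of_real t - c)) \<in> borel_measurable borel" if "Im c < 0" for c
    using Lp[OF that] by (simp add: L2_def)
  define k where "k = (\<lambda>t. f (of_real t) * (1 / (complex_of_real t - a)))"
  have km: "k \<in> borel_measurable borel" unfolding k_def by (intro borel_measurable_times m pm a)
  let ?g = "\<lambda>n t. (- b n) * (k t * (1 / (of_real t - b n)))"
  have "(\<lambda>n. LINT t|lborel. ?g n t) \<longlonglongrightarrow> (LINT t|lborel. k t)"
  proof (rule integral_dominated_convergence)
    show ki: "integrable lborel (\<lambda>t. cmod (k t))"
      using L2_mult_norm_integrable[OF boundary_L2 Lp[OF a]] by (simp only: k_def norm_mult)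
    show "k \<in> borel_measurable lborel" using km by simp
    show "?g n \<in> borel_measurable lborel" for n
      using borel_measurable_times[OF borel_measurable_const borel_measurable_times[OF km pm[OF bneg[of n]]]]
      by simp
    have nz: "of_real t - b n \<noteq> 0" for n t
    proof
      assume "of_real t - b n = 0"
      then have "Im (of_real t - b n) = 0" by simp
      then show False using S(1)[of n] Imb[of n] by simp
    qed
    show "AE t in lborel. (\<lambda>n. ?g n t) \<longlonglongrightarrow> k t"
    proof (rule AE_I2)
      fix t :: real
      have inv0: "(\<lambda>n. complex_of_real (inverse (S n))) \<longlonglongrightarrow> of_real 0"
        by (intro tendsto_of_real S(2))
      have "(\<lambda>n. of_real t * complex_of_real (inverse (S n)) + \<i>) \<longlonglongrightarrow> of_real t * of_real 0 + \<i>"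
        by (intro tendsto_add tendsto_mult tendsto_const inv0)
      then have "(\<lambda>n. \<i> / (of_real t * complex_of_real (inverse (S n)) + \<i>)) \<longlonglongrightarrow> \<i> / (of_real t * of_real 0 + \<i>)"
        by (intro tendsto_divide tendsto_const) auto
      moreover have "\<i> / (of_real t * complex_of_real (inverse (S n)) + \<i>) = (- b n) * (1 / (of_real t - b n))" for n
      proof -
        have "complex_of_real (S n) \<noteq> 0" using S(1)[of n] by simp
        then have "of_real t * complex_of_real (inverse (S n)) + \<i> = (of_real t - b n) / of_real (S n)"
          by (simp add: field_simps b_def)
        then show ?thesis by (simp add: b_def)
      qed
      ultimately have "(\<lambda>n. (- b n) * (1 / (of_real t - b n))) \<longlonglongrightarrow> 1" by simp
      from tendsto_mult[OF tendsto_const[of "k t"] this]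
      have "(\<lambda>n. k t * ((- b n) * (1 / (of_real t - b n)))) \<longlonglongrightarrow> k t" by (simp only: mult_1_right)
      moreover have "k t * ((- b n) * (1 / (of_real t - b n))) = ?g n t" for n
        by (rule mult.left_commute)
      ultimately show "(\<lambda>n. ?g n t) \<longlonglongrightarrow> k t"
        by (simp only:)
    qed
    show "AE t in lborel. norm (?g n t) \<le> cmod (k t)" for n
    proof (rule AE_I2)
      fix t :: real
      have "cmod (- b n) \<le> cmod (of_real t - b n)"
        using abs_Im_le_pole_dist[of "b n" t] Imb[of n] nb[of n] by simp
      then have "cmod (- b n) * cmod (1 / (of_real t - b n)) \<le> 1"
        using nz[of t n] by (simp add: norm_divide)
      then have "cmod (k t) * (cmod (- b n) * cmod (1 / (of_real t - b n))) \<le> cmod (k t) * 1"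
        by (intro mult_left_mono) auto
      then show "norm (?g n t) \<le> cmod (k t)"
        by (simp only: norm_mult mult.left_commute mult_1_right)
    qed
  qed
  moreover have "(LINT t|lborel. ?g n t) = 0" for n
  proof -
    have eq: "k t * (1 / (of_real t - b n)) = f (of_real t) / ((of_real t - a) * (of_real t - b n))" for t
      unfolding k_def by simp
    show ?thesis unfolding integral_mult_right_zero eq two_poles_integral[OF a bneg] by (rule mult_zero_right)
  qed
  ultimately have "(LINT t|lborel. k t) = 0"
    by (simp only: LIMSEQ_const_iff)
  then show ?thesis by (simp add: k_def)
qed

text \<open>The Cauchy kernels at w and at cnj w differ by 2 i Im w times the Poisson kernel, and
  the one at cnj w integrates to zero against f.\<close>

lemma Cauchy:
  assumes w: "0 < Im w"
  shows "(LINT t|lborel. f (of_real t) / (of_real t - w)) = 2 * of_real pi * \<i> * f w"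
proof -
  have i: "integrable lborel (\<lambda>t. f (of_real t) / (of_real t - c))" if "Im c \<noteq> 0" for c
    using L2_mult_integrable[OF boundary_L2 L2_pole[OF that]] by simp
  have "f (of_real t) / (of_real t - w) - f (of_real t) / (of_real t - cnj w)
      = (2 * \<i> * of_real (Im w)) * (f (of_real t) / of_real ((t - Re w)\<^sup>2 + (Im w)\<^sup>2))" for t
  proof -
    have nz: "of_real t - w \<noteq> 0" "of_real t - cnj w \<noteq> 0" using w by (auto simp: complex_eq_iff)
    have "u / a - u / b = (b - a) * (u / (a * b))" if "a \<noteq> 0" "b \<noteq> 0" for u a b :: complex
      using that by (simp add: field_simps)
    from this[OF nz, of "f (of_real t)"]
    have "f (of_real t) / (of_real t - w) - f (of_real t) / (of_real t - cnj w)
      = ((of_real t - cnj w) - (of_real t - w)) * (f (of_real t) / ((of_real t - w) * (of_real t - cnj w)))" .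
    also have "(of_real t - w) * (of_real t - cnj w) = of_real ((t - Re w)\<^sup>2 + (Im w)\<^sup>2)"
      by (simp add: complex_eq_iff power2_eq_square algebra_simps)
    also have "(of_real t - cnj w) - (of_real t - w) = 2 * \<i> * of_real (Im w)"
      by (simp add: complex_eq_iff)
    finally show ?thesis .
  qed
  then have "(LINT t|lborel. f (of_real t) / (of_real t - w) - f (of_real t) / (of_real t - cnj w))
      = (2 * \<i> * of_real (Im w)) * (of_real (pi / Im w) * f w)"
    by (simp only: integral_mult_right_zero Poisson[OF w])
  then show ?thesis
    using w i[of w] i[of "cnj w"] lower_pole_integral[of "cnj w"] by simp
qed

end

section \<open>De Branges spaces\<close>

lemma star_of_real [simp]: "star F (of_real t) = cnj (F (of_real t))"
  by (simp add: star_def)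

lemma star_star [simp]: "star (star F) = F"
  by (simp add: star_def fun_eq_iff)

lemma entire_star:
  assumes "entire F" shows "entire (star F)"
proof -
  have "cnj \<circ> F \<circ> cnj holomorphic_on UNIV"
    by (rule holomorphic_on_compose_cnj_cnj) (use assms in \<open>auto simp: entire_def intro: holomorphic_on_subset\<close>)
  then show ?thesis by (simp add: entire_def o_def star_def[abs_def])
qed

lemma entire_holomorphic: "entire F \<Longrightarrow> F holomorphic_on A"
  by (auto simp: entire_def intro: holomorphic_on_subset)

lemma entire_continuous: "entire F \<Longrightarrow> continuous_on A F"
  by (intro holomorphic_on_imp_continuous_on entire_holomorphic)

lemma entire_vanishes_real:
  assumes F: "entire F" and z: "\<And>t. F (complex_of_real t) = 0"
  shows "F w = 0"
proof (rule analytic_continuation[of F UNIV "range complex_of_real" 0])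
  show "0 islimpt range complex_of_real"
    unfolding islimpt_approachable
  proof (intro allI impI)
    fix e :: real assume "0 < e"
    then show "\<exists>x'\<in>range complex_of_real. x' \<noteq> 0 \<and> dist x' 0 < e"
      by (intro bexI[OF _ rangeI[of _ "e / 2"]]) auto
  qed
qed (use F z in \<open>auto simp: entire_def\<close>)

text \<open>Comparison is asked only for large |z|; on the remaining compact part continuity up to
  the boundary supplies a bound. Small distances to a removed pole therefore never have to be
  estimated.\<close>

lemma hardy2_dominated:
  assumes cont: "continuous_on {z. 0 \<le> Im z} k" and hol: "k holomorphic_on {z. 0 < Im z}"
    and f: "hardy2 f"
    and bd: "\<And>z. 0 < Im z \<Longrightarrow> T \<le> cmod z \<Longrightarrow> cmod (k z) \<le> A * cmod (f z) + B / (1 + cmod z)"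
  shows "hardy2 k"
proof -
  let ?H = "{z. 0 \<le> Im z}"
  obtain C where C: "\<And>y. y > 0 \<Longrightarrow> integrable lborel (\<lambda>x. (cmod (f (Complex x y)))\<^sup>2)"
     "\<And>y. y > 0 \<Longrightarrow> (LINT x|lborel. (cmod (f (Complex x y)))\<^sup>2) \<le> C"
    using f by (auto simp: hardy2_def)
  have "compact (k ` (?H \<inter> cball 0 T))"
    by (intro compact_continuous_image continuous_on_subset[OF cont] closed_Int_compact
        closed_halfspace_Im_ge) auto
  then obtain Q where Q: "\<And>z. 0 \<le> Im z \<Longrightarrow> cmod z \<le> T \<Longrightarrow> cmod (k z) \<le> Q"
    using compact_imp_bounded by (force simp: bounded_iff)
  \<comment> \<open>The summand 2 B^2 pays for the term B/(1 + |z|); the other makes S/(1 + x^2) at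
    least Q^2 for |x| <= T.\<close>
  define S where "S = 2 * B\<^sup>2 + Q\<^sup>2 * (1 + T\<^sup>2)"
  have S0: "0 \<le> S" unfolding S_def by (intro add_nonneg_nonneg mult_nonneg_nonneg) auto
  have key: "(cmod (k z))\<^sup>2 \<le> 2 * A\<^sup>2 * (cmod (f z))\<^sup>2 + S * (1 / ((Re z - 0)\<^sup>2 + 1\<^sup>2))" if z: "0 < Im z" for z
  proof (cases "T \<le> cmod z")
    case True
    have nz: "1 + cmod z \<noteq> 0" using norm_ge_zero[of z] by linarith
    have "(cmod (k z))\<^sup>2 \<le> (A * cmod (f z) + B / (1 + cmod z))\<^sup>2"
      by (intro power_mono bd[OF z True]) auto
    also have "\<dots> \<le> 2 * (A * cmod (f z))\<^sup>2 + 2 * (B / (1 + cmod z))\<^sup>2"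
      using sum_squares_bound[of "A * cmod (f z)" "B / (1 + cmod z)"] by (simp add: power2_sum)
    also have "(B / (1 + cmod z))\<^sup>2 \<le> B\<^sup>2 / (1 + (Re z)\<^sup>2)"
      unfolding power_divide
    proof (intro divide_left_mono)
      have "(Re z)\<^sup>2 \<le> (cmod z)\<^sup>2" by (simp add: cmod_power2)
      then show "1 + (Re z)\<^sup>2 \<le> (1 + cmod z)\<^sup>2"
        by (simp add: power2_sum) (use norm_ge_zero[of z] in linarith)
    qed (use nz in \<open>auto intro!: mult_pos_pos add_pos_nonneg\<close>)
    also have "2 * (A * cmod (f z))\<^sup>2 + 2 * (B\<^sup>2 / (1 + (Re z)\<^sup>2)) \<le> 2 * A\<^sup>2 * (cmod (f z))\<^sup>2 + S / (1 + (Re z)\<^sup>2)"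
    proof -
      have "2 * B\<^sup>2 \<le> S" by (simp add: S_def)
      then have "2 * B\<^sup>2 / (1 + (Re z)\<^sup>2) \<le> S / (1 + (Re z)\<^sup>2)"
        by (intro divide_right_mono) auto
      then show ?thesis by (simp add: power_mult_distrib)
    qed
    finally show ?thesis by (simp add: add.commute)
  next
    case False
    then have le: "cmod z \<le> T" by simp
    have "(cmod (k z))\<^sup>2 \<le> Q\<^sup>2"
      using Q[of z] z le by (intro power_mono) auto
    also have "\<dots> = Q\<^sup>2 * (1 + T\<^sup>2) / (1 + T\<^sup>2)"
      by (simp add: add_nonneg_eq_0_iff)
    also have "\<dots> \<le> S / (1 + T\<^sup>2)"
      by (intro divide_right_mono) (auto simp: S_def)
    also have "\<dots> \<le> S / (1 + (Re z)\<^sup>2)"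
    proof (intro divide_left_mono S0)
      have "(Re z)\<^sup>2 \<le> (cmod z)\<^sup>2" by (simp add: cmod_power2)
      also have "\<dots> \<le> T\<^sup>2" using le by (intro power_mono) auto
      finally show "1 + (Re z)\<^sup>2 \<le> 1 + T\<^sup>2" by simp
    qed (auto intro!: mult_pos_pos add_pos_nonneg)
    finally have "(cmod (k z))\<^sup>2 \<le> S / (1 + (Re z)\<^sup>2)" .
    moreover have "0 \<le> 2 * A\<^sup>2 * (cmod (f z))\<^sup>2" by simp
    moreover have "S * (1 / ((Re z - 0)\<^sup>2 + 1\<^sup>2)) = S / (1 + (Re z)\<^sup>2)" by (simp add: add.commute)
    ultimately show ?thesis by linarith
  qed
  have p: "integrable lborel (\<lambda>t::real. 1 / ((t - 0)\<^sup>2 + 1\<^sup>2))"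
    by (rule poisson_kernel_integrable) simp
  show ?thesis
    unfolding hardy2_def
  proof (intro conjI hol exI[of _ "2 * A\<^sup>2 * C + S * pi"] allI impI)
    fix y :: real assume y: "0 < y"
    have i: "integrable lborel (\<lambda>x. 2 * A\<^sup>2 * (cmod (f (Complex x y)))\<^sup>2 + S * (1 / ((x - 0)\<^sup>2 + 1\<^sup>2)))"
      using C(1)[OF y] p by (intro Bochner_Integration.integrable_add integrable_mult_right)
    have key': "(cmod (k (Complex x y)))\<^sup>2 \<le> 2 * A\<^sup>2 * (cmod (f (Complex x y)))\<^sup>2 + S * (1 / ((x - 0)\<^sup>2 + 1\<^sup>2))" for x
      using key[of "Complex x y"] y by simp
    have km: "(\<lambda>t. k (Complex t y)) \<in> borel_measurable borel"
      by (rule closed_half_plane_line_measurable[OF cont]) (use y in simp)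
    show ki: "integrable lborel (\<lambda>x. (cmod (k (Complex x y)))\<^sup>2)"
    proof (rule Bochner_Integration.integrable_bound[OF i])
      show "(\<lambda>x. (cmod (k (Complex x y)))\<^sup>2) \<in> borel_measurable lborel"
        using km by simp
      show "AE x in lborel. norm ((cmod (k (Complex x y)))\<^sup>2)
          \<le> norm (2 * A\<^sup>2 * (cmod (f (Complex x y)))\<^sup>2 + S * (1 / ((x - 0)\<^sup>2 + 1\<^sup>2)))"
      proof (rule AE_I2)
        fix x
        show "norm ((cmod (k (Complex x y)))\<^sup>2) \<le> norm (2 * A\<^sup>2 * (cmod (f (Complex x y)))\<^sup>2 + S * (1 / ((x - 0)\<^sup>2 + 1\<^sup>2)))"
          using order_trans[OF key'[of x] abs_ge_self] by simp
      qed
    qed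
    have "(LINT x|lborel. (cmod (k (Complex x y)))\<^sup>2)
      \<le> (LINT x|lborel. 2 * A\<^sup>2 * (cmod (f (Complex x y)))\<^sup>2 + S * (1 / ((x - 0)\<^sup>2 + 1\<^sup>2)))"
      by (intro integral_mono ki i key')
    also have "\<dots> = 2 * A\<^sup>2 * (LINT x|lborel. (cmod (f (Complex x y)))\<^sup>2) + S * (LINT x::real|lborel. 1 / ((x - 0)\<^sup>2 + 1\<^sup>2))"
      by (subst Bochner_Integration.integral_add[OF integrable_mult_right[OF C(1)[OF y]] integrable_mult_right[OF p]])
         (simp only: integral_mult_right_zero)
    also have "(LINT x::real|lborel. 1 / ((x - 0)\<^sup>2 + 1\<^sup>2)) = pi"
      using poisson_kernel_integral[of 1 0] by simp
    also have "2 * A\<^sup>2 * (LINT x|lborel. (cmod (f (Complex x y)))\<^sup>2) + S * pi \<le> 2 * A\<^sup>2 * C + S * pi"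
      using C(2)[OF y] by (intro add_right_mono mult_left_mono) auto
    finally show "(LINT x|lborel. (cmod (k (Complex x y)))\<^sup>2) \<le> 2 * A\<^sup>2 * C + S * pi" .
  qed
qed

lemma hardy2_0: "hardy2 (\<lambda>z. 0)"
  by (auto simp: hardy2_def intro!: exI[of _ 0])

lemma hardy2_add:
  assumes "hardy_closed f" "hardy_closed g"
  shows "hardy2 (\<lambda>z. f z + g z)"
proof -
  interpret F: hardy_closed f by fact
  interpret G: hardy_closed g by fact
  obtain C where "0 \<le> C" and C: "\<And>y. 0 \<le> y \<Longrightarrow> L2 lborel (\<lambda>t. f (Complex t y))"
    "\<And>y. 0 \<le> y \<Longrightarrow> (LINT t|lborel. (cmod (f (Complex t y)))\<^sup>2) \<le> C"
    by (rule F.line_bound, rule that; simp)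
  obtain D where "0 \<le> D" and D: "\<And>y. 0 \<le> y \<Longrightarrow> L2 lborel (\<lambda>t. g (Complex t y))"
    "\<And>y. 0 \<le> y \<Longrightarrow> (LINT t|lborel. (cmod (g (Complex t y)))\<^sup>2) \<le> D"
    by (rule G.line_bound, rule that; simp)
  show ?thesis
    unfolding hardy2_def
  proof (intro conjI exI[of _ "2 * C + 2 * D"] allI impI)
    show "(\<lambda>z. f z + g z) holomorphic_on {z. 0 < Im z}"
      by (rule holomorphic_on_add[OF F.hol G.hol])
    fix y :: real assume "0 < y"
    then have y: "0 \<le> y" by simp
    have L: "L2 lborel (\<lambda>t. f (Complex t y) + g (Complex t y))" by (rule L2_add[OF C(1)[OF y] D(1)[OF y]])
    then show i: "integrable lborel (\<lambda>x. (cmod (f (Complex x y) + g (Complex x y)))\<^sup>2)"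
      unfolding L2_def by blast
    have fg: "integrable lborel (\<lambda>t. (cmod (f (Complex t y)))\<^sup>2)" "integrable lborel (\<lambda>t. (cmod (g (Complex t y)))\<^sup>2)"
      using C(1)[OF y] D(1)[OF y] unfolding L2_def by blast+
    have "(LINT x|lborel. (cmod (f (Complex x y) + g (Complex x y)))\<^sup>2)
        \<le> (LINT t|lborel. 2 * (cmod (f (Complex t y)))\<^sup>2 + 2 * (cmod (g (Complex t y)))\<^sup>2)"
    proof (rule integral_mono[OF i])
      show "integrable lborel (\<lambda>t. 2 * (cmod (f (Complex t y)))\<^sup>2 + 2 * (cmod (g (Complex t y)))\<^sup>2)"
        using fg by (intro Bochner_Integration.integrable_add integrable_mult_right)
      fix t
      have "(cmod (f (Complex t y) + g (Complex t y)))\<^sup>2 \<le> (cmod (f (Complex t y)) + cmod (g (Complex t y)))\<^sup>2"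
        by (intro power_mono norm_triangle_ineq) auto
      then show "(cmod (f (Complex t y) + g (Complex t y)))\<^sup>2 \<le> 2 * (cmod (f (Complex t y)))\<^sup>2 + 2 * (cmod (g (Complex t y)))\<^sup>2"
        using sum_squares_bound[of "cmod (f (Complex t y))" "cmod (g (Complex t y))"]
        unfolding power2_sum by linarith
    qed
    also have "\<dots> = 2 * (LINT t|lborel. (cmod (f (Complex t y)))\<^sup>2) + 2 * (LINT t|lborel. (cmod (g (Complex t y)))\<^sup>2)"
      by (subst Bochner_Integration.integral_add[OF integrable_mult_right[OF fg(1)] integrable_mult_right[OF fg(2)]])
         (simp only: integral_mult_right_zero)
    also have "\<dots> \<le> 2 * C + 2 * D"
      using C(2)[OF y] D(2)[OF y] by linarith
    finally show "(LINT x|lborel. (cmod (f (Complex x y) + g (Complex x y)))\<^sup>2) \<le> 2 * C + 2 * D" .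
  qed
qed

locale de_branges =
  fixes E :: "complex \<Rightarrow> complex"
  assumes HB: "hermite_biehler E"
begin

lemma E_entire: "entire E" and E_real_nz: "E (of_real t) \<noteq> 0"
  and star_E_less: "0 < Im z \<Longrightarrow> cmod (star E z) < cmod (E z)"
  using HB by (auto simp: hermite_biehler_def)

lemma E_nz: "0 \<le> Im z \<Longrightarrow> E z \<noteq> 0"
proof (cases "Im z = 0")
  case True
  then have "z = of_real (Re z)" by (simp add: complex_eq_iff)
  then show ?thesis using E_real_nz by metis
next
  case False
  assume "0 \<le> Im z"
  then have "0 < Im z" using False by simp
  from star_E_less[OF this] show ?thesis by auto
qed

lemma quotient_continuous: "entire F \<Longrightarrow> continuous_on {z. 0 \<le> Im z} (\<lambda>z. F z / E z)"
  using E_nz by (intro continuous_intros entire_continuous E_entire) auto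

lemma quotient_holomorphic: "entire F \<Longrightarrow> (\<lambda>z. F z / E z) holomorphic_on {z. 0 < Im z}"
  using E_nz by (intro holomorphic_intros entire_holomorphic E_entire) auto

lemma deBranges_entire: "F \<in> deBranges E \<Longrightarrow> entire F"
  by (simp add: deBranges_def)

lemma deBranges_star: "F \<in> deBranges E \<Longrightarrow> star F \<in> deBranges E"
  by (auto simp: deBranges_def entire_star)

lemma deBranges_hardy: "F \<in> deBranges E \<Longrightarrow> hardy_closed (\<lambda>z. F z / E z)"
  unfolding hardy_closed_def using quotient_continuous by (auto simp: deBranges_def)

lemma deBranges_hardyI:
  assumes F: "entire F" and h: "hardy2 f" "hardy2 g"
    and 1: "\<And>z. 0 < Im z \<Longrightarrow> T \<le> cmod z \<Longrightarrow> cmod (F z / E z) \<le> A * cmod (f z) + B / (1 + cmod z)"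
    and 2: "\<And>z. 0 < Im z \<Longrightarrow> T \<le> cmod z \<Longrightarrow> cmod (star F z / E z) \<le> A * cmod (g z) + B / (1 + cmod z)"
  shows "F \<in> deBranges E"
  unfolding deBranges_def
proof (intro CollectI conjI F)
  show "hardy2 (\<lambda>z. F z / E z)"
    by (rule hardy2_dominated[OF quotient_continuous[OF F] quotient_holomorphic[OF F] h(1) 1])
  show "hardy2 (\<lambda>z. star F z / E z)"
    by (rule hardy2_dominated[OF quotient_continuous quotient_holomorphic h(2) 2]) (use F entire_star in auto)
qed

text \<open>The majorant is symmetric: conjugating z exchanges |E| with |star E| and |G| with |star
  G|. One estimate on the whole plane thus serves both F and \<open>star F\<close>.\<close>

lemma deBrangesI:
  assumes F: "entire F" and G: "G \<in> deBranges E" and B: "0 \<le> B"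
    and le: "\<And>z. T \<le> cmod z \<Longrightarrow> cmod (F z) \<le> A * cmod (G z) + B * (cmod (E z) + cmod (star E z)) / (1 + cmod z)"
  shows "F \<in> deBranges E"
proof (rule deBranges_hardyI[OF F, where B = "2 * B"])
  show "hardy2 (\<lambda>z. G z / E z)" "hardy2 (\<lambda>z. star G z / E z)"
    using G by (auto simp: deBranges_def)
  fix z assume z: "0 < Im z" "T \<le> cmod z"
  have nz: "0 < cmod (E z)" using E_nz[of z] z by simp
  have aux: "u / cmod (E z) \<le> A * (g / cmod (E z)) + 2 * B / (1 + cmod z)"
    if u: "u \<le> A * g + B * s / (1 + cmod z)" and s: "s \<le> 2 * cmod (E z)" for u g s
  proof -
    have "B * s / (1 + cmod z) \<le> B * (2 * cmod (E z)) / (1 + cmod z)"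
      using B s by (intro divide_right_mono mult_left_mono) auto
    with u have "u \<le> A * g + B * (2 * cmod (E z)) / (1 + cmod z)" by linarith
    then have "u / cmod (E z) \<le> (A * g + B * (2 * cmod (E z)) / (1 + cmod z)) / cmod (E z)"
      by (intro divide_right_mono) auto
    also have "\<dots> = A * (g / cmod (E z)) + 2 * B / (1 + cmod z)"
      using nz by (simp add: add_divide_distrib)
    finally show ?thesis .
  qed
  have s: "cmod (E z) + cmod (star E z) \<le> 2 * cmod (E z)" using star_E_less[OF z(1)] by simp
  show "cmod (F z / E z) \<le> A * cmod (G z / E z) + 2 * B / (1 + cmod z)"
    unfolding norm_divide by (rule aux[OF le[OF z(2)] s])
  have "cmod (star F z) \<le> A * cmod (star G z) + B * (cmod (E z) + cmod (star E z)) / (1 + cmod z)"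
    using le[of "cnj z"] z(2) by (simp add: star_def add.commute)
  then show "cmod (star F z / E z) \<le> A * cmod (star G z / E z) + 2 * B / (1 + cmod z)"
    unfolding norm_divide by (rule aux[OF _ s])
qed

lemma deBranges_0: "(\<lambda>z. 0) \<in> deBranges E"
  using hardy2_0 by (simp add: deBranges_def entire_def star_def)

lemma deBranges_cmult:
  assumes "F \<in> deBranges E" shows "(\<lambda>z. c * F z) \<in> deBranges E"
proof (rule deBrangesI[OF _ assms, where A = "cmod c" and B = 0 and T = 0])
  show "entire (\<lambda>z. c * F z)"
    using deBranges_entire[OF assms] unfolding entire_def by (intro holomorphic_intros)
qed (simp_all add: norm_mult)

lemma deBranges_add:
  assumes F: "F \<in> deBranges E" and G: "G \<in> deBranges E"
  shows "(\<lambda>z. F z + G z) \<in> deBranges E"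
proof -
  have e: "entire (\<lambda>z. F z + G z)"
    using deBranges_entire[OF F] deBranges_entire[OF G] unfolding entire_def by (intro holomorphic_intros)
  have s: "star (\<lambda>z. F z + G z) = (\<lambda>z. star F z + star G z)" by (simp add: star_def fun_eq_iff)
  have 1: "hardy2 (\<lambda>z. F z / E z + G z / E z)"
    by (rule hardy2_add[OF deBranges_hardy[OF F] deBranges_hardy[OF G]])
  have 2: "hardy2 (\<lambda>z. star F z / E z + star G z / E z)"
    by (rule hardy2_add[OF deBranges_hardy[OF deBranges_star[OF F]] deBranges_hardy[OF deBranges_star[OF G]]])
  show ?thesis
    unfolding deBranges_def using e 1 2 by (simp only: s add_divide_distrib mem_Collect_eq)
qed

lemma deBranges_diff: "F \<in> deBranges E \<Longrightarrow> G \<in> deBranges E \<Longrightarrow> (\<lambda>z. F z - G z) \<in> deBranges E"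
  using deBranges_add[of F "\<lambda>z. (-1) * G z"] deBranges_cmult[of G "-1"] by simp

lemma deBranges_sum:
  assumes "finite A" "A \<subseteq> deBranges E" shows "(\<lambda>z. \<Sum>f\<in>A. c f * f z) \<in> deBranges E"
  using assms by (induction A) (auto intro!: deBranges_0 deBranges_add deBranges_cmult)

lemma lin_span_deBranges: "S \<subseteq> deBranges E \<Longrightarrow> lin_span S \<subseteq> deBranges E"
  unfolding lin_span_def using deBranges_sum by blast

definition quot :: "(complex \<Rightarrow> complex) \<Rightarrow> complex \<Rightarrow> complex \<Rightarrow> complex" where
  "quot F a z = (if z = a then deriv F a else (F z - F a) / (z - a))"

lemma entire_quot: "entire F \<Longrightarrow> entire (quot F a)"
  unfolding quot_def[abs_def] entire_def by (rule pole_lemma_open) auto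

text \<open>For |w| >= |a| + 1 the divisor w - a has modulus at least 1, and by
  \<open>deBrangesI\<close> large |w| decide about membership.\<close>

lemma deBranges_quot:
  assumes F: "F \<in> deBranges E" and z: "F a = 0"
  shows "quot F a \<in> deBranges E"
proof (rule deBrangesI[OF entire_quot[OF deBranges_entire[OF F]] F, where A = 1 and B = 0 and T = "cmod a + 1"])
  fix w assume w: "cmod a + 1 \<le> cmod w"
  have "cmod w \<le> cmod (w - a) + cmod a" using norm_triangle_ineq[of "w - a" a] by simp
  with w have 1: "1 \<le> cmod (w - a)" by linarith
  have "cmod (F w) / cmod (w - a) \<le> cmod (F w) / 1"
    using 1 by (intro divide_left_mono) (auto intro!: mult_pos_pos)
  moreover have "w \<noteq> a" using w by auto
  ultimately show "cmod (quot F a w) \<le> 1 * cmod (F w) + 0 * (cmod (E w) + cmod (star E w)) / (1 + cmod w)"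
    using z by (simp add: quot_def norm_divide)
qed simp

definition kernel_num :: "complex \<Rightarrow> complex \<Rightarrow> complex" where
  "kernel_num w z = cnj (E w) * E z - cnj (star E w) * star E z"

lemma entire_kernel_num: "entire (kernel_num w)"
  using E_entire entire_star[OF E_entire] unfolding entire_def kernel_num_def[abs_def]
  by (intro holomorphic_intros)

lemma kernel_num_cnj: "kernel_num w (cnj w) = 0"
  by (simp add: kernel_num_def star_def mult.commute)

text \<open>Both branches of the kernel are one divided difference of \<open>kernel_num\<close>,
  which vanishes at cnj w; entireness then follows without a case distinction.\<close>

lemma repkernel_eq: "repkernel E w z = - quot (kernel_num w) (cnj w) z / (2 * of_real pi * \<i>)"
proof (cases "z = cnj w")
  case True
  have d: "(E has_field_derivative deriv E u) (at u)" "(star E has_field_derivative deriv (star E) u) (at u)" for u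
    using E_entire entire_star[OF E_entire]
    by (auto simp: entire_def intro!: holomorphic_derivI[of _ UNIV])
  have "(kernel_num w has_field_derivative cnj (E w) * deriv E (cnj w) - cnj (star E w) * deriv (star E) (cnj w)) (at (cnj w))"
    unfolding kernel_num_def[abs_def] by (intro DERIV_diff DERIV_cmult d)
  then have "deriv (kernel_num w) (cnj w) = cnj (E w) * deriv E (cnj w) - cnj (star E w) * deriv (star E) (cnj w)"
    by (rule DERIV_imp_deriv)
  then show ?thesis using True by (simp add: repkernel_def quot_def)
next
  case False
  have "- (n / d) / c = n / (c * (- d))" for n d c :: complex by simp
  from this[of "kernel_num w z" "z - cnj w" "2 * of_real pi * \<i>"] False show ?thesis
    unfolding repkernel_def quot_def kernel_num_cnj by (simp add: kernel_num_def)
qed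

lemma entire_repkernel: "entire (repkernel E w)"
proof -
  have "(\<lambda>z. - quot (kernel_num w) (cnj w) z / (2 * of_real pi * \<i>)) holomorphic_on UNIV"
    using entire_quot[OF entire_kernel_num] unfolding entire_def by (intro holomorphic_intros) auto
  moreover have "repkernel E w = (\<lambda>z. - quot (kernel_num w) (cnj w) z / (2 * of_real pi * \<i>))"
    by (rule ext) (rule repkernel_eq)
  ultimately show ?thesis unfolding entire_def by simp
qed

lemma repkernel_off: "z \<noteq> cnj w \<Longrightarrow> repkernel E w z = kernel_num w z / (2 * of_real pi * \<i> * (cnj w - z))"
  by (simp add: repkernel_def kernel_num_def)

lemma repkernel_deBranges: "repkernel E w \<in> deBranges E"
proof (rule deBrangesI[OF entire_repkernel deBranges_0,
    where A = 0 and T = "2 * cmod w + 1" and B = "(cmod (E w) + cmod (star E w))"])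
  fix z assume z: "2 * cmod w + 1 \<le> cmod z"
  have "cmod z \<le> cmod (cnj w - z) + cmod (cnj w)"
    using norm_triangle_ineq[of "cnj w - z" "- cnj w"] by (simp add: norm_minus_commute)
  then have 1: "(1 + cmod z) / 2 \<le> cmod (cnj w - z)" using z by simp
  have ne: "z \<noteq> cnj w"
  proof
    assume "z = cnj w"
    with 1 have "1 + cmod w \<le> 0" by simp
    then show False using norm_ge_zero[of w] by linarith
  qed
  have "1 + cmod z \<le> 2 * pi * cmod (cnj w - z)"
  proof -
    have "1 * (1 + cmod z) \<le> pi * (2 * cmod (cnj w - z))"
      using 1 pi_gt3 by (intro mult_mono) auto
    then show ?thesis by simp
  qed
  moreover have "cmod (kernel_num w z) \<le> (cmod (E w) + cmod (star E w)) * (cmod (E z) + cmod (star E z))"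
  proof -
    have "cmod (kernel_num w z) \<le> cmod (E w) * cmod (E z) + cmod (star E w) * cmod (star E z)"
      unfolding kernel_num_def using norm_triangle_ineq4[of "cnj (E w) * E z" "cnj (star E w) * star E z"]
      by (simp add: norm_mult)
    also have "\<dots> \<le> (cmod (E w) + cmod (star E w)) * (cmod (E z) + cmod (star E z))"
      by (simp add: algebra_simps)
    finally show ?thesis .
  qed
  ultimately have "cmod (kernel_num w z) / (2 * pi * cmod (cnj w - z))
     \<le> (cmod (E w) + cmod (star E w)) * (cmod (E z) + cmod (star E z)) / (1 + cmod z)"
    by (intro frac_le) (auto intro!: add_pos_nonneg)
  then show "cmod (repkernel E w z) \<le> 0 * cmod 0 + (cmod (E w) + cmod (star E w)) * (cmod (E z) + cmod (star E z)) / (1 + cmod z)"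
    unfolding repkernel_off[OF ne] by (simp add: norm_divide norm_mult)
qed simp

end

section \<open>Inner product, norm and reproducing kernel\<close>

context de_branges
begin

definition sqn :: "(complex \<Rightarrow> complex) \<Rightarrow> real" where
  "sqn F = (LINT t|lborel. (cmod (F (of_real t) / E (of_real t)))\<^sup>2)"

lemma sqn_nonneg [simp]: "0 \<le> sqn F"
  by (simp add: sqn_def)

lemma dB_norm_eq: "dB_norm E F = sqrt (sqn F)"
  by (simp add: dB_norm_def sqn_def norm_divide)

lemma dB_inner_eq:
  "dB_inner E F G = (LINT t|lborel. F (of_real t) / E (of_real t) * cnj (G (of_real t) / E (of_real t)))"
  unfolding dB_inner_def
proof (intro Bochner_Integration.integral_cong refl)
  fix t
  have "complex_of_real ((cmod (E (of_real t)))\<^sup>2) = E (of_real t) * cnj (E (of_real t))"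
    by (rule complex_norm_square)
  then show "F (of_real t) * cnj (G (of_real t)) / of_real ((cmod (E (of_real t)))\<^sup>2)
      = F (of_real t) / E (of_real t) * cnj (G (of_real t) / E (of_real t))"
    by simp
qed

lemma deBranges_L2: "F \<in> deBranges E \<Longrightarrow> L2 lborel (\<lambda>t. F (of_real t) / E (of_real t))"
  using hardy_closed.boundary_L2[OF deBranges_hardy] .

lemma dB_inner_integrable:
  assumes "F \<in> deBranges E" "G \<in> deBranges E"
  shows "integrable lborel (\<lambda>t. F (of_real t) / E (of_real t) * cnj (G (of_real t) / E (of_real t)))"
  by (rule L2_mult_integrable[OF deBranges_L2[OF assms(1)] L2_cnj[OF deBranges_L2[OF assms(2)]]])

lemma dB_inner_add_left:
  assumes "F \<in> deBranges E" "G \<in> deBranges E" "H \<in> deBranges E"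
  shows "dB_inner E (\<lambda>z. F z + G z) H = dB_inner E F H + dB_inner E G H"
  unfolding dB_inner_eq add_divide_distrib distrib_right
  by (rule Bochner_Integration.integral_add[OF dB_inner_integrable[OF assms(1,3)] dB_inner_integrable[OF assms(2,3)]])

lemma dB_inner_cmult_left: "dB_inner E (\<lambda>z. c * F z) H = c * dB_inner E F H"
proof -
  have "c * F (of_real t) / e * h = c * (F (of_real t) / e * h)" for t and e h :: complex by simp
  then show ?thesis unfolding dB_inner_eq by (simp only: integral_mult_right_zero)
qed

lemma dB_inner_cnj: "cnj (dB_inner E F G) = dB_inner E G F"
proof -
  have "cnj (dB_inner E F G) = (LINT t|lborel. cnj (F (of_real t) / E (of_real t) * cnj (G (of_real t) / E (of_real t))))"
    unfolding dB_inner_eq by (rule Bochner_Integration.integral_cnj[symmetric])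
  then show ?thesis unfolding dB_inner_eq by (simp add: mult.commute)
qed

lemma dB_inner_sqn: "dB_inner E F F = of_real (sqn F)"
  unfolding dB_inner_eq sqn_def complex_norm_square[symmetric] by (rule integral_complex_of_real)

lemma dB_inner_star: "dB_inner E (star F) (star G) = cnj (dB_inner E F G)"
proof -
  have "cnj (dB_inner E F G) = (LINT t|lborel. cnj (F (of_real t) * cnj (G (of_real t)) / of_real ((cmod (E (of_real t)))\<^sup>2)))"
    unfolding dB_inner_def by (rule Bochner_Integration.integral_cnj[symmetric])
  also have "\<dots> = dB_inner E (star F) (star G)"
    unfolding dB_inner_def star_of_real complex_cnj_divide complex_cnj_mult complex_cnj_cnj complex_cnj_complex_of_real ..
  finally show ?thesis by (rule sym)
qed

lemma dB_Cauchy_Schwarz: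
  assumes "F \<in> deBranges E" "G \<in> deBranges E"
  shows "(cmod (dB_inner E F G))\<^sup>2 \<le> sqn F * sqn G"
  using L2_Cauchy_Schwarz[OF deBranges_L2[OF assms(1)] L2_cnj[OF deBranges_L2[OF assms(2)]]]
  unfolding dB_inner_eq sqn_def complex_mod_cnj .

lemma sqn_star: "sqn (star F) = sqn F"
  by (simp add: sqn_def norm_divide)

lemma sqn_cmult: "sqn (\<lambda>z. c * F z) = (cmod c)\<^sup>2 * sqn F"
proof -
  have "(cmod (c * f / e))\<^sup>2 = (cmod c)\<^sup>2 * (cmod (f / e))\<^sup>2" for f e
    by (simp add: norm_mult norm_divide power_mult_distrib power_divide)
  then show ?thesis unfolding sqn_def by (simp only: integral_mult_right_zero)
qed

lemma parallelogram:
  assumes "F \<in> deBranges E" "G \<in> deBranges E"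
  shows "sqn (\<lambda>z. F z + G z) + sqn (\<lambda>z. F z - G z) = 2 * sqn F + 2 * sqn G"
proof -
  let ?f = "\<lambda>t. F (complex_of_real t) / E (of_real t)" and ?g = "\<lambda>t. G (complex_of_real t) / E (of_real t)"
  note L = deBranges_L2[OF assms(1)] deBranges_L2[OF assms(2)]
  have i: "integrable lborel (\<lambda>t. (cmod (?f t + ?g t))\<^sup>2)" "integrable lborel (\<lambda>t. (cmod (?f t - ?g t))\<^sup>2)"
    "integrable lborel (\<lambda>t. (cmod (?f t))\<^sup>2)" "integrable lborel (\<lambda>t. (cmod (?g t))\<^sup>2)"
    using L2_add[OF L] L2_diff[OF L] L unfolding L2_def by blast+
  have p: "(cmod (a + b))\<^sup>2 + (cmod (a - b))\<^sup>2 = 2 * (cmod a)\<^sup>2 + 2 * (cmod b)\<^sup>2" for a b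
    unfolding cmod_power2 by (simp add: power2_eq_square algebra_simps)
  have "sqn (\<lambda>z. F z + G z) + sqn (\<lambda>z. F z - G z) = (LINT t|lborel. (cmod (?f t + ?g t))\<^sup>2 + (cmod (?f t - ?g t))\<^sup>2)"
    unfolding sqn_def add_divide_distrib diff_divide_distrib
    by (rule Bochner_Integration.integral_add[OF i(1,2), symmetric])
  also have "\<dots> = 2 * sqn F + 2 * sqn G"
    unfolding p sqn_def
    by (subst Bochner_Integration.integral_add[OF integrable_mult_right[OF i(3)] integrable_mult_right[OF i(4)]])
       (simp only: integral_mult_right_zero)
  finally show ?thesis .
qed

text \<open>F/E is continuous on the real line and nonempty open sets are not negligible, so
  vanishing almost everywhere is vanishing everywhere there; the identity theorem does the
  rest.\<close>

lemma sqn_eq_0: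
  assumes F: "F \<in> deBranges E" and z: "sqn F = 0"
  shows "F w = 0"
proof (rule entire_vanishes_real[OF deBranges_entire[OF F]])
  fix t :: real
  let ?q = "\<lambda>t. (cmod (F (of_real t) / E (of_real t)))\<^sup>2"
  have i: "integrable lborel ?q" using deBranges_L2[OF F] by (simp add: L2_def)
  have "AE t in lborel. ?q t = 0"
    using integral_nonneg_eq_0_iff_AE[OF i] z by (simp add: sqn_def)
  moreover have "continuous_on UNIV ?q"
  proof -
    have c: "continuous_on UNIV (\<lambda>t. G (complex_of_real t))" if "entire G" for G
      by (rule continuous_on_compose2[OF entire_continuous[OF that, of UNIV]]) (auto intro: continuous_on_of_real continuous_on_id)
    show ?thesis
      by (intro continuous_on_power continuous_on_norm continuous_on_divide c E_entire deBranges_entire[OF F])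
         (use E_real_nz in simp)
  qed
  ultimately have "?q t = 0"
  proof -
    assume ae: "AE t in lborel. ?q t = 0" and c: "continuous_on UNIV ?q"
    have o: "open {t. ?q t \<noteq> 0}"
      by (rule open_Collect_neq[OF c continuous_on_const])
    have "{t. ?q t \<noteq> 0} \<in> null_sets lborel"
      using ae AE_iff_null[of lborel "\<lambda>t. ?q t = 0"] borel_open[OF o] by simp
    then have "{t. ?q t \<noteq> 0} \<in> null_sets lebesgue" by (rule null_sets_completionI)
    then have "negligible {t. ?q t \<noteq> 0}" by (simp add: negligible_iff_null_sets)
    with o have "{t. ?q t \<noteq> 0} = {}" using open_not_negligible by blast
    then show "?q t = 0" by blast
  qed
  then show "F (of_real t) = 0" using E_real_nz[of t] by simp
qed

text \<open>The integrand splits into multiples of a Cauchy integrand of F/E with pole w and of the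
  conjugate of one of (star F)/E with pole cnj w. The first integral will reproduce F w, the second
  vanishes.\<close>

lemma repkernel_quotient:
  assumes w: "0 < Im w"
  shows "F (of_real t) / E (of_real t) * cnj (repkernel E w (of_real t) / E (of_real t))
    = E w / (2 * of_real pi * \<i>) * (F (of_real t) / E (of_real t) / (of_real t - w))
      - star E w / (2 * of_real pi * \<i>) * cnj (star F (of_real t) / E (of_real t) / (of_real t - cnj w))"
proof -
  have ne: "of_real t \<noteq> cnj w" "of_real t \<noteq> w" using w by (auto simp: complex_eq_iff)
  have nz: "E (of_real t) \<noteq> 0" "cnj (E (of_real t)) \<noteq> 0" using E_real_nz by auto
  have alg: "f / e * (- ((a * e' - b * e) / (p * (w - x))) / e')
     = a / p * (f / e / (x - w)) - b / p * (f / e' / (x - w))"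
    if "e \<noteq> 0" "e' \<noteq> 0" "x - w \<noteq> 0" "p \<noteq> 0" for f e e' a b p x w :: complex
  proof -
    have s: "p * (w - x) = - (p * (x - w))" by (simp add: algebra_simps)
    have 1: "f / e * (- ((a * e' - b * e) / (p * (w - x))) / e') = f / e * ((a * e' - b * e) / (p * (x - w))) / e'"
      by (simp only: s minus_divide_right minus_minus times_divide_eq_right times_divide_eq_left)
    have "f / e * ((a * e' - b * e) / (p * d)) / e' = a / p * (f / e / d) - b / p * (f / e' / d)" if "d \<noteq> 0" for d
      using that \<open>e \<noteq> 0\<close> \<open>e' \<noteq> 0\<close> \<open>p \<noteq> 0\<close> by (simp add: field_simps)
    note 2 = this[OF \<open>x - w \<noteq> 0\<close>]
    show ?thesis unfolding 1 2 ..
  qed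
  have "cnj (repkernel E w (of_real t)) = - ((E w * cnj (E (of_real t)) - star E w * E (of_real t)) / ((2 * of_real pi * \<i>) * (w - of_real t)))"
    unfolding repkernel_off[OF ne(1)] kernel_num_def by simp
  then have k: "cnj (repkernel E w (of_real t) / E (of_real t))
      = - ((E w * cnj (E (of_real t)) - star E w * E (of_real t)) / ((2 * of_real pi * \<i>) * (w - of_real t))) / cnj (E (of_real t))"
    by (simp only: complex_cnj_divide)
  have r: "cnj (star F (of_real t) / E (of_real t) / (of_real t - cnj w)) = F (of_real t) / cnj (E (of_real t)) / (of_real t - w)"
    by (simp only: complex_cnj_divide complex_cnj_diff complex_cnj_cnj star_of_real complex_cnj_complex_of_real)
  have nz2: "of_real t - w \<noteq> 0" "2 * of_real pi * \<i> \<noteq> (0 :: complex)" using ne by auto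
  show ?thesis unfolding k r by (rule alg[OF nz nz2])
qed

lemma reproducing_upper:
  assumes F: "F \<in> deBranges E" and w: "0 < Im w"
  shows "dB_inner E F (repkernel E w) = F w"
proof -
  let ?c = "2 * of_real pi * \<i> :: complex"
  interpret F: hardy_closed "\<lambda>z. F z / E z" by (rule deBranges_hardy[OF F])
  interpret S: hardy_closed "\<lambda>z. star F z / E z" by (rule deBranges_hardy[OF deBranges_star[OF F]])
  have w': "Im (cnj w) < 0" using w by simp
  have i1: "integrable lborel (\<lambda>t. F (of_real t) / E (of_real t) / (of_real t - w))"
    using L2_mult_integrable[OF F.boundary_L2 L2_pole[of w]] w by simp
  have i2: "integrable lborel (\<lambda>t. star F (of_real t) / E (of_real t) / (of_real t - cnj w))"
    using L2_mult_integrable[OF S.boundary_L2 L2_pole[of "cnj w"]] w by simp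
  have "dB_inner E F (repkernel E w)
    = (LINT t|lborel. E w / ?c * (F (of_real t) / E (of_real t) / (of_real t - w)))
      - (LINT t|lborel. star E w / ?c * cnj (star F (of_real t) / E (of_real t) / (of_real t - cnj w)))"
    unfolding dB_inner_eq repkernel_quotient[OF w]
    by (rule Bochner_Integration.integral_diff[OF integrable_mult_right[OF i1] integrable_mult_right[OF integrable_cnj[OF i2]]])
  also have "\<dots> = E w / ?c * (?c * (F w / E w)) - star E w / ?c * cnj 0"
    unfolding integral_mult_right_zero Bochner_Integration.integral_cnj F.Cauchy[OF w] S.lower_pole_integral[OF w'] ..
  also have "\<dots> = F w" using E_nz[of w] w by simp
  finally show ?thesis .
qed

text \<open>At the removable point the formula says that the kernel is real, which holds because the
  derivative of \<open>star E\<close> at a real point is the conjugate of that of E.\<close>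

lemma repkernel_cnj_sym:
  shows "cnj (repkernel E w (of_real t)) = repkernel E (of_real t) w"
proof (cases "of_real t = cnj w")
  case False
  then have ne: "of_real t \<noteq> cnj w" "w \<noteq> cnj (of_real t)" by (auto simp: complex_eq_iff)
  have n: "cnj (kernel_num w (of_real t)) = kernel_num (of_real t) w"
    by (simp add: kernel_num_def mult.commute)
  have d: "cnj (2 * of_real pi * \<i> * (cnj w - of_real t)) = 2 * of_real pi * \<i> * (cnj (of_real t) - w)"
    by (simp add: algebra_simps)
  show ?thesis
    unfolding repkernel_off[OF ne(1)] repkernel_off[OF ne(2)] complex_cnj_divide n d ..
next
  case True
  then have w: "w = of_real t" by (auto simp: complex_eq_iff)
  have "(E has_field_derivative deriv E (of_real t)) (at (cnj (of_real t)))"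
    using E_entire by (auto simp: entire_def intro!: holomorphic_derivI[of _ UNIV])
  from has_field_derivative_cnj_cnj[OF this]
  have "(star E has_field_derivative cnj (deriv E (of_real t))) (at (of_real t))"
    by (simp add: o_def star_def[abs_def])
  then have "deriv (star E) (of_real t) = cnj (deriv E (of_real t))" by (rule DERIV_imp_deriv)
  moreover have "- (u - cnj u) / (2 * of_real pi * \<i>) = of_real (- Im u / pi)" for u
    unfolding complex_diff_cnj by simp
  from this[of "cnj (E (of_real t)) * deriv E (of_real t)"]
  have "- (cnj (E (of_real t)) * deriv E (of_real t) - E (of_real t) * cnj (deriv E (of_real t))) / (2 * of_real pi * \<i>) \<in> \<real>"
    unfolding complex_cnj_mult complex_cnj_cnj by (simp only: Reals_of_real)
  ultimately show ?thesis unfolding w repkernel_def by (simp add: Reals_cnj_iff)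
qed

lemma repkernel_diag:
  assumes w: "0 < Im w"
  shows "repkernel E w w = of_real (((cmod (E w))\<^sup>2 - (cmod (star E w))\<^sup>2) / (4 * pi * Im w))"
proof -
  have ne: "w \<noteq> cnj w" using w by (auto simp: complex_eq_iff)
  have "kernel_num w w = of_real ((cmod (E w))\<^sup>2 - (cmod (star E w))\<^sup>2)"
    unfolding kernel_num_def of_real_diff complex_norm_square by (simp add: mult.commute)
  moreover have "2 * of_real pi * \<i> * (cnj w - w) = of_real (4 * pi * Im w)"
    by (simp add: complex_eq_iff)
  ultimately show ?thesis unfolding repkernel_off[OF ne] by (simp only: of_real_divide)
qed

lemma sqn_repkernel:
  assumes w: "0 < Im w"
  shows "sqn (repkernel E w) = ((cmod (E w))\<^sup>2 - (cmod (star E w))\<^sup>2) / (4 * pi * Im w)"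
proof -
  have "complex_of_real (sqn (repkernel E w)) = repkernel E w w"
    using reproducing_upper[OF repkernel_deBranges w, of w] by (simp only: dB_inner_sqn)
  then show ?thesis unfolding repkernel_diag[OF w] by (simp only: of_real_eq_iff)
qed

lemma eval_upper:
  assumes F: "F \<in> deBranges E" and w: "0 < Im w"
  shows "(cmod (F w))\<^sup>2 \<le> sqn F * (((cmod (E w))\<^sup>2 - (cmod (star E w))\<^sup>2) / (4 * pi * Im w))"
  using dB_Cauchy_Schwarz[OF F repkernel_deBranges[of w]]
  unfolding reproducing_upper[OF F w] sqn_repkernel[OF w] .

lemma star_E_Complex: "cmod (star E (Complex x y)) = cmod (E (Complex x (- y)))"
  by (simp add: star_def complex_cnj)

text \<open>With a and b the values of E at x + i y and x - i y, |star E| at x + i y is |b| and the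
  numerator is |a|^2 - |b|^2 = Re ((a - b) cnj (a + b)). Divided by y, the difference a - b becomes
  a vertical derivative of E.\<close>

lemma kernel_diag_limit:
  fixes y :: "nat \<Rightarrow> real"
  assumes y: "\<And>n. 0 < y n" "y \<longlonglongrightarrow> 0"
  shows "(\<lambda>n. ((cmod (E (Complex x (y n))))\<^sup>2 - (cmod (star E (Complex x (y n))))\<^sup>2) / (4 * pi * y n))
     \<longlonglongrightarrow> - Im (cnj (E (of_real x)) * deriv E (of_real x)) / pi"
proof -
  let ?a = "\<lambda>n. E (Complex x (y n))" and ?b = "\<lambda>n. E (Complex x (- y n))"
  have d: "(E has_field_derivative deriv E (of_real x)) (at (of_real x))"
    using E_entire by (auto simp: entire_def intro!: holomorphic_derivI[of _ UNIV])
  have lim: "(\<lambda>n. (E (of_real x + \<i> * of_real (s n)) - E (of_real x)) / (\<i> * of_real (s n))) \<longlonglongrightarrow> deriv E (of_real x)"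
    if s: "\<And>n. s n \<noteq> 0" "s \<longlonglongrightarrow> 0" for s :: "nat \<Rightarrow> real"
  proof -
    have "filterlim (\<lambda>n. \<i> * complex_of_real (s n)) (at 0) sequentially"
      unfolding filterlim_at
    proof
      have "(\<lambda>n. \<i> * complex_of_real (s n)) \<longlonglongrightarrow> \<i> * of_real 0"
        by (intro tendsto_intros s(2))
      then show "(\<lambda>n. \<i> * complex_of_real (s n)) \<longlonglongrightarrow> 0" by simp
    qed (use s(1) in auto)
    from filterlim_compose[OF d[unfolded DERIV_def] this] show ?thesis .
  qed
  have C: "Complex x u = of_real x + \<i> * of_real u" for u by (simp add: complex_eq_iff)
  have y0: "y n \<noteq> 0" for n using y(1)[of n] by simp
  have l1: "(\<lambda>n. (?a n - E (of_real x)) / (\<i> * of_real (y n))) \<longlonglongrightarrow> deriv E (of_real x)"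
    unfolding C by (rule lim) (use y y0 in auto)
  have my: "(\<lambda>n. - y n) \<longlonglongrightarrow> 0" using tendsto_minus[OF y(2)] by simp
  have l2: "(\<lambda>n. (?b n - E (of_real x)) / (\<i> * of_real (- y n))) \<longlonglongrightarrow> deriv E (of_real x)"
    unfolding C by (rule lim[OF _ my]) (use y0 in auto)
  have cE: "isCont E z" for z
    using entire_continuous[OF E_entire, of UNIV] by (simp add: continuous_on_eq_continuous_at)
  have l3: "?a \<longlonglongrightarrow> E (of_real x)"
  proof -
    have "(\<lambda>n. Complex x (y n)) \<longlonglongrightarrow> Complex x 0" by (intro tendsto_Complex tendsto_const y(2))
    from isCont_tendsto_compose[OF cE this] show ?thesis by (simp add: complex_of_real_def)
  qed
  have l4: "?b \<longlonglongrightarrow> E (of_real x)"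
  proof -
    have "(\<lambda>n. Complex x (- y n)) \<longlonglongrightarrow> Complex x 0" by (intro tendsto_Complex tendsto_const my)
    from isCont_tendsto_compose[OF cE this] show ?thesis by (simp add: complex_of_real_def)
  qed
  have l5: "(\<lambda>n. (\<i> * ((?a n - E (of_real x)) / (\<i> * of_real (y n))) + \<i> * ((?b n - E (of_real x)) / (\<i> * of_real (- y n)))) * cnj (?a n + ?b n))
      \<longlonglongrightarrow> (\<i> * deriv E (of_real x) + \<i> * deriv E (of_real x)) * cnj (E (of_real x) + E (of_real x))"
    by (intro tendsto_intros l1 l2 l3 l4)
  have sq: "(cmod a)\<^sup>2 - (cmod b)\<^sup>2 = Re ((a - b) * cnj (a + b))" for a b
    unfolding cmod_power2 by (simp add: power2_eq_square algebra_simps)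
  have eq: "((cmod (?a n))\<^sup>2 - (cmod (star E (Complex x (y n))))\<^sup>2) / (4 * pi * y n)
     = Re ((\<i> * ((?a n - E (of_real x)) / (\<i> * of_real (y n))) + \<i> * ((?b n - E (of_real x)) / (\<i> * of_real (- y n)))) * cnj (?a n + ?b n)) / (4 * pi)" for n
  proof -
    have "\<i> * ((?a n - E (of_real x)) / (\<i> * of_real (y n))) + \<i> * ((?b n - E (of_real x)) / (\<i> * of_real (- y n)))
        = (?a n - ?b n) / of_real (y n)"
      using y0[of n] by (simp add: field_simps)
    then have "Re ((\<i> * ((?a n - E (of_real x)) / (\<i> * of_real (y n))) + \<i> * ((?b n - E (of_real x)) / (\<i> * of_real (- y n)))) * cnj (?a n + ?b n))
       = Re ((?a n - ?b n) * cnj (?a n + ?b n) / of_real (y n))" by simp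
    also have "\<dots> = ((cmod (?a n))\<^sup>2 - (cmod (?b n))\<^sup>2) / y n"
      unfolding Re_divide_of_real sq ..
    finally show ?thesis unfolding star_E_Complex by (simp add: field_simps)
  qed
  have "(\<lambda>n. ((cmod (?a n))\<^sup>2 - (cmod (star E (Complex x (y n))))\<^sup>2) / (4 * pi * y n))
     \<longlonglongrightarrow> Re ((\<i> * deriv E (of_real x) + \<i> * deriv E (of_real x)) * cnj (E (of_real x) + E (of_real x))) / (4 * pi)"
    unfolding eq by (intro tendsto_divide tendsto_Re l5 tendsto_const) simp
  also have "Re ((\<i> * deriv E (of_real x) + \<i> * deriv E (of_real x)) * cnj (E (of_real x) + E (of_real x))) / (4 * pi)
     = - Im (cnj (E (of_real x)) * deriv E (of_real x)) / pi"
    by (simp add: field_simps)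
  finally show ?thesis .
qed

end

section \<open>The phase derivative as the diagonal of the kernel, and bounds for point
  values\<close>

locale de_branges_phase = de_branges +
  fixes \<phi> \<phi>' :: "real \<Rightarrow> real" and M :: real
  assumes phase: "phase_function E \<phi> \<phi>'"
    and phase_deriv_AE_le: "AE t in lborel. \<bar>\<phi>' t\<bar> \<le> M"
begin

lemma phase_mono: "mono \<phi>" and phase_deriv: "(\<phi> has_real_derivative \<phi>' t) (at t)"
  and phase_real: "E (of_real t) * exp (\<i> * of_real (\<phi> t)) \<in> \<real>"
  using phase by (auto simp: phase_function_def)

lemma Im_complex_of_real_mult: "Im (of_real r * z) = r * Im z"
  by simp

text \<open>E e^{i phi} is real on the real line, so its derivative is real as well; the imaginary
  part of this derivative gives Im (E'/E) = -phi'.\<close>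

lemma Im_log_deriv: "Im (cnj (E (of_real t)) * deriv E (of_real t)) = - \<phi>' t * (cmod (E (of_real t)))\<^sup>2"
proof -
  let ?e = "\<lambda>t. exp (\<i> * complex_of_real (\<phi> t))"
  have d: "((\<lambda>t. E (complex_of_real t)) has_vector_derivative deriv E (of_real t)) (at t)"
  proof -
    have "(E has_field_derivative deriv E (of_real t)) (at (of_real t))"
      using E_entire by (auto simp: entire_def intro!: holomorphic_derivI[of _ UNIV])
    then show ?thesis by (rule has_vector_derivative_real_field)
  qed
  have "((\<lambda>t. complex_of_real (\<phi> t)) has_vector_derivative of_real (\<phi>' t)) (at t)"
    using phase_deriv[of t] by (intro has_vector_derivative_of_real) (simp add: has_real_derivative_iff_has_vector_derivative)
  then have "((\<lambda>t. \<i> * complex_of_real (\<phi> t)) has_vector_derivative \<i> * of_real (\<phi>' t)) (at t)"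
    by (rule has_vector_derivative_mult_right)
  moreover have "(exp has_field_derivative ?e t) (at (\<i> * complex_of_real (\<phi> t)))"
    by (rule DERIV_exp)
  ultimately have "((exp \<circ> (\<lambda>t. \<i> * complex_of_real (\<phi> t))) has_vector_derivative \<i> * of_real (\<phi>' t) * ?e t) (at t)"
    by (rule field_vector_diff_chain_at)
  then have e: "(?e has_vector_derivative \<i> * of_real (\<phi>' t) * ?e t) (at t)" by (simp add: o_def)
  have "((\<lambda>t. E (complex_of_real t) * ?e t) has_vector_derivative
      E (of_real t) * (\<i> * of_real (\<phi>' t) * ?e t) + deriv E (of_real t) * ?e t) (at t)"
    by (rule has_vector_derivative_mult[OF d e])
  then have "((\<lambda>t. Im (E (complex_of_real t) * ?e t)) has_vector_derivative
      Im (E (of_real t) * (\<i> * of_real (\<phi>' t) * ?e t) + deriv E (of_real t) * ?e t)) (at t)"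
    by (rule bounded_linear.has_vector_derivative[OF bounded_linear_Im])
  moreover have "(\<lambda>t. Im (E (complex_of_real t) * ?e t)) = (\<lambda>t. 0)"
    using phase_real by (auto simp: complex_is_Real_iff)
  ultimately have "Im (E (of_real t) * (\<i> * of_real (\<phi>' t) * ?e t) + deriv E (of_real t) * ?e t) = 0"
    by (metis has_vector_derivative_const vector_derivative_unique_at)
  then have z: "\<phi>' t * Re (E (of_real t) * ?e t) + Im (deriv E (of_real t) * ?e t) = 0"
    by (simp add: algebra_simps)
  define r where "r = Re (E (of_real t) * ?e t)"
  have r: "E (of_real t) * ?e t = of_real r"
    using phase_real[of t] unfolding r_def by (simp add: complex_is_Real_iff complex_eq_iff)
  have u: "cnj (?e t) * ?e t = 1"
    by (simp add: exp_cnj flip: exp_add)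
  have "cnj (E (of_real t)) * deriv E (of_real t) = cnj (E (of_real t)) * deriv E (of_real t) * (cnj (?e t) * ?e t)"
    unfolding u by simp
  also have "\<dots> = cnj (E (of_real t) * ?e t) * (deriv E (of_real t) * ?e t)"
    by (simp only: complex_cnj_mult mult_ac)
  also have "\<dots> = of_real r * (deriv E (of_real t) * ?e t)" unfolding r complex_cnj_complex_of_real ..
  finally have "Im (cnj (E (of_real t)) * deriv E (of_real t)) = Im (of_real r * (deriv E (of_real t) * ?e t))"
    by (rule arg_cong)
  also have "\<dots> = r * Im (deriv E (of_real t) * ?e t)" by (rule Im_complex_of_real_mult)
  also have "Im (deriv E (of_real t) * ?e t) = - (\<phi>' t * r)" using z unfolding r_def by linarith
  also have "r * - (\<phi>' t * r) = - \<phi>' t * r\<^sup>2" by (simp add: power2_eq_square)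
  also have "r\<^sup>2 = (cmod (E (of_real t)))\<^sup>2"
  proof -
    have "cmod (E (of_real t) * ?e t) = cmod (E (of_real t))" by (simp add: norm_mult)
    then show ?thesis unfolding r by (metis norm_of_real power2_abs)
  qed
  finally show ?thesis .
qed

lemma kernel_diag_tendsto:
  fixes y :: "nat \<Rightarrow> real"
  assumes y: "\<And>n. 0 < y n" "y \<longlonglongrightarrow> 0"
  shows "(\<lambda>n. ((cmod (E (Complex x (y n))))\<^sup>2 - (cmod (star E (Complex x (y n))))\<^sup>2) / (4 * pi * y n))
     \<longlonglongrightarrow> \<phi>' x * (cmod (E (of_real x)))\<^sup>2 / pi"
  using kernel_diag_limit[OF assms] unfolding Im_log_deriv by simp

lemma inverse_Suc: "0 < 1 / real (Suc n)" "(\<lambda>n. 1 / real (Suc n)) \<longlonglongrightarrow> 0"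
  using LIMSEQ_inverse_real_of_nat by (simp_all add: inverse_eq_divide)

text \<open>Limit of \<open>eval_upper\<close> along the vertical; the factor of
  \<open>sqn F\<close> is the value of the kernel on the diagonal at x.\<close>

lemma eval_real:
  assumes F: "F \<in> deBranges E"
  shows "(cmod (F (of_real x)))\<^sup>2 \<le> sqn F * (\<phi>' x * (cmod (E (of_real x)))\<^sup>2 / pi)"
proof (rule LIMSEQ_le)
  let ?y = "\<lambda>n. 1 / real (Suc n)"
  have "(\<lambda>n. Complex x (?y n)) \<longlonglongrightarrow> Complex x 0"
    by (intro tendsto_Complex tendsto_const inverse_Suc)
  moreover have "isCont F (Complex x 0)"
    using entire_continuous[OF deBranges_entire[OF F], of UNIV] by (simp add: continuous_on_eq_continuous_at)
  ultimately have "(\<lambda>n. F (Complex x (?y n))) \<longlonglongrightarrow> F (Complex x 0)"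
    using isCont_tendsto_compose by blast
  then show "(\<lambda>n. (cmod (F (Complex x (?y n))))\<^sup>2) \<longlonglongrightarrow> (cmod (F (of_real x)))\<^sup>2"
    unfolding complex_of_real_def by (intro tendsto_intros)
  show "(\<lambda>n. sqn F * (((cmod (E (Complex x (?y n))))\<^sup>2 - (cmod (star E (Complex x (?y n))))\<^sup>2) / (4 * pi * ?y n)))
      \<longlonglongrightarrow> sqn F * (\<phi>' x * (cmod (E (of_real x)))\<^sup>2 / pi)"
    by (intro tendsto_mult tendsto_const kernel_diag_tendsto inverse_Suc)
  show "\<exists>N. \<forall>n\<ge>N. (cmod (F (Complex x (?y n))))\<^sup>2
      \<le> sqn F * (((cmod (E (Complex x (?y n))))\<^sup>2 - (cmod (star E (Complex x (?y n))))\<^sup>2) / (4 * pi * ?y n))"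
    using eval_upper[OF F, of "Complex x (?y n)" for n] inverse_Suc(1) by simp
qed

text \<open>Where phi' <= 0, \<open>eval_real\<close> would make every function of the space vanish.
  But the kernel at i vanishes at a real point only if E and \<open>star E\<close> have equal
  modulus at i.\<close>

lemma phase_deriv_pos: "0 < \<phi>' x"
proof (rule ccontr)
  assume "\<not> 0 < \<phi>' x"
  then have "\<phi>' x * (cmod (E (of_real x)))\<^sup>2 / pi \<le> 0"
    by (simp add: divide_nonpos_pos mult_nonpos_nonneg)
  then have "sqn (repkernel E \<i>) * (\<phi>' x * (cmod (E (of_real x)))\<^sup>2 / pi) \<le> 0"
    by (intro mult_nonneg_nonpos) auto
  with eval_real[OF repkernel_deBranges, of \<i> x] have "(cmod (repkernel E \<i> (of_real x)))\<^sup>2 \<le> 0" by linarith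
  then have 0: "repkernel E \<i> (of_real x) = 0" by simp
  have ne: "of_real x \<noteq> cnj \<i>" by (simp add: complex_eq_iff)
  have "2 * of_real pi * \<i> * (cnj \<i> - of_real x) \<noteq> 0" using ne by auto
  with 0 have "kernel_num \<i> (of_real x) = 0" unfolding repkernel_off[OF ne] by simp
  then have "cnj (E \<i>) * E (of_real x) = cnj (star E \<i>) * cnj (E (of_real x))" by (simp add: kernel_num_def)
  then have "cmod (cnj (E \<i>) * E (of_real x)) = cmod (cnj (star E \<i>) * cnj (E (of_real x)))" by simp
  then have "cmod (E \<i>) = cmod (star E \<i>)" using E_real_nz[of x] by (simp add: norm_mult)
  then show False using star_E_less[of \<i>] by simp
qed

lemma phase_deriv_eq: "\<phi>' t = - Im (cnj (E (of_real t)) * deriv E (of_real t)) / (cmod (E (of_real t)))\<^sup>2"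
  unfolding Im_log_deriv using E_real_nz[of t] by simp

lemma phase_deriv_continuous: "continuous_on A \<phi>'"
proof -
  have c: "continuous_on A (\<lambda>t. G (complex_of_real t))" if "entire G" for G
    by (rule continuous_on_compose2[OF entire_continuous[OF that, of UNIV]]) (auto intro!: continuous_intros)
  have "entire (deriv E)"
    using E_entire unfolding entire_def by (rule holomorphic_deriv) simp
  then have "continuous_on A (\<lambda>t. - Im (cnj (E (of_real t)) * deriv E (of_real t)) / (cmod (E (of_real t)))\<^sup>2)"
    using E_real_nz by (intro continuous_intros c E_entire) auto
  then show ?thesis by (simp only: phase_deriv_eq[symmetric])
qed

text \<open>phi' is continuous, being an expression in E and its derivative, so the essential bound
  holds at every point.\<close>

lemma phase_deriv_le: "\<phi>' t \<le> M"
proof -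
  have o: "open {t. M < \<phi>' t}"
    using open_Collect_less[OF continuous_on_const phase_deriv_continuous] by simp
  have "AE t in lborel. \<not> M < \<phi>' t"
    using phase_deriv_AE_le by eventually_elim auto
  then have "{t. M < \<phi>' t} \<in> null_sets lborel"
    using AE_iff_null[of lborel "\<lambda>t. \<not> M < \<phi>' t"] borel_open[OF o] by simp
  then have "{t. M < \<phi>' t} \<in> null_sets lebesgue" by (rule null_sets_completionI)
  then have "negligible {t. M < \<phi>' t}" by (simp add: negligible_iff_null_sets)
  with o have "{t. M < \<phi>' t} = {}" using open_not_negligible by blast
  then show ?thesis by (auto simp: not_less)
qed

lemma M_pos: "0 < M"
  using phase_deriv_pos[of 0] phase_deriv_le[of 0] by linarith

text \<open>On the real line this is \<open>eval_real\<close> with phi' <= M; above it F/E is the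
  Poisson average of its boundary values. The bounded phase derivative is what makes all quotients
  F/E bounded.\<close>

lemma eval_closed:
  assumes F: "F \<in> deBranges E" and w: "0 \<le> Im w"
  shows "cmod (F w / E w) \<le> sqrt (M / pi * sqn F)"
proof -
  have r: "cmod (F (of_real t) / E (of_real t)) \<le> sqrt (M / pi * sqn F)" for t
  proof -
    have nz: "0 < (cmod (E (of_real t)))\<^sup>2" using E_real_nz[of t] by simp
    have "(cmod (F (of_real t) / E (of_real t)))\<^sup>2 = (cmod (F (of_real t)))\<^sup>2 / (cmod (E (of_real t)))\<^sup>2"
      by (simp add: norm_divide power_divide)
    also have "\<dots> \<le> sqn F * (\<phi>' t * (cmod (E (of_real t)))\<^sup>2 / pi) / (cmod (E (of_real t)))\<^sup>2"
      using eval_real[OF F, of t] by (intro divide_right_mono) auto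
    also have "\<dots> = sqn F * (\<phi>' t / pi)" using nz by simp
    also have "\<dots> \<le> sqn F * (M / pi)"
      using phase_deriv_le[of t] by (intro mult_left_mono divide_right_mono) auto
    finally have "(cmod (F (of_real t) / E (of_real t)))\<^sup>2 \<le> M / pi * sqn F" by (simp add: mult.commute)
    then show ?thesis by (rule real_le_rsqrt)
  qed
  show ?thesis
  proof (cases "Im w = 0")
    case True
    then have "w = of_real (Re w)" by (simp add: complex_eq_iff)
    then show ?thesis using r by metis
  next
    case False
    then have w: "0 < Im w" using w by simp
    interpret F: hardy_closed "\<lambda>z. F z / E z" by (rule deBranges_hardy[OF F])
    let ?P = "\<lambda>t. 1 / ((t - Re w)\<^sup>2 + (Im w)\<^sup>2)" and ?S = "sqrt (M / pi * sqn F)"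
    have pk: "integrable lborel ?P" by (rule poisson_kernel_integrable[OF w])
    have "pi / Im w * cmod (F w / E w) = cmod (LINT t|lborel. F (of_real t) / E (of_real t) / of_real ((t - Re w)\<^sup>2 + (Im w)\<^sup>2))"
      unfolding F.Poisson[OF w] norm_mult norm_of_real using w by simp
    also have "\<dots> \<le> (LINT t|lborel. cmod (F (of_real t) / E (of_real t) / of_real ((t - Re w)\<^sup>2 + (Im w)\<^sup>2)))"
      by (rule integral_norm_bound)
    also have "\<dots> \<le> (LINT t|lborel. ?S * ?P t)"
    proof (rule integral_mono')
      show "integrable lborel (\<lambda>t. ?S * ?P t)" by (rule integrable_mult_right[OF pk])
      fix t
      have "cmod (F (of_real t) / E (of_real t) / of_real ((t - Re w)\<^sup>2 + (Im w)\<^sup>2)) = cmod (F (of_real t) / E (of_real t)) * ?P t"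
        by (subst norm_divide, subst norm_of_real) simp
      also have "\<dots> \<le> ?S * ?P t" by (intro mult_right_mono r) auto
      finally show "cmod (F (of_real t) / E (of_real t) / of_real ((t - Re w)\<^sup>2 + (Im w)\<^sup>2)) \<le> ?S * ?P t" .
    qed (use M_pos in auto)
    also have "\<dots> = ?S * (pi / Im w)"
      using poisson_kernel_integral[OF w] by (simp only: integral_mult_right_zero)
    finally have "pi / Im w * cmod (F w / E w) \<le> pi / Im w * ?S" by (simp only: mult.commute)
    moreover have "0 < pi / Im w" using w by simp
    ultimately show ?thesis by (simp only: mult_le_cancel_left_pos)
  qed
qed

lemma eval_bound:
  assumes F: "F \<in> deBranges E"
  shows "cmod (F w) \<le> sqrt (M / pi * sqn F) * (cmod (E w) + cmod (star E w))"
proof (cases "0 \<le> Im w")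
  case True
  have "cmod (F w) = cmod (F w / E w) * cmod (E w)" using E_nz[OF True] by (simp add: norm_divide)
  also have "\<dots> \<le> sqrt (M / pi * sqn F) * (cmod (E w) + cmod (star E w))"
    using eval_closed[OF F True] M_pos by (intro mult_mono) auto
  finally show ?thesis .
next
  case False
  then have c: "0 \<le> Im (cnj w)" by simp
  have "cmod (F w) = cmod (star F (cnj w) / E (cnj w)) * cmod (star E w)"
    using E_nz[OF c] by (simp add: norm_divide star_def)
  also have "\<dots> \<le> sqrt (M / pi * sqn F) * (cmod (E w) + cmod (star E w))"
    using eval_closed[OF deBranges_star[OF F] c] M_pos unfolding sqn_star by (intro mult_mono) auto
  finally show ?thesis .
qed

text \<open>The kernels at x + i/(n+1) have bounded norms, since these converge by
  \<open>kernel_diag_tendsto\<close>, and they tend pointwise on the real line to the kernel at x;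
  weak convergence carries the reproducing formula to the boundary.\<close>

lemma reproducing_real:
  assumes F: "F \<in> deBranges E"
  shows "dB_inner E F (repkernel E (of_real x)) = F (of_real x)"
proof -
  let ?w = "\<lambda>n. Complex x (1 / real (Suc n))"
  have wlim: "?w \<longlonglongrightarrow> of_real x"
    unfolding complex_of_real_def by (intro tendsto_Complex tendsto_const inverse_Suc)
  have wpos: "0 < Im (?w n)" for n by simp
  have cont: "(\<lambda>n. G (?w n)) \<longlonglongrightarrow> G (of_real x)" if "entire G" for G
  proof (rule isCont_tendsto_compose[OF _ wlim])
    show "isCont G (of_real x)"
      using entire_continuous[OF that, of UNIV] by (simp add: continuous_on_eq_continuous_at)
  qed
  note seE = entire_star[OF E_entire]
  let ?K = "\<lambda>n t. cnj (repkernel E (?w n) (of_real t) / E (of_real t))"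
  obtain B2 where B2: "\<And>n. sqn (repkernel E (?w n)) \<le> B2"
  proof -
    have "convergent (\<lambda>n. sqn (repkernel E (?w n)))"
      unfolding sqn_repkernel[OF wpos] complex.sel
      by (rule convergentI) (rule kernel_diag_tendsto[OF inverse_Suc])
    from convergent_imp_Bseq[OF this] obtain K where "\<And>n. norm (sqn (repkernel E (?w n))) \<le> K"
      unfolding Bseq_def by blast
    then show ?thesis using that[of K] unfolding real_norm_def by (meson abs_le_D1)
  qed
  have L: "L2 lborel (\<lambda>t. ?K n t)" for n by (rule L2_cnj[OF deBranges_L2[OF repkernel_deBranges]])
  have "(\<lambda>n. LINT t|lborel. ?K n t * (F (of_real t) / E (of_real t)))
      \<longlonglongrightarrow> (LINT t|lborel. cnj (repkernel E (of_real x) (of_real t) / E (of_real t)) * (F (of_real t) / E (of_real t)))"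
  proof (rule L2_weak_limit[OF L _ _ deBranges_L2[OF F], where C = B2])
    show "(LINT t|lborel. (cmod (?K n t))\<^sup>2) \<le> B2" for n
      using B2[of n] unfolding sqn_def complex_mod_cnj .
    fix t :: real
    show "(\<lambda>n. ?K n t) \<longlonglongrightarrow> cnj (repkernel E (of_real x) (of_real t) / E (of_real t))"
      unfolding complex_cnj_divide repkernel_cnj_sym
      by (intro tendsto_divide tendsto_const cont entire_repkernel) (use E_real_nz in simp)
  qed
  moreover have "(LINT t|lborel. ?K n t * (F (of_real t) / E (of_real t))) = F (?w n)" for n
    using reproducing_upper[OF F wpos[of n]] unfolding dB_inner_eq by (simp only: mult.commute)
  ultimately have "(\<lambda>n. F (?w n)) \<longlonglongrightarrow> dB_inner E F (repkernel E (of_real x))"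
    unfolding dB_inner_eq by (simp only: mult.commute)
  with cont[OF deBranges_entire[OF F]] show ?thesis using LIMSEQ_unique by blast
qed

end

lemma sqrt_of_real_measurable: "(\<lambda>r. complex_of_real (sqrt r)) \<in> borel_measurable borel"
  by (intro borel_measurable_continuous_onI continuous_intros)

context hardy_closed
begin

text \<open>Cauchy-Schwarz with the Poisson kernel as weight bounds |f|^2 at a point by the Poisson
  average of |f|^2 on the real line; the normalised kernel has mass one in the other variable too,
  so integration in x finishes. For quotients F/E this replaces the unspecified Hardy constant by
  \<open>sqn\<close>.\<close>

lemma line_le_boundary:
  assumes y: "0 < y"
  shows "(LINT x|lborel. (cmod (f (Complex x y)))\<^sup>2) \<le> (LINT t|lborel. (cmod (f (of_real t)))\<^sup>2)"
proof -
  define u where "u = (\<lambda>t. (cmod (f (of_real t)))\<^sup>2)"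
  have fm: "(\<lambda>t. f (of_real t)) \<in> borel_measurable borel" using boundary_L2 by (simp add: L2_def)
  have um [measurable]: "u \<in> borel_measurable borel"
    unfolding u_def by (intro borel_measurable_power measurable_compose[OF fm]) simp
  have ui: "integrable lborel u" using boundary_L2 by (simp add: L2_def u_def)
  have u0: "0 \<le> u t" for t by (simp add: u_def)
  define P where "P = (\<lambda>x t. 1 / ((t - x)\<^sup>2 + y\<^sup>2) :: real)"
  have P0: "0 \<le> P x t" for x t by (simp add: P_def)
  have Pb: "P x t \<le> 1 / y\<^sup>2" for x t unfolding P_def using y by (intro divide_left_mono) (auto intro!: mult_pos_pos add_nonneg_pos)
  have Pm: "P x \<in> borel_measurable borel" for x unfolding P_def by measurable
  have Pi: "integrable lborel (P x)" "(LINT t|lborel. P x t) = pi / y" for x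
    using poisson_kernel[OF y, of x] by (simp_all add: P_def)
  have uP: "integrable lborel (\<lambda>t. u t * P x t)" for x
  proof (rule Bochner_Integration.integrable_bound)
    show "integrable lborel (\<lambda>t. u t * (1 / y\<^sup>2))" by (rule integrable_mult_left[OF ui])
    show "(\<lambda>t. u t * P x t) \<in> borel_measurable lborel" using um Pm by simp
    show "AE t in lborel. norm (u t * P x t) \<le> norm (u t * (1 / y\<^sup>2))"
    proof (rule AE_I2)
      fix t
      have "u t * P x t \<le> u t * (1 / y\<^sup>2)" by (rule mult_left_mono[OF Pb u0])
      moreover have "0 \<le> u t * P x t" by (rule mult_nonneg_nonneg[OF u0 P0])
      ultimately show "norm (u t * P x t) \<le> norm (u t * (1 / y\<^sup>2))" unfolding real_norm_def by linarith
    qed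
  qed
  have pw: "(cmod (f (Complex x y)))\<^sup>2 \<le> y / pi * (LINT t|lborel. u t * P x t)" for x
  proof -
    have sP: "(cmod (complex_of_real (sqrt (P x t))))\<^sup>2 = P x t" for t
      using P0 by (simp add: power2_eq_square)
    have "(\<lambda>t. complex_of_real (sqrt (P x t))) \<in> borel_measurable borel"
      by (rule measurable_compose[OF Pm sqrt_of_real_measurable])
    then have m2: "(\<lambda>t. complex_of_real (sqrt (P x t))) \<in> borel_measurable lborel" by simp
    have L1: "L2 lborel (\<lambda>t. complex_of_real (sqrt (P x t)))"
      unfolding L2_def sP using Pi(1)[of x] m2 by blast
    have sfP: "(cmod (f (of_real t) * complex_of_real (sqrt (P x t))))\<^sup>2 = u t * P x t" for t
      unfolding norm_mult power_mult_distrib sP u_def ..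
    have m1: "(\<lambda>t. f (of_real t) * complex_of_real (sqrt (P x t))) \<in> borel_measurable lborel"
      using fm m2 by (intro borel_measurable_times) simp_all
    have L2: "L2 lborel (\<lambda>t. f (of_real t) * complex_of_real (sqrt (P x t)))"
      unfolding L2_def sfP using uP[of x] m1 by blast
    have e: "f (of_real t) * complex_of_real (sqrt (P x t)) * complex_of_real (sqrt (P x t)) = f (of_real t) / of_real ((t - x)\<^sup>2 + y\<^sup>2)" for t
    proof -
      have "complex_of_real (sqrt (P x t)) * complex_of_real (sqrt (P x t)) = of_real (P x t)"
        using P0[of x t] by (simp only: of_real_mult[symmetric] real_sqrt_mult_self abs_of_nonneg)
      also have "\<dots> = 1 / of_real ((t - x)\<^sup>2 + y\<^sup>2)" unfolding P_def by (simp only: of_real_divide of_real_1)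
      finally show ?thesis by (simp only: mult.assoc times_divide_eq_right mult_1_right)
    qed
    have "(LINT t|lborel. f (of_real t) * complex_of_real (sqrt (P x t)) * complex_of_real (sqrt (P x t)))
        = of_real (pi / y) * f (Complex x y)"
      unfolding e using Poisson[of "Complex x y"] y by (simp only: complex.sel)
    with L2_Cauchy_Schwarz[OF L2 L1]
    have "(cmod (of_real (pi / y) * f (Complex x y)))\<^sup>2 \<le> (LINT t|lborel. u t * P x t) * (pi / y)"
      by (simp only: sP sfP Pi(2))
    then have "(pi / y)\<^sup>2 * (cmod (f (Complex x y)))\<^sup>2 \<le> (LINT t|lborel. u t * P x t) * (pi / y)"
      by (simp only: norm_mult norm_of_real power_mult_distrib power2_abs)
    note le = this
    have c: "0 < pi / y" using y by simp
    have "pi / y * (pi / y * (cmod (f (Complex x y)))\<^sup>2) = (pi / y)\<^sup>2 * (cmod (f (Complex x y)))\<^sup>2"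
      by (simp only: power2_eq_square mult.assoc)
    also note le
    also have "(LINT t|lborel. u t * P x t) * (pi / y) = pi / y * (LINT t|lborel. u t * P x t)"
      by (rule mult.commute)
    finally have "pi / y * (pi / y * (cmod (f (Complex x y)))\<^sup>2) \<le> pi / y * (LINT t|lborel. u t * P x t)" .
    then have "pi / y * (cmod (f (Complex x y)))\<^sup>2 \<le> (LINT t|lborel. u t * P x t)"
      using c by (simp only: mult_le_cancel_left_pos)
    then have "y / pi * (pi / y * (cmod (f (Complex x y)))\<^sup>2) \<le> y / pi * (LINT t|lborel. u t * P x t)"
      using y by (intro mult_left_mono) auto
    then show ?thesis using y by simp
  qed
  have "(\<integral>\<^sup>+x. ennreal ((cmod (f (Complex x y)))\<^sup>2) \<partial>lborel) \<le> (\<integral>\<^sup>+x. \<integral>\<^sup>+t. ennreal (y / pi * (u t * P x t)) \<partial>lborel \<partial>lborel)"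
  proof (intro nn_integral_mono)
    fix x
    have i: "integrable lborel (\<lambda>t. y / pi * (u t * P x t))" by (rule integrable_mult_right[OF uP])
    have "ennreal ((cmod (f (Complex x y)))\<^sup>2) \<le> ennreal (LINT t|lborel. y / pi * (u t * P x t))"
      using pw[of x] by (intro ennreal_leI) (simp only: integral_mult_right_zero)
    also have "\<dots> = (\<integral>\<^sup>+t. ennreal (y / pi * (u t * P x t)) \<partial>lborel)"
      by (rule nn_integral_eq_integral[OF i, symmetric]) (use y u0 P0 in auto)
    finally show "ennreal ((cmod (f (Complex x y)))\<^sup>2) \<le> (\<integral>\<^sup>+t. ennreal (y / pi * (u t * P x t)) \<partial>lborel)" .
  qed
  also have "\<dots> = (\<integral>\<^sup>+t. \<integral>\<^sup>+x. ennreal (y / pi * (u t * P x t)) \<partial>lborel \<partial>lborel)"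
  proof (rule lborel_pair.Fubini')
    have "(\<lambda>p. ennreal (y / pi * (u (fst p) * (1 / ((fst p - snd p)\<^sup>2 + y\<^sup>2))))) \<in> borel_measurable (lborel \<Otimes>\<^sub>M lborel)"
      by measurable
    then show "(\<lambda>(t, x). ennreal (y / pi * (u t * P x t))) \<in> borel_measurable (lborel \<Otimes>\<^sub>M lborel)"
      unfolding P_def by (simp only: case_prod_beta')
  qed
  also have "\<dots> = (\<integral>\<^sup>+t. ennreal (u t) \<partial>lborel)"
  proof (intro nn_integral_cong)
    fix t
    have sym: "P x t = P t x" for x by (simp add: P_def power2_commute)
    have eq: "y / pi * (u t * P x t) = u t * (y / pi) * P t x" for x
      unfolding sym[of x] by (simp only: mult_ac)
    have i: "integrable lborel (\<lambda>x. u t * (y / pi) * P t x)" by (rule integrable_mult_right[OF Pi(1)])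
    have "(\<integral>\<^sup>+x. ennreal (y / pi * (u t * P x t)) \<partial>lborel) = ennreal (LINT x|lborel. u t * (y / pi) * P t x)"
      unfolding eq by (rule nn_integral_eq_integral[OF i]) (use y u0 P0 in auto)
    also have "(LINT x|lborel. u t * (y / pi) * P t x) = u t * (y / pi) * (pi / y)"
      using Pi(2)[of t] by (simp only: integral_mult_right_zero)
    also have "\<dots> = u t" using y by simp
    finally show "(\<integral>\<^sup>+x. ennreal (y / pi * (u t * P x t)) \<partial>lborel) = ennreal (u t)" .
  qed
  also have "\<dots> = ennreal (LINT t|lborel. u t)"
    by (rule nn_integral_eq_integral[OF ui]) (use u0 in auto)
  finally have le: "(\<integral>\<^sup>+x. ennreal ((cmod (f (Complex x y)))\<^sup>2) \<partial>lborel) \<le> ennreal (LINT t|lborel. u t)" .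
  have i: "integrable lborel (\<lambda>x. (cmod (f (Complex x y)))\<^sup>2)"
    using hardy y by (auto simp: hardy2_def)
  have "0 \<le> (LINT t|lborel. u t)" by (intro integral_nonneg_AE AE_I2 u0)
  then show ?thesis
    using le nn_integral_eq_integral[OF i] by (simp add: ennreal_le_iff u_def)
qed

end

section \<open>Completeness of the space and orthogonality to a closed span\<close>

lemma lin_span_incl: "s \<in> S \<Longrightarrow> s \<in> lin_span S"
  unfolding lin_span_def
  by (rule CollectI, rule exI[of _ "{s}"], rule exI[of _ "\<lambda>_. 1"]) auto

lemma lin_span_0: "(\<lambda>z. 0) \<in> lin_span S"
  unfolding lin_span_def
  by (rule CollectI, rule exI[of _ "{}"]) auto

lemma lin_span_lincomb:
  assumes "F \<in> lin_span S" "G \<in> lin_span S"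
  shows "(\<lambda>z. a * F z + b * G z) \<in> lin_span S"
proof -
  obtain A c where A: "finite A" "A \<subseteq> S" "F = (\<lambda>z. \<Sum>f\<in>A. c f * f z)"
    using assms(1) unfolding lin_span_def by blast
  obtain B d where B: "finite B" "B \<subseteq> S" "G = (\<lambda>z. \<Sum>f\<in>B. d f * f z)"
    using assms(2) unfolding lin_span_def by blast
  define e where "e = (\<lambda>f. a * (if f \<in> A then c f else 0) + b * (if f \<in> B then d f else 0))"
  have "a * F z + b * G z = (\<Sum>f\<in>A \<union> B. e f * f z)" for z
  proof -
    have "F z = (\<Sum>f\<in>A \<union> B. (if f \<in> A then c f else 0) * f z)"
      unfolding A(3) by (rule sum.mono_neutral_cong_left) (use A B in auto)
    moreover have "G z = (\<Sum>f\<in>A \<union> B. (if f \<in> B then d f else 0) * f z)"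
      unfolding B(3) by (rule sum.mono_neutral_cong_left) (use A B in auto)
    ultimately show ?thesis
      unfolding e_def by (simp only: sum_distrib_left sum.distrib[symmetric] distrib_right mult.assoc)
  qed
  then show ?thesis unfolding lin_span_def using A B by (intro CollectI exI[of _ "A \<union> B"] exI[of _ e]) auto
qed

context de_branges
begin

lemma sqn_diff:
  assumes "F \<in> deBranges E" "G \<in> deBranges E"
  shows "sqn (\<lambda>z. F z - G z) = sqn F - 2 * Re (dB_inner E F G) + sqn G"
proof -
  let ?f = "\<lambda>t. F (complex_of_real t) / E (of_real t)" and ?g = "\<lambda>t. G (complex_of_real t) / E (of_real t)"
  note L = deBranges_L2[OF assms(1)] deBranges_L2[OF assms(2)]
  have i: "integrable lborel (\<lambda>t. (cmod (?f t))\<^sup>2)" "integrable lborel (\<lambda>t. (cmod (?g t))\<^sup>2)"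
    using L unfolding L2_def by blast+
  have j: "integrable lborel (\<lambda>t. Re (?f t * cnj (?g t)))"
    by (rule integrable_Re[OF dB_inner_integrable[OF assms]])
  have p: "(cmod (a - b))\<^sup>2 = (cmod a)\<^sup>2 - 2 * Re (a * cnj b) + (cmod b)\<^sup>2" for a b
    unfolding cmod_power2 by (simp add: power2_eq_square algebra_simps)
  have "sqn (\<lambda>z. F z - G z) = (LINT t|lborel. (cmod (?f t))\<^sup>2 - 2 * Re (?f t * cnj (?g t)) + (cmod (?g t))\<^sup>2)"
    unfolding sqn_def diff_divide_distrib p ..
  also have "\<dots> = (LINT t|lborel. (cmod (?f t))\<^sup>2 - 2 * Re (?f t * cnj (?g t))) + (LINT t|lborel. (cmod (?g t))\<^sup>2)"
    by (rule Bochner_Integration.integral_add[OF Bochner_Integration.integrable_diff[OF i(1) integrable_mult_right[OF j]] i(2)])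
  also have "(LINT t|lborel. (cmod (?f t))\<^sup>2 - 2 * Re (?f t * cnj (?g t))) = (LINT t|lborel. (cmod (?f t))\<^sup>2) - (LINT t|lborel. 2 * Re (?f t * cnj (?g t)))"
    by (rule Bochner_Integration.integral_diff[OF i(1) integrable_mult_right[OF j]])
  also have "(LINT t|lborel. 2 * Re (?f t * cnj (?g t))) = 2 * Re (dB_inner E F G)"
    unfolding dB_inner_eq integral_mult_right_zero integral_Re[OF dB_inner_integrable[OF assms]] ..
  finally show ?thesis unfolding sqn_def .
qed

lemma inner_lin_span_0:
  assumes S: "S \<subseteq> deBranges E" and F: "F \<in> deBranges E" and o: "\<And>s. s \<in> S \<Longrightarrow> dB_inner E F s = 0"
    and G: "G \<in> lin_span S"
  shows "dB_inner E F G = 0"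
proof -
  obtain A c where A: "finite A" "A \<subseteq> S" "G = (\<lambda>z. \<Sum>f\<in>A. c f * f z)"
    using G unfolding lin_span_def by blast
  have "dB_inner E (\<lambda>z. \<Sum>f\<in>A. c f * f z) F = 0"
    using A(1,2)
  proof (induction A)
    case empty
    then show ?case by (simp add: dB_inner_def)
  next
    case (insert s A)
    have s: "s \<in> deBranges E" "dB_inner E s F = 0"
      using insert S o[of s] dB_inner_cnj[of F s] by auto
    have A: "(\<lambda>z. \<Sum>f\<in>A. c f * f z) \<in> deBranges E"
      by (rule deBranges_sum) (use insert S in auto)
    have "dB_inner E (\<lambda>z. c s * s z + (\<Sum>f\<in>A. c f * f z)) F = c s * dB_inner E s F + dB_inner E (\<lambda>z. \<Sum>f\<in>A. c f * f z) F"
      unfolding dB_inner_add_left[OF deBranges_cmult[OF s(1)] A F] dB_inner_cmult_left ..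
    then show ?case using insert s by simp
  qed
  then show ?thesis unfolding A(3) using dB_inner_cnj[of "\<lambda>z. \<Sum>f\<in>A. c f * f z" F] by simp
qed

text \<open>Subtract the best multiple of s, with c = <A,s>/|s|^2: the squared norm drops by
  |<A,s>|^2/|s|^2, and by hypothesis it cannot drop below d.\<close>

lemma approx_orthogonal:
  assumes A: "A \<in> deBranges E" and s: "s \<in> deBranges E" and d: "\<And>c. d \<le> sqn (\<lambda>z. A z - c * s z)"
  shows "(cmod (dB_inner E A s))\<^sup>2 \<le> (sqn A - d) * sqn s"
proof -
  define a where "a = dB_inner E A s"
  have e: "sqn (\<lambda>z. A z - c * s z) = sqn A - 2 * Re (cnj c * a) + (cmod c)\<^sup>2 * sqn s" for c
  proof -
    have "dB_inner E A (\<lambda>z. c * s z) = cnj (c * dB_inner E s A)"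
      using dB_inner_cnj[of "\<lambda>z. c * s z" A] dB_inner_cmult_left[of c s A] by simp
    also have "\<dots> = cnj c * a" using dB_inner_cnj[of s A] by (simp add: a_def)
    finally show ?thesis using sqn_diff[OF A deBranges_cmult[OF s], of c] sqn_cmult[of c s] by simp
  qed
  show ?thesis
  proof (cases "sqn s = 0")
    case True
    then show ?thesis using dB_Cauchy_Schwarz[OF A s] by simp
  next
    case False
    then have q: "0 < sqn s" using sqn_nonneg[of s] by linarith
    have c: "cnj (a / of_real (sqn s)) * a = of_real ((cmod a)\<^sup>2 / sqn s)"
      unfolding complex_cnj_divide complex_cnj_complex_of_real of_real_divide complex_norm_square
      by (simp add: mult.commute)
    have "Re (cnj (a / of_real (sqn s)) * a) = (cmod a)\<^sup>2 / sqn s" unfolding c by (rule Re_complex_of_real)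
    moreover have "(cmod (a / of_real (sqn s)))\<^sup>2 * sqn s = (cmod a)\<^sup>2 / sqn s"
      using q by (simp only: norm_divide norm_of_real power_divide power2_abs) (simp add: power2_eq_square)
    ultimately have "d \<le> sqn A - (cmod a)\<^sup>2 / sqn s"
      using d[of "a / of_real (sqn s)"] e[of "a / of_real (sqn s)"] by linarith
    then show ?thesis using q unfolding a_def[symmetric] by (simp add: field_simps)
  qed
qed

end

context de_branges_phase
begin

text \<open>Point values are bounded by the norm locally uniformly (\<open>eval_bound\<close>), so a
  norm Cauchy sequence converges to an entire function. Fatou on every horizontal line, with the
  bound of \<open>line_le_boundary\<close> common to all heights, puts the limit and its star into
  the space.\<close>

lemma deBranges_Cauchy_limit:
  fixes H :: "nat \<Rightarrow> complex \<Rightarrow> complex"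
  assumes H: "\<And>n. H n \<in> deBranges E"
    and cau: "\<And>e. 0 < e \<Longrightarrow> \<exists>N. \<forall>m\<ge>N. \<forall>n\<ge>N. sqn (\<lambda>z. H m z - H n z) \<le> e"
  shows "\<exists>h. h \<in> deBranges E \<and> (\<lambda>n. sqn (\<lambda>z. H n z - h z)) \<longlonglongrightarrow> 0"
proof -
  let ?c = "\<lambda>w. cmod (E w) + cmod (star E w)"
  have d: "(\<lambda>z. H m z - H n z) \<in> deBranges E" for m n by (rule deBranges_diff[OF H H])
  have ev: "cmod (H m w - H n w) \<le> sqrt (M / pi * e) * ?c w" if "sqn (\<lambda>z. H m z - H n z) \<le> e" for m n w e
  proof -
    have "cmod (H m w - H n w) \<le> sqrt (M / pi * sqn (\<lambda>z. H m z - H n z)) * ?c w"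
      by (rule eval_bound[OF d])
    also have "\<dots> \<le> sqrt (M / pi * e) * ?c w"
      using that M_pos by (intro mult_right_mono real_sqrt_le_mono mult_left_mono) auto
    finally show ?thesis .
  qed
  have Q: "\<exists>N. \<forall>m\<ge>N. \<forall>n\<ge>N. \<forall>w. ?c w \<le> B \<longrightarrow> cmod (H m w - H n w) \<le> e" if "0 < e" "0 < B" for e B
  proof -
    \<comment> \<open>Chosen so that \<open>eval_bound\<close> turns a squared norm of this size
      into e/B times |E| + |star E|.\<close>
    have e': "0 < (e / B)\<^sup>2 * (pi / M)" using that M_pos by simp
    from cau[OF e'] obtain N where N: "\<forall>m\<ge>N. \<forall>n\<ge>N. sqn (\<lambda>z. H m z - H n z) \<le> (e / B)\<^sup>2 * (pi / M)" ..
    have sq: "sqrt (M / pi * ((e / B)\<^sup>2 * (pi / M))) = e / B"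
      using that M_pos by (simp add: real_sqrt_mult)
    show ?thesis
    proof (intro exI[of _ N] allI impI)
      fix m n w assume mn: "m \<ge> N" "n \<ge> N" and w: "?c w \<le> B"
      have "cmod (H m w - H n w) \<le> e / B * ?c w"
        using ev[of m n "(e / B)\<^sup>2 * (pi / M)" w] N mn unfolding sq by blast
      also have "\<dots> \<le> e / B * B" using w that by (intro mult_left_mono) auto
      finally show "cmod (H m w - H n w) \<le> e" using that by simp
    qed
  qed
  have "Cauchy (\<lambda>n. H n w)" for w
  proof (rule metric_CauchyI)
    fix e :: real assume e: "0 < e"
    have "0 < ?c w + 1" by (simp add: add_nonneg_pos)
    from Q[OF half_gt_zero[OF e] this] obtain N
      where N: "\<forall>m\<ge>N. \<forall>n\<ge>N. \<forall>v. ?c v \<le> ?c w + 1 \<longrightarrow> cmod (H m v - H n v) \<le> e / 2" ..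
    have "dist (H m w) (H n w) < e" if "m \<ge> N" "n \<ge> N" for m n
    proof -
      have "?c w \<le> ?c w + 1" by simp
      then have "cmod (H m w - H n w) \<le> e / 2" using N that by blast
      then show ?thesis using e by (simp add: dist_norm)
    qed
    then show "\<exists>N. \<forall>m\<ge>N. \<forall>n\<ge>N. dist (H m w) (H n w) < e" by blast
  qed
  then have "\<forall>w. \<exists>l. (\<lambda>n. H n w) \<longlonglongrightarrow> l"
    unfolding Cauchy_convergent_iff convergent_def by blast
  then have "\<exists>h. \<forall>w. (\<lambda>n. H n w) \<longlonglongrightarrow> h w" by (rule choice)
  then obtain h where h: "\<And>w. (\<lambda>n. H n w) \<longlonglongrightarrow> h w" by blast
  have cc: "continuous_on A ?c" for A
    by (intro continuous_intros entire_continuous E_entire entire_star)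
  have he: "entire h"
    unfolding entire_def
  proof (rule holomorphic_uniform_sequence[of UNIV H])
    fix x :: complex
    have "compact (?c ` cball x 1)" by (intro compact_continuous_image cc compact_cball)
    then have "bounded (?c ` cball x 1)" by (rule compact_imp_bounded)
    then obtain B where B: "\<And>w. w \<in> cball x 1 \<Longrightarrow> \<bar>?c w\<bar> \<le> B"
      unfolding bounded_iff real_norm_def by blast
    have B1: "0 < \<bar>B\<bar> + 1" by simp
    have "uniform_limit (cball x 1) H h sequentially"
    proof (rule uniform_limitI)
      fix e :: real assume e: "0 < e"
      have "0 < e / 2" using e by simp
      from Q[OF this B1] obtain N where
        N: "\<forall>m\<ge>N. \<forall>n\<ge>N. \<forall>w. ?c w \<le> \<bar>B\<bar> + 1 \<longrightarrow> cmod (H m w - H n w) \<le> e / 2" by blast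
      have "dist (H n w) (h w) < e" if n: "n \<ge> N" and w: "w \<in> cball x 1" for n w
      proof -
        have cw: "?c w \<le> \<bar>B\<bar> + 1" using B[OF w] by linarith
        have "(\<lambda>m. cmod (H m w - H n w)) \<longlonglongrightarrow> cmod (h w - H n w)"
          by (intro tendsto_intros h)
        then have "cmod (h w - H n w) \<le> e / 2"
          by (rule LIMSEQ_le_const2) (use N n cw in blast)
        then show ?thesis using e by (simp add: dist_norm norm_minus_commute)
      qed
      then show "\<forall>\<^sub>F n in sequentially. \<forall>w\<in>cball x 1. dist (H n w) (h w) < e"
        unfolding eventually_sequentially by blast
    qed
    then show "\<exists>d>0. cball x d \<subseteq> UNIV \<and> uniform_limit (cball x d) H h sequentially"
      by (intro exI[of _ 1]) auto
  qed (use deBranges_entire[OF H] in \<open>auto simp: entire_def\<close>)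
  obtain N0 where N0: "\<forall>m\<ge>N0. \<forall>n\<ge>N0. sqn (\<lambda>z. H m z - H n z) \<le> 1"
    using cau[OF zero_less_one] ..
  define C where "C = 2 * sqn (H N0) + 2"
  have sqC: "sqn (H (n + N0)) \<le> C" for n
  proof -
    have "sqn (\<lambda>z. H N0 z + (H (n + N0) z - H N0 z)) \<le> 2 * sqn (H N0) + 2 * sqn (\<lambda>z. H (n + N0) z - H N0 z)"
      using parallelogram[OF H d, of N0 "n + N0" N0] sqn_nonneg[of "\<lambda>z. H N0 z - (H (n + N0) z - H N0 z)"] by linarith
    moreover have "sqn (\<lambda>z. H (n + N0) z - H N0 z) \<le> 1" using N0 by simp
    ultimately show ?thesis by (simp add: C_def)
  qed
  have hd: "hardy2 (\<lambda>z. G z / E z)"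
    if G: "entire G" and K: "\<And>n. K n \<in> deBranges E" "\<And>n. sqn (K n) \<le> C" "\<And>z. (\<lambda>n. K n z) \<longlonglongrightarrow> G z" for G K
    unfolding hardy2_def
  proof (intro conjI exI[of _ C] allI impI)
    show "(\<lambda>z. G z / E z) holomorphic_on {z. 0 < Im z}" by (rule quotient_holomorphic[OF G])
    fix y :: real assume y: "0 < y"
    have L: "L2 lborel (\<lambda>t. K n (Complex t y) / E (Complex t y))" for n
    proof -
      interpret hardy_closed "\<lambda>z. K n z / E z" by (rule deBranges_hardy[OF K(1)])
      show ?thesis using hardy line_measurable[of y] y by (auto simp: hardy2_def L2_def)
    qed
    have B: "(LINT t|lborel. (cmod (K n (Complex t y) / E (Complex t y)))\<^sup>2) \<le> C" for n
    proof -
      interpret hardy_closed "\<lambda>z. K n z / E z" by (rule deBranges_hardy[OF K(1)])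
      show ?thesis using line_le_boundary[OF y] K(2)[of n] unfolding sqn_def by linarith
    qed
    have lim: "(\<lambda>n. K n (Complex t y) / E (Complex t y)) \<longlonglongrightarrow> G (Complex t y) / E (Complex t y)" for t
      by (intro tendsto_divide K(3) tendsto_const E_nz) (use y in simp)
    show "integrable lborel (\<lambda>t. (cmod (G (Complex t y) / E (Complex t y)))\<^sup>2)"
      using L2_Fatou(1)[OF L B lim] by (simp add: L2_def)
    show "(LINT t|lborel. (cmod (G (Complex t y) / E (Complex t y)))\<^sup>2) \<le> C"
      by (rule L2_Fatou(2)[OF L B lim])
  qed
  have hlim: "(\<lambda>n. H (n + N0) z) \<longlonglongrightarrow> h z" for z by (rule LIMSEQ_ignore_initial_segment[OF h])
  have "hardy2 (\<lambda>z. h z / E z)"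
    by (rule hd[OF he, of "\<lambda>n. H (n + N0)"]) (use H sqC hlim in auto)
  moreover have "hardy2 (\<lambda>z. star h z / E z)"
  proof (rule hd[OF entire_star[OF he], of "\<lambda>n. star (H (n + N0))"])
    show "(\<lambda>n. star (H (n + N0)) z) \<longlonglongrightarrow> star h z" for z
      unfolding star_def by (intro tendsto_intros hlim)
  qed (use H sqC deBranges_star sqn_star in auto)
  ultimately have hB: "h \<in> deBranges E" using he by (simp add: deBranges_def)
  have lim0: "(\<lambda>n. sqn (\<lambda>z. H n z - h z)) \<longlonglongrightarrow> 0"
  proof (rule LIMSEQ_I)
    fix r :: real assume r: "0 < r"
    then have "0 < r / 2" by simp
    from cau[OF this] obtain N where N: "\<forall>m\<ge>N. \<forall>n\<ge>N. sqn (\<lambda>z. H m z - H n z) \<le> r / 2" by blast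
    have "sqn (\<lambda>z. H n z - h z) \<le> r / 2" if n: "n \<ge> N" for n
      unfolding sqn_def
    proof (rule L2_Fatou(2))
      show "L2 lborel (\<lambda>t. (H n (of_real t) - H (m + N) (of_real t)) / E (of_real t))" for m
        by (rule deBranges_L2[OF d])
      show "(LINT t|lborel. (cmod ((H n (of_real t) - H (m + N) (of_real t)) / E (of_real t)))\<^sup>2) \<le> r / 2" for m
        using N n unfolding sqn_def by simp
      show "(\<lambda>m. (H n (of_real t) - H (m + N) (of_real t)) / E (of_real t)) \<longlonglongrightarrow> (H n (of_real t) - h (of_real t)) / E (of_real t)" for t
        by (intro tendsto_divide tendsto_diff tendsto_const LIMSEQ_ignore_initial_segment[OF h] E_real_nz)
    qed
    note le = this
    have "norm (sqn (\<lambda>z. H n z - h z) - 0) < r" if "n \<ge> N" for n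
    proof -
      have "norm (sqn (\<lambda>z. H n z - h z) - 0) = sqn (\<lambda>z. H n z - h z)" by simp
      also have "\<dots> \<le> r / 2" by (rule le[OF that])
      also have "\<dots> < r" using r by simp
      finally show ?thesis .
    qed
    then show "\<exists>no. \<forall>n\<ge>no. norm (sqn (\<lambda>z. H n z - h z) - 0) < r" by blast
  qed
  have "h \<in> deBranges E \<and> (\<lambda>n. sqn (\<lambda>z. H n z - h z)) \<longlonglongrightarrow> 0" using hB lim0 by (rule conjI)
  then show "\<exists>h. h \<in> deBranges E \<and> (\<lambda>n. sqn (\<lambda>z. H n z - h z)) \<longlonglongrightarrow> 0" by (rule exI[of _ h])
qed

text \<open>The classical projection argument: h is the limit of F - G n along a minimising sequence
  in the span. It is nonzero because the distance is positive, and orthogonal because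
  \<open>approx_orthogonal\<close> makes the inner products with a fixed s tend to zero.\<close>

lemma not_in_closed_span_orthogonal:
  assumes S: "S \<subseteq> deBranges E" and F: "F \<in> deBranges E" and n: "\<not> in_closed_span E S F"
  obtains h where "h \<in> deBranges E" "\<exists>z. h z \<noteq> 0" "\<And>s. s \<in> S \<Longrightarrow> dB_inner E h s = 0"
proof -
  have "\<exists>\<epsilon>>0. \<forall>G\<in>lin_span S. \<epsilon> \<le> dB_norm E (\<lambda>z. F z - G z)"
    using n unfolding in_closed_span_def by (simp add: not_less)
  then obtain \<epsilon> where eps: "0 < \<epsilon>" "\<And>G. G \<in> lin_span S \<Longrightarrow> \<epsilon> \<le> dB_norm E (\<lambda>z. F z - G z)"
    by blast
  have sp: "lin_span S \<subseteq> deBranges E" by (rule lin_span_deBranges[OF S])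
  let ?V = "(\<lambda>G. sqn (\<lambda>z. F z - G z)) ` lin_span S"
  define d where "d = Inf ?V"
  have bdd: "bdd_below ?V" by (rule bdd_belowI[of _ 0]) auto
  have ne: "?V \<noteq> {}" using lin_span_0 by blast
  have dle: "d \<le> sqn (\<lambda>z. F z - G z)" if "G \<in> lin_span S" for G
    unfolding d_def by (rule cInf_lower[OF _ bdd]) (use that in blast)
  have "\<epsilon>\<^sup>2 \<le> d"
    unfolding d_def
  proof (rule cInf_greatest[OF ne])
    fix v assume "v \<in> ?V"
    then obtain G where G: "G \<in> lin_span S" "v = sqn (\<lambda>z. F z - G z)" by blast
    have "\<epsilon>\<^sup>2 \<le> (dB_norm E (\<lambda>z. F z - G z))\<^sup>2"
      using eps(1) eps(2)[OF G(1)] by (intro power_mono) auto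
    then show "\<epsilon>\<^sup>2 \<le> v" unfolding dB_norm_eq G(2) by simp
  qed
  moreover have "0 < \<epsilon>\<^sup>2" using eps(1) by simp
  ultimately have d0: "0 < d" by linarith
  have "\<exists>G. G \<in> lin_span S \<and> sqn (\<lambda>z. F z - G z) < d + 1 / real (Suc n)" for n
  proof -
    have "Inf ?V < d + 1 / real (Suc n)" by (simp add: d_def)
    from cInf_lessD[OF ne this] show ?thesis by blast
  qed
  then have "\<forall>n. \<exists>G. G \<in> lin_span S \<and> sqn (\<lambda>z. F z - G z) < d + 1 / real (Suc n)" by blast
  from choice[OF this] obtain G where G': "\<forall>n. G n \<in> lin_span S \<and> sqn (\<lambda>z. F z - G n z) < d + 1 / real (Suc n)" ..
  then have G: "G n \<in> lin_span S" "sqn (\<lambda>z. F z - G n z) < d + 1 / real (Suc n)" for n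
    by simp_all
  define H where "H = (\<lambda>n z. F z - G n z)"
  have H: "H n \<in> deBranges E" for n unfolding H_def by (rule deBranges_diff[OF F]) (use sp G in blast)
  have Hs: "sqn (H n) < d + 1 / real (Suc n)" for n using G(2)[of n] by (simp add: H_def)
  have par: "sqn (\<lambda>z. H m z - H n z) \<le> 2 / real (Suc m) + 2 / real (Suc n)" for m n
  proof -
    \<comment> \<open>The midpoint of two approximants is again in the span, so the sum of the two
      errors has squared norm at least 4 d; the parallelogram law then bounds their
      difference.\<close>
    have "(\<lambda>z. 1 / 2 * G m z + 1 / 2 * G n z) \<in> lin_span S" by (rule lin_span_lincomb[OF G(1) G(1)])
    from dle[OF this] have "4 * d \<le> (cmod 2)\<^sup>2 * sqn (\<lambda>z. F z - (1 / 2 * G m z + 1 / 2 * G n z))" by simp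
    also have "\<dots> = sqn (\<lambda>z. 2 * (F z - (1 / 2 * G m z + 1 / 2 * G n z)))" by (rule sqn_cmult[symmetric])
    also have "(\<lambda>z. 2 * (F z - (1 / 2 * G m z + 1 / 2 * G n z))) = (\<lambda>z. H m z + H n z)"
      by (auto simp: H_def algebra_simps)
    finally have "4 * d \<le> sqn (\<lambda>z. H m z + H n z)" .
    with parallelogram[OF H H, of m n] Hs[of m] Hs[of n] show ?thesis by simp
  qed
  have cau: "\<exists>N. \<forall>m\<ge>N. \<forall>n\<ge>N. sqn (\<lambda>z. H m z - H n z) \<le> e" if e: "0 < e" for e
  proof -
    obtain N where N: "4 / e < real N" using reals_Archimedean2 by blast
    have "2 / real (Suc m) \<le> e / 2" if "m \<ge> N" for m
    proof -
      have "4 / e < real (Suc m)" using N that by linarith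
      then show ?thesis using e by (simp add: field_simps)
    qed
    note b = this
    have "sqn (\<lambda>z. H m z - H n z) \<le> e" if "m \<ge> N" "n \<ge> N" for m n
    proof -
      have "sqn (\<lambda>z. H m z - H n z) \<le> 2 / real (Suc m) + 2 / real (Suc n)" by (rule par)
      also have "\<dots> \<le> e / 2 + e / 2" by (intro add_mono b that)
      finally show ?thesis by simp
    qed
    then show ?thesis by blast
  qed
  have "\<exists>h. h \<in> deBranges E \<and> (\<lambda>n. sqn (\<lambda>z. H n z - h z)) \<longlonglongrightarrow> 0"
    by (rule deBranges_Cauchy_limit[OF H]) (rule cau)
  then obtain h where h: "h \<in> deBranges E" "(\<lambda>n. sqn (\<lambda>z. H n z - h z)) \<longlonglongrightarrow> 0"
    by blast
  show ?thesis
  proof (rule that[OF h(1)])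
    show "\<exists>z. h z \<noteq> 0"
    proof (rule ccontr)
      assume "\<nexists>z. h z \<noteq> 0"
      then have hz: "h z = 0" for z by blast
      have "(\<lambda>z. H n z - h z) = H n" for n unfolding hz by (rule ext) (rule diff_zero)
      then have lim0: "(\<lambda>n. sqn (H n)) \<longlonglongrightarrow> 0" using h(2) by (simp only:)
      have "d \<le> sqn (H n)" for n using dle[OF G(1)] unfolding H_def .
      then have "d \<le> 0" using LIMSEQ_le_const[OF lim0, of d] by blast
      with d0 show False by simp
    qed
    fix s assume s: "s \<in> S"
    have sB: "s \<in> deBranges E" using S s by blast
    have lim1: "(\<lambda>n. sqn (\<lambda>z. H n z - h z) * sqn s) \<longlonglongrightarrow> 0"
      using tendsto_mult[OF h(2) tendsto_const[of "sqn s"]] by simp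
    have lim2: "(\<lambda>n. 1 / real (Suc n) * sqn s) \<longlonglongrightarrow> 0"
      using tendsto_mult[OF inverse_Suc(2) tendsto_const[of "sqn s"]] by simp
    have le: "(cmod (dB_inner E h s))\<^sup>2 \<le> 2 * (sqn (\<lambda>z. H n z - h z) * sqn s) + 2 * (1 / real (Suc n) * sqn s)" for n
    proof -
      have hn: "(\<lambda>z. H n z - h z) \<in> deBranges E" by (rule deBranges_diff[OF H h(1)])
      have dc: "d \<le> sqn (\<lambda>z. H n z - c * s z)" for c
      proof -
        have "(\<lambda>z. 1 * G n z + c * s z) \<in> lin_span S" by (rule lin_span_lincomb[OF G(1) lin_span_incl[OF s]])
        moreover have "(\<lambda>z. F z - (1 * G n z + c * s z)) = (\<lambda>z. H n z - c * s z)"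
          by (rule ext) (simp add: H_def)
        ultimately show ?thesis using dle[of "\<lambda>z. 1 * G n z + c * s z"] by (simp only:)
      qed
      have "(cmod (dB_inner E (H n) s))\<^sup>2 \<le> (sqn (H n) - d) * sqn s" by (rule approx_orthogonal[OF H sB dc])
      also have "\<dots> \<le> 1 / real (Suc n) * sqn s" using Hs[of n] by (intro mult_right_mono) auto
      finally have 1: "(cmod (dB_inner E (H n) s))\<^sup>2 \<le> 1 / real (Suc n) * sqn s" .
      have 2: "(cmod (dB_inner E (\<lambda>z. H n z - h z) s))\<^sup>2 \<le> sqn (\<lambda>z. H n z - h z) * sqn s"
        by (rule dB_Cauchy_Schwarz[OF hn sB])
      have "dB_inner E (\<lambda>z. (H n z - h z) + h z) s = dB_inner E (\<lambda>z. H n z - h z) s + dB_inner E h s"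
        by (rule dB_inner_add_left[OF hn h(1) sB])
      moreover have "(\<lambda>z. (H n z - h z) + h z) = H n" by (rule ext) (rule diff_add_cancel)
      ultimately have "dB_inner E h s = dB_inner E (H n) s - dB_inner E (\<lambda>z. H n z - h z) s" by (simp only:) simp
      then have "cmod (dB_inner E h s) \<le> cmod (dB_inner E (H n) s) + cmod (dB_inner E (\<lambda>z. H n z - h z) s)"
        using norm_triangle_ineq4[of "dB_inner E (H n) s" "dB_inner E (\<lambda>z. H n z - h z) s"] by simp
      then have "(cmod (dB_inner E h s))\<^sup>2 \<le> (cmod (dB_inner E (H n) s) + cmod (dB_inner E (\<lambda>z. H n z - h z) s))\<^sup>2"
        by (intro power_mono) auto
      also have "\<dots> \<le> 2 * (cmod (dB_inner E (H n) s))\<^sup>2 + 2 * (cmod (dB_inner E (\<lambda>z. H n z - h z) s))\<^sup>2"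
        using sum_squares_bound[of "cmod (dB_inner E (H n) s)" "cmod (dB_inner E (\<lambda>z. H n z - h z) s)"]
        unfolding power2_sum by linarith
      finally show ?thesis using 1 2 by linarith
    qed
    have "(\<lambda>n. 2 * (sqn (\<lambda>z. H n z - h z) * sqn s) + 2 * (1 / real (Suc n) * sqn s)) \<longlonglongrightarrow> 2 * 0 + 2 * 0"
      by (intro tendsto_add tendsto_mult tendsto_const lim1 lim2)
    then have "(cmod (dB_inner E h s))\<^sup>2 \<le> 2 * 0 + 2 * 0"
      by (rule LIMSEQ_le_const) (use le in blast)
    then show "dB_inner E h s = 0" by simp
  qed
qed

text \<open>Vanishing on L is orthogonality to every kernel, hence to every G in their span; then
  the squared norm of F is at most that of F - G, which can be made arbitrarily small.\<close>

lemma complete_kernels_unique: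
  assumes c: "dB_complete E ((\<lambda>l. repkernel E (of_real l)) ` L)" and F: "F \<in> deBranges E"
    and z: "\<And>l. l \<in> L \<Longrightarrow> F (of_real l) = 0"
  shows "F w = 0"
proof (rule sqn_eq_0[OF F])
  let ?S = "(\<lambda>l. repkernel E (of_real l)) ` L"
  have S: "?S \<subseteq> deBranges E" by (rule image_subsetI) (rule repkernel_deBranges)
  have o: "dB_inner E F s = 0" if "s \<in> ?S" for s
  proof -
    from that obtain l where "l \<in> L" "s = repkernel E (of_real l)" by blast
    then show ?thesis using reproducing_real[OF F, of l] z[of l] by (simp only:)
  qed
  have "sqn F \<le> e" if e: "0 < e" for e
  proof -
    have cs: "in_closed_span E ?S F" using c F unfolding dB_complete_def by (rule bspec)
    have "0 < sqrt e" using e by simp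
    then have "\<exists>G\<in>lin_span ?S. dB_norm E (\<lambda>z. F z - G z) < sqrt e"
      using cs[unfolded in_closed_span_def] by (elim allE[of _ "sqrt e"] impE)
    then obtain G where G: "G \<in> lin_span ?S" "dB_norm E (\<lambda>z. F z - G z) < sqrt e" by (rule bexE)
    have GB: "G \<in> deBranges E" using lin_span_deBranges[OF S] G(1) by blast
    have "dB_inner E F G = 0" by (rule inner_lin_span_0[OF S F o G(1)])
    then have "sqn F \<le> sqn (\<lambda>z. F z - G z)" using sqn_diff[OF F GB] sqn_nonneg[of G] by simp
    also have "\<dots> < e" using G(2) unfolding dB_norm_eq by simp
    finally show ?thesis by simp
  qed
  then have "sqn F \<le> 0" by (rule field_le_epsilon) simp
  then show "sqn F = 0" using sqn_nonneg[of F] by linarith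
qed

end

section \<open>Cauchy transforms\<close>

definition ctrans :: "(real \<Rightarrow> complex) \<Rightarrow> complex \<Rightarrow> complex" where
  "ctrans u w = (LINT t|lborel. u t / (of_real t - w))"

lemma pole_measurable: "(\<lambda>t. 1 / (complex_of_real t - w)) \<in> borel_measurable borel"
  by measurable

lemma ctrans_integrable:
  assumes u: "integrable lborel u" and w: "Im w \<noteq> 0"
  shows "integrable lborel (\<lambda>t. u t / (of_real t - w))"
proof (rule Bochner_Integration.integrable_bound)
  show "integrable lborel (\<lambda>t. 1 / \<bar>Im w\<bar> * cmod (u t))"
    by (rule integrable_mult_right[OF integrable_norm[OF u]])
  have um: "u \<in> borel_measurable lborel" using u by simp
  have "(\<lambda>t. u t * (1 / (complex_of_real t - w))) \<in> borel_measurable lborel"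
    using borel_measurable_times[OF um, of "\<lambda>t. 1 / (complex_of_real t - w)"] pole_measurable by simp
  then show "(\<lambda>t. u t / (of_real t - w)) \<in> borel_measurable lborel" by simp
  show "AE t in lborel. norm (u t / (of_real t - w)) \<le> norm (1 / \<bar>Im w\<bar> * cmod (u t))"
  proof (rule AE_I2)
    fix t
    have "cmod (u t) / cmod (of_real t - w) \<le> cmod (u t) / \<bar>Im w\<bar>"
      using abs_Im_le_pole_dist[of w t] w by (intro divide_left_mono) (auto intro!: mult_pos_pos)
    then show "norm (u t / (of_real t - w)) \<le> norm (1 / \<bar>Im w\<bar> * cmod (u t))"
      by (simp add: norm_divide)
  qed
qed

lemma ctrans_bound:
  assumes u: "integrable lborel u" and w: "Im w \<noteq> 0"
  shows "cmod (ctrans u w) \<le> (LINT t|lborel. cmod (u t)) / \<bar>Im w\<bar>"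
proof -
  have "cmod (ctrans u w) \<le> (LINT t|lborel. cmod (u t / (of_real t - w)))"
    unfolding ctrans_def by (rule integral_norm_bound)
  also have "\<dots> \<le> (LINT t|lborel. 1 / \<bar>Im w\<bar> * cmod (u t))"
  proof (rule integral_mono')
    show "integrable lborel (\<lambda>t. 1 / \<bar>Im w\<bar> * cmod (u t))"
      by (rule integrable_mult_right[OF integrable_norm[OF u]])
    fix t
    have "cmod (u t) / cmod (of_real t - w) \<le> cmod (u t) / \<bar>Im w\<bar>"
      using abs_Im_le_pole_dist[of w t] w by (intro divide_left_mono) (auto intro!: mult_pos_pos)
    then show "cmod (u t / (of_real t - w)) \<le> 1 / \<bar>Im w\<bar> * cmod (u t)"
      by (simp add: norm_divide)
  qed simp
  also have "\<dots> = (LINT t|lborel. cmod (u t)) / \<bar>Im w\<bar>" by (subst integral_mult_right_zero) simp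
  finally show ?thesis .
qed

text \<open>Within distance |Im w|/2 of w all poles keep a fixed distance from the real line, and
  the difference quotients are dominated by a multiple of |u|.\<close>

lemma ctrans_deriv:
  assumes u: "integrable lborel u" and w: "Im w \<noteq> 0"
  shows "(ctrans u has_field_derivative (LINT t|lborel. u t / ((of_real t - w) * (of_real t - w)))) (at w)"
proof -
  let ?D = "LINT t|lborel. u t / ((of_real t - w) * (of_real t - w))"
  let ?r = "\<bar>Im w\<bar> / 2"
  have r: "0 < ?r" using w by simp
  have um: "u \<in> borel_measurable lborel" using u by simp
  have "(\<lambda>z. (ctrans u z - ctrans u w) / (z - w)) \<midarrow>w\<rightarrow> ?D"
    unfolding tendsto_at_iff_sequentially
  proof (intro allI impI)
    fix Z :: "nat \<Rightarrow> complex" assume Z: "\<forall>i. Z i \<in> UNIV - {w}" "Z \<longlonglongrightarrow> w"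
    from tendstoD[OF Z(2) r] obtain N where N: "\<And>n. n \<ge> N \<Longrightarrow> dist (Z n) w < ?r"
      unfolding eventually_sequentially by blast
    define Y where "Y = (\<lambda>n. Z (n + N))"
    have Y: "Y n \<noteq> w" "cmod (Y n - w) < ?r" for n
      using Z(1) N[of "n + N"] by (auto simp: Y_def dist_norm)
    have Ylim: "Y \<longlonglongrightarrow> w" unfolding Y_def by (rule LIMSEQ_ignore_initial_segment[OF Z(2)])
    have ImY: "?r \<le> \<bar>Im (Y n)\<bar>" for n
      using abs_Im_le_cmod[of "Y n - w"] Y(2)[of n] by simp
    have ImY0: "Im (Y n) \<noteq> 0" for n using ImY[of n] r by auto
    have nz: "of_real t - Y n \<noteq> 0" "of_real t - w \<noteq> 0" for t n
      using ImY0[of n] w by (auto simp: complex_eq_iff)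
    have eq: "(ctrans u (Y n) - ctrans u w) / (Y n - w) = (LINT t|lborel. u t / ((of_real t - Y n) * (of_real t - w)))" for n
    proof -
      have "ctrans u (Y n) - ctrans u w = (LINT t|lborel. u t / (of_real t - Y n) - u t / (of_real t - w))"
        unfolding ctrans_def
        by (rule Bochner_Integration.integral_diff[OF ctrans_integrable[OF u ImY0] ctrans_integrable[OF u w], symmetric])
      also have "\<dots> = (LINT t|lborel. (Y n - w) * (u t / ((of_real t - Y n) * (of_real t - w))))"
      proof (intro Bochner_Integration.integral_cong refl)
        fix t
        have "x / a - x / b = (b - a) * (x / (a * b))" if "a \<noteq> 0" "b \<noteq> 0" for x a b :: complex
          using that by (simp add: field_simps)
        from this[OF nz(1)[of t n] nz(2)[of t], of "u t"]
        show "u t / (of_real t - Y n) - u t / (of_real t - w) = (Y n - w) * (u t / ((of_real t - Y n) * (of_real t - w)))"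
          by simp
      qed
      finally show ?thesis using Y(1)[of n] by (simp only: integral_mult_right_zero) simp
    qed
    have "(\<lambda>n. LINT t|lborel. u t / ((of_real t - Y n) * (of_real t - w))) \<longlonglongrightarrow> ?D"
    proof (rule integral_dominated_convergence)
      show "integrable lborel (\<lambda>t. 1 / (?r * \<bar>Im w\<bar>) * cmod (u t))"
        by (rule integrable_mult_right[OF integrable_norm[OF u]])
      have m: "(\<lambda>t. u t / ((complex_of_real t - a) * (complex_of_real t - w))) \<in> borel_measurable lborel" for a
      proof -
        have "(\<lambda>t. 1 / ((complex_of_real t - a) * (complex_of_real t - w))) \<in> borel_measurable borel" by measurable
        then have "(\<lambda>t. u t * (1 / ((complex_of_real t - a) * (complex_of_real t - w)))) \<in> borel_measurable lborel"
          using um by (intro borel_measurable_times) auto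
        then show ?thesis by simp
      qed
      show "(\<lambda>t. u t / ((of_real t - Y n) * (of_real t - w))) \<in> borel_measurable lborel" for n by (rule m)
      show "(\<lambda>t. u t / ((of_real t - w) * (of_real t - w))) \<in> borel_measurable lborel" by (rule m)
      show "AE t in lborel. (\<lambda>n. u t / ((of_real t - Y n) * (of_real t - w))) \<longlonglongrightarrow> u t / ((of_real t - w) * (of_real t - w))"
        by (intro AE_I2 tendsto_divide tendsto_mult tendsto_diff tendsto_const Ylim) (use nz in simp)
      show "AE t in lborel. norm (u t / ((of_real t - Y n) * (of_real t - w))) \<le> 1 / (?r * \<bar>Im w\<bar>) * cmod (u t)" for n
      proof (rule AE_I2)
        fix t
        have "?r * \<bar>Im w\<bar> \<le> cmod (of_real t - Y n) * cmod (of_real t - w)"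
          using abs_Im_le_pole_dist[of w t] order_trans[OF ImY abs_Im_le_pole_dist[of "Y n" t]] r
          by (intro mult_mono) auto
        then have "cmod (u t) / (cmod (of_real t - Y n) * cmod (of_real t - w)) \<le> cmod (u t) / (?r * \<bar>Im w\<bar>)"
          using r w nz(1)[of t n] nz(2)[of t] by (intro divide_left_mono mult_pos_pos) auto
        then show "norm (u t / ((of_real t - Y n) * (of_real t - w))) \<le> 1 / (?r * \<bar>Im w\<bar>) * cmod (u t)"
          by (simp add: norm_divide norm_mult mult.commute[of "cmod (u t)" 2])
      qed
    qed
    then have "(\<lambda>n. (ctrans u (Y n) - ctrans u w) / (Y n - w)) \<longlonglongrightarrow> ?D"
      by (simp only: eq)
    then have "(\<lambda>n. (ctrans u (Z (n + N)) - ctrans u w) / (Z (n + N) - w)) \<longlonglongrightarrow> ?D"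
      by (simp only: Y_def)
    then have "(\<lambda>n. (ctrans u (Z n) - ctrans u w) / (Z n - w)) \<longlonglongrightarrow> ?D"
      by (rule LIMSEQ_offset)
    then show "((\<lambda>z. (ctrans u z - ctrans u w) / (z - w)) \<circ> Z) \<longlonglongrightarrow> ?D"
      by (simp add: o_def)
  qed
  then show ?thesis by (simp add: has_field_derivative_iff)
qed

lemma ctrans_holomorphic:
  assumes u: "integrable lborel u" and A: "\<And>z. z \<in> A \<Longrightarrow> Im z \<noteq> 0"
  shows "ctrans u holomorphic_on A"
  unfolding holomorphic_on_def field_differentiable_def
  using ctrans_deriv[OF u A] has_field_derivative_at_within by blast

lemma sq_pole_integral_line:
  assumes y: "0 < y"
  shows "integrable lborel (\<lambda>x. 1 / (cmod (of_real t - Complex x y))\<^sup>2)"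
    and "(LINT x|lborel. 1 / (cmod (of_real t - Complex x y))\<^sup>2) = pi / y"
proof -
  have "1 / (cmod (of_real t - Complex x y))\<^sup>2 = 1 / ((x - t)\<^sup>2 + y\<^sup>2)" for x
    unfolding cmod_sq_of_real_diff by (simp add: power2_commute)
  then show "integrable lborel (\<lambda>x. 1 / (cmod (of_real t - Complex x y))\<^sup>2)"
    and "(LINT x|lborel. 1 / (cmod (of_real t - Complex x y))\<^sup>2) = pi / y"
    using poisson_kernel_integrable[OF y, of t] poisson_kernel_integral[OF y, of t] by simp_all
qed

lemma ctrans_line_measurable:
  assumes u: "integrable lborel u" and y: "y \<noteq> 0"
  shows "(\<lambda>x. ctrans u (Complex x y)) \<in> borel_measurable borel"
proof (rule borel_measurable_continuous_onI)
  have c: "continuous_on {z. Im z \<noteq> 0} (ctrans u)"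
    by (rule holomorphic_on_imp_continuous_on[OF ctrans_holomorphic[OF u]]) simp
  show "continuous_on UNIV (\<lambda>x. ctrans u (Complex x y))"
  proof (rule continuous_on_compose2[OF c])
    show "continuous_on UNIV (\<lambda>t. Complex t y)"
      unfolding Complex_eq by (intro continuous_intros)
  qed (use y in auto)
qed

text \<open>Cauchy-Schwarz with weight |u|, followed by Fubini. The bound degenerates as y tends to
  0, but it gives finiteness on each line and decay as y grows, and this decay later closes the
  argument for the uniform bound.\<close>

lemma ctrans_rough_L2:
  assumes u: "integrable lborel u" and y: "0 < y"
  shows "integrable lborel (\<lambda>x. (cmod (ctrans u (Complex x y)))\<^sup>2)"
    and "(LINT x|lborel. (cmod (ctrans u (Complex x y)))\<^sup>2) \<le> (LINT t|lborel. cmod (u t))\<^sup>2 * pi / y"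
proof -
  let ?I = "LINT t|lborel. cmod (u t)"
  have I0: "0 \<le> ?I" by simp
  have um: "u \<in> borel_measurable borel" using borel_measurable_integrable[OF u] by simp
  define v where "v = (\<lambda>t. cmod (u t))"
  have vm [measurable]: "v \<in> borel_measurable borel" unfolding v_def by (rule measurable_compose[OF um borel_measurable_norm])
  have vi: "integrable lborel v" unfolding v_def by (rule integrable_norm[OF u])
  have v0: "0 \<le> v t" for t by (simp add: v_def)
  define Q where "Q = (\<lambda>x t. 1 / (cmod (complex_of_real t - Complex x y))\<^sup>2)"
  have Qeq: "Q x t = 1 / ((x - t)\<^sup>2 + y\<^sup>2)" for x t
    unfolding Q_def cmod_sq_of_real_diff by (simp add: power2_commute)
  have Q0: "0 \<le> Q x t" for x t by (simp add: Q_def)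
  have Qb: "Q x t \<le> 1 / y\<^sup>2" for x t
    unfolding Qeq using y by (intro divide_left_mono) (auto intro!: mult_pos_pos add_nonneg_pos)
  have Qm: "Q x \<in> borel_measurable borel" for x unfolding Qeq[abs_def] by measurable
  have vQ: "integrable lborel (\<lambda>t. v t * Q x t)" for x
  proof (rule Bochner_Integration.integrable_bound)
    show "integrable lborel (\<lambda>t. v t * (1 / y\<^sup>2))" by (rule integrable_mult_left[OF vi])
    show "(\<lambda>t. v t * Q x t) \<in> borel_measurable lborel" using vm Qm[of x] by simp
    show "AE t in lborel. norm (v t * Q x t) \<le> norm (v t * (1 / y\<^sup>2))"
    proof (rule AE_I2)
      fix t
      have "v t * Q x t \<le> v t * (1 / y\<^sup>2)" by (rule mult_left_mono[OF Qb v0])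
      moreover have "0 \<le> v t * Q x t" by (rule mult_nonneg_nonneg[OF v0 Q0])
      ultimately show "norm (v t * Q x t) \<le> norm (v t * (1 / y\<^sup>2))" unfolding real_norm_def by linarith
    qed
  qed
  have pw: "(cmod (ctrans u (Complex x y)))\<^sup>2 \<le> ?I * (LINT t|lborel. v t * Q x t)" for x
  proof -
    let ?a = "\<lambda>t. complex_of_real (sqrt (v t))" and ?b = "\<lambda>t. complex_of_real (sqrt (v t * Q x t))"
    have sa: "(cmod (?a t))\<^sup>2 = v t" for t using v0[of t] by simp
    have sb: "(cmod (?b t))\<^sup>2 = v t * Q x t" for t using v0[of t] Q0[of x t] by simp
    have am: "?a \<in> borel_measurable borel" by (rule measurable_compose[OF vm sqrt_of_real_measurable])
    have "(\<lambda>t. v t * Q x t) \<in> borel_measurable borel" using vm Qm[of x] by (rule borel_measurable_times)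
    then have bm: "?b \<in> borel_measurable borel" by (rule measurable_compose[OF _ sqrt_of_real_measurable])
    have La: "L2 lborel ?a" unfolding L2_def sa using am vi by simp
    have Lb: "L2 lborel ?b" unfolding L2_def sb using bm vQ[of x] by simp
    have ab: "cmod (?a t) * cmod (?b t) = cmod (u t / (of_real t - Complex x y))" for t
    proof -
      have sQ: "sqrt (Q x t) = 1 / cmod (of_real t - Complex x y)"
        unfolding Q_def by (simp add: real_sqrt_divide)
      have "cmod (?a t) * cmod (?b t) = sqrt (v t) * (sqrt (v t) * sqrt (Q x t))"
        by (simp only: norm_of_real real_sqrt_mult) (use v0[of t] Q0[of x t] in simp)
      also have "\<dots> = v t * sqrt (Q x t)" using v0[of t] by simp
      finally show ?thesis unfolding sQ v_def by (simp add: norm_divide)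
    qed
    have "cmod (ctrans u (Complex x y)) \<le> (LINT t|lborel. cmod (?a t) * cmod (?b t))"
      unfolding ab ctrans_def by (rule integral_norm_bound)
    then have "(cmod (ctrans u (Complex x y)))\<^sup>2 \<le> (LINT t|lborel. cmod (?a t) * cmod (?b t))\<^sup>2"
      by (intro power_mono) auto
    also have "\<dots> \<le> ?I * (LINT t|lborel. v t * Q x t)"
      using L2_Cauchy_Schwarz_norm[OF La Lb] unfolding sa sb by (simp only: v_def)
    finally show ?thesis .
  qed
  have "(\<integral>\<^sup>+x. ennreal ((cmod (ctrans u (Complex x y)))\<^sup>2) \<partial>lborel) \<le> (\<integral>\<^sup>+x. \<integral>\<^sup>+t. ennreal (?I * (v t * Q x t)) \<partial>lborel \<partial>lborel)"
  proof (intro nn_integral_mono)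
    fix x
    have "ennreal ((cmod (ctrans u (Complex x y)))\<^sup>2) \<le> ennreal (LINT t|lborel. ?I * (v t * Q x t))"
      using pw[of x] by (intro ennreal_leI) (simp only: integral_mult_right_zero)
    also have "\<dots> = (\<integral>\<^sup>+t. ennreal (?I * (v t * Q x t)) \<partial>lborel)"
      by (rule nn_integral_eq_integral[OF integrable_mult_right[OF vQ], symmetric]) (use I0 v0 Q0 in auto)
    finally show "ennreal ((cmod (ctrans u (Complex x y)))\<^sup>2) \<le> (\<integral>\<^sup>+t. ennreal (?I * (v t * Q x t)) \<partial>lborel)" .
  qed
  also have "\<dots> = (\<integral>\<^sup>+t. \<integral>\<^sup>+x. ennreal (?I * (v t * Q x t)) \<partial>lborel \<partial>lborel)"
  proof (rule lborel_pair.Fubini')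
    have "(\<lambda>p. ennreal (?I * (v (fst p) * (1 / ((snd p - fst p)\<^sup>2 + y\<^sup>2))))) \<in> borel_measurable (lborel \<Otimes>\<^sub>M lborel)"
      by measurable
    then show "(\<lambda>(t, x). ennreal (?I * (v t * Q x t))) \<in> borel_measurable (lborel \<Otimes>\<^sub>M lborel)"
      unfolding Qeq by (simp only: case_prod_beta')
  qed
  also have "\<dots> = (\<integral>\<^sup>+t. ennreal (?I * (pi / y) * v t) \<partial>lborel)"
  proof (intro nn_integral_cong)
    fix t
    have Qi: "integrable lborel (\<lambda>x. Q x t)" "(LINT x|lborel. Q x t) = pi / y"
      unfolding Q_def by (rule sq_pole_integral_line[OF y])+
    have eq: "?I * (v t * Q x t) = ?I * v t * Q x t" for x by simp
    have "(\<integral>\<^sup>+x. ennreal (?I * (v t * Q x t)) \<partial>lborel) = ennreal (LINT x|lborel. ?I * v t * Q x t)"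
      unfolding eq by (rule nn_integral_eq_integral[OF integrable_mult_right[OF Qi(1)]]) (use I0 v0 Q0 in auto)
    also have "(LINT x|lborel. ?I * v t * Q x t) = ?I * (pi / y) * v t"
      using Qi(2) by (simp only: integral_mult_right_zero) simp
    finally show "(\<integral>\<^sup>+x. ennreal (?I * (v t * Q x t)) \<partial>lborel) = ennreal (?I * (pi / y) * v t)" .
  qed
  also have "\<dots> = ennreal (LINT t|lborel. ?I * (pi / y) * v t)"
    by (rule nn_integral_eq_integral[OF integrable_mult_right[OF vi]]) (use I0 v0 y in auto)
  also have "(LINT t|lborel. ?I * (pi / y) * v t) = ?I\<^sup>2 * pi / y"
    by (simp only: integral_mult_right_zero v_def) (simp add: power2_eq_square)
  finally have le: "(\<integral>\<^sup>+x. ennreal ((cmod (ctrans u (Complex x y)))\<^sup>2) \<partial>lborel) \<le> ennreal (?I\<^sup>2 * pi / y)" .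
  have m: "(\<lambda>x. (cmod (ctrans u (Complex x y)))\<^sup>2) \<in> borel_measurable borel"
    by (rule borel_measurable_power[OF measurable_compose[OF ctrans_line_measurable[OF u] borel_measurable_norm]])
       (use y in simp)
  show i: "integrable lborel (\<lambda>x. (cmod (ctrans u (Complex x y)))\<^sup>2)"
    by (intro integrableI_nonneg) (use le m in \<open>auto intro: le_less_trans\<close>)
  show "(LINT x|lborel. (cmod (ctrans u (Complex x y)))\<^sup>2) \<le> ?I\<^sup>2 * pi / y"
    using le nn_integral_eq_integral[OF i] y by (simp add: ennreal_le_iff)
qed

text \<open>Above height y the transform is a Hardy function continuous on its boundary line, so the
  Cauchy formula of \<open>hardy_closed\<close> applies to it.\<close>

lemma ctrans_shift_hardy:
  assumes u: "integrable lborel u" and y: "0 < y"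
  shows "hardy_closed (\<lambda>z. ctrans u (z + \<i> * of_real y))"
proof
  have c: "continuous_on {z. Im z \<noteq> 0} (ctrans u)"
    by (rule holomorphic_on_imp_continuous_on[OF ctrans_holomorphic[OF u]]) simp
  show "continuous_on {z. 0 \<le> Im z} (\<lambda>z. ctrans u (z + \<i> * of_real y))"
    by (rule continuous_on_compose2[OF c]) (use y in \<open>auto intro!: continuous_on_add continuous_on_id continuous_on_const\<close>)
  have "(ctrans u \<circ> (\<lambda>z. z + \<i> * of_real y)) holomorphic_on {z. 0 < Im z}"
    by (rule holomorphic_on_compose_gen[OF _ ctrans_holomorphic[OF u, of "{z. Im z \<noteq> 0}"]])
       (use y in \<open>auto intro!: holomorphic_on_add holomorphic_on_ident holomorphic_on_const\<close>)
  then have h: "(\<lambda>z. ctrans u (z + \<i> * of_real y)) holomorphic_on {z. 0 < Im z}" by (simp add: o_def)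
  show "hardy2 (\<lambda>z. ctrans u (z + \<i> * of_real y))"
    unfolding hardy2_def
  proof (intro conjI h exI[of _ "(LINT t|lborel. cmod (u t))\<^sup>2 * pi / y"] allI impI)
    fix s :: real assume s: "0 < s"
    have ys: "0 < s + y" using s y by simp
    have eq: "Complex x s + \<i> * of_real y = Complex x (s + y)" for x by (simp add: complex_eq_iff)
    show "integrable lborel (\<lambda>x. (cmod (ctrans u (Complex x s + \<i> * of_real y)))\<^sup>2)"
      unfolding eq by (rule ctrans_rough_L2(1)[OF u ys])
    have "(LINT x|lborel. (cmod (ctrans u (Complex x (s + y))))\<^sup>2) \<le> (LINT t|lborel. cmod (u t))\<^sup>2 * pi / (s + y)"
      by (rule ctrans_rough_L2(2)[OF u ys])
    also have "\<dots> \<le> (LINT t|lborel. cmod (u t))\<^sup>2 * pi / y"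
      using s y by (intro divide_left_mono mult_pos_pos mult_nonneg_nonneg) auto
    finally show "(LINT x|lborel. (cmod (ctrans u (Complex x s + \<i> * of_real y)))\<^sup>2) \<le> (LINT t|lborel. cmod (u t))\<^sup>2 * pi / y"
      unfolding eq .
  qed
qed

text \<open>The norm of the Cauchy transform on the line of height \<open>y\<close>, paired with itself and reproduced by the
  Cauchy formula, is a pairing of \<open>u\<close> with the Cauchy transform on the line of height \<open>2 * y\<close>.\<close>

lemma ctrans_doubling:
  assumes u: "integrable lborel u" and u2: "L2 lborel u" and y: "0 < y"
  defines "N \<equiv> \<lambda>y. LINT x|lborel. (cmod (ctrans u (Complex x y)))\<^sup>2"
  shows "(N y)\<^sup>2 \<le> 4 * pi\<^sup>2 * (LINT t|lborel. (cmod (u t))\<^sup>2) * N (2 * y)"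
proof -
  interpret K: hardy_closed "\<lambda>z. ctrans u (z + \<i> * of_real y)" by (rule ctrans_shift_hardy[OF u y])
  define k where "k = (\<lambda>x. ctrans u (Complex x y))"
  have keq: "ctrans u (of_real x + \<i> * of_real y) = k x" for x
    unfolding k_def by (simp add: Complex_eq)
  have kL: "L2 lborel k" using K.boundary_L2 unfolding keq .
  have km: "k \<in> borel_measurable borel" using kL by (simp add: L2_def)
  have um: "u \<in> borel_measurable borel" using borel_measurable_integrable[OF u] by simp
  have pole: "Im (Complex s y) \<noteq> 0" for s using y by simp
  have pL: "L2 lborel (\<lambda>x. 1 / (of_real x - Complex s y))" for s by (rule L2_pole[OF pole])
  define F where "F = (\<lambda>s x. cnj (u s) * (k x * (1 / (of_real x - Complex s y))))"
  have pn: "(LINT x|lborel. (cmod (1 / (of_real x - Complex s y)))\<^sup>2) = pi / y" for s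
  proof -
    have "(cmod (1 / (of_real x - Complex s y)))\<^sup>2 = 1 / ((x - s)\<^sup>2 + y\<^sup>2)" for x
      unfolding norm_divide power_divide cmod_sq_of_real_diff by simp
    then show ?thesis using poisson_kernel_integral[OF y, of s] by simp
  qed
  have Fm: "case_prod F \<in> borel_measurable (lborel \<Otimes>\<^sub>M lborel)"
  proof -
    have 1: "(\<lambda>p. cnj (u (fst p))) \<in> borel_measurable (lborel \<Otimes>\<^sub>M lborel)"
      by (rule measurable_compose[OF measurable_compose[OF measurable_fst] borel_measurable_cnj]) (use um in simp)
    have 2: "(\<lambda>p. k (snd p)) \<in> borel_measurable (lborel \<Otimes>\<^sub>M lborel)"
      by (rule measurable_compose[OF measurable_snd]) (use km in simp)
    have 3: "(\<lambda>p. 1 / (complex_of_real (snd p) - Complex (fst p) y)) \<in> borel_measurable (lborel \<Otimes>\<^sub>M lborel)"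
      unfolding Complex_eq by measurable
    have "(\<lambda>p. cnj (u (fst p)) * (k (snd p) * (1 / (of_real (snd p) - Complex (fst p) y)))) \<in> borel_measurable (lborel \<Otimes>\<^sub>M lborel)"
      by (intro borel_measurable_times 1 2 3)
    then show ?thesis unfolding F_def by (simp only: case_prod_beta')
  qed
  \<comment> \<open>By Cauchy-Schwarz the inner integral of |F s x| is at most |u s| times this B,
    which makes F integrable on the product and justifies Fubini.\<close>
  define B where "B = sqrt ((LINT x|lborel. (cmod (k x))\<^sup>2) * (pi / y))"
  have inner: "integrable lborel (F s)" for s
    unfolding F_def by (rule integrable_mult_right[OF L2_mult_integrable[OF kL pL]])
  have inner_norm: "(LINT x|lborel. norm (F s x)) \<le> cmod (u s) * B" for s
  proof -
    have "(LINT x|lborel. norm (F s x)) = cmod (u s) * (LINT x|lborel. cmod (k x) * cmod (1 / (of_real x - Complex s y)))"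
      unfolding F_def norm_mult complex_mod_cnj by (rule integral_mult_right_zero)
    also have "(LINT x|lborel. cmod (k x) * cmod (1 / (of_real x - Complex s y))) \<le> B"
      unfolding B_def using L2_Cauchy_Schwarz_norm[OF kL pL[of s]] unfolding pn by (rule real_le_rsqrt)
    finally show ?thesis by (simp add: mult_left_mono)
  qed
  have Fi: "integrable (lborel \<Otimes>\<^sub>M lborel) (case_prod F)"
  proof (rule lborel_pair.Fubini_integrable[OF Fm])
    show "AE x in lborel. integrable lborel (\<lambda>y. case_prod F (x, y))" using inner by simp
    show "integrable lborel (\<lambda>x. LINT y|lborel. norm (case_prod F (x, y)))"
    proof (rule Bochner_Integration.integrable_bound)
      show "integrable lborel (\<lambda>s. cmod (u s) * B)" by (rule integrable_mult_left[OF integrable_norm[OF u]])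
      have "(\<lambda>p. norm (case_prod F p)) \<in> borel_measurable (lborel \<Otimes>\<^sub>M lborel)"
        by (rule measurable_compose[OF Fm borel_measurable_norm])
      then show "(\<lambda>x. LINT y|lborel. norm (case_prod F (x, y))) \<in> borel_measurable lborel"
        by (intro lborel.borel_measurable_lebesgue_integral) (simp add: case_prod_beta')
      show "AE x in lborel. norm (LINT y|lborel. norm (case_prod F (x, y))) \<le> norm (cmod (u x) * B)"
      proof (rule AE_I2)
        fix s
        have "0 \<le> (LINT y|lborel. norm (F s y))" by simp
        then show "norm (LINT y|lborel. norm (case_prod F (s, y))) \<le> norm (cmod (u s) * B)"
          using inner_norm[of s] by simp
      qed
    qed
  qed
  \<comment> \<open>Conjugation moves the pole: 1/(s - (x + i y)) becomes -1/(x - (s + i y)), a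
    Cauchy kernel in x. The Cauchy formula for the transform shifted by y then evaluates it at
    height 2 y.\<close>
  have cn: "cnj (k x) = - (LINT s|lborel. cnj (u s) * (1 / (of_real x - Complex s y)))" for x
  proof -
    have "cnj (k x) = (LINT s|lborel. cnj (u s / (of_real s - Complex x y)))"
      unfolding k_def ctrans_def by (rule Bochner_Integration.integral_cnj[symmetric])
    also have "\<dots> = (LINT s|lborel. - (cnj (u s) * (1 / (of_real x - Complex s y))))"
    proof (intro Bochner_Integration.integral_cong refl)
      fix s
      have "cnj (of_real s - Complex x y) = - (of_real x - Complex s y)" by (simp add: complex_eq_iff)
      then show "cnj (u s / (of_real s - Complex x y)) = - (cnj (u s) * (1 / (of_real x - Complex s y)))"
        by (simp only: complex_cnj_divide) (simp add: divide_minus_right[symmetric] del: divide_minus_right)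
    qed
    finally show ?thesis by simp
  qed
  have "complex_of_real (N y) = (LINT x|lborel. k x * cnj (k x))"
    unfolding N_def complex_norm_square[symmetric] k_def by (rule integral_complex_of_real[symmetric])
  also have "\<dots> = (LINT x|lborel. - (LINT s|lborel. F s x))"
  proof (intro Bochner_Integration.integral_cong refl)
    fix x
    have e: "F s x = k x * (cnj (u s) * (1 / (of_real x - Complex s y)))" for s
      unfolding F_def by (rule mult.left_commute)
    show "k x * cnj (k x) = - (LINT s|lborel. F s x)"
      unfolding e cn integral_mult_right_zero by simp
  qed
  also have "\<dots> = - (LINT x|lborel. LINT s|lborel. F s x)" by simp
  also have "(LINT x|lborel. LINT s|lborel. F s x) = (LINT s|lborel. LINT x|lborel. F s x)"
    by (rule lborel_pair.Fubini_integral[OF Fi])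
  also have "\<dots> = (LINT s|lborel. cnj (u s) * (2 * of_real pi * \<i> * ctrans u (Complex s (2 * y))))"
  proof (intro Bochner_Integration.integral_cong refl)
    fix s
    have p: "0 < Im (Complex s y)" using y by simp
    have "(LINT x|lborel. k x / (of_real x - Complex s y)) = 2 * of_real pi * \<i> * ctrans u (Complex s y + \<i> * of_real y)"
      using K.Cauchy[OF p] unfolding keq .
    moreover have "Complex s y + \<i> * of_real y = Complex s (2 * y)" by (simp add: complex_eq_iff)
    ultimately show "(LINT x|lborel. F s x) = cnj (u s) * (2 * of_real pi * \<i> * ctrans u (Complex s (2 * y)))"
      unfolding F_def integral_mult_right_zero by simp
  qed
  also have "\<dots> = 2 * of_real pi * \<i> * (LINT s|lborel. cnj (u s) * ctrans u (Complex s (2 * y)))"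
  proof -
    have e: "a * (c * b) = c * (a * b)" for a b c :: complex by (rule mult.left_commute)
    show ?thesis unfolding e[of _ "2 * of_real pi * \<i>"] by (rule integral_mult_right_zero)
  qed
  finally have eq: "complex_of_real (N y) = - (2 * of_real pi * \<i> * (LINT s|lborel. cnj (u s) * ctrans u (Complex s (2 * y))))" .
  have N0: "0 \<le> N y" by (simp add: N_def)
  have L2y: "L2 lborel (\<lambda>s. ctrans u (Complex s (2 * y)))"
    using ctrans_rough_L2(1)[OF u, of "2 * y"] ctrans_line_measurable[OF u, of "2 * y"] y by (simp add: L2_def)
  have "N y = cmod (complex_of_real (N y))" using N0 by simp
  also have "\<dots> = 2 * pi * cmod (LINT s|lborel. cnj (u s) * ctrans u (Complex s (2 * y)))"
    unfolding eq by (simp add: norm_mult)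
  finally have "(N y)\<^sup>2 = 4 * pi\<^sup>2 * (cmod (LINT s|lborel. cnj (u s) * ctrans u (Complex s (2 * y))))\<^sup>2"
    by (simp only: power_mult_distrib) simp
  also have "\<dots> \<le> 4 * pi\<^sup>2 * ((LINT t|lborel. (cmod (u t))\<^sup>2) * N (2 * y))"
    using L2_Cauchy_Schwarz[OF L2_cnj[OF u2] L2y] unfolding N_def complex_mod_cnj by (intro mult_left_mono) auto
  finally show ?thesis by (simp only: mult.assoc)
qed

text \<open>Were the value N y larger than the claimed K, the inequality (N y)^2 <= K N (2 y) would
  give N (2 y) >= N y > K, and so on along all heights 2^n y, against the decay in
  \<open>ctrans_rough_L2\<close>.\<close>

lemma ctrans_L2:
  assumes u: "integrable lborel u" and u2: "L2 lborel u" and y: "0 < y"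
  shows "(LINT x|lborel. (cmod (ctrans u (Complex x y)))\<^sup>2) \<le> 4 * pi\<^sup>2 * (LINT t|lborel. (cmod (u t))\<^sup>2)"
proof (rule ccontr)
  define N where "N = (\<lambda>y. LINT x|lborel. (cmod (ctrans u (Complex x y)))\<^sup>2)"
  define K where "K = 4 * pi\<^sup>2 * (LINT t|lborel. (cmod (u t))\<^sup>2)"
  assume "\<not> ?thesis"
  then have b: "K < N y" by (simp add: N_def K_def)
  have K0: "0 \<le> K" by (simp add: K_def)
  have d: "(N s)\<^sup>2 \<le> K * N (2 * s)" if "0 < s" for s
    using ctrans_doubling[OF u u2 that] unfolding N_def K_def .
  have step: "N s \<le> N (2 * s)" if s: "0 < s" "K < N s" for s
  proof -
    have pos: "0 < N s" using K0 s by linarith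
    have "N s * N s \<le> K * N (2 * s)" using d[OF s(1)] by (simp only: power2_eq_square)
    also have "\<dots> \<le> N s * N (2 * s)"
      using s(2) by (intro mult_right_mono) (auto simp: N_def)
    finally show ?thesis using pos by (simp only: mult_le_cancel_left_pos)
  qed
  have all: "N y \<le> N (2 ^ n * y)" for n
  proof (induction n)
    case (Suc n)
    have "0 < 2 ^ n * y" using y by simp
    moreover have "K < N (2 ^ n * y)" using b Suc by linarith
    ultimately have "N (2 ^ n * y) \<le> N (2 * (2 ^ n * y))" by (rule step)
    then show ?case using Suc by (simp add: mult.assoc)
  qed simp
  let ?I = "(LINT t|lborel. cmod (u t))\<^sup>2 * pi"
  have "N (2 ^ n * y) \<le> ?I / y * (1 / 2) ^ n" for n
  proof -
    have "N (2 ^ n * y) \<le> ?I / (2 ^ n * y)"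
      unfolding N_def by (rule ctrans_rough_L2(2)[OF u]) (use y in simp)
    then show ?thesis by (simp add: power_one_over field_simps)
  qed
  then have le: "N y \<le> ?I / y * (1 / 2) ^ n" for n using all[of n] order_trans by blast
  have "(\<lambda>n. ?I / y * (1 / 2) ^ n) \<longlonglongrightarrow> ?I / y * 0"
    by (rule tendsto_mult[OF tendsto_const LIMSEQ_power_zero]) simp
  then have "N y \<le> ?I / y * 0"
    by (rule LIMSEQ_le_const) (use le in blast)
  then show False using b K0 by simp
qed

section \<open>Functions orthogonal to a mixed system\<close>

lemma entire_Lipschitz_cball:
  assumes F: "entire F"
  shows "\<exists>D\<ge>0. \<forall>z\<in>cball a r. \<forall>w\<in>cball a r. cmod (F z - F w) \<le> D * cmod (z - w)"
proof -
  have "deriv F holomorphic_on UNIV"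
    using F unfolding entire_def by (rule holomorphic_deriv) simp
  then have "continuous_on (cball a r) (deriv F)"
    by (rule holomorphic_on_imp_continuous_on[OF holomorphic_on_subset[OF _ subset_UNIV]])
  then have "bounded (deriv F ` cball a r)"
    by (intro compact_imp_bounded compact_continuous_image compact_cball)
  then obtain D where D: "\<And>z. z \<in> cball a r \<Longrightarrow> cmod (deriv F z) \<le> D"
    unfolding bounded_iff by blast
  have dF: "(F has_field_derivative deriv F z) (at z within cball a r)" for z
    using F unfolding entire_def
    by (rule has_field_derivative_at_within[OF holomorphic_derivI[OF _ open_UNIV UNIV_I]])
  have "cmod (F z - F w) \<le> \<bar>D\<bar> * cmod (z - w)" if "z \<in> cball a r" "w \<in> cball a r" for z w
  proof -
    have "cmod (F z - F w) \<le> D * cmod (z - w)"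
      by (rule field_differentiable_bound[OF convex_cball dF D]) (use that in auto)
    also have "\<dots> \<le> \<bar>D\<bar> * cmod (z - w)" by (intro mult_right_mono) auto
    finally show ?thesis .
  qed
  then show ?thesis using abs_ge_zero[of D] by blast
qed

lemma entire_bound_cball:
  assumes F: "entire F"
  shows "\<exists>B\<ge>0. \<forall>z\<in>cball a r. cmod (F z) \<le> B"
proof -
  have "bounded (F ` cball a r)"
    by (intro compact_imp_bounded compact_continuous_image compact_cball entire_continuous[OF F])
  then obtain B where B: "\<And>z. z \<in> cball a r \<Longrightarrow> cmod (F z) \<le> B"
    unfolding bounded_iff by blast
  then have "cmod (F z) \<le> \<bar>B\<bar>" if "z \<in> cball a r" for z using that by fastforce
  then show ?thesis using abs_ge_zero[of B] by blast
qed

text \<open>\<open>g\<close> is the biorthogonal function of a chosen point l0 of Lam1. Completeness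
  of the kernels enters as \<open>unique\<close>, and orthogonality to the other biorthogonal
  functions as \<open>orth\<close>: dividing g by z - l yields a combination of those for l0 and
  l.\<close>

locale mixed_orthogonal = de_branges_phase +
  fixes g h :: "complex \<Rightarrow> complex" and l0 :: real and Lam1 Lam2 :: "real set"
  assumes gB: "g \<in> deBranges E" and hB: "h \<in> deBranges E"
    and g_star: "star g = g" and h_star: "star h = h"
    and g_l0: "g (of_real l0) = 1" and l0: "l0 \<in> Lam1"
    and g_zero: "g z = 0 \<longleftrightarrow> z \<in> of_real ` (Lam1 \<union> Lam2 - {l0})"
    and g_simple: "g z = 0 \<Longrightarrow> deriv g z \<noteq> 0"
    and h_nonzero: "\<exists>z. h z \<noteq> 0"
    and h_L2: "l \<in> Lam2 \<Longrightarrow> h (of_real l) = 0"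
    and disjoint: "Lam1 \<inter> Lam2 = {}"
    and orth: "l \<in> Lam1 \<Longrightarrow> l \<noteq> l0 \<Longrightarrow> dB_inner E (quot g (of_real l)) h = 0"
    and unique: "F \<in> deBranges E \<Longrightarrow> (\<And>l. l \<in> Lam1 \<union> Lam2 - {l0} \<Longrightarrow> F (of_real l) = 0) \<Longrightarrow> F z = F (of_real l0) * g z"
begin

lemma real_on_real: "cnj (g (of_real t)) = g (of_real t)" "cnj (h (of_real t)) = h (of_real t)"
  using fun_cong[OF g_star, of "of_real t"] fun_cong[OF h_star, of "of_real t"] unfolding star_of_real .

lemma ge: "entire g" and he: "entire h"
  using deBranges_entire gB hB by blast+

definition v :: "real \<Rightarrow> real" where "v t = (cmod (h (of_real t) / E (of_real t)))\<^sup>2"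
definition u1 :: "real \<Rightarrow> complex" where "u1 t = g (of_real t) / E (of_real t) * cnj (h (of_real t) / E (of_real t))"
definition u2 :: "real \<Rightarrow> complex" where "u2 t = of_real (v t)"

lemma u2_eq: "u2 t = h (of_real t) / E (of_real t) * cnj (h (of_real t) / E (of_real t))"
  unfolding u2_def v_def by (rule complex_norm_square)

lemma v_nonneg [simp]: "0 \<le> v t" by (simp add: v_def)

lemma v_integrable: "integrable lborel v"
  using deBranges_L2[OF hB] by (simp add: L2_def v_def[abs_def])

lemma u1_integrable: "integrable lborel u1"
  unfolding u1_def[abs_def] by (rule dB_inner_integrable[OF gB hB])

lemma u2_integrable: "integrable lborel u2"
  unfolding u2_eq[abs_def] by (rule dB_inner_integrable[OF hB hB])

lemma u_real: "cnj (u1 t) = u1 t" "cnj (u2 t) = u2 t"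
proof -
  show "cnj (u1 t) = u1 t"
    unfolding u1_def complex_cnj_mult complex_cnj_divide real_on_real complex_cnj_cnj by simp
  show "cnj (u2 t) = u2 t" unfolding u2_def by (rule complex_cnj_complex_of_real)
qed

text \<open>h/E is bounded on the real line by \<open>eval_closed\<close>, so both products keep the
  square integrability of their other factor. This is what \<open>ctrans_L2\<close> asks
  for.\<close>

lemma u_L2: "L2 lborel u1" "L2 lborel u2"
proof -
  let ?B = "sqrt (M / pi * sqn h)"
  have b: "cmod (cnj (h (of_real t) / E (of_real t))) \<le> ?B" for t
    unfolding complex_mod_cnj by (rule eval_closed[OF hB]) simp
  have "cmod (u1 t) \<le> ?B * cmod (g (of_real t) / E (of_real t))" for t
    unfolding u1_def norm_mult[of "g _ / _"] using b[of t] by (subst mult.commute) (rule mult_right_mono, auto)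
  then show "L2 lborel u1"
    by (rule L2_bound[OF deBranges_L2[OF gB] borel_measurable_integrable[OF u1_integrable]])
  have "cmod (u2 t) \<le> ?B * cmod (h (of_real t) / E (of_real t))" for t
    unfolding u2_eq norm_mult[of "h _ / _"] using b[of t] by (subst mult.commute) (rule mult_right_mono, auto)
  then show "L2 lborel u2"
    by (rule L2_bound[OF deBranges_L2[OF hB] borel_measurable_integrable[OF u2_integrable]])
qed

text \<open>The two Cauchy kernels are combined before integration: for real w the numerator
  vanishes at t = w, so the integral makes sense there too and \<open>P\<close> is defined on the
  whole plane at once.\<close>

definition ker :: "complex \<Rightarrow> real \<Rightarrow> complex" where
  "ker w t = (h w * u1 t - g w * u2 t) / (of_real t - w)"

definition P :: "complex \<Rightarrow> complex" where "P w = (LINT t|lborel. ker w t)"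

lemma ker_eq: "ker w t = (h w * (g (of_real t) - g w) - g w * (h (of_real t) - h w)) / (of_real t - w)
    * (cnj (h (of_real t)) / (E (of_real t) * cnj (E (of_real t))))"
proof -
  have "h w * u1 t - g w * u2 t = (h w * (g (of_real t) - g w) - g w * (h (of_real t) - h w))
      * (cnj (h (of_real t)) / (E (of_real t) * cnj (E (of_real t))))"
    unfolding u1_def u2_eq complex_cnj_divide by (simp add: diff_divide_distrib algebra_simps)
  then show ?thesis unfolding ker_def by simp
qed

lemma P_off_real:
  assumes w: "Im w \<noteq> 0"
  shows "P w = h w * ctrans u1 w - g w * ctrans u2 w"
proof -
  have "P w = (LINT t|lborel. h w * (u1 t / (of_real t - w)) - g w * (u2 t / (of_real t - w)))"
    unfolding P_def ker_def diff_divide_distrib by simp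
  also have "\<dots> = (LINT t|lborel. h w * (u1 t / (of_real t - w))) - (LINT t|lborel. g w * (u2 t / (of_real t - w)))"
    by (rule Bochner_Integration.integral_diff)
       (rule integrable_mult_right[OF ctrans_integrable[OF u1_integrable w]],
        rule integrable_mult_right[OF ctrans_integrable[OF u2_integrable w]])
  finally show ?thesis unfolding ctrans_def integral_mult_right_zero .
qed

lemma ker_measurable: "ker w \<in> borel_measurable borel"
proof -
  have "u1 \<in> borel_measurable borel" "u2 \<in> borel_measurable borel"
    using borel_measurable_integrable[OF u1_integrable] borel_measurable_integrable[OF u2_integrable] by simp_all
  note [measurable] = this
  have "(\<lambda>t. (h w * u1 t - g w * u2 t) * (1 / (complex_of_real t - w))) \<in> borel_measurable borel"
    by measurable
  then show ?thesis unfolding ker_def[abs_def] by simp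
qed

text \<open>Dominated convergence. Near x, \<open>ker_eq\<close> bounds the integrand by Lipschitz
  constants of g and h; for t farther than 2 from x the pole is at distance at least 1 from
  t.\<close>

lemma P_continuous_real: "isCont P (of_real x)"
  unfolding continuous_at_sequentially
proof (intro allI impI)
  fix W :: "nat \<Rightarrow> complex" assume W: "W \<longlonglongrightarrow> of_real x"
  obtain N where N: "\<And>n. n \<ge> N \<Longrightarrow> dist (W n) (of_real x) < 1"
    using tendstoD[OF W zero_less_one] unfolding eventually_sequentially by blast
  define Y where "Y = (\<lambda>n. W (n + N))"
  have Yl: "Y \<longlonglongrightarrow> of_real x" unfolding Y_def by (rule LIMSEQ_ignore_initial_segment[OF W])
  have Y1: "cmod (Y n - of_real x) < 1" for n using N[of "n + N"] by (simp add: Y_def dist_norm)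
  let ?C = "cball (complex_of_real x) 2"
  have YC: "Y n \<in> ?C" for n using Y1[of n] by (simp add: dist_norm norm_minus_commute)
  obtain D1 where D1: "0 \<le> D1" "\<And>z w. z \<in> ?C \<Longrightarrow> w \<in> ?C \<Longrightarrow> cmod (g z - g w) \<le> D1 * cmod (z - w)"
    using entire_Lipschitz_cball[OF ge, of "of_real x" 2] by blast
  obtain D2 where D2: "0 \<le> D2" "\<And>z w. z \<in> ?C \<Longrightarrow> w \<in> ?C \<Longrightarrow> cmod (h z - h w) \<le> D2 * cmod (z - w)"
    using entire_Lipschitz_cball[OF he, of "of_real x" 2] by blast
  obtain B1 where B1: "0 \<le> B1" "\<And>z. z \<in> ?C \<Longrightarrow> cmod (g z) \<le> B1"
    using entire_bound_cball[OF ge, of "of_real x" 2] by blast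
  obtain B2 where B2: "0 \<le> B2" "\<And>z. z \<in> ?C \<Longrightarrow> cmod (h z) \<le> B2"
    using entire_bound_cball[OF he, of "of_real x" 2] by blast
  let ?q = "\<lambda>t. cnj (h (of_real t)) / (E (of_real t) * cnj (E (of_real t)))"
  have "continuous_on {x - 2..x + 2} ?q"
  proof -
    have c: "continuous_on A (\<lambda>t. G (complex_of_real t))" if "entire G" for G A
      by (rule continuous_on_compose2[OF entire_continuous[OF that, of UNIV]]) (auto intro: continuous_on_of_real continuous_on_id)
    show ?thesis
      by (intro continuous_on_divide continuous_on_mult continuous_on_cnj c E_entire he) (use E_real_nz in simp)
  qed
  then have "bounded (?q ` {x - 2..x + 2})"
    by (intro compact_imp_bounded compact_continuous_image compact_Icc)
  then obtain Q where Q: "\<And>t. t \<in> {x - 2..x + 2} \<Longrightarrow> cmod (?q t) \<le> Q"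
    unfolding bounded_iff by blast
  define A where "A = (B2 * D1 + B1 * D2) * \<bar>Q\<bar>"
  have A0: "0 \<le> A" using B1 B2 D1 D2 by (simp add: A_def)
  let ?dom = "\<lambda>t. (B2 * cmod (u1 t) + B1 * cmod (u2 t)) + A * indicator {x - 2..x + 2} t"
  have dom: "cmod (ker (Y n) t) \<le> ?dom t" for n t
  proof (cases "t \<in> {x - 2..x + 2}")
    case True
    have "dist (complex_of_real x) (of_real t) = \<bar>x - t\<bar>"
      unfolding dist_norm of_real_diff[symmetric] norm_of_real ..
    with True have tC: "of_real t \<in> ?C" by (simp add: abs_le_iff)
    show ?thesis
    proof (cases "of_real t = Y n")
      case True
      \<comment> \<open>Division by zero has value 0, so the single exceptional point satisfies the
        bound as well.\<close>
      then have "ker (Y n) t = 0" by (simp add: ker_def)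
      moreover have "0 \<le> ?dom t" using A0 B1(1) B2(1) by (intro add_nonneg_nonneg mult_nonneg_nonneg) simp_all
      ultimately show ?thesis by (simp only: norm_zero)
    next
      case False
      then have p: "0 < cmod (of_real t - Y n)" by simp
      let ?n = "h (Y n) * (g (of_real t) - g (Y n)) - g (Y n) * (h (of_real t) - h (Y n))"
      have "cmod ?n \<le> cmod (h (Y n)) * cmod (g (of_real t) - g (Y n)) + cmod (g (Y n)) * cmod (h (of_real t) - h (Y n))"
        using norm_triangle_ineq4[of "h (Y n) * (g (of_real t) - g (Y n))" "g (Y n) * (h (of_real t) - h (Y n))"]
        by (simp only: norm_mult)
      also have "\<dots> \<le> B2 * (D1 * cmod (of_real t - Y n)) + B1 * (D2 * cmod (of_real t - Y n))"
        using B1 B2 D1 D2 YC tC by (intro add_mono mult_mono) auto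
      also have "\<dots> = (B2 * D1 + B1 * D2) * cmod (of_real t - Y n)" by (simp add: algebra_simps)
      finally have "cmod (?n / (of_real t - Y n)) \<le> B2 * D1 + B1 * D2"
        using p by (simp only: norm_divide pos_divide_le_eq)
      then have "cmod (ker (Y n) t) \<le> A"
        unfolding ker_eq norm_mult[of "_ / (_ - _)"] A_def
        using Q[OF \<open>t \<in> {x - 2..x + 2}\<close>] B1 B2 D1 D2 by (intro mult_mono) auto
      moreover have "0 \<le> B2 * cmod (u1 t) + B1 * cmod (u2 t)" using B1 B2 by simp
      moreover have "?dom t = (B2 * cmod (u1 t) + B1 * cmod (u2 t)) + A"
        using \<open>t \<in> {x - 2..x + 2}\<close> by (simp only: indicator_simps mult_1_right)
      ultimately show ?thesis by linarith
    qed
  next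
    case False
    then have "2 < \<bar>t - x\<bar>" unfolding atLeastAtMost_iff by linarith
    also have "\<bar>t - x\<bar> = cmod (of_real t - of_real x)" unfolding of_real_diff[symmetric] norm_of_real ..
    also have "\<dots> \<le> cmod (of_real t - Y n) + cmod (Y n - of_real x)"
      using norm_triangle_ineq[of "of_real t - Y n" "Y n - of_real x"] by simp
    finally have p: "1 \<le> cmod (of_real t - Y n)" using Y1[of n] by simp
    have "cmod (h (Y n) * u1 t - g (Y n) * u2 t) \<le> cmod (h (Y n)) * cmod (u1 t) + cmod (g (Y n)) * cmod (u2 t)"
      using norm_triangle_ineq4[of "h (Y n) * u1 t" "g (Y n) * u2 t"] by (simp only: norm_mult)
    also have "\<dots> \<le> B2 * cmod (u1 t) + B1 * cmod (u2 t)"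
      using B1 B2 YC by (intro add_mono mult_right_mono) auto
    finally have "cmod (ker (Y n) t) \<le> (B2 * cmod (u1 t) + B1 * cmod (u2 t)) / 1"
      unfolding ker_def norm_divide using p B1 B2 by (intro frac_le) auto
    then show ?thesis using False by simp
  qed
  have "(\<lambda>n. LINT t|lborel. ker (Y n) t) \<longlonglongrightarrow> (LINT t|lborel. ker (of_real x) t)"
  proof (rule integral_dominated_convergence)
    show "integrable lborel ?dom"
      by (intro Bochner_Integration.integrable_add integrable_mult_right integrable_norm u1_integrable u2_integrable) simp
    show "AE t in lborel. (\<lambda>n. ker (Y n) t) \<longlonglongrightarrow> ker (of_real x) t"
    proof (rule AE_I'[of "{x}"])
      show "{t \<in> space lborel. \<not> (\<lambda>n. ker (Y n) t) \<longlonglongrightarrow> ker (of_real x) t} \<subseteq> {x}"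
      proof (intro subsetI, rule ccontr)
        fix t assume t: "t \<in> {t \<in> space lborel. \<not> (\<lambda>n. ker (Y n) t) \<longlonglongrightarrow> ker (of_real x) t}" and "t \<notin> {x}"
        then have ne: "complex_of_real t - of_real x \<noteq> 0" by simp
        have c: "(\<lambda>n. G (Y n)) \<longlonglongrightarrow> G (of_real x)" if "entire G" for G
        proof (rule isCont_tendsto_compose[OF _ Yl])
          show "isCont G (of_real x)"
            using entire_continuous[OF that, of UNIV] by (simp add: continuous_on_eq_continuous_at)
        qed
        have "(\<lambda>n. ker (Y n) t) \<longlonglongrightarrow> ker (of_real x) t"
          unfolding ker_def
          by (intro tendsto_divide tendsto_diff tendsto_mult tendsto_const c ge he Yl ne)
        with t show False by simp
      qed
      show "{x} \<in> null_sets lborel" by (rule finite_imp_null_set_lborel) simp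
    qed
    show "AE t in lborel. norm (ker (Y n) t) \<le> ?dom t" for n by (rule AE_I2) (rule dom)
    show "ker (Y n) \<in> borel_measurable lborel" for n using ker_measurable[of "Y n"] by simp
    show "ker (of_real x) \<in> borel_measurable lborel" using ker_measurable[of "of_real x"] by simp
  qed
  then have "(\<lambda>n. P (W (n + N))) \<longlonglongrightarrow> P (of_real x)" by (simp add: P_def Y_def)
  then have "(\<lambda>n. P (W n)) \<longlonglongrightarrow> P (of_real x)" by (rule LIMSEQ_offset)
  then show "(P \<circ> W) \<longlonglongrightarrow> P (of_real x)" by (simp add: o_def)
qed

text \<open>Off the real line P is a combination of Cauchy transforms with entire coefficients; a
  continuous function holomorphic on both sides of a line is holomorphic across it.\<close>

lemma P_entire: "entire P"
proof -
  have hol: "P holomorphic_on A" if A: "\<And>z. z \<in> A \<Longrightarrow> Im z \<noteq> 0" for A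
  proof (rule holomorphic_transform[OF holomorphic_on_diff[OF
        holomorphic_on_mult[OF entire_holomorphic[OF he] ctrans_holomorphic[OF u1_integrable A]]
        holomorphic_on_mult[OF entire_holomorphic[OF ge] ctrans_holomorphic[OF u2_integrable A]]]])
    show "h x * ctrans u1 x - g x * ctrans u2 x = P x" if "x \<in> A" for x
      by (rule P_off_real[OF A[OF that], symmetric])
  qed
  have cont: "isCont P z" for z
  proof (cases "Im z = 0")
    case True
    then have "z = of_real (Re z)" by (simp add: complex_eq_iff)
    then show ?thesis using P_continuous_real[of "Re z"] by simp
  next
    case False
    have o: "open {z. Im z \<noteq> 0}"
      by (rule open_Collect_neq) (rule continuous_on_Im[OF continuous_on_id], rule continuous_on_const)
    have "P holomorphic_on {z. Im z \<noteq> 0}" by (rule hol) simp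
    from continuous_on_interior[OF holomorphic_on_imp_continuous_on[OF this]] show ?thesis
      using False o by (simp add: interior_open)
  qed
  have "P holomorphic_on UNIV"
  proof (rule holomorphic_on_paste_across_line[OF open_UNIV, of "\<i>" P 0])
    show "P holomorphic_on UNIV \<inter> {z. \<i> \<bullet> z < 0}" "P holomorphic_on UNIV \<inter> {z. 0 < \<i> \<bullet> z}"
      by (rule hol; simp)+
    show "continuous_on UNIV P" using cont by (simp add: continuous_on_eq_continuous_at)
  qed simp
  then show ?thesis by (simp add: entire_def)
qed

lemma P_star: "star P = P"
proof
  fix w
  have c: "cnj (ker (cnj w) t) = ker w t" for t
  proof -
    have "cnj (g (cnj w)) = g w" "cnj (h (cnj w)) = h w"
      using fun_cong[OF g_star, of w] fun_cong[OF h_star, of w] unfolding star_def .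
    then show ?thesis
      unfolding ker_def complex_cnj_divide complex_cnj_diff complex_cnj_mult u_real complex_cnj_cnj complex_cnj_complex_of_real
      by (simp only:)
  qed
  show "star P w = P w"
    unfolding star_def P_def Bochner_Integration.integral_cnj[symmetric] c ..
qed

text \<open>On each horizontal line P/E is a difference of two products of a bounded quotient with a
  Cauchy transform, and \<open>ctrans_L2\<close> bounds the latter uniformly in the height. The
  condition on \<open>star P\<close> is the same one, as \<open>star P\<close> is P.\<close>

lemma P_deBranges: "P \<in> deBranges E"
proof -
  let ?A = "sqrt (M / pi * sqn h)" and ?B = "sqrt (M / pi * sqn g)"
  have "hardy2 (\<lambda>z. P z / E z)"
    unfolding hardy2_def
  proof (intro conjI allI impI exI[of _ "2 * ?A\<^sup>2 * (4 * pi\<^sup>2 * (LINT t|lborel. (cmod (u1 t))\<^sup>2)) + 2 * ?B\<^sup>2 * (4 * pi\<^sup>2 * (LINT t|lborel. (cmod (u2 t))\<^sup>2))"])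
    show "(\<lambda>z. P z / E z) holomorphic_on {z. 0 < Im z}" by (rule quotient_holomorphic[OF P_entire])
    fix y :: real assume y: "0 < y"
    let ?c1 = "\<lambda>x. ctrans u1 (Complex x y)" and ?c2 = "\<lambda>x. ctrans u2 (Complex x y)"
    have b: "(cmod (P (Complex x y) / E (Complex x y)))\<^sup>2 \<le> 2 * ?A\<^sup>2 * (cmod (?c1 x))\<^sup>2 + 2 * ?B\<^sup>2 * (cmod (?c2 x))\<^sup>2" for x
    proof -
      let ?w = "Complex x y"
      have "P ?w / E ?w = h ?w / E ?w * ?c1 x - g ?w / E ?w * ?c2 x"
        using P_off_real[of ?w] y by (simp add: diff_divide_distrib)
      then have "cmod (P ?w / E ?w) \<le> cmod (h ?w / E ?w) * cmod (?c1 x) + cmod (g ?w / E ?w) * cmod (?c2 x)"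
        using norm_triangle_ineq4[of "h ?w / E ?w * ?c1 x" "g ?w / E ?w * ?c2 x"] by (simp only: norm_mult)
      also have "\<dots> \<le> ?A * cmod (?c1 x) + ?B * cmod (?c2 x)"
        using y by (intro add_mono mult_right_mono eval_closed hB gB) auto
      finally have "(cmod (P ?w / E ?w))\<^sup>2 \<le> (?A * cmod (?c1 x) + ?B * cmod (?c2 x))\<^sup>2"
        by (intro power_mono) auto
      also have "\<dots> \<le> 2 * (?A * cmod (?c1 x))\<^sup>2 + 2 * (?B * cmod (?c2 x))\<^sup>2"
        using sum_squares_bound[of "?A * cmod (?c1 x)" "?B * cmod (?c2 x)"] unfolding power2_sum by linarith
      finally show ?thesis by (simp only: power_mult_distrib mult.assoc)
    qed
    have i1: "integrable lborel (\<lambda>x. (cmod (?c1 x))\<^sup>2)" and i2: "integrable lborel (\<lambda>x. (cmod (?c2 x))\<^sup>2)"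
      using ctrans_rough_L2(1)[OF u1_integrable y] ctrans_rough_L2(1)[OF u2_integrable y] by blast+
    have j1: "integrable lborel (\<lambda>x. 2 * ?A\<^sup>2 * (cmod (?c1 x))\<^sup>2)" and j2: "integrable lborel (\<lambda>x. 2 * ?B\<^sup>2 * (cmod (?c2 x))\<^sup>2)"
      by (rule integrable_mult_right[OF i1], rule integrable_mult_right[OF i2])
    have j: "integrable lborel (\<lambda>x. 2 * ?A\<^sup>2 * (cmod (?c1 x))\<^sup>2 + 2 * ?B\<^sup>2 * (cmod (?c2 x))\<^sup>2)"
      by (rule Bochner_Integration.integrable_add[OF j1 j2])
    have m: "(\<lambda>x. P (Complex x y) / E (Complex x y)) \<in> borel_measurable borel"
      by (rule closed_half_plane_line_measurable[OF quotient_continuous[OF P_entire]]) (use y in simp)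
    show i: "integrable lborel (\<lambda>x. (cmod (P (Complex x y) / E (Complex x y)))\<^sup>2)"
    proof (rule Bochner_Integration.integrable_bound[OF j])
      show "(\<lambda>x. (cmod (P (Complex x y) / E (Complex x y)))\<^sup>2) \<in> borel_measurable lborel"
        using borel_measurable_power[OF measurable_compose[OF m borel_measurable_norm]] by simp
      show "AE x in lborel. norm ((cmod (P (Complex x y) / E (Complex x y)))\<^sup>2)
          \<le> norm (2 * ?A\<^sup>2 * (cmod (?c1 x))\<^sup>2 + 2 * ?B\<^sup>2 * (cmod (?c2 x))\<^sup>2)"
        by (intro AE_I2) (use order_trans[OF b abs_ge_self] in simp)
    qed
    have "(LINT x|lborel. (cmod (P (Complex x y) / E (Complex x y)))\<^sup>2)
        \<le> (LINT x|lborel. 2 * ?A\<^sup>2 * (cmod (?c1 x))\<^sup>2 + 2 * ?B\<^sup>2 * (cmod (?c2 x))\<^sup>2)"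
      by (rule integral_mono[OF i j b])
    also have "\<dots> = 2 * ?A\<^sup>2 * (LINT x|lborel. (cmod (?c1 x))\<^sup>2) + 2 * ?B\<^sup>2 * (LINT x|lborel. (cmod (?c2 x))\<^sup>2)"
      unfolding Bochner_Integration.integral_add[OF j1 j2] integral_mult_right_zero ..
    also have "\<dots> \<le> 2 * ?A\<^sup>2 * (4 * pi\<^sup>2 * (LINT t|lborel. (cmod (u1 t))\<^sup>2)) + 2 * ?B\<^sup>2 * (4 * pi\<^sup>2 * (LINT t|lborel. (cmod (u2 t))\<^sup>2))"
      using ctrans_L2[OF u1_integrable u_L2(1) y] ctrans_L2[OF u2_integrable u_L2(2) y]
      by (intro add_mono mult_left_mono mult_nonneg_nonneg) auto
    finally show "(LINT x|lborel. (cmod (P (Complex x y) / E (Complex x y)))\<^sup>2)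
        \<le> 2 * ?A\<^sup>2 * (4 * pi\<^sup>2 * (LINT t|lborel. (cmod (u1 t))\<^sup>2)) + 2 * ?B\<^sup>2 * (4 * pi\<^sup>2 * (LINT t|lborel. (cmod (u2 t))\<^sup>2))" .
  qed
  then show ?thesis using P_entire by (simp add: deBranges_def P_star)
qed

lemma u1_over_linear:
  assumes "t \<noteq> x"  "g (of_real x) = 0"
  shows "u1 t / (of_real t - of_real x) = quot g (of_real x) (of_real t) / E (of_real t) * cnj (h (of_real t) / E (of_real t))"
  using assms by (simp add: u1_def quot_def)

text \<open>The orthogonality relation, read as the vanishing of the first Cauchy transform at l;
  the two integrands differ at most at t = l.\<close>

lemma orth_pole:
  assumes l: "l \<in> Lam1" "l \<noteq> l0"
  shows "(LINT t|lborel. u1 t / (of_real t - of_real l)) = 0"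
proof -
  have gl: "g (of_real l) = 0" using l by (auto simp: g_zero)
  have i: "integrable lborel (\<lambda>t. quot g (of_real l) (of_real t) / E (of_real t) * cnj (h (of_real t) / E (of_real t)))"
    by (rule dB_inner_integrable[OF deBranges_quot[OF gB gl] hB])
  have "(LINT t|lborel. u1 t / (of_real t - of_real l)) = (LINT t|lborel. quot g (of_real l) (of_real t) / E (of_real t) * cnj (h (of_real t) / E (of_real t)))"
  proof (rule integral_cong_AE)
    have "u1 \<in> borel_measurable borel" using borel_measurable_integrable[OF u1_integrable] by simp
    note [measurable] = this
    have "(\<lambda>t. u1 t * (1 / (complex_of_real t - of_real l))) \<in> borel_measurable borel" by measurable
    then show "(\<lambda>t. u1 t / (of_real t - of_real l)) \<in> borel_measurable lborel" by simp
    show "(\<lambda>t. quot g (of_real l) (of_real t) / E (of_real t) * cnj (h (of_real t) / E (of_real t))) \<in> borel_measurable lborel"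
      by (rule borel_measurable_integrable[OF i])
    show "AE t in lborel. u1 t / (of_real t - of_real l) = quot g (of_real l) (of_real t) / E (of_real t) * cnj (h (of_real t) / E (of_real t))"
    proof (rule AE_I'[of "{l}"])
      show "{l} \<in> null_sets lborel" by (rule finite_imp_null_set_lborel) simp
    qed (use u1_over_linear[OF _ gl] in blast)
  qed
  also have "\<dots> = dB_inner E (quot g (of_real l)) h" by (rule dB_inner_eq[symmetric])
  also have "\<dots> = 0" by (rule orth[OF l])
  finally show ?thesis .
qed

definition c :: real where "c = Re (P (of_real l0))"

text \<open>P vanishes at all nodes other than l0: on Lam2 both g and h are zero, and on the rest of
  Lam1 the term with g drops out while \<open>orth_pole\<close> kills the other. So
  \<open>unique\<close> applies, and the factor P(l0) is real by symmetry.\<close>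

lemma P_eq: "P w = of_real c * g w"
proof -
  have "P (of_real l) = 0" if l: "l \<in> Lam1 \<union> Lam2 - {l0}" for l
  proof -
    have gl: "g (of_real l) = 0" using l by (auto simp: g_zero)
    show ?thesis
    proof (cases "l \<in> Lam2")
      case True
      then show ?thesis using h_L2[OF True] gl by (simp add: P_def ker_def)
    next
      case False
      have "P (of_real l) = (LINT t|lborel. h (of_real l) * (u1 t / (of_real t - of_real l)))"
        unfolding P_def ker_def gl by simp
      also have "\<dots> = h (of_real l) * (LINT t|lborel. u1 t / (of_real t - of_real l))"
        by (rule integral_mult_right_zero)
      also have "\<dots> = 0" using orth_pole[of l] l False by simp
      finally show ?thesis .
    qed
  qed
  then have "P w = P (of_real l0) * g w" by (rule unique[OF P_deBranges])
  moreover have "cnj (P (of_real l0)) = P (of_real l0)"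
    using fun_cong[OF P_star, of "of_real l0"] unfolding star_of_real .
  then have "P (of_real l0) = of_real c" by (simp add: c_def complex_eq_iff)
  ultimately show ?thesis by simp
qed

text \<open>A Herglotz function: a real constant plus the Cauchy transform of a positive measure, so
  that its imaginary part has the sign of Im w.\<close>

definition m :: "complex \<Rightarrow> complex" where "m w = of_real c + ctrans u2 w"

lemma key_identity: "Im w \<noteq> 0 \<Longrightarrow> h w * ctrans u1 w = m w * g w"
  using P_off_real[of w] P_eq[of w] by (simp add: m_def algebra_simps)

end

section \<open>Dividing out finitely many zeros on the real line\<close>

context de_branges
begin

lemma quot_eqI:
  assumes k: "entire k" and eq: "\<And>z. F z = (z - a) * k z"
  shows "quot F a = k"
proof
  fix z
  have dk: "(k has_field_derivative deriv k a) (at a)"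
    using k unfolding entire_def by (rule holomorphic_derivI[OF _ open_UNIV UNIV_I])
  have "((\<lambda>z. (z - a) * k z) has_field_derivative ((a - a) * deriv k a + (1 - 0) * k a)) (at a)"
    by (intro DERIV_mult' DERIV_diff DERIV_ident DERIV_const dk)
  moreover have "F = (\<lambda>z. (z - a) * k z)" using eq by blast
  ultimately have "deriv F a = k a" by (simp add: DERIV_imp_deriv)
  then show "quot F a z = k z" using eq by (simp add: quot_def)
qed

lemma quot_self: "quot F a a = deriv F a"
  by (simp add: quot_def)

lemma quot_factor: "F a = 0 \<Longrightarrow> F z = (z - a) * quot F a z"
  by (simp add: quot_def)

text \<open>The points are distinct, so the product of the linear factors already removed does not
  vanish at the next one, and the remaining factor must.\<close>

lemma factor_out:
  assumes "finite S" "entire F" "\<And>s. s \<in> S \<Longrightarrow> F (complex_of_real s) = 0"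
  shows "\<exists>k. entire k \<and> (\<forall>z. F z = (\<Prod>s\<in>S. z - of_real s) * k z)"
  using assms(1,3)
proof (induction S)
  case empty
  then show ?case using assms(2) by auto
next
  case (insert s S)
  then obtain k where k: "entire k" "\<And>z. F z = (\<Prod>s\<in>S. z - of_real s) * k z" by blast
  have "(\<Prod>t\<in>S. complex_of_real s - of_real t) \<noteq> 0"
    using insert.hyps by (subst prod_zero_iff) auto
  moreover have "F (of_real s) = 0" using insert.prems by simp
  ultimately have "k (of_real s) = 0" using k(2)[of "of_real s"] by simp
  then have "k z = (z - of_real s) * quot k (of_real s) z" for z by (rule quot_factor)
  then have "F z = (\<Prod>s\<in>insert s S. z - of_real s) * quot k (of_real s) z" for z
    using k(2)[of z] insert.hyps by (simp add: mult_ac)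
  then show ?case using entire_quot[OF k(1)] by blast
qed

end

lemma entire_prod_linear: "entire (\<lambda>z. \<Prod>s\<in>S. z - complex_of_real s)"
  unfolding entire_def by (intro holomorphic_on_prod holomorphic_on_diff holomorphic_on_ident holomorphic_on_const)

lemma entire_mult: "entire F \<Longrightarrow> entire G \<Longrightarrow> entire (\<lambda>z. F z * G z)"
  unfolding entire_def by (rule holomorphic_on_mult)

lemma entire_finite_zeros:
  assumes F: "entire F" and nz: "\<exists>z. F z \<noteq> 0"
  shows "finite {x::real. F (of_real x) = 0 \<and> \<bar>x - a\<bar> \<le> r}"
proof -
  obtain b where b: "F b \<noteq> 0" using nz by blast
  have nc: "\<not> F constant_on UNIV" if "F z = 0" for z
    unfolding constant_on_def using b that by (metis UNIV_I)
  show ?thesis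
  proof (cases "\<exists>z. F z = 0")
    case True
    then have "\<not> F constant_on UNIV" using nc by blast
    then have "finite {z \<in> cball (of_real a) r. F z = 0}"
      using F by (intro holomorphic_compact_finite_zeros[of F UNIV]) (auto simp: entire_def)
    moreover have "of_real ` {x::real. F (of_real x) = 0 \<and> \<bar>x - a\<bar> \<le> r} \<subseteq> {z \<in> cball (of_real a) r. F z = 0}"
    proof (rule image_subsetI)
      fix x assume x: "x \<in> {x::real. F (of_real x) = 0 \<and> \<bar>x - a\<bar> \<le> r}"
      have "dist (complex_of_real a) (of_real x) = \<bar>a - x\<bar>"
        unfolding dist_norm of_real_diff[symmetric] norm_of_real ..
      then show "complex_of_real x \<in> {z \<in> cball (of_real a) r. F z = 0}" using x by (simp add: abs_minus_commute)
    qed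
    ultimately have "finite (complex_of_real ` {x::real. F (of_real x) = 0 \<and> \<bar>x - a\<bar> \<le> r})"
      by (rule rev_finite_subset)
    then show ?thesis by (rule finite_imageD) (auto simp: inj_on_def)
  next
    case False
    then show ?thesis by simp
  qed
qed

section \<open>Lower bounds for m, and the extra zeros of h\<close>

context mixed_orthogonal
begin

definition poi :: "complex \<Rightarrow> real" where
  "poi w = (LINT t|lborel. v t / ((t - Re w)\<^sup>2 + (Im w)\<^sup>2))"

lemma v_measurable: "v \<in> borel_measurable borel"
  using borel_measurable_integrable[OF v_integrable] by simp

lemma poi_integrable:
  assumes "Im w \<noteq> 0"
  shows "integrable lborel (\<lambda>t. v t / ((t - Re w)\<^sup>2 + (Im w)\<^sup>2))"
proof (rule Bochner_Integration.integrable_bound)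
  show "integrable lborel (\<lambda>t. v t * (1 / (Im w)\<^sup>2))" by (rule integrable_mult_left[OF v_integrable])
  note [measurable] = v_measurable
  show "(\<lambda>t. v t / ((t - Re w)\<^sup>2 + (Im w)\<^sup>2)) \<in> borel_measurable lborel" by measurable
  have "0 < (Im w)\<^sup>2" using assms by simp
  then have "v t / ((t - Re w)\<^sup>2 + (Im w)\<^sup>2) \<le> v t / (Im w)\<^sup>2" for t
    by (intro divide_left_mono mult_pos_pos add_nonneg_pos) auto
  then show "AE t in lborel. norm (v t / ((t - Re w)\<^sup>2 + (Im w)\<^sup>2)) \<le> norm (v t * (1 / (Im w)\<^sup>2))"
    by (intro AE_I2) simp
qed

lemma Im_m:
  assumes w: "Im w \<noteq> 0"
  shows "Im (m w) = Im w * poi w"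
proof -
  have i: "integrable lborel (\<lambda>t. u2 t / (of_real t - w))" by (rule ctrans_integrable[OF u2_integrable w])
  have e: "Im (u2 t / (of_real t - w)) = Im w * (v t / ((t - Re w)\<^sup>2 + (Im w)\<^sup>2))" for t
    unfolding u2_def by (simp add: Im_divide power2_eq_square)
  have "Im (m w) = (LINT t|lborel. Im (u2 t / (of_real t - w)))"
    unfolding m_def ctrans_def integral_Im[OF i] by simp
  then show ?thesis unfolding e integral_mult_right_zero poi_def .
qed

text \<open>The weight comes from |t - w| <= (1 + |t|)(1 + |w|), which separates t from w; thus
  a0/(1 + |w|)^2 is a lower bound for \<open>poi w\<close>.\<close>

definition a0 :: real where "a0 = (LINT t|lborel. v t / (1 + \<bar>t\<bar>)\<^sup>2)"

lemma a0_integrable: "integrable lborel (\<lambda>t. v t / (1 + \<bar>t\<bar>)\<^sup>2)"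
proof (rule Bochner_Integration.integrable_bound[OF v_integrable])
  note [measurable] = v_measurable
  show "(\<lambda>t. v t / (1 + \<bar>t\<bar>)\<^sup>2) \<in> borel_measurable lborel" by measurable
  have "v t / (1 + \<bar>t\<bar>)\<^sup>2 \<le> v t / 1" for t
    by (intro divide_left_mono) auto
  then show "AE t in lborel. norm (v t / (1 + \<bar>t\<bar>)\<^sup>2) \<le> norm (v t)"
    by (intro AE_I2) simp
qed

lemma sqn_h_pos: "0 < sqn h"
proof -
  have "sqn h \<noteq> 0" using sqn_eq_0[OF hB] h_nonzero by blast
  then show ?thesis using sqn_nonneg[of h] by linarith
qed

lemma v_integral: "(LINT t|lborel. v t) = sqn h"
  by (simp add: v_def sqn_def)

lemma a0_pos: "0 < a0"
proof -
  have n: "0 \<le> v t / (1 + \<bar>t\<bar>)\<^sup>2" for t by simp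
  have "a0 \<noteq> 0"
  proof
    assume "a0 = 0"
    then have "AE t in lborel. v t / (1 + \<bar>t\<bar>)\<^sup>2 = 0"
      using integral_nonneg_eq_0_iff_AE[OF a0_integrable] n by (simp add: a0_def)
    then have "AE t in lborel. v t = 0"
    proof eventually_elim
      fix t assume "v t / (1 + \<bar>t\<bar>)\<^sup>2 = 0"
      moreover have "(1 + \<bar>t\<bar>)\<^sup>2 \<noteq> 0" by (simp add: add_nonneg_eq_0_iff)
      ultimately show "v t = 0" by simp
    qed
    then have "(LINT t|lborel. v t) = 0" using integral_nonneg_eq_0_iff_AE[OF v_integrable] by simp
    then show False using v_integral sqn_h_pos by simp
  qed
  moreover have "0 \<le> a0" unfolding a0_def by (intro integral_nonneg_AE AE_I2 n)
  ultimately show ?thesis by linarith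
qed

lemma poi_lower:
  assumes w: "Im w \<noteq> 0"
  shows "a0 / (1 + cmod w)\<^sup>2 \<le> poi w"
proof -
  have "a0 / (1 + cmod w)\<^sup>2 = (LINT t|lborel. v t / (1 + \<bar>t\<bar>)\<^sup>2 / (1 + cmod w)\<^sup>2)"
    unfolding a0_def by (rule integral_divide_zero[symmetric])
  also have "\<dots> \<le> poi w"
    unfolding poi_def
  proof (rule integral_mono)
    show "integrable lborel (\<lambda>t. v t / (1 + \<bar>t\<bar>)\<^sup>2 / (1 + cmod w)\<^sup>2)"
      by (rule integrable_divide_zero) (rule a0_integrable)
    show "integrable lborel (\<lambda>t. v t / ((t - Re w)\<^sup>2 + (Im w)\<^sup>2))" by (rule poi_integrable[OF w])
    fix t
    have "cmod (of_real t - w) \<le> \<bar>t\<bar> + cmod w" using norm_triangle_ineq4[of "of_real t" w] by simp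
    also have "\<dots> \<le> (1 + \<bar>t\<bar>) * (1 + cmod w)" by (simp add: algebra_simps)
    finally have "(cmod (of_real t - w))\<^sup>2 \<le> ((1 + \<bar>t\<bar>) * (1 + cmod w))\<^sup>2" by (intro power_mono) auto
    then have le: "(t - Re w)\<^sup>2 + (Im w)\<^sup>2 \<le> (1 + \<bar>t\<bar>)\<^sup>2 * (1 + cmod w)\<^sup>2"
      unfolding cmod_sq_of_real_diff power_mult_distrib .
    have p: "0 < (t - Re w)\<^sup>2 + (Im w)\<^sup>2" using w by (intro add_nonneg_pos) auto
    have "v t / ((1 + \<bar>t\<bar>)\<^sup>2 * (1 + cmod w)\<^sup>2) \<le> v t / ((t - Re w)\<^sup>2 + (Im w)\<^sup>2)"
      using le p by (intro divide_left_mono mult_pos_pos) auto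
    then show "v t / (1 + \<bar>t\<bar>)\<^sup>2 / (1 + cmod w)\<^sup>2 \<le> v t / ((t - Re w)\<^sup>2 + (Im w)\<^sup>2)" by simp
  qed
  finally show ?thesis .
qed

text \<open>Crude, but linear in |Im w| and with only polynomial loss in |w|: the first is used for
  the simplicity of extra zeros, both for the bound on g/h.\<close>

lemma m_lower:
  assumes w: "Im w \<noteq> 0"
  shows "\<bar>Im w\<bar> * (a0 / (1 + cmod w)\<^sup>2) \<le> cmod (m w)"
proof -
  have "\<bar>Im w\<bar> * (a0 / (1 + cmod w)\<^sup>2) \<le> \<bar>Im w\<bar> * poi w"
    by (intro mult_left_mono poi_lower w) auto
  also have "\<dots> \<le> \<bar>Im w * poi w\<bar>" unfolding abs_mult by (intro mult_left_mono) auto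
  also have "\<dots> \<le> cmod (m w)" unfolding Im_m[OF w, symmetric] by (rule abs_Im_le_cmod)
  finally show ?thesis .
qed

lemma m_nz: "Im w \<noteq> 0 \<Longrightarrow> m w \<noteq> 0"
proof
  assume w: "Im w \<noteq> 0" and "m w = 0"
  then have "\<bar>Im w\<bar> * (a0 / (1 + cmod w)\<^sup>2) \<le> 0" using m_lower[OF w] by simp
  moreover have "1 + cmod w \<noteq> 0" using norm_ge_zero[of w] by linarith
  then have "0 < \<bar>Im w\<bar> * (a0 / (1 + cmod w)\<^sup>2)" using w a0_pos by simp
  ultimately show False by linarith
qed

text \<open>At a nonreal zero of h, \<open>key_identity\<close> leaves m g = 0, and m has no nonreal
  zeros; but g vanishes only at real nodes.\<close>

lemma h_zero_real: "h w = 0 \<Longrightarrow> w = of_real (Re w)"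
proof -
  assume h: "h w = 0"
  have "Im w = 0"
  proof (rule ccontr)
    assume w: "Im w \<noteq> 0"
    have "g w = 0" using key_identity[OF w] m_nz[OF w] h by simp
    then have "Im w = 0" by (auto simp: g_zero)
    with w show False by simp
  qed
  then show ?thesis by (simp add: complex_eq_iff)
qed

text \<open>The zeros of h beyond the simple ones forced by Lam2: every zero off Lam2, and those
  points of Lam2 at which h vanishes at least twice. By \<open>X_mult\<close> each carries exactly
  one surplus zero, so a set records them without multiplicities.\<close>

definition X :: "real set" where
  "X = {x. h (of_real x) = 0 \<and> (x \<in> Lam2 \<longrightarrow> deriv h (of_real x) = 0)}"

text \<open>What remains of h after removing the surplus zero at x, and at a point of Lam2 also the
  forced one.\<close>

definition hx :: "real \<Rightarrow> complex \<Rightarrow> complex" where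
  "hx x = (if x \<in> Lam2 then quot (quot h (of_real x)) (of_real x) else quot h (of_real x))"

lemma entire_hx: "entire (hx x)"
  unfolding hx_def using entire_quot[OF entire_quot[OF he]] entire_quot[OF he] by simp

definition vp :: "real \<Rightarrow> nat \<Rightarrow> complex" where "vp x n = Complex x (1 / real (Suc n))"

lemma vp_Im: "0 < Im (vp x n)" and vp_Re: "Re (vp x n) = x"
  by (simp_all add: vp_def)

lemma vp_lim: "vp x \<longlonglongrightarrow> of_real x"
  unfolding vp_def complex_of_real_def by (intro tendsto_Complex tendsto_const inverse_Suc)

lemma vp_entire: "entire F \<Longrightarrow> (\<lambda>n. F (vp x n)) \<longlonglongrightarrow> F (of_real x)"
proof (rule isCont_tendsto_compose[OF _ vp_lim])
  assume "entire F"
  from entire_continuous[OF this, of UNIV] show "isCont F (of_real x)"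
    by (simp add: continuous_on_eq_continuous_at)
qed

lemma vp_diff_le: "cmod (vp x n - of_real x) \<le> cmod (of_real t - vp x n)"
proof -
  have "vp x n - of_real x = \<i> * of_real (Im (vp x n))" by (simp add: vp_def complex_eq_iff)
  then have "cmod (vp x n - of_real x) = \<bar>Im (vp x n)\<bar>" by (simp only: norm_mult norm_of_real norm_ii mult_1_left)
  then show ?thesis using abs_Im_le_pole_dist[of "vp x n" t] by simp
qed

lemma re_diff_le: "cmod (of_real t - of_real x) \<le> cmod (of_real t - vp x n)"
proof -
  have "cmod (of_real t - of_real x) = \<bar>t - x\<bar>" unfolding of_real_diff[symmetric] norm_of_real ..
  also have "\<dots> = \<bar>Re (of_real t - vp x n)\<bar>" by (simp add: vp_Re)
  also have "\<dots> \<le> cmod (of_real t - vp x n)" by (rule abs_Re_le_cmod)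
  finally show ?thesis .
qed

text \<open>The limit is, up to sign, the mass that the measure u dt puts on the point x, which is
  zero. Along the vertical |z - x| <= |t - z|, so |u| dominates.\<close>

lemma pole_shrink:
  assumes u: "integrable lborel u"
  shows "(\<lambda>n. (vp x n - of_real x) * ctrans u (vp x n)) \<longlonglongrightarrow> 0"
proof -
  have um: "u \<in> borel_measurable borel" using borel_measurable_integrable[OF u] by simp
  have "(\<lambda>n. LINT t|lborel. (vp x n - of_real x) * (u t / (of_real t - vp x n))) \<longlonglongrightarrow> (LINT t|(lborel :: real measure). 0)"
  proof (rule integral_dominated_convergence[where w = "\<lambda>t. cmod (u t)"])
    show "integrable lborel (\<lambda>t. cmod (u t))" by (rule integrable_norm[OF u])
    show "(\<lambda>t. (vp x n - of_real x) * (u t / (of_real t - vp x n))) \<in> borel_measurable lborel" for n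
      by (rule borel_measurable_integrable[OF integrable_mult_right[OF ctrans_integrable[OF u]]])
         (use vp_Im[of x n] in linarith)
    show "AE t in lborel. norm ((vp x n - of_real x) * (u t / (of_real t - vp x n))) \<le> cmod (u t)" for n
    proof (rule AE_I2)
      fix t
      have "0 < cmod (of_real t - vp x n)"
        using abs_Im_le_pole_dist[of "vp x n" t] vp_Im[of x n] by linarith
      then have "cmod (vp x n - of_real x) / cmod (of_real t - vp x n) \<le> 1"
        using vp_diff_le[of x n t] by simp
      then have "cmod (u t) * (cmod (vp x n - of_real x) / cmod (of_real t - vp x n)) \<le> cmod (u t) * 1"
        by (intro mult_left_mono) auto
      then show "norm ((vp x n - of_real x) * (u t / (of_real t - vp x n))) \<le> cmod (u t)"
        by (simp add: norm_mult norm_divide mult.commute)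
    qed
    show "AE t in lborel. (\<lambda>n. (vp x n - of_real x) * (u t / (of_real t - vp x n))) \<longlonglongrightarrow> 0"
    proof (rule AE_I'[of "{x}"])
      show "{x} \<in> null_sets lborel" by (rule finite_imp_null_set_lborel) simp
      have "(\<lambda>n. (vp x n - of_real x) * (u t / (of_real t - vp x n))) \<longlonglongrightarrow> 0" if "t \<noteq> x" for t
      proof -
        have "(\<lambda>n. (vp x n - of_real x) * (u t / (of_real t - vp x n))) \<longlonglongrightarrow> (of_real x - of_real x) * (u t / (of_real t - of_real x))"
          by (intro tendsto_mult tendsto_diff tendsto_divide tendsto_const vp_lim) (use that in simp)
        then show ?thesis by simp
      qed
      then show "{t \<in> space lborel. \<not> (\<lambda>n. (vp x n - of_real x) * (u t / (of_real t - vp x n))) \<longlonglongrightarrow> 0} \<subseteq> {x}"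
        by blast
    qed
  qed simp
  then show ?thesis unfolding integral_mult_right_zero ctrans_def by simp
qed

text \<open>Along the vertical |t - x| <= |t - z|, so the limiting integrand itself
  dominates.\<close>

lemma pole_limit:
  assumes u: "integrable lborel u" and i: "integrable lborel (\<lambda>t. u t / (of_real t - of_real x))"
  shows "(\<lambda>n. ctrans u (vp x n)) \<longlonglongrightarrow> (LINT t|lborel. u t / (of_real t - of_real x))"
  unfolding ctrans_def
proof (rule integral_dominated_convergence[where w = "\<lambda>t. cmod (u t / (of_real t - of_real x))"])
  show "integrable lborel (\<lambda>t. cmod (u t / (of_real t - of_real x)))" by (rule integrable_norm[OF i])
  show "(\<lambda>t. u t / (of_real t - of_real x)) \<in> borel_measurable lborel" by (rule borel_measurable_integrable[OF i])
  show "(\<lambda>t. u t / (of_real t - vp x n)) \<in> borel_measurable lborel" for n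
    by (rule borel_measurable_integrable[OF ctrans_integrable[OF u]]) (use vp_Im[of x n] in linarith)
  have ne: "AE t in lborel. t \<noteq> x"
    by (rule AE_I'[of "{x}"]) (auto intro: finite_imp_null_set_lborel)
  from ne show "AE t in lborel. norm (u t / (of_real t - vp x n)) \<le> cmod (u t / (of_real t - of_real x))" for n
  proof eventually_elim
    fix t assume "t \<noteq> x"
    then have p: "0 < cmod (complex_of_real t - of_real x)" by simp
    show "norm (u t / (of_real t - vp x n)) \<le> cmod (u t / (of_real t - of_real x))"
      unfolding norm_divide by (rule divide_left_mono[OF re_diff_le norm_ge_zero])
        (rule mult_pos_pos[OF less_le_trans[OF p re_diff_le] p])
  qed
  from ne show "AE t in lborel. (\<lambda>n. u t / (of_real t - vp x n)) \<longlonglongrightarrow> u t / (of_real t - of_real x)"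
  proof eventually_elim
    fix t assume "t \<noteq> x"
    then show "(\<lambda>n. u t / (of_real t - vp x n)) \<longlonglongrightarrow> u t / (of_real t - of_real x)"
      by (intro tendsto_divide tendsto_diff tendsto_const vp_lim) simp
  qed
qed

lemma u1_pole_integrable:
  assumes "g (of_real x) = 0"
  shows "integrable lborel (\<lambda>t. u1 t / (of_real t - of_real x))"
proof -
  have i: "integrable lborel (\<lambda>t. quot g (of_real x) (of_real t) / E (of_real t) * cnj (h (of_real t) / E (of_real t)))"
    by (rule dB_inner_integrable[OF deBranges_quot[OF gB assms] hB])
  show ?thesis
  proof (rule integrable_cong_AE_imp[OF i])
    have "u1 \<in> borel_measurable borel" using borel_measurable_integrable[OF u1_integrable] by simp
    note [measurable] = this
    have "(\<lambda>t. u1 t * (1 / (complex_of_real t - of_real x))) \<in> borel_measurable borel" by measurable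
    then show "(\<lambda>t. u1 t / (of_real t - of_real x)) \<in> borel_measurable lborel" by simp
    show "AE t in lborel. quot g (of_real x) (of_real t) / E (of_real t) * cnj (h (of_real t) / E (of_real t)) = u1 t / (of_real t - of_real x)"
    proof (rule AE_I'[of "{x}"])
      show "{x} \<in> null_sets lborel" by (rule finite_imp_null_set_lborel) simp
    qed (use u1_over_linear[OF _ assms] in force)
  qed
qed

text \<open>One normal form for three cases, obtained from \<open>key_identity\<close> by cancelling
  common zeros at x. If g(x) is nonzero, G = g and q = (z - x) C_1. At a node G is g divided by z -
  x: for x in Lam2 a multiple zero of h meets a simple one of g and q is as before; for x in Lam1, q
  = C_1, which tends to 0 by orthogonality.\<close>

lemma X_core:
  assumes x: "x \<in> X"
  shows "\<exists>G q. entire G \<and> G (of_real x) \<noteq> 0 \<and> (\<forall>n. m (vp x n) * G (vp x n) = hx x (vp x n) * q n) \<and> q \<longlonglongrightarrow> 0"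
proof -
  let ?x = "complex_of_real x"
  have hx0: "h ?x = 0" using x by (simp add: X_def)
  have key: "h (vp x n) * ctrans u1 (vp x n) = m (vp x n) * g (vp x n)" for n
    by (rule key_identity) (use vp_Im[of x n] in linarith)
  have nz: "vp x n - ?x \<noteq> 0" for n using vp_Im[of x n] by (auto simp: complex_eq_iff)
  have h1: "h z = (z - ?x) * quot h ?x z" for z by (rule quot_factor[of h ?x z, OF hx0])
  have wit: ?thesis if "entire G" "G ?x \<noteq> 0" "q \<longlonglongrightarrow> 0" "\<And>n. m (vp x n) * G (vp x n) = hx x (vp x n) * q n" for G q
    by (rule exI[of _ G], rule exI[of _ q]) (use that in simp)
  show ?thesis
  proof (cases "g ?x = 0")
    case False
    then have nl: "x \<notin> Lam2 \<or> x = l0" by (auto simp: g_zero)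
    have "l0 \<notin> Lam2" using l0 disjoint by blast
    then have n2: "x \<notin> Lam2" using nl by blast
    have "m (vp x n) * g (vp x n) = hx x (vp x n) * ((vp x n - ?x) * ctrans u1 (vp x n))" for n
      unfolding key[symmetric] hx_def using n2 h1[of "vp x n"] by simp
    then show ?thesis by (rule wit[OF ge False pole_shrink[OF u1_integrable, of x]])
  next
    case True
    have g1: "g z = (z - ?x) * quot g ?x z" for z by (rule quot_factor[of g ?x z, OF True])
    have gx: "quot g ?x ?x \<noteq> 0" unfolding quot_self by (rule g_simple[OF True])
    show ?thesis
    proof (cases "x \<in> Lam2")
      case True
      then have "quot h ?x ?x = 0" using x by (simp add: X_def quot_self)
      then have h2: "quot h ?x z = (z - ?x) * hx x z" for z using quot_factor[of "quot h ?x" ?x z] True by (simp add: hx_def)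
      have e1: "(vp x n - ?x) * (m (vp x n) * quot g ?x (vp x n)) = (vp x n - ?x) * (hx x (vp x n) * ((vp x n - ?x) * ctrans u1 (vp x n)))" for n
        using key[of n] unfolding h1[of "vp x n"] g1[of "vp x n"] h2 by (simp only: mult_ac)
      have "m (vp x n) * quot g ?x (vp x n) = hx x (vp x n) * ((vp x n - ?x) * ctrans u1 (vp x n))" for n
        using e1[of n] unfolding mult_left_cancel[OF nz[of n]] .
      then show ?thesis by (rule wit[OF entire_quot[OF ge] gx pole_shrink[OF u1_integrable, of x]])
    next
      case False
      then have xl: "x \<in> Lam1" "x \<noteq> l0" using True by (auto simp: g_zero)
      have e1: "(vp x n - ?x) * (m (vp x n) * quot g ?x (vp x n)) = (vp x n - ?x) * (hx x (vp x n) * ctrans u1 (vp x n))" for n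
        using key[of n] False unfolding h1[of "vp x n"] g1[of "vp x n"] hx_def by (simp only: mult_ac if_False)
      have e: "m (vp x n) * quot g ?x (vp x n) = hx x (vp x n) * ctrans u1 (vp x n)" for n
        using e1[of n] unfolding mult_left_cancel[OF nz[of n]] .
      have l: "(\<lambda>n. ctrans u1 (vp x n)) \<longlonglongrightarrow> 0"
        using pole_limit[OF u1_integrable u1_pole_integrable[OF True]] unfolding orth_pole[OF xl] .
      show ?thesis by (rule wit[OF entire_quot[OF ge] gx l e])
    qed
  qed
qed

lemma X_m_limit:
  assumes x: "x \<in> X"
  shows "(\<lambda>n. m (vp x n)) \<longlonglongrightarrow> 0"
proof -
  obtain G q where G: "entire G" "G (of_real x) \<noteq> 0" and e: "\<And>n. m (vp x n) * G (vp x n) = hx x (vp x n) * q n" and q: "q \<longlonglongrightarrow> 0"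
    using X_core[OF x] by blast
  have "(\<lambda>n. hx x (vp x n) * q n / G (vp x n)) \<longlonglongrightarrow> hx x (of_real x) * 0 / G (of_real x)"
    by (intro tendsto_divide tendsto_mult vp_entire entire_hx G q)
  then have l: "(\<lambda>n. m (vp x n) * G (vp x n) / G (vp x n)) \<longlonglongrightarrow> 0" unfolding e by simp
  have "\<forall>\<^sub>F n in sequentially. G (vp x n) \<noteq> 0"
    using tendsto_imp_eventually_ne[OF vp_entire[OF G(1)] G(2)] .
  then have "\<forall>\<^sub>F n in sequentially. m (vp x n) * G (vp x n) / G (vp x n) = m (vp x n)"
    by eventually_elim simp
  from Lim_transform_eventually[OF l this] show ?thesis .
qed

text \<open>A further zero of \<open>hx x\<close> would make m(x + i s) of size o(s), while
  \<open>m_lower\<close> gives at least a constant times s.\<close>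

lemma X_mult:
  assumes x: "x \<in> X"
  shows "hx x (of_real x) \<noteq> 0"
proof
  let ?x = "complex_of_real x"
  assume "hx x ?x = 0"
  then have f: "hx x z = (z - ?x) * quot (hx x) ?x z" for z by (rule quot_factor)
  obtain G q where G: "entire G" "G ?x \<noteq> 0" and e: "\<And>n. m (vp x n) * G (vp x n) = hx x (vp x n) * q n" and q: "q \<longlonglongrightarrow> 0"
    using X_core[OF x] by blast
  have le: "a0 / (1 + cmod (vp x n))\<^sup>2 * cmod (G (vp x n)) \<le> cmod (quot (hx x) ?x (vp x n)) * cmod (q n)" for n
  proof -
    have w: "Im (vp x n) \<noteq> 0" using vp_Im[of x n] by linarith
    have d: "cmod (vp x n - ?x) = \<bar>Im (vp x n)\<bar>"
    proof -
      have "vp x n - ?x = \<i> * of_real (Im (vp x n))" by (simp add: vp_def complex_eq_iff)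
      then show ?thesis by (simp only: norm_mult norm_of_real norm_ii mult_1_left)
    qed
    have "\<bar>Im (vp x n)\<bar> * (a0 / (1 + cmod (vp x n))\<^sup>2) * cmod (G (vp x n)) \<le> cmod (m (vp x n)) * cmod (G (vp x n))"
      by (intro mult_right_mono m_lower w) auto
    also have "\<dots> = \<bar>Im (vp x n)\<bar> * (cmod (quot (hx x) ?x (vp x n)) * cmod (q n))"
      unfolding norm_mult[symmetric] e f[of "vp x n"] unfolding norm_mult d by simp
    finally have "\<bar>Im (vp x n)\<bar> * (a0 / (1 + cmod (vp x n))\<^sup>2 * cmod (G (vp x n))) \<le> \<bar>Im (vp x n)\<bar> * (cmod (quot (hx x) ?x (vp x n)) * cmod (q n))"
      by (simp only: mult.assoc)
    moreover have "0 < \<bar>Im (vp x n)\<bar>" using w by simp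
    ultimately show ?thesis by (simp only: mult_le_cancel_left_pos)
  qed
  have n1: "1 + cmod ?x \<noteq> 0" using norm_ge_zero[of ?x] by linarith
  have "(\<lambda>n. a0 / (1 + cmod (vp x n))\<^sup>2 * cmod (G (vp x n))) \<longlonglongrightarrow> a0 / (1 + cmod ?x)\<^sup>2 * cmod (G ?x)"
    by (intro tendsto_mult tendsto_divide tendsto_power tendsto_add tendsto_norm tendsto_const vp_lim vp_entire G) (use n1 in simp)
  moreover have "(\<lambda>n. cmod (quot (hx x) ?x (vp x n)) * cmod (q n)) \<longlonglongrightarrow> cmod (quot (hx x) ?x ?x) * cmod 0"
    by (intro tendsto_mult tendsto_norm vp_entire entire_quot entire_hx q)
  ultimately have "a0 / (1 + cmod ?x)\<^sup>2 * cmod (G ?x) \<le> cmod (quot (hx x) ?x ?x) * cmod 0"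
    by (rule LIMSEQ_le) (use le in blast)
  then have "a0 / (1 + cmod ?x)\<^sup>2 * cmod (G ?x) \<le> 0" by simp
  moreover have "0 < a0 / (1 + cmod ?x)\<^sup>2 * cmod (G ?x)"
    using a0_pos n1 G(2) by (intro mult_pos_pos divide_pos_pos) auto
  ultimately show False by linarith
qed

end

section \<open>A Jensen-type inequality\<close>

text \<open>On the circle R^2 is \<zeta> times its conjugate; up to R the reflected factor has the
  modulus of the original one.\<close>

lemma circle_pole_norm:
  assumes "cmod \<zeta> = R"
  shows "cmod (of_real (R\<^sup>2) - of_real b * \<zeta>) = R * cmod (\<zeta> - of_real b)"
proof -
  have "complex_of_real (R\<^sup>2) = \<zeta> * cnj \<zeta>" unfolding assms[symmetric] by (rule complex_norm_square)
  then have "of_real (R\<^sup>2) - of_real b * \<zeta> = \<zeta> * cnj (\<zeta> - of_real b)" by (simp add: algebra_simps)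
  then have "cmod (of_real (R\<^sup>2) - of_real b * \<zeta>) = cmod (\<zeta> * cnj (\<zeta> - of_real b))" by (simp only:)
  then show ?thesis by (simp only: norm_mult complex_mod_cnj assms)
qed

text \<open>A polynomial whose modulus on the circle measures the distance to the real axis and
  which does not vanish at the centre.\<close>

lemma circle_square_norm:
  assumes "cmod \<zeta> = R"
  shows "cmod (\<zeta>\<^sup>2 - of_real (R\<^sup>2)) = 2 * R * \<bar>Im \<zeta>\<bar>"
proof -
  have "complex_of_real (R\<^sup>2) = \<zeta> * cnj \<zeta>" unfolding assms[symmetric] by (rule complex_norm_square)
  then have "\<zeta>\<^sup>2 - of_real (R\<^sup>2) = \<zeta> * (\<zeta> - cnj \<zeta>)" by (simp add: algebra_simps power2_eq_square)
  then have "\<zeta>\<^sup>2 - of_real (R\<^sup>2) = \<zeta> * (of_real (2 * Im \<zeta>) * \<i>)" by (simp only: complex_diff_cnj)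
  then show ?thesis by (simp only: norm_mult norm_of_real norm_ii assms abs_mult)
qed

context mixed_orthogonal
begin

text \<open>A point lying in both Lam2 and X is divided out twice. That no zero is left over at a
  real point of U follows from \<open>X_mult\<close> on X and from the definition of
  \<open>X\<close> elsewhere.\<close>

lemma factor_h:
  assumes fC: "finite (Lam2 \<inter> U)" and fY: "finite (X \<inter> U)"
  shows "\<exists>h1. entire h1 \<and> (\<forall>z. h z = (\<Prod>s\<in>Lam2 \<inter> U. z - of_real s) * ((\<Prod>s\<in>X \<inter> U. z - of_real s) * h1 z))
    \<and> (\<forall>x\<in>U. h1 (of_real x) \<noteq> 0)"
proof -
  let ?C = "Lam2 \<inter> U" let ?Y = "X \<inter> U"
  let ?p = "\<lambda>S z. \<Prod>s\<in>S. z - complex_of_real s"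
  have pnz: "?p (S - {x}) (of_real x) \<noteq> 0" if "finite S" for S x
    using that by (subst prod_zero_iff) auto
  have pr: "?p S z = (z - of_real x) * ?p (S - {x}) z" if "finite S" "x \<in> S" for S x z
    by (rule prod.remove[OF that])
  have "\<exists>k. entire k \<and> (\<forall>z. h z = ?p ?C z * k z)" by (rule factor_out[OF fC he]) (simp add: h_L2)
  then obtain k1 where k1c: "entire k1 \<and> (\<forall>z. h z = ?p ?C z * k1 z)" by (rule exE)
  have k1: "entire k1" "\<And>z. h z = ?p ?C z * k1 z" by (rule conjunct1[OF k1c], rule spec[OF conjunct2[OF k1c]])
  have kz: "k1 (of_real a) = 0" if a: "a \<in> ?Y" for a
  proof (cases "a \<in> Lam2")
    case True
    then have aC: "a \<in> ?C" using a by blast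
    have "quot h (of_real a) = (\<lambda>z. ?p (?C - {a}) z * k1 z)"
      by (rule quot_eqI[OF entire_mult[OF entire_prod_linear k1(1)]]) (simp only: k1(2) pr[OF fC aC] mult.assoc)
    then have "quot h (of_real a) (of_real a) = ?p (?C - {a}) (of_real a) * k1 (of_real a)" by (rule fun_cong)
    moreover have "deriv h (of_real a) = 0" using a True by (simp add: X_def)
    ultimately show ?thesis using pnz[OF fC, of a] by (simp only: quot_self mult_eq_0_iff) simp
  next
    case False
    then have "?C - {a} = ?C" by blast
    then have "?p ?C (of_real a) \<noteq> 0" using pnz[OF fC, of a] by simp
    moreover have "h (of_real a) = 0" using a by (simp add: X_def)
    ultimately show ?thesis using k1(2)[of "of_real a"] by simp
  qed
  have "\<exists>k. entire k \<and> (\<forall>z. k1 z = ?p ?Y z * k z)" by (rule factor_out[OF fY k1(1)]) (rule kz)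
  then obtain h1 where h1c: "entire h1 \<and> (\<forall>z. k1 z = ?p ?Y z * h1 z)" by (rule exE)
  have h1: "entire h1" "\<And>z. k1 z = ?p ?Y z * h1 z" by (rule conjunct1[OF h1c], rule spec[OF conjunct2[OF h1c]])
  have hz: "h z = ?p ?C z * (?p ?Y z * h1 z)" for z using k1(2)[of z] unfolding h1(2)[of z] .
  have "h1 (of_real x) \<noteq> 0" if x: "x \<in> U" for x
  proof
    assume z: "h1 (of_real x) = 0"
    then have h0: "h (of_real x) = 0" by (simp add: hz)
    show False
    proof (cases "x \<in> X")
      case True
      then have xY: "x \<in> ?Y" using x by blast
      show False
      proof (cases "x \<in> Lam2")
        case l: True
        then have xC: "x \<in> ?C" using x by blast
        have 1: "quot h (of_real x) = (\<lambda>z. ?p (?C - {x}) z * (?p ?Y z * h1 z))"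
          by (rule quot_eqI[OF entire_mult[OF entire_prod_linear entire_mult[OF entire_prod_linear h1(1)]]])
            (simp only: hz pr[OF fC xC] mult.assoc)
        have 2: "quot (quot h (of_real x)) (of_real x) = (\<lambda>z. ?p (?C - {x}) z * (?p (?Y - {x}) z * h1 z))"
          by (rule quot_eqI[OF entire_mult[OF entire_prod_linear entire_mult[OF entire_prod_linear h1(1)]]])
            (simp only: 1 pr[OF fY xY] mult_ac)
        have "hx x (of_real x) = 0" unfolding hx_def using l z by (simp add: 2)
        then show False using X_mult[OF True] by blast
      next
        case l: False
        have 1: "quot h (of_real x) = (\<lambda>z. ?p ?C z * (?p (?Y - {x}) z * h1 z))"
          by (rule quot_eqI[OF entire_mult[OF entire_prod_linear entire_mult[OF entire_prod_linear h1(1)]]])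
            (simp only: hz pr[OF fY xY] mult_ac)
        have "hx x (of_real x) = 0" unfolding hx_def using l z by (simp add: 1)
        then show False using X_mult[OF True] by blast
      qed
    next
      case False
      then have l: "x \<in> Lam2" "deriv h (of_real x) \<noteq> 0" using h0 by (auto simp: X_def)
      then have xC: "x \<in> ?C" using x by blast
      have 1: "quot h (of_real x) = (\<lambda>z. ?p (?C - {x}) z * (?p ?Y z * h1 z))"
        by (rule quot_eqI[OF entire_mult[OF entire_prod_linear entire_mult[OF entire_prod_linear h1(1)]]])
          (simp only: hz pr[OF fC xC] mult.assoc)
      have "quot h (of_real x) (of_real x) = 0" using z by (simp add: 1)
      then show False using l(2) by (simp add: quot_self)
    qed
  qed
  then have h1F: "entire h1 \<and> (\<forall>z. h z = ?p ?C z * (?p ?Y z * h1 z)) \<and> (\<forall>x\<in>U. h1 (of_real x) \<noteq> 0)"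
    by (intro conjI allI ballI h1(1) hz)
  show ?thesis by (rule exI[of _ h1], rule h1F)
qed

lemma finite_X: "finite {x \<in> X. \<bar>x - a\<bar> \<le> r}"
  by (rule finite_subset[OF _ entire_finite_zeros[OF he h_nonzero, of a r]]) (auto simp: X_def)

lemma finite_Lam2: "finite {x \<in> Lam2. \<bar>x - a\<bar> \<le> r}"
  by (rule finite_subset[OF _ entire_finite_zeros[OF he h_nonzero, of a r]]) (auto simp: h_L2)

lemma g_nonzero: "\<exists>z. g z \<noteq> 0"
  using g_l0 by (intro exI[of _ "of_real l0"]) simp

lemma finite_Lam1: "finite {x \<in> Lam1 - {l0}. \<bar>x - a\<bar> \<le> r}"
  by (rule finite_subset[OF _ entire_finite_zeros[OF ge g_nonzero, of a r]]) (auto simp: g_zero)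

definition n1 :: real where "n1 = (LINT t|lborel. cmod (u1 t))"

text \<open>g/h = C_1/m off the real line, with |C_1| <= n1/|Im w| and |m| bounded below by
  \<open>m_lower\<close>; each of the two costs one factor |Im w|.\<close>

lemma quotient_bound:
  assumes w: "Im w \<noteq> 0"
  shows "cmod (g w) / cmod (h w) * (Im w)\<^sup>2 \<le> n1 * (1 + cmod w)\<^sup>2 / a0"
proof -
  let ?G = "cmod (g w) / cmod (h w)" and ?q = "(1 + cmod w)\<^sup>2"
  have h0: "h w \<noteq> 0"
  proof
    assume "h w = 0"
    then have "w = of_real (Re w)" by (rule h_zero_real)
    then have "Im w = Im (complex_of_real (Re w))" by (rule arg_cong)
    with w show False by simp
  qed
  have I: "0 < \<bar>Im w\<bar>" using w by simp
  have "cmod (h w) * cmod (ctrans u1 w) = cmod (m w) * cmod (g w)"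
    unfolding norm_mult[symmetric] key_identity[OF w] ..
  then have mG: "cmod (m w) * ?G = cmod (ctrans u1 w)" using h0 by (simp add: field_simps)
  have "0 < 1 + cmod w" using norm_ge_zero[of w] by linarith
  then have q: "0 < ?q" by simp
  have "\<bar>Im w\<bar> * (a0 / ?q) * ?G \<le> cmod (m w) * ?G" by (intro mult_right_mono m_lower w) simp
  also have "\<dots> \<le> n1 / \<bar>Im w\<bar>" unfolding mG n1_def by (rule ctrans_bound[OF u1_integrable w])
  finally have "(\<bar>Im w\<bar> * (a0 / ?q) * ?G) * \<bar>Im w\<bar> \<le> n1 / \<bar>Im w\<bar> * \<bar>Im w\<bar>"
    by (rule mult_right_mono) simp
  moreover have "n1 / \<bar>Im w\<bar> * \<bar>Im w\<bar> = n1" using I by simp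
  moreover have "(\<bar>Im w\<bar> * (a0 / ?q) * ?G) * \<bar>Im w\<bar> = (a0 / ?q) * (?G * (Im w)\<^sup>2)"
  proof -
    have sq: "(Im w)\<^sup>2 = \<bar>Im w\<bar> * \<bar>Im w\<bar>" by (simp add: power2_eq_square)
    show ?thesis unfolding sq by (simp only: mult_ac)
  qed
  ultimately have "(a0 / ?q) * (?G * (Im w)\<^sup>2) \<le> n1" by (simp only:)
  then have "(?q / a0) * ((a0 / ?q) * (?G * (Im w)\<^sup>2)) \<le> (?q / a0) * n1"
    using q a0_pos by (intro mult_left_mono) auto
  moreover have "(?q / a0) * ((a0 / ?q) * y) = y" for y using q a0_pos by simp
  moreover have "(?q / a0) * n1 = n1 * ?q / a0" by simp
  ultimately show ?thesis by (simp only:)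
qed

text \<open>The Blaschke factors of the disc and the factor $((z-x_0)^2-R^2)^2$, which absorbs the
  singularity of the bound for $g/h$ at the real axis, turn $g/h$ into a function that the maximum
  principle bounds independently of $R$.\<close>

lemma Jensen_product:
  assumes h0: "h (of_real x0) \<noteq> 0" and g0: "g (of_real x0) \<noteq> 0" and R: "1 \<le> R"
    and nz: "\<And>x. \<bar>x - x0\<bar> = R \<Longrightarrow> h (of_real x) \<noteq> 0"
    and A_def: "A = {l \<in> Lam1 - {l0}. \<bar>l - x0\<bar> < R}" and Y_def: "Y = {a \<in> X. \<bar>a - x0\<bar> < R}"
  shows "(\<Prod>l\<in>A. R / \<bar>l - x0\<bar>) * (cmod (g (of_real x0)) / cmod (h (of_real x0)))
    \<le> 4 * n1 * (2 + \<bar>x0\<bar>)\<^sup>2 / a0 * (\<Prod>a\<in>Y. R / \<bar>a - x0\<bar>)"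
proof -
  define U where "U = {x. \<bar>x - x0\<bar> < R}"
  define C where "C = Lam2 \<inter> U"
  let ?p = "\<lambda>S z. \<Prod>s\<in>S. z - complex_of_real s"
  let ?K = "4 * n1 * (2 + \<bar>x0\<bar>)\<^sup>2 / a0"
  have YU: "Y = X \<inter> U" by (auto simp: Y_def U_def)
  have fA: "finite A" by (rule finite_subset[OF _ finite_Lam1[of x0 R]]) (auto simp: A_def)
  have fY: "finite Y" by (rule finite_subset[OF _ finite_X[of x0 R]]) (auto simp: Y_def)
  have fC: "finite C" by (rule finite_subset[OF _ finite_Lam2[of x0 R]]) (auto simp: C_def U_def)
  have "\<exists>k. entire k \<and> (\<forall>z. g z = ?p (A \<union> C) z * k z)"
    by (rule factor_out[OF _ ge]) (use fA fC disjoint l0 in \<open>auto simp: g_zero A_def C_def\<close>)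
  then obtain g1 where g1c: "entire g1 \<and> (\<forall>z. g z = ?p (A \<union> C) z * g1 z)" by (rule exE)
  have g1: "entire g1" "\<And>z. g z = ?p (A \<union> C) z * g1 z" by (rule conjunct1[OF g1c], rule spec[OF conjunct2[OF g1c]])
  have AC: "A \<inter> C = {}" using disjoint by (auto simp: A_def C_def)
  have gz: "g z = ?p A z * ?p C z * g1 z" for z unfolding g1(2) prod.union_disjoint[OF fA fC AC] ..
  obtain h1 where h1c: "entire h1 \<and> (\<forall>z. h z = ?p C z * (?p Y z * h1 z)) \<and> (\<forall>x\<in>U. h1 (of_real x) \<noteq> 0)"
    using factor_h[OF fC[unfolded C_def] fY[unfolded YU]] unfolding C_def[symmetric] YU[symmetric] by (rule exE)
  have h1: "entire h1" "\<And>z. h z = ?p C z * (?p Y z * h1 z)" "\<And>x. x \<in> U \<Longrightarrow> h1 (of_real x) \<noteq> 0"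
    by (rule conjunct1[OF h1c], rule spec[OF conjunct1[OF conjunct2[OF h1c]]], rule bspec[OF conjunct2[OF conjunct2[OF h1c]]])
  have dist_real: "dist (complex_of_real x0) (of_real x) = \<bar>x - x0\<bar>" for x
    unfolding dist_norm of_real_diff[symmetric] norm_of_real by (rule abs_minus_commute)
  have h1nz: "h1 z \<noteq> 0" if z: "z \<in> cball (of_real x0) R" for z
  proof
    assume "h1 z = 0"
    then have hz0: "h z = 0" by (simp add: h1(2))
    then have zr: "z = of_real (Re z)" by (rule h_zero_real)
    have "dist (complex_of_real x0) (of_real (Re z)) \<le> R" using z zr by simp
    then have "\<bar>Re z - x0\<bar> \<le> R" unfolding dist_real .
    moreover have "\<bar>Re z - x0\<bar> \<noteq> R" using nz[of "Re z"] hz0 zr by auto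
    ultimately have "Re z \<in> U" by (simp add: U_def)
    then show False using h1(3) zr \<open>h1 z = 0\<close> by metis
  qed
  have zC: "cmod (z - of_real x0) \<le> R" if "z \<in> cball (of_real x0) R" for z
    using that by (simp add: dist_norm norm_minus_commute)
  have den: "of_real (R\<^sup>2) - of_real (a - x0) * (z - of_real x0) \<noteq> 0" if a: "a \<in> Y" and z: "z \<in> cball (of_real x0) R" for a and z :: complex
  proof
    assume "of_real (R\<^sup>2) - of_real (a - x0) * (z - of_real x0) = 0"
    then have "complex_of_real (R\<^sup>2) = of_real (a - x0) * (z - of_real x0)" by (simp only: right_minus_eq)
    then have "cmod (complex_of_real (R\<^sup>2)) = cmod (of_real (a - x0) * (z - of_real x0))" by (rule arg_cong)
    then have "R * R = \<bar>a - x0\<bar> * cmod (z - of_real x0)" unfolding norm_mult norm_of_real by (simp add: power2_eq_square)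
    also have "\<dots> \<le> \<bar>a - x0\<bar> * R" using zC[OF z] by (rule mult_left_mono) simp
    also have "\<dots> < R * R" using a R by (intro mult_strict_right_mono) (auto simp: Y_def)
    finally show False by simp
  qed
  \<comment> \<open>The linear factors of A and Y, divided out of g and h, reappear as reflected
    factors with no zeros in the disc and the original modulus on the circle. There |\<Psi>| is
    |g/h| times 4 (Im z)^2/R^2; at the centre the last factor is 1.\<close>
  define \<Psi> where "\<Psi> = (\<lambda>z. g1 z / h1 z * (\<Prod>l\<in>A. (of_real (R\<^sup>2) - of_real (l - x0) * (z - of_real x0)) / of_real R)
     * (\<Prod>a\<in>Y. of_real R / (of_real (R\<^sup>2) - of_real (a - x0) * (z - of_real x0)))
     * (((z - of_real x0)\<^sup>2 - of_real (R\<^sup>2))\<^sup>2 / of_real (R ^ 4)))"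
  have hol: "\<Psi> holomorphic_on cball (of_real x0) R"
  proof -
    have e: "g1 holomorphic_on cball (of_real x0) R" "h1 holomorphic_on cball (of_real x0) R"
      using g1(1) h1(1) unfolding entire_def by (auto elim: holomorphic_on_subset)
    show ?thesis unfolding \<Psi>_def
      by (intro holomorphic_on_mult holomorphic_on_divide holomorphic_on_prod holomorphic_on_diff holomorphic_on_power
           holomorphic_on_ident holomorphic_on_const e) (use h1nz den R in auto)
  qed
  have bd: "cmod (\<Psi> z) \<le> ?K" if z: "z \<in> sphere (of_real x0) R" for z
  proof -
    let ?\<zeta> = "z - of_real x0"
    have n: "cmod ?\<zeta> = R" using z by (simp add: dist_norm norm_minus_commute)
    have zz: "?\<zeta> - of_real (l - x0) = z - of_real l" for l by simp
    have zc: "z \<in> cball (of_real x0) R" using z by simp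
    have hn: "h z \<noteq> 0"
    proof
      assume hz0: "h z = 0"
      then have zr: "z = of_real (Re z)" by (rule h_zero_real)
      have "dist (complex_of_real x0) (of_real (Re z)) = R" using z zr by simp
      then have "\<bar>Re z - x0\<bar> = R" unfolding dist_real .
      then show False using nz[of "Re z"] hz0 zr by auto
    qed
    have pa: "cmod (\<Prod>l\<in>A. (of_real (R\<^sup>2) - of_real (l - x0) * ?\<zeta>) / of_real R) = cmod (?p A z)"
      unfolding prod_norm[symmetric] norm_divide circle_pole_norm[OF n] norm_of_real zz
      using R by (intro prod.cong) auto
    have py: "cmod (\<Prod>a\<in>Y. of_real R / (of_real (R\<^sup>2) - of_real (a - x0) * ?\<zeta>)) = 1 / cmod (?p Y z)"
    proof -
      have "cmod (\<Prod>a\<in>Y. of_real R / (of_real (R\<^sup>2) - of_real (a - x0) * ?\<zeta>)) = (\<Prod>a\<in>Y. 1 / cmod (z - of_real a))"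
        unfolding prod_norm[symmetric] norm_divide circle_pole_norm[OF n] norm_of_real zz
        using R by (intro prod.cong) auto
      then show ?thesis unfolding prod_dividef prod_norm by simp
    qed
    have pq: "cmod ((?\<zeta>\<^sup>2 - of_real (R\<^sup>2))\<^sup>2 / of_real (R ^ 4)) = 4 * (Im z)\<^sup>2 / R\<^sup>2"
    proof -
      have "cmod ((?\<zeta>\<^sup>2 - of_real (R\<^sup>2))\<^sup>2 / of_real (R ^ 4)) = (2 * R * \<bar>Im z\<bar>)\<^sup>2 / R ^ 4"
        unfolding norm_divide norm_power circle_square_norm[OF n] norm_of_real by simp
      also have "\<dots> = 4 * (Im z)\<^sup>2 / R\<^sup>2"
        using R by (simp add: power_mult_distrib field_simps power_numeral_reduce)
      finally show ?thesis .
    qed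
    have nzs: "cmod (?p C z) \<noteq> 0" "cmod (?p Y z) \<noteq> 0" "cmod (h1 z) \<noteq> 0" using hn h1(2)[of z] by auto
    have G: "cmod (g z) / cmod (h z) = cmod (g1 z) / cmod (h1 z) * cmod (?p A z) * (1 / cmod (?p Y z))"
      unfolding gz h1(2) norm_mult using nzs by (simp add: field_simps)
    have P: "cmod (\<Psi> z) = cmod (g z) / cmod (h z) * (4 * (Im z)\<^sup>2 / R\<^sup>2)"
      unfolding \<Psi>_def norm_mult pa py pq G norm_divide[of "g1 z"] ..
    have K0: "0 \<le> ?K" using a0_pos by (intro divide_nonneg_pos mult_nonneg_nonneg) (auto simp: n1_def)
    show ?thesis
    proof (cases "Im z = 0")
      \<comment> \<open>At the two real points of the circle \<open>quotient_bound\<close> says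
        nothing, but the quadratic factor vanishes.\<close>
      case True
      then show ?thesis using K0 unfolding P by simp
    next
      case False
      have "cmod z \<le> cmod ?\<zeta> + cmod (complex_of_real x0)" using norm_triangle_ineq[of ?\<zeta> "of_real x0"] by simp
      then have "cmod z \<le> R + \<bar>x0\<bar>" unfolding n norm_of_real .
      moreover have "\<bar>x0\<bar> * 1 \<le> \<bar>x0\<bar> * R" using R by (intro mult_left_mono) auto
      \<comment> \<open>The growth (1 + |z|)^2 is thereby absorbed by the R^2 in the denominator,
        and the bound does not depend on R.\<close>
      ultimately have q: "1 + cmod z \<le> (2 + \<bar>x0\<bar>) * R" using R by (simp add: distrib_right)
      have "n1 * (1 + cmod z)\<^sup>2 \<le> n1 * ((2 + \<bar>x0\<bar>) * R)\<^sup>2"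
        using q by (intro mult_left_mono power_mono) (auto simp: n1_def)
      then have "n1 * (1 + cmod z)\<^sup>2 / a0 \<le> n1 * ((2 + \<bar>x0\<bar>) * R)\<^sup>2 / a0" using a0_pos by (intro divide_right_mono) auto
      with quotient_bound[OF False] have "cmod (g z) / cmod (h z) * (Im z)\<^sup>2 \<le> n1 * ((2 + \<bar>x0\<bar>) * R)\<^sup>2 / a0" by linarith
      then have "(4 / R\<^sup>2) * (cmod (g z) / cmod (h z) * (Im z)\<^sup>2) \<le> (4 / R\<^sup>2) * (n1 * ((2 + \<bar>x0\<bar>) * R)\<^sup>2 / a0)"
        by (rule mult_left_mono) simp
      also have "\<dots> = ?K" using R by (simp add: power_mult_distrib)
      finally show ?thesis unfolding P by (simp add: mult_ac)
    qed
  qed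
  have "cmod (\<Psi> (of_real x0)) \<le> ?K"
  proof (rule maximum_modulus_frontier[of \<Psi> "cball (of_real x0) R"])
    show "\<Psi> holomorphic_on interior (cball (of_real x0) R)"
      by (rule holomorphic_on_subset[OF hol interior_subset])
    show "continuous_on (closure (cball (of_real x0) R)) \<Psi>"
      unfolding closure_closed[OF closed_cball] by (rule holomorphic_on_imp_continuous_on[OF hol])
    show "cmod (\<Psi> z) \<le> ?K" if "z \<in> frontier (cball (of_real x0) R)" for z
      using that bd R by (simp add: frontier_cball)
  qed (use R in auto)
  moreover have "cmod (\<Psi> (of_real x0)) = cmod (g1 (of_real x0)) / cmod (h1 (of_real x0)) * R ^ card A / R ^ card Y"
  proof -
    have "\<Psi> (of_real x0) = g1 (of_real x0) / h1 (of_real x0) * of_real (R ^ card A) * of_real (1 / R ^ card Y)"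
    proof -
      have "complex_of_real (R\<^sup>2) / of_real R = of_real R" "of_real R / complex_of_real (R\<^sup>2) = of_real (1 / R)"
        "(- complex_of_real (R\<^sup>2))\<^sup>2 / of_real (R ^ 4) = 1"
        using R by (simp_all add: power2_eq_square power_numeral_reduce)
      then show ?thesis unfolding \<Psi>_def by (simp del: of_real_power add: power_one_over) (simp add: power_one_over)
    qed
    then show ?thesis using R unfolding norm_mult norm_divide norm_of_real by (simp add: norm_mult norm_divide norm_power)
  qed
  ultimately have M: "cmod (g1 (of_real x0)) / cmod (h1 (of_real x0)) * R ^ card A / R ^ card Y \<le> ?K" by simp
  let ?a = "\<Prod>l\<in>A. \<bar>l - x0\<bar>" and ?y = "\<Prod>l\<in>Y. \<bar>l - x0\<bar>"
  have pn: "cmod (?p S (of_real x0)) = (\<Prod>l\<in>S. \<bar>l - x0\<bar>)" for S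
    unfolding prod_norm[symmetric] of_real_diff[symmetric] norm_of_real by (simp only: abs_minus_commute)
  have nza: "?a \<noteq> 0" using g0 unfolding gz pn[symmetric] by auto
  have nzy: "?y \<noteq> 0" "cmod (?p C (of_real x0)) \<noteq> 0" "cmod (h1 (of_real x0)) \<noteq> 0" using h0 unfolding h1(2) pn[symmetric] by auto
  have y0: "0 < ?y" using nzy(1) prod_nonneg[of Y "\<lambda>l. \<bar>l - x0\<bar>"] by (simp add: less_le)
  have "(\<Prod>l\<in>A. R / \<bar>l - x0\<bar>) * (cmod (g (of_real x0)) / cmod (h (of_real x0)))
    = (cmod (g1 (of_real x0)) / cmod (h1 (of_real x0)) * R ^ card A / R ^ card Y) * (R ^ card Y / ?y)"
    unfolding gz h1(2) norm_mult pn[of A] pn[of Y] prod_dividef prod_constant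
    using nza nzy R by (simp add: field_simps)
  also have "\<dots> \<le> ?K * (R ^ card Y / ?y)" using M y0 R by (intro mult_right_mono) auto
  also have "R ^ card Y / ?y = (\<Prod>a\<in>Y. R / \<bar>a - x0\<bar>)" unfolding prod_dividef prod_constant ..
  finally show ?thesis .
qed

text \<open>Logarithms of \<open>Jensen_product\<close>; the resulting constant depends on x0 but
  not on R.\<close>

lemma Jensen_inequality:
  assumes h0: "h (of_real x0) \<noteq> 0" and g0: "g (of_real x0) \<noteq> 0"
  shows "\<exists>K. \<forall>R\<ge>1. (\<forall>x. \<bar>x - x0\<bar> = R \<longrightarrow> h (of_real x) \<noteq> 0) \<longrightarrow>
    (\<Sum>l | l \<in> Lam1 - {l0} \<and> \<bar>l - x0\<bar> < R. ln (R / \<bar>l - x0\<bar>)) \<le> K + (\<Sum>a | a \<in> X \<and> \<bar>a - x0\<bar> < R. ln (R / \<bar>a - x0\<bar>))"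
proof (intro exI allI impI)
  let ?K = "4 * n1 * (2 + \<bar>x0\<bar>)\<^sup>2 / a0" and ?G = "cmod (g (of_real x0)) / cmod (h (of_real x0))"
  fix R :: real assume R: "1 \<le> R" and nz: "\<forall>x. \<bar>x - x0\<bar> = R \<longrightarrow> h (of_real x) \<noteq> 0"
  define A where "A = {l \<in> Lam1 - {l0}. \<bar>l - x0\<bar> < R}"
  define Y where "Y = {a \<in> X. \<bar>a - x0\<bar> < R}"
  have fA: "finite A" by (rule finite_subset[OF _ finite_Lam1[of x0 R]]) (auto simp: A_def)
  have fY: "finite Y" by (rule finite_subset[OF _ finite_X[of x0 R]]) (auto simp: Y_def)
  have "x0 \<notin> A" using g0 by (auto simp: A_def g_zero)
  then have pA: "0 < R / \<bar>l - x0\<bar>" if "l \<in> A" for l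
    using that R by (intro divide_pos_pos) (auto simp: zero_less_abs_iff)
  have "x0 \<notin> Y" using h0 by (auto simp: Y_def X_def)
  then have pY: "0 < R / \<bar>a - x0\<bar>" if "a \<in> Y" for a
    using that R by (intro divide_pos_pos) (auto simp: zero_less_abs_iff)
  have LA: "ln (\<Prod>l\<in>A. R / \<bar>l - x0\<bar>) = (\<Sum>l\<in>A. ln (R / \<bar>l - x0\<bar>))"
    by (rule ln_prod[OF fA]) (use pA in force)
  have LY: "ln (\<Prod>a\<in>Y. R / \<bar>a - x0\<bar>) = (\<Sum>a\<in>Y. ln (R / \<bar>a - x0\<bar>))"
    by (rule ln_prod[OF fY]) (use pY in force)
  have PA: "0 < (\<Prod>l\<in>A. R / \<bar>l - x0\<bar>)" and PY: "0 < (\<Prod>a\<in>Y. R / \<bar>a - x0\<bar>)"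
    using pA pY by (auto intro: prod_pos)
  have G: "0 < ?G" using h0 g0 by simp
  have le: "(\<Prod>l\<in>A. R / \<bar>l - x0\<bar>) * ?G \<le> ?K * (\<Prod>a\<in>Y. R / \<bar>a - x0\<bar>)"
    by (rule Jensen_product[OF h0 g0 R _ A_def Y_def]) (use nz in blast)
  have "0 < (\<Prod>l\<in>A. R / \<bar>l - x0\<bar>) * ?G" using PA G by (rule mult_pos_pos)
  with le have "0 < ?K * (\<Prod>a\<in>Y. R / \<bar>a - x0\<bar>)" by linarith
  then have K: "0 < ?K" using PY by (simp only: zero_less_mult_iff) linarith
  have "(\<Prod>l\<in>A. R / \<bar>l - x0\<bar>) \<le> ?K / ?G * (\<Prod>a\<in>Y. R / \<bar>a - x0\<bar>)" using iffD2[OF pos_le_divide_eq[OF G] le] by (simp only: times_divide_eq_left)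
  then have "ln (\<Prod>l\<in>A. R / \<bar>l - x0\<bar>) \<le> ln (?K / ?G * (\<Prod>a\<in>Y. R / \<bar>a - x0\<bar>))"
    using PA by (intro ln_mono) auto
  also have "\<dots> = ln (?K / ?G) + ln (\<Prod>a\<in>Y. R / \<bar>a - x0\<bar>)"
    by (rule ln_mult_pos[OF divide_pos_pos[OF K G] PY])
  finally have "(\<Sum>l\<in>A. ln (R / \<bar>l - x0\<bar>)) \<le> ln (?K / ?G) + (\<Sum>a\<in>Y. ln (R / \<bar>a - x0\<bar>))"
    unfolding LA LY .
  then show "(\<Sum>l | l \<in> Lam1 - {l0} \<and> \<bar>l - x0\<bar> < R. ln (R / \<bar>l - x0\<bar>)) \<le> ln (?K / ?G) + (\<Sum>a | a \<in> X \<and> \<bar>a - x0\<bar> < R. ln (R / \<bar>a - x0\<bar>))"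
    unfolding A_def Y_def .
qed

end

section \<open>Local estimates at the extra zeros\<close>

lemma norm_integral_le:
  fixes f :: "'a \<Rightarrow> complex"
  assumes f: "integrable M f" and g: "integrable M g" and le: "\<And>x. cmod (f x) \<le> g x"
  shows "cmod (integral\<^sup>L M f) \<le> integral\<^sup>L M g"
  by (rule order_trans[OF integral_norm_bound integral_mono[OF integrable_norm[OF f] g le]])

context de_branges
begin

lemma quot_norm_sq:
  assumes "F (of_real a) = 0"
  shows "(cmod (F (of_real t) / E (of_real t)))\<^sup>2 = (t - a)\<^sup>2 * (cmod (quot F (of_real a) (of_real t) / E (of_real t)))\<^sup>2"
proof -
  have n: "cmod (complex_of_real t - of_real a) = \<bar>t - a\<bar>" unfolding of_real_diff[symmetric] norm_of_real ..
  have "F (of_real t) = (of_real t - of_real a) * quot F (of_real a) (of_real t)"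
    by (rule quot_factor[of F "of_real a", OF assms])
  then have "cmod (F (of_real t) / E (of_real t)) = \<bar>t - a\<bar> * cmod (quot F (of_real a) (of_real t) / E (of_real t))"
    by (simp only: norm_divide norm_mult n times_divide_eq_right)
  then show ?thesis by (simp add: power_mult_distrib)
qed

end

context mixed_orthogonal
begin

lemma eval_ratio:
  assumes "F \<in> deBranges E"
  shows "(cmod (F (of_real t) / E (of_real t)))\<^sup>2 \<le> sqn F * \<phi>' t / pi"
proof -
  have e: "0 < (cmod (E (of_real t)))\<^sup>2" using E_real_nz[of t] by simp
  have "(cmod (F (of_real t) / E (of_real t)))\<^sup>2 = (cmod (F (of_real t)))\<^sup>2 / (cmod (E (of_real t)))\<^sup>2"
    by (simp add: norm_divide power_divide)
  also have "\<dots> \<le> sqn F * (\<phi>' t * (cmod (E (of_real t)))\<^sup>2 / pi) / (cmod (E (of_real t)))\<^sup>2"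
    using eval_real[OF assms] e by (intro divide_right_mono) auto
  also have "\<dots> = sqn F * \<phi>' t / pi" using e by simp
  finally show ?thesis .
qed

lemma X_zero: "x \<in> X \<Longrightarrow> h (of_real x) = 0"
  by (simp add: X_def)

text \<open>h(x) = 0 makes u2/(t - x) a product of two square integrable quotients, hence
  integrable; the vertical limit of m, which is zero, is then given by the integral at x
  itself.\<close>

lemma X_pole:
  assumes x: "x \<in> X"
  shows "integrable lborel (\<lambda>t. u2 t / (of_real t - of_real x))"
    and "of_real c + (LINT t|lborel. u2 t / (of_real t - of_real x)) = 0"
proof -
  let ?x = "complex_of_real x"
  have hx0: "h ?x = 0" by (rule X_zero[OF x])
  have i: "integrable lborel (\<lambda>t. quot h ?x (of_real t) / E (of_real t) * cnj (h (of_real t) / E (of_real t)))"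
    by (rule dB_inner_integrable[OF deBranges_quot[OF hB hx0] hB])
  show j: "integrable lborel (\<lambda>t. u2 t / (of_real t - of_real x))"
  proof (rule integrable_cong_AE_imp[OF i])
    have "u2 \<in> borel_measurable borel" using borel_measurable_integrable[OF u2_integrable] by simp
    note [measurable] = this
    have "(\<lambda>t. u2 t * (1 / (complex_of_real t - of_real x))) \<in> borel_measurable borel" by measurable
    then show "(\<lambda>t. u2 t / (of_real t - of_real x)) \<in> borel_measurable lborel" by simp
    show "AE t in lborel. quot h ?x (of_real t) / E (of_real t) * cnj (h (of_real t) / E (of_real t)) = u2 t / (of_real t - ?x)"
    proof (rule AE_I'[of "{x}"])
      show "{x} \<in> null_sets lborel" by (rule finite_imp_null_set_lborel) simp
      have "quot h ?x (of_real t) / E (of_real t) * cnj (h (of_real t) / E (of_real t)) = u2 t / (of_real t - ?x)" if "t \<noteq> x" for t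
      proof -
        have q: "quot h ?x (of_real t) = h (of_real t) / (of_real t - ?x)" using that hx0 by (simp add: quot_def)
        show ?thesis unfolding u2_eq q by simp
      qed
      then show "{t \<in> space lborel. quot h ?x (of_real t) / E (of_real t) * cnj (h (of_real t) / E (of_real t)) \<noteq> u2 t / (of_real t - ?x)} \<subseteq> {x}"
        by blast
    qed
  qed
  have "(\<lambda>n. m (vp x n)) \<longlonglongrightarrow> of_real c + (LINT t|lborel. u2 t / (of_real t - of_real x))"
    unfolding m_def by (intro tendsto_add tendsto_const pole_limit[OF u2_integrable j])
  then show "of_real c + (LINT t|lborel. u2 t / (of_real t - of_real x)) = 0"
    using LIMSEQ_unique X_m_limit[OF x] by blast
qed

lemma quot_sq_integrable:
  "F \<in> deBranges E \<Longrightarrow> integrable lborel (\<lambda>t. (cmod (F (of_real t) / E (of_real t)))\<^sup>2)"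
  using deBranges_L2[of F] by (simp add: L2_def)

text \<open>Write v = (t - x)^2 k. Within distance s the evaluation bound gives k <= d/pi times the
  integral of k; this contributes at most half of that integral because 4 s d <= pi, and it is
  absorbed. Farther away (t - x)^2 + s^2 <= 2 (t - x)^2 leads to 2 poi, doubled by the
  absorption.\<close>

lemma local_mass:
  assumes x: "x \<in> X" and s: "0 < s" and d: "0 < d" and sd: "4 * s * d \<le> pi"
    and le: "\<And>t. \<bar>t - x\<bar> \<le> s \<Longrightarrow> \<phi>' t \<le> d"
  shows "sqn (quot h (of_real x)) \<le> 4 * poi (Complex x s)"
proof -
  let ?J = "quot h (of_real x)"
  have J: "?J \<in> deBranges E" by (rule deBranges_quot[OF hB X_zero[OF x]])
  let ?k = "\<lambda>t. (cmod (?J (of_real t) / E (of_real t)))\<^sup>2"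
  have vk: "v t = (t - x)\<^sup>2 * ?k t" for t unfolding v_def by (rule quot_norm_sq[of h x, OF X_zero[OF x]])
  have i1: "integrable lborel (\<lambda>t. indicator {x - s..x + s} t * (sqn ?J * d / pi))"
    using s by (intro integrable_mult_left integrable_real_indicator) auto
  have i2: "integrable lborel (\<lambda>t. v t / ((t - x)\<^sup>2 + s\<^sup>2))" using poi_integrable[of "Complex x s"] s by simp
  have "sqn ?J = (LINT t|lborel. ?k t)" by (simp add: sqn_def)
  also have "\<dots> \<le> (LINT t|lborel. indicator {x - s..x + s} t * (sqn ?J * d / pi) + 2 * (v t / ((t - x)\<^sup>2 + s\<^sup>2)))"
  proof (rule integral_mono[OF quot_sq_integrable[OF J] Bochner_Integration.integrable_add[OF i1 integrable_mult_right[OF i2]]])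
    fix t
    have v0: "0 \<le> v t / ((t - x)\<^sup>2 + s\<^sup>2)" by (intro divide_nonneg_nonneg add_nonneg_nonneg) auto
    show "?k t \<le> indicator {x - s..x + s} t * (sqn ?J * d / pi) + 2 * (v t / ((t - x)\<^sup>2 + s\<^sup>2))"
    proof (cases "t \<in> {x - s..x + s}")
      case True
      then have "\<bar>t - x\<bar> \<le> s" by auto
      then have "sqn ?J * \<phi>' t / pi \<le> sqn ?J * d / pi"
        using le by (intro divide_right_mono mult_left_mono sqn_nonneg) auto
      moreover have "indicator {x - s..x + s} t = (1 :: real)" using True by simp
      ultimately show ?thesis using eval_ratio[OF J, of t] v0 by (simp only:)
    next
      case False
      then have "s \<le> \<bar>t - x\<bar>" by auto
      then have "s\<^sup>2 \<le> (t - x)\<^sup>2" using s by (metis less_imp_le power2_abs power_mono)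
      then have le2: "(t - x)\<^sup>2 + s\<^sup>2 \<le> 2 * (t - x)\<^sup>2" by simp
      have p: "0 < (t - x)\<^sup>2 + s\<^sup>2" using s by (intro add_nonneg_pos) auto
      have "?k t * ((t - x)\<^sup>2 + s\<^sup>2) \<le> ?k t * (2 * (t - x)\<^sup>2)" by (rule mult_left_mono[OF le2]) simp
      also have "\<dots> = 2 * v t" unfolding vk by simp
      finally have "?k t \<le> 2 * v t / ((t - x)\<^sup>2 + s\<^sup>2)" using p by (simp only: pos_le_divide_eq)
      then show ?thesis using False by simp
    qed
  qed
  also have "\<dots> = 2 * s * (sqn ?J * d / pi) + 2 * poi (Complex x s)"
    unfolding Bochner_Integration.integral_add[OF i1 integrable_mult_right[OF i2]] integral_mult_left_zero integral_mult_right_zero poi_def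
    using s by simp
  also have "2 * s * (sqn ?J * d / pi) \<le> sqn ?J / 2"
  proof -
    have "sqn ?J * (4 * s * d) \<le> sqn ?J * pi" by (rule mult_left_mono[OF sd sqn_nonneg])
    then have "sqn ?J * (4 * s * d) / (2 * pi) \<le> sqn ?J * pi / (2 * pi)" by (rule divide_right_mono) simp
    then show ?thesis by (simp add: mult_ac)
  qed
  finally show ?thesis by simp
qed

text \<open>m vanishes at x, so m(x + i s) is the integral of a difference of two Cauchy kernels, of
  modulus s/(a b) <= s/2 (1/a^2 + 1/b^2), where a and b are the distances of t to x + i s and to x.
  The two terms integrate to poi and to at most 4 poi, by \<open>local_mass\<close>, and s poi is
  the imaginary part of m.\<close>

lemma m_local:
  assumes x: "x \<in> X" and s: "0 < s" and d: "0 < d" and sd: "4 * s * d \<le> pi"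
    and le: "\<And>t. \<bar>t - x\<bar> \<le> s \<Longrightarrow> \<phi>' t \<le> d"
  shows "cmod (m (Complex x s)) \<le> 5 / 2 * Im (m (Complex x s))"
proof -
  let ?J = "quot h (of_real x)" and ?z = "Complex x s"
  have J: "?J \<in> deBranges E" by (rule deBranges_quot[OF hB X_zero[OF x]])
  let ?k = "\<lambda>t. (cmod (?J (of_real t) / E (of_real t)))\<^sup>2"
  have vk: "v t = (t - x)\<^sup>2 * ?k t" for t unfolding v_def by (rule quot_norm_sq[of h x, OF X_zero[OF x]])
  have z: "Im ?z \<noteq> 0" using s by simp
  have j1: "integrable lborel (\<lambda>t. u2 t / (of_real t - ?z))" by (rule ctrans_integrable[OF u2_integrable z])
  have j2: "integrable lborel (\<lambda>t. u2 t / (of_real t - of_real x))" by (rule X_pole(1)[OF x])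
  have i2: "integrable lborel (\<lambda>t. v t / ((t - x)\<^sup>2 + s\<^sup>2))" using poi_integrable[of ?z] s by simp
  have "m ?z = (LINT t|lborel. u2 t / (of_real t - ?z)) - (LINT t|lborel. u2 t / (of_real t - of_real x))"
    using X_pole(2)[OF x] unfolding m_def ctrans_def by (simp add: algebra_simps eq_neg_iff_add_eq_0)
  also have "\<dots> = (LINT t|lborel. u2 t / (of_real t - ?z) - u2 t / (of_real t - of_real x))"
    by (rule Bochner_Integration.integral_diff[OF j1 j2, symmetric])
  finally have "cmod (m ?z) = cmod (LINT t|lborel. u2 t / (of_real t - ?z) - u2 t / (of_real t - of_real x))" by simp
  also have "\<dots> \<le> (LINT t|lborel. s / 2 * (v t / ((t - x)\<^sup>2 + s\<^sup>2) + ?k t))"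
  proof (rule norm_integral_le[OF Bochner_Integration.integrable_diff[OF j1 j2]
        integrable_mult_right[OF Bochner_Integration.integrable_add[OF i2 quot_sq_integrable[OF J]]]])
    fix t
    show "cmod (u2 t / (of_real t - ?z) - u2 t / (of_real t - of_real x)) \<le> s / 2 * (v t / ((t - x)\<^sup>2 + s\<^sup>2) + ?k t)"
    proof (cases "t = x")
      case True
      then have "v t = 0" using vk[of t] by simp
      then show ?thesis using s by (simp add: u2_def)
    next
      case False
      define a where "a = cmod (of_real t - ?z)"
      define b where "b = \<bar>t - x\<bar>"
      have a2: "a\<^sup>2 = (t - x)\<^sup>2 + s\<^sup>2" unfolding a_def cmod_sq_of_real_diff by simp
      have b0: "0 < b" using False by (simp add: b_def)
      have "s \<le> a" using abs_Im_le_pole_dist[of ?z t] s unfolding a_def by simp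
      then have a0: "0 < a" using s by linarith
      have n1: "of_real t - ?z \<noteq> 0" using a0 unfolding a_def zero_less_norm_iff .
      have n2: "complex_of_real t - of_real x \<noteq> 0" using False by simp
      have e: "u2 t / (of_real t - ?z) - u2 t / (of_real t - of_real x) = u2 t * (\<i> * of_real s) / ((of_real t - ?z) * (of_real t - of_real x))"
      proof -
        have "(of_real t - of_real x) - (of_real t - ?z) = \<i> * of_real s" by (simp add: complex_eq_iff)
        then show ?thesis unfolding diff_frac_eq[OF n1 n2] right_diff_distrib[symmetric] by (simp only:)
      qed
      have bn: "cmod (complex_of_real t - of_real x) = b" unfolding of_real_diff[symmetric] norm_of_real b_def ..
      have "cmod (u2 t / (of_real t - ?z) - u2 t / (of_real t - of_real x)) = v t * s / (a * b)"
        unfolding e unfolding norm_divide norm_mult bn a_def[symmetric] u2_def norm_of_real using s by simp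
      also have "\<dots> \<le> s / 2 * (v t / a\<^sup>2 + v t / b\<^sup>2)"
      proof -
        have "0 \<le> (1 / a - 1 / b)\<^sup>2" by simp
        then have "1 / (a * b) \<le> (1 / a\<^sup>2 + 1 / b\<^sup>2) / 2" by (simp add: power2_diff power_divide)
        then have "v t * s * (1 / (a * b)) \<le> v t * s * ((1 / a\<^sup>2 + 1 / b\<^sup>2) / 2)" using s by (intro mult_left_mono) auto
        then show ?thesis by (simp add: distrib_left mult_ac add_divide_distrib)
      qed
      also have "v t / b\<^sup>2 = ?k t" unfolding vk[of t] b_def using False by simp
      finally show ?thesis unfolding a2 .
    qed
  qed
  also have "\<dots> = s / 2 * (poi ?z + sqn ?J)"
    unfolding integral_mult_right_zero Bochner_Integration.integral_add[OF i2 quot_sq_integrable[OF J]]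
    by (simp add: poi_def sqn_def)
  also have "\<dots> \<le> s / 2 * (5 * poi ?z)"
    using local_mass[OF x s d sd le] s by (intro mult_left_mono) auto
  also have "\<dots> = 5 / 2 * Im (m ?z)" unfolding Im_m[OF z] by simp
  finally show ?thesis .
qed

text \<open>With J = h/((z - x1)(z - x2)) and k = |J/E|^2, the vanishing of m at both points says
  that (t - x1)(t - x2) k has integral zero. Outside the interval enlarged by \<delta> the product
  is at least 2 \<delta>^2, inside at least -\<delta>^2/4, so enough of k lies inside, where it is
  at most \<open>sqn J\<close> phi'/pi. The phase must then increase by at least 8 pi/9 > 1.\<close>

lemma X_spacing:
  assumes x1: "x1 \<in> X" and x2: "x2 \<in> X" and lt: "x1 < x2" and \<delta>: "\<delta> = x2 - x1"
  shows "1 \<le> \<phi> (x2 + \<delta>) - \<phi> (x1 - \<delta>)"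
proof -
  let ?J1 = "quot h (of_real x1)"
  let ?J = "quot ?J1 (of_real x2)"
  have d0: "0 < \<delta>" using lt \<delta> by simp
  have h1: "h (of_real x1) = 0" and h2: "h (of_real x2) = 0" by (rule X_zero[OF x1], rule X_zero[OF x2])
  have J1: "?J1 \<in> deBranges E" by (rule deBranges_quot[OF hB h1])
  have "h (of_real x2) = (of_real x2 - of_real x1) * ?J1 (of_real x2)" by (rule quot_factor[of h "of_real x1", OF h1])
  then have J1z: "?J1 (of_real x2) = 0" using h2 lt by simp
  have J: "?J \<in> deBranges E" by (rule deBranges_quot[OF J1 J1z])
  let ?k = "\<lambda>t. (cmod (?J (of_real t) / E (of_real t)))\<^sup>2"
  let ?Q = "sqn ?J"
  have vk: "v t = (t - x1)\<^sup>2 * ((t - x2)\<^sup>2 * ?k t)" for t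
    unfolding v_def quot_norm_sq[of h x1, OF h1] quot_norm_sq[of ?J1 x2, OF J1z] ..
  have "?Q \<noteq> 0"
  proof
    assume "?Q = 0"
    then have "?J z = 0" for z by (rule sqn_eq_0[OF J])
    then have "?J1 z = 0" for z using quot_factor[of ?J1 "of_real x2" z, OF J1z] by simp
    then have "h z = 0" for z using quot_factor[of h "of_real x1" z, OF h1] by simp
    then show False using h_nonzero by blast
  qed
  then have Q0: "0 < ?Q" using sqn_nonneg[of ?J] by linarith
  let ?f = "\<lambda>t. - \<delta> * ((t - x1) * (t - x2) * ?k t)"
  have j1: "integrable lborel (\<lambda>t. u2 t / (of_real t - of_real x1))" and j2: "integrable lborel (\<lambda>t. u2 t / (of_real t - of_real x2))"
    by (rule X_pole(1)[OF x1], rule X_pole(1)[OF x2])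
  have e: "u2 t / (of_real t - of_real x1) - u2 t / (of_real t - of_real x2) = of_real (?f t)" for t
  proof -
    have r: "v t / (t - x1) - v t / (t - x2) = ?f t"
    proof (cases "t = x1 \<or> t = x2")
      case True
      then have "v t = 0" using vk[of t] by auto
      then show ?thesis using True by auto
    next
      case False
      then have n: "t - x1 \<noteq> 0" "t - x2 \<noteq> 0" by auto
      have "v t / (t - x1) = (t - x1) * ((t - x2)\<^sup>2 * ?k t)" "v t / (t - x2) = (t - x1)\<^sup>2 * ((t - x2) * ?k t)"
        unfolding vk[of t] using n by (simp_all add: power2_eq_square)
      then show ?thesis unfolding \<delta> by (simp only:) (simp add: power2_eq_square algebra_simps)
    qed
    show ?thesis unfolding r[symmetric] u2_def by simp
  qed
  have jc: "integrable lborel (\<lambda>t. complex_of_real (?f t))"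
    using Bochner_Integration.integrable_diff[OF j1 j2] unfolding e .
  have fi: "integrable lborel ?f" using integrable_Re[OF jc] by simp
  have "(LINT t|lborel. complex_of_real (?f t)) = (LINT t|lborel. u2 t / (of_real t - of_real x1)) - (LINT t|lborel. u2 t / (of_real t - of_real x2))"
    unfolding e[symmetric] by (rule Bochner_Integration.integral_diff[OF j1 j2])
  also have "\<dots> = 0" using X_pole(2)[OF x1] X_pole(2)[OF x2] by (simp add: add_eq_0_iff)
  finally have "complex_of_real (LINT t|lborel. ?f t) = 0" unfolding integral_complex_of_real .
  then have f0: "(LINT t|lborel. ?f t) = 0" by (simp only: of_real_eq_0_iff)
  let ?a = "x1 - \<delta>" and ?b = "x2 + \<delta>"
  have ab: "?a \<le> ?b" using d0 lt by simp
  have cont: "isCont \<phi>' t" for t using phase_deriv_continuous[of UNIV] by (simp add: continuous_on_eq_continuous_at)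
  have pi1: "integrable lborel (\<lambda>t. \<phi>' t * indicator {?a..?b} t)"
    using borel_integrable_atLeastAtMost[of ?a ?b \<phi>'] cont by (simp add: mult.commute)
  have pi2: "(LINT t|lborel. \<phi>' t * indicator {?a..?b} t) = \<phi> ?b - \<phi> ?a"
    by (rule integral_FTC_Icc_real[OF ab]) (auto simp: cont phase_deriv)
  \<comment> \<open>9/4 is 2 + 1/4: adding 2 \<delta>^3 k makes the integrand nonpositive outside
    the enlarged interval and at most 9/4 \<delta>^3 k inside.\<close>
  let ?c = "9 / 4 * \<delta> ^ 3 * (?Q / pi)"
  have "2 * \<delta> ^ 3 * ?Q = (LINT t|lborel. ?f t + 2 * \<delta> ^ 3 * ?k t)"
    unfolding Bochner_Integration.integral_add[OF fi integrable_mult_right[OF quot_sq_integrable[OF J]]] integral_mult_right_zero[of _ "2 * \<delta> ^ 3"] f0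
    by (simp add: sqn_def)
  also have "\<dots> \<le> (LINT t|lborel. ?c * (\<phi>' t * indicator {?a..?b} t))"
  proof (rule integral_mono[OF Bochner_Integration.integrable_add[OF fi integrable_mult_right[OF quot_sq_integrable[OF J]]] integrable_mult_right[OF pi1]])
    fix t
    have eq: "?f t + 2 * \<delta> ^ 3 * ?k t = \<delta> * (2 * \<delta>\<^sup>2 - (t - x1) * (t - x2)) * ?k t"
      by (simp add: power2_eq_square power3_eq_cube algebra_simps)
    show "?f t + 2 * \<delta> ^ 3 * ?k t \<le> ?c * (\<phi>' t * indicator {?a..?b} t)"
    proof (cases "t \<in> {?a..?b}")
      case True
      have "0 \<le> (2 * t - x1 - x2)\<^sup>2" by simp
      moreover have "(2 * t - x1 - x2)\<^sup>2 = 4 * ((t - x1) * (t - x2)) + \<delta>\<^sup>2"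
        unfolding \<delta> by (simp add: power2_eq_square algebra_simps)
      ultimately have "- (\<delta>\<^sup>2 / 4) \<le> (t - x1) * (t - x2)" by linarith
      then have "\<delta> * (2 * \<delta>\<^sup>2 - (t - x1) * (t - x2)) * ?k t \<le> \<delta> * (9 / 4 * \<delta>\<^sup>2) * ?k t"
        using d0 by (intro mult_right_mono mult_left_mono) auto
      also have "\<dots> \<le> \<delta> * (9 / 4 * \<delta>\<^sup>2) * (?Q * \<phi>' t / pi)"
        using d0 eval_ratio[OF J, of t] by (intro mult_left_mono) auto
      also have "\<dots> = ?c * (\<phi>' t * indicator {?a..?b} t)" using True by (simp add: power2_eq_square power3_eq_cube)
      finally show ?thesis unfolding eq .
    next
      case False
      have "2 * \<delta> * \<delta> \<le> (t - x1) * (t - x2)"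
      proof (cases "t < ?a")
        case True
        then have "(2 * \<delta>) * \<delta> \<le> (x2 - t) * (x1 - t)" using d0 \<delta> by (intro mult_mono) auto
        then show ?thesis by (simp add: algebra_simps)
      next
        case f: False
        then have "t > ?b" using False by auto
        then show ?thesis using d0 \<delta> by (intro mult_mono) auto
      qed
      then have "2 * \<delta>\<^sup>2 - (t - x1) * (t - x2) \<le> 0" by (simp add: power2_eq_square)
      then have "\<delta> * (2 * \<delta>\<^sup>2 - (t - x1) * (t - x2)) * ?k t \<le> 0"
        using d0 by (intro mult_nonpos_nonneg mult_nonneg_nonpos) auto
      then show ?thesis unfolding eq using False by simp
    qed
  qed
  also have "\<dots> = ?c * (\<phi> ?b - \<phi> ?a)" unfolding integral_mult_right_zero[of _ ?c] pi2 ..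
  finally have F: "2 * \<delta> ^ 3 * ?Q \<le> ?c * (\<phi> ?b - \<phi> ?a)" .
  have e1: "2 * d * q = (d * q) * 2" and e2: "9 / 4 * d * (q / pi) * W = (d * q) * (9 / 4 * W / pi)" for d q W :: real
    by simp_all
  have "(\<delta> ^ 3 * ?Q) * 2 \<le> (\<delta> ^ 3 * ?Q) * (9 / 4 * (\<phi> ?b - \<phi> ?a) / pi)" using F unfolding e1 e2 .
  moreover have "0 < \<delta> ^ 3 * ?Q" using d0 Q0 by simp
  ultimately have "2 \<le> 9 / 4 * (\<phi> ?b - \<phi> ?a) / pi" by (simp only: mult_le_cancel_left_pos)
  then have "2 * pi \<le> 9 / 4 * (\<phi> ?b - \<phi> ?a)" using pi_gt_zero by (simp only: pos_le_divide_eq)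
  then show ?thesis using pi_gt3 unfolding right_diff_distrib by linarith
qed

end

section \<open>A weak type bound\<close>

text \<open>A bounded holomorphic function on the open half plane need not extend to the real line;
  from the line of height \<sigma> upwards it is continuous and \<open>bounded_Poisson\<close>
  applies.\<close>

lemma Poisson_shift:
  assumes hol: "f holomorphic_on {z. 0 < Im z}" and bd: "\<forall>z. 0 < Im z \<longrightarrow> cmod (f z) \<le> B"
    and \<sigma>: "0 < \<sigma>" and w: "\<sigma> < Im w"
  shows "(LINT t|lborel. f (Complex t \<sigma>) / of_real ((t - Re w)\<^sup>2 + (Im w - \<sigma>)\<^sup>2)) = of_real (pi / (Im w - \<sigma>)) * f w"
proof -
  define s where "s = \<i> * complex_of_real \<sigma>"
  have Is: "Im s = \<sigma>" "Re s = 0" by (simp_all add: s_def)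
  have e: "of_real t + s = Complex t \<sigma>" for t by (simp add: complex_eq_iff Is)
  have h2: "(\<lambda>z. f (z + s)) holomorphic_on {z. - \<sigma> < Im z}"
  proof -
    have "(f \<circ> (\<lambda>z. z + s)) holomorphic_on {z. - \<sigma> < Im z}"
      by (rule holomorphic_on_compose_gen[OF _ hol]) (auto simp: Is intro!: holomorphic_intros)
    then show ?thesis by (simp add: o_def)
  qed
  have "(LINT t|lborel. (\<lambda>z. f (z + s)) (of_real t) / of_real ((t - Re (w - s))\<^sup>2 + (Im (w - s))\<^sup>2))
      = of_real (pi / Im (w - s)) * (\<lambda>z. f (z + s)) (w - s)"
  proof (rule bounded_Poisson)
    show "continuous_on {z. 0 \<le> Im z} (\<lambda>z. f (z + s))"
      by (rule continuous_on_subset[OF holomorphic_on_imp_continuous_on[OF h2]]) (use \<sigma> in auto)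
    show "(\<lambda>z. f (z + s)) holomorphic_on {z. 0 < Im z}"
      by (rule holomorphic_on_subset[OF h2]) (use \<sigma> in auto)
    show "cmod (f (z + s)) \<le> B" if "0 \<le> Im z" for z using bd that \<sigma> Is by simp
    show "0 < Im (w - s)" using w Is by simp
  qed
  then show ?thesis by (simp add: e Is)
qed

lemma Poisson_shift_Re:
  assumes hol: "f holomorphic_on {z. 0 < Im z}" and bd: "\<forall>z. 0 < Im z \<longrightarrow> cmod (f z) \<le> B"
    and \<sigma>: "0 < \<sigma>" and w: "\<sigma> < Im w"
  shows "integrable lborel (\<lambda>t. Re (f (Complex t \<sigma>)) / ((t - Re w)\<^sup>2 + (Im w - \<sigma>)\<^sup>2))"
    and "(LINT t|lborel. Re (f (Complex t \<sigma>)) / ((t - Re w)\<^sup>2 + (Im w - \<sigma>)\<^sup>2)) = pi / (Im w - \<sigma>) * Re (f w)"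
proof -
  let ?F = "\<lambda>t. f (Complex t \<sigma>) / of_real ((t - Re w)\<^sup>2 + (Im w - \<sigma>)\<^sup>2)"
  have "continuous_on UNIV (\<lambda>t. f (Complex t \<sigma>))"
    by (rule continuous_on_compose2[OF holomorphic_on_imp_continuous_on[OF hol]])
       (use \<sigma> in \<open>auto simp: Complex_eq intro!: continuous_intros\<close>)
  then have fm: "(\<lambda>t. f (Complex t \<sigma>)) \<in> borel_measurable borel" by (rule borel_measurable_continuous_onI)
  have i: "integrable lborel ?F"
  proof (rule Bochner_Integration.integrable_bound)
    show "integrable lborel (\<lambda>t. B * (1 / ((t - Re w)\<^sup>2 + (Im w - \<sigma>)\<^sup>2)))"
      by (rule integrable_mult_right[OF poisson_kernel_integrable]) (use w in simp)
    have "(\<lambda>t. complex_of_real ((t - Re w)\<^sup>2 + (Im w - \<sigma>)\<^sup>2)) \<in> borel_measurable borel" by measurable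
    then show "?F \<in> borel_measurable lborel" using borel_measurable_divide[OF fm] by simp
    show "AE t in lborel. cmod (?F t) \<le> norm (B * (1 / ((t - Re w)\<^sup>2 + (Im w - \<sigma>)\<^sup>2)))"
    proof (rule AE_I2)
      fix t
      have "0 < (t - Re w)\<^sup>2 + (Im w - \<sigma>)\<^sup>2" using w by (intro add_nonneg_pos) auto
      moreover have "cmod (f (Complex t \<sigma>)) \<le> B" using bd \<sigma> by simp
      ultimately have "cmod (?F t) \<le> B / ((t - Re w)\<^sup>2 + (Im w - \<sigma>)\<^sup>2)"
        unfolding norm_divide norm_of_real by (simp add: divide_right_mono)
      then show "cmod (?F t) \<le> norm (B * (1 / ((t - Re w)\<^sup>2 + (Im w - \<sigma>)\<^sup>2)))"
        using abs_ge_self[of "B / ((t - Re w)\<^sup>2 + (Im w - \<sigma>)\<^sup>2)"] by simp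
    qed
  qed
  have e: "Re (?F t) = Re (f (Complex t \<sigma>)) / ((t - Re w)\<^sup>2 + (Im w - \<sigma>)\<^sup>2)" for t by (rule Re_divide_of_real)
  show "integrable lborel (\<lambda>t. Re (f (Complex t \<sigma>)) / ((t - Re w)\<^sup>2 + (Im w - \<sigma>)\<^sup>2))"
    using integrable_Re[OF i] unfolding e .
  have "(LINT t|lborel. Re (?F t)) = Re (of_real (pi / (Im w - \<sigma>)) * f w)"
    unfolding integral_Re[OF i] Poisson_shift[OF hol bd \<sigma> w] ..
  then show "(LINT t|lborel. Re (f (Complex t \<sigma>)) / ((t - Re w)\<^sup>2 + (Im w - \<sigma>)\<^sup>2)) = pi / (Im w - \<sigma>) * Re (f w)"
    unfolding e Re_complex_of_real mult.commute[of "complex_of_real _"] by simp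
qed

text \<open>Both values are Poisson integrals over the line of height s/4, taken 3 s/4 and s/4 above
  it. The first kernel is at most twice the second, and the normalisations pi/height contribute a
  factor 3.\<close>

lemma Poisson_Harnack:
  assumes hol: "f holomorphic_on {z. 0 < Im z}" and bd: "\<forall>z. 0 < Im z \<longrightarrow> cmod (f z) \<le> B"
    and pos: "\<forall>z. 0 < Im z \<longrightarrow> 0 \<le> Re (f z)" and s: "0 < s" and t: "\<bar>t - x\<bar> \<le> s / 2"
  shows "Re (f (Complex x s)) \<le> 6 * Re (f (Complex t (s / 2)))"
proof -
  have s4: "0 < s / 4" "s / 4 < Im (Complex x s)" "s / 4 < Im (Complex t (s / 2))" using s by auto
  note P1 = Poisson_shift_Re[OF hol bd s4(1,2)] and P2 = Poisson_shift_Re[OF hol bd s4(1,3)]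
  have "pi / (Im (Complex x s) - s / 4) * Re (f (Complex x s)) \<le>
      (LINT u|lborel. 2 * (Re (f (Complex u (s / 4))) / ((u - Re (Complex t (s / 2)))\<^sup>2 + (Im (Complex t (s / 2)) - s / 4)\<^sup>2)))"
    unfolding P1(2)[symmetric]
  proof (rule integral_mono[OF P1(1) integrable_mult_right[OF P2(1)]])
    fix u
    let ?a = "(u - x)\<^sup>2 + (s - s / 4)\<^sup>2" and ?b = "(u - t)\<^sup>2 + (s / 2 - s / 4)\<^sup>2"
    \<comment> \<open>The parallelogram identity for u - t = (u - x) - (t - x), with p the square
      that is dropped, reduces the comparison to linear arithmetic in y, which stands for
      s^2.\<close>
    have gen: "q + k2 \<le> 2 * (r + k1)"
      if "a \<le> b" "0 \<le> p" "q + p = 2 * r + 2 * a" "b = 1 / 4 * y" "k1 = 9 / 16 * y" "k2 = 1 / 16 * y" "0 \<le> y"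
      for a b p q r y k1 k2 :: real using that unfolding distrib_left by linarith
    have "(t - x)\<^sup>2 \<le> (s / 2)\<^sup>2" using t by (metis abs_ge_zero power2_abs power_mono)
    then have le: "?b \<le> 2 * ?a"
      by (rule gen[where p = "((u - x) + (t - x))\<^sup>2" and y = "s\<^sup>2"]) (simp, simp_all add: power2_eq_square field_simps)
    have b0: "0 < ?b" using s by (intro add_nonneg_pos) auto
    have r0: "0 \<le> Re (f (Complex u (s / 4)))" using pos s by simp
    have "2 * Re (f (Complex u (s / 4))) / (2 * ?a) \<le> 2 * Re (f (Complex u (s / 4))) / ?b"
      using le b0 r0 by (intro divide_left_mono mult_pos_pos) auto
    moreover have e: "2 * y / (2 * q) = y / q" for y q :: real by simp
    ultimately have "Re (f (Complex u (s / 4))) / ?a \<le> 2 * Re (f (Complex u (s / 4))) / ?b" by (simp only: e)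
    then show "Re (f (Complex u (s / 4))) / ((u - Re (Complex x s))\<^sup>2 + (Im (Complex x s) - s / 4)\<^sup>2)
      \<le> 2 * (Re (f (Complex u (s / 4))) / ((u - Re (Complex t (s / 2)))\<^sup>2 + (Im (Complex t (s / 2)) - s / 4)\<^sup>2))" by simp
  qed
  also have "\<dots> = 2 * (pi / (Im (Complex t (s / 2)) - s / 4) * Re (f (Complex t (s / 2))))"
    unfolding integral_mult_right_zero P2(2) ..
  finally have "pi * (4 / (3 * s) * Re (f (Complex x s))) \<le> pi * (8 / s * Re (f (Complex t (s / 2))))"
    using s by (simp add: field_simps)
  then have "4 / (3 * s) * Re (f (Complex x s)) \<le> 8 / s * Re (f (Complex t (s / 2)))"
    using pi_gt_zero by (simp only: mult_le_cancel_left_pos)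
  then show ?thesis using s by (simp add: field_simps)
qed

text \<open>A quantitative form of the weak type $(1,1)$ bound for the Cauchy transform: the Cayley
  transform of the Cauchy transform has a positive real part that is bounded below near the points
  where the transform is large, and its Poisson integral at a high point is small.\<close>

lemma ctrans_weak_type:
  fixes v2 :: "real \<Rightarrow> real"
  assumes int: "integrable lborel v2" and nn: "\<And>t. 0 \<le> v2 t" and mass: "(LINT t|lborel. v2 t) \<le> \<epsilon>"
    and S: "finite S" "S \<subseteq> {\<alpha>..\<beta>}" and r: "\<beta> - \<alpha> \<le> r"
    and sep: "\<And>x y. x \<in> S \<Longrightarrow> y \<in> S \<Longrightarrow> x \<noteq> y \<Longrightarrow> \<delta> \<le> \<bar>x - y\<bar>"
    and \<delta>: "0 < \<delta>" "2 * \<delta> \<le> s" and s: "s \<le> r" and \<mu>: "0 < \<mu>"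
    and lower: "\<And>x. x \<in> S \<Longrightarrow> \<mu> \<le> cmod (ctrans (\<lambda>t. of_real (v2 t)) (Complex x s))"
  shows "real (card S) * \<delta> \<le> 60 * pi * \<epsilon> / \<mu>"
proof -
  let ?u = "\<lambda>t. complex_of_real (v2 t)"
  define f where "f = ctrans ?u"
  \<comment> \<open>The factor -i moves the nonnegative imaginary part of f into the real part. Then
    q has modulus at most 1, and real part at least 1/2 wherever |f| >= \<mu>.\<close>
  define p where "p = (\<lambda>z. - \<i> * f z)"
  define q where "q = (\<lambda>z. p z / (p z + of_real \<mu>))"
  have s0: "0 < s" and r0: "0 < r" using \<delta> s by auto
  have ui: "integrable lborel ?u" by (rule integrable_of_real[OF int])
  have fpos: "0 \<le> Im (f z)" if z: "0 < Im z" for z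
  proof -
    have i: "integrable lborel (\<lambda>t. ?u t / (of_real t - z))" by (rule ctrans_integrable[OF ui]) (use z in simp)
    have "Im (?u t / (of_real t - z)) = v2 t * Im z / ((t - Re z)\<^sup>2 + (Im z)\<^sup>2)" for t
      by (simp add: Im_divide)
    then have "0 \<le> Im (?u t / (of_real t - z))" for t using nn z by (simp only:) (intro divide_nonneg_nonneg mult_nonneg_nonneg add_nonneg_nonneg, auto)
    then show ?thesis unfolding f_def ctrans_def integral_Im[OF i, symmetric] by (intro integral_nonneg_AE AE_I2)
  qed
  have pRe: "Re (p z) = Im (f z)" "Im (p z) = - Re (f z)" for z by (simp_all add: p_def)
  have ppos: "0 \<le> Re (p z)" if "0 < Im z" for z using fpos[OF that] by (simp add: pRe)
  have pn: "cmod (p z) = cmod (f z)" for z unfolding p_def norm_mult by simp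
  have den: "\<mu> \<le> cmod (p z + of_real \<mu>)" if "0 < Im z" for z
    using abs_Re_le_cmod[of "p z + of_real \<mu>"] ppos[OF that] by simp
  have dnz: "p z + of_real \<mu> \<noteq> 0" if "0 < Im z" for z using den[OF that] \<mu> by auto
  have hol: "q holomorphic_on {z. 0 < Im z}"
    unfolding q_def p_def f_def
    by (intro holomorphic_on_divide holomorphic_on_mult holomorphic_on_add holomorphic_on_const ctrans_holomorphic[OF ui])
       (use dnz[unfolded p_def f_def] in auto)
  have q1: "cmod (q z) \<le> 1" if z: "0 < Im z" for z
  proof -
    have "(Re (p z))\<^sup>2 \<le> (Re (p z) + \<mu>)\<^sup>2" using ppos[OF z] \<mu> by (intro power_mono) auto
    then have "cmod (p z) \<le> cmod (p z + of_real \<mu>)" unfolding cmod_def by (intro real_sqrt_le_mono) simp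
    moreover have "0 < cmod (p z + of_real \<mu>)" using dnz[OF z] by simp
    ultimately show ?thesis unfolding q_def norm_divide by simp
  qed
  have qRe: "Re (q z) = (Re (p z) * (Re (p z) + \<mu>) + (Im (p z))\<^sup>2) / ((Re (p z) + \<mu>)\<^sup>2 + (Im (p z))\<^sup>2)" for z
    unfolding q_def Re_divide by (simp add: power2_eq_square)
  have qpos: "0 \<le> Re (q z)" if "0 < Im z" for z
    unfolding qRe using ppos[OF that] \<mu> by (intro divide_nonneg_nonneg add_nonneg_nonneg mult_nonneg_nonneg) auto
  have qhalf: "1 / 2 \<le> Re (q z)" if z: "0 < Im z" "\<mu> \<le> cmod (f z)" for z
  proof -
    have "\<mu>\<^sup>2 \<le> (cmod (p z))\<^sup>2" using z \<mu> by (intro power_mono) (auto simp: pn)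
    then have "\<mu>\<^sup>2 \<le> (Re (p z))\<^sup>2 + (Im (p z))\<^sup>2" unfolding cmod_power2 .
    then have "(Re (p z) + \<mu>)\<^sup>2 + (Im (p z))\<^sup>2 \<le> 2 * (Re (p z) * (Re (p z) + \<mu>) + (Im (p z))\<^sup>2)"
      by (simp add: power2_eq_square algebra_simps)
    moreover have "0 < (Re (p z) + \<mu>)\<^sup>2 + (Im (p z))\<^sup>2" using ppos[OF z(1)] \<mu> by (intro add_pos_nonneg) auto
    ultimately show ?thesis unfolding qRe by (simp add: field_simps)
  qed
  \<comment> \<open>Seen from height r above the line of height s/2, every point of the window is at
    distance comparable with r, while |f| at this point is at most \<epsilon>/r.\<close>
  let ?w = "Complex \<alpha> (s / 2 + r)"
  have s2: "0 < s / 2" "s / 2 < Im ?w" using s0 r0 by auto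
  have q1': "\<forall>z. 0 < Im z \<longrightarrow> cmod (q z) \<le> 1" and qpos': "\<forall>z. 0 < Im z \<longrightarrow> 0 \<le> Re (q z)"
    using q1 qpos by blast+
  note P = Poisson_shift_Re[OF hol q1' s2]
  let ?I = "\<lambda>x. {x..<x + \<delta>}"
  \<comment> \<open>60 is 12 times 5: Harnack turns 1/2 into 1/12, and (t - \<alpha>)^2 + r^2 <= 5
    r^2 because |t - \<alpha>| <= 2 r.\<close>
  let ?G = "\<lambda>t. \<Sum>x\<in>S. indicator (?I x) t * (1 / (60 * r\<^sup>2))"
  have Gi: "integrable lborel (\<lambda>t. indicator (?I x) t * (1 / (60 * r\<^sup>2)))" for x
    using \<delta> by (intro integrable_mult_left integrable_real_indicator) auto
  have "(LINT t|lborel. ?G t) = (\<Sum>x\<in>S. LINT t|lborel. indicator (?I x) t * (1 / (60 * r\<^sup>2)))"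
    by (rule Bochner_Integration.integral_sum) (rule Gi)
  also have "\<dots> = (\<Sum>x\<in>S. \<delta> * (1 / (60 * r\<^sup>2)))"
    unfolding integral_mult_left_zero using \<delta> by (intro sum.cong) auto
  finally have Gv: "(LINT t|lborel. ?G t) = real (card S) * \<delta> / (60 * r\<^sup>2)" by simp
  have "(LINT t|lborel. ?G t) \<le> (LINT t|lborel. Re (q (Complex t (s / 2))) / ((t - Re ?w)\<^sup>2 + (Im ?w - s / 2)\<^sup>2))"
  proof (rule integral_mono[OF _ P(1)])
    show "integrable lborel ?G" by (rule Bochner_Integration.integrable_sum) (rule Gi)
    fix t
    have q0: "0 \<le> Re (q (Complex t (s / 2)))" by (rule qpos) (use s0 in simp)
    show "?G t \<le> Re (q (Complex t (s / 2))) / ((t - Re ?w)\<^sup>2 + (Im ?w - s / 2)\<^sup>2)"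
    proof (cases "\<exists>x\<in>S. t \<in> ?I x")
      case False
      then have "?G t = 0" by (intro sum.neutral) (auto simp: indicator_def)
      then show ?thesis using q0 by (simp add: divide_nonneg_nonneg)
    next
      case True
      then obtain x where x: "x \<in> S" "t \<in> ?I x" by blast
      have "indicator (?I y) t * (1 / (60 * r\<^sup>2)) = (if y = x then 1 / (60 * r\<^sup>2) else 0)" if y: "y \<in> S" for y
      proof (cases "y = x")
        case True
        then show ?thesis using x by simp
      next
        case False
        have "t \<notin> ?I y"
        proof
          assume "t \<in> ?I y"
          with x(2) have "\<bar>x - y\<bar> < \<delta>" by auto
          with sep[OF x(1) y] False show False by auto
        qed
        then show ?thesis using False by simp
      qed
      then have "?G t = (\<Sum>y\<in>S. if y = x then 1 / (60 * r\<^sup>2) else 0)" by (intro sum.cong) auto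
      also have "\<dots> = 1 / (60 * r\<^sup>2)" using S(1) x(1) by simp
      finally have G: "?G t = 1 / (60 * r\<^sup>2)" .
      have "\<bar>t - x\<bar> \<le> s / 2" using x(2) \<delta> by auto
      from Poisson_Harnack[OF hol q1' qpos' s0 this]
      have "Re (q (Complex x s)) \<le> 6 * Re (q (Complex t (s / 2)))" .
      moreover have "1 / 2 \<le> Re (q (Complex x s))"
        by (rule qhalf) (use s0 lower[OF x(1)] in \<open>auto simp: f_def\<close>)
      ultimately have l: "1 / 12 \<le> Re (q (Complex t (s / 2)))" by linarith
      have "\<bar>t - \<alpha>\<bar> \<le> 2 * r" using x S(2) r \<delta> s by fastforce
      then have "(t - \<alpha>)\<^sup>2 \<le> (2 * r)\<^sup>2" by (metis abs_ge_zero power2_abs power_mono)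
      then have d: "(t - \<alpha>)\<^sup>2 + r\<^sup>2 \<le> 5 * r\<^sup>2" by (simp add: power_mult_distrib)
      have d0: "0 < (t - \<alpha>)\<^sup>2 + r\<^sup>2" using r0 by (intro add_nonneg_pos) auto
      have "1 / (60 * r\<^sup>2) = (1 / 12) / (5 * r\<^sup>2)" by simp
      also have "\<dots> \<le> (1 / 12) / ((t - \<alpha>)\<^sup>2 + r\<^sup>2)" by (rule divide_left_mono[OF d]) (use d0 r0 in auto)
      also have "\<dots> \<le> Re (q (Complex t (s / 2))) / ((t - \<alpha>)\<^sup>2 + r\<^sup>2)" using l d0 by (intro divide_right_mono) auto
      finally show ?thesis unfolding G by simp
    qed
  qed
  also have "\<dots> = pi / r * Re (q ?w)" unfolding P(2) by simp
  also have "\<dots> \<le> pi / r * (\<epsilon> / (r * \<mu>))"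
  proof (rule mult_left_mono)
    have w0: "0 < Im ?w" using s2 by linarith
    have "cmod (f ?w) \<le> (LINT t|lborel. cmod (?u t)) / \<bar>Im ?w\<bar>"
      unfolding f_def by (rule ctrans_bound[OF ui]) (use w0 in linarith)
    also have "(LINT t|lborel. cmod (?u t)) = (LINT t|lborel. v2 t)" using nn by simp
    also have "\<dots> / \<bar>Im ?w\<bar> \<le> \<epsilon> / \<bar>Im ?w\<bar>" using mass by (intro divide_right_mono) auto
    also have "\<dots> \<le> \<epsilon> / r"
    proof (rule divide_left_mono)
      show "0 \<le> \<epsilon>" using mass integral_nonneg_AE[OF AE_I2[of lborel "\<lambda>t. 0 \<le> v2 t"]] nn by fastforce
    qed (use s0 r0 in auto)
    finally have fw: "cmod (f ?w) \<le> \<epsilon> / r" .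
    have "Re (q ?w) \<le> cmod (q ?w)" by (rule complex_Re_le_cmod)
    also have "\<dots> \<le> cmod (f ?w) / \<mu>"
      unfolding q_def norm_divide pn by (rule divide_left_mono[OF den[OF w0] norm_ge_zero]) (rule mult_pos_pos[OF less_le_trans[OF \<mu> den[OF w0]] \<mu>])
    also have "\<dots> \<le> \<epsilon> / r / \<mu>" using fw \<mu> by (intro divide_right_mono) auto
    finally show "Re (q ?w) \<le> \<epsilon> / (r * \<mu>)" by simp
  qed (use r0 in simp)
  finally have "real (card S) * \<delta> / (60 * r\<^sup>2) \<le> pi / r * (\<epsilon> / (r * \<mu>))" unfolding Gv .
  then have "(60 * r\<^sup>2) * (real (card S) * \<delta> / (60 * r\<^sup>2)) \<le> (60 * r\<^sup>2) * (pi / r * (\<epsilon> / (r * \<mu>)))"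
    by (rule mult_left_mono) simp
  then show ?thesis using r0 \<mu> by (simp add: power2_eq_square)
qed

section \<open>The central part and the tail of the measure; sparsity of the extra zeros\<close>

context mixed_orthogonal
begin

definition vin :: "real \<Rightarrow> real \<Rightarrow> real" where "vin T t = v t * indicator {-T..T} t"
definition vout :: "real \<Rightarrow> real \<Rightarrow> real" where "vout T t = v t * indicator (- {-T..T}) t"

lemma vin_integrable: "integrable lborel (vin T)"
  unfolding vin_def[abs_def] by (rule integrable_real_mult_indicator[OF _ v_integrable]) simp

lemma vout_integrable: "integrable lborel (vout T)"
  unfolding vout_def[abs_def] by (rule integrable_real_mult_indicator[OF _ v_integrable]) simp

lemma vin_nonneg: "0 \<le> vin T t" and vout_nonneg: "0 \<le> vout T t"
  by (simp_all add: vin_def vout_def)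

lemma vin_vout: "v t = vin T t + vout T t"
  by (simp add: vin_def vout_def indicator_def)

lemma vin_integral: "(LINT t|lborel. vin T t) = sqn h - (LINT t|lborel. vout T t)"
  unfolding v_integral[symmetric] vin_vout[of _ T] Bochner_Integration.integral_add[OF vin_integrable vout_integrable] by simp

lemma vout_integral_nonneg: "0 \<le> (LINT t|lborel. vout T t)"
  by (intro integral_nonneg_AE AE_I2 vout_nonneg)

lemma vout_small:
  assumes "0 < \<epsilon>"
  shows "\<exists>T>0. (LINT t|lborel. vout T t) \<le> \<epsilon>"
proof -
  have "(\<lambda>n. LINT t|lborel. vout (real n) t) \<longlonglongrightarrow> (LINT t|(lborel :: real measure). 0)"
  proof (rule integral_dominated_convergence[where w = v])
    show "(\<lambda>t. vout (real n) t) \<in> borel_measurable lborel" for n by (rule borel_measurable_integrable[OF vout_integrable])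
    show "AE t in lborel. norm (vout (real n) t) \<le> v t" for n by (intro AE_I2) (simp add: vout_def indicator_def)
    have "(\<lambda>n. vout (real n) t) \<longlonglongrightarrow> 0" for t
    proof (rule tendsto_eventually)
      show "\<forall>\<^sub>F n in sequentially. vout (real n) t = 0"
        using eventually_ge_at_top[of "nat \<lceil>\<bar>t\<bar>\<rceil>"]
      proof eventually_elim
        fix n assume "nat \<lceil>\<bar>t\<bar>\<rceil> \<le> n"
        then have "\<bar>t\<bar> \<le> real n" by (simp only: nat_ceiling_le_eq)
        then show "vout (real n) t = 0" by (simp add: vout_def indicator_def abs_le_iff)
      qed
    qed
    then show "AE t in lborel. (\<lambda>n. vout (real n) t) \<longlonglongrightarrow> 0" by (intro AE_I2)
  qed (simp_all add: v_integrable)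
  then have "(\<lambda>n. LINT t|lborel. vout (real n) t) \<longlonglongrightarrow> 0" by simp
  then have "\<forall>\<^sub>F n in sequentially. (LINT t|lborel. vout (real n) t) < \<epsilon>"
    by (rule order_tendstoD(2)[OF _ assms])
  with eventually_gt_at_top[of "0 :: nat"] have "\<forall>\<^sub>F n in sequentially. 0 < n \<and> (LINT t|lborel. vout (real n) t) < \<epsilon>"
    by eventually_elim simp
  then obtain n :: nat where "0 < n" "(LINT t|lborel. vout (real n) t) < \<epsilon>"
    unfolding eventually_sequentially by blast
  then show ?thesis by (intro exI[of _ "real n"]) auto
qed

abbreviation cin :: "real \<Rightarrow> complex \<Rightarrow> complex" where "cin T \<equiv> ctrans (\<lambda>t. of_real (vin T t))"
abbreviation cout :: "real \<Rightarrow> complex \<Rightarrow> complex" where "cout T \<equiv> ctrans (\<lambda>t. of_real (vout T t))"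

lemma cin_integrable: "Im z \<noteq> 0 \<Longrightarrow> integrable lborel (\<lambda>t. of_real (vin T t) / (of_real t - z))"
  by (rule ctrans_integrable[OF integrable_of_real[OF vin_integrable]])

lemma m_split:
  assumes z: "Im z \<noteq> 0"
  shows "m z = (of_real c + cin T z) + cout T z"
proof -
  have e: "u2 t / (of_real t - z) = of_real (vin T t) / (of_real t - z) + of_real (vout T t) / (of_real t - z)" for t
    unfolding u2_def vin_vout[of t T] by (simp add: add_divide_distrib)
  have "ctrans u2 z = cin T z + cout T z"
    unfolding ctrans_def e
    by (rule Bochner_Integration.integral_add[OF cin_integrable[OF z] ctrans_integrable[OF integrable_of_real[OF vout_integrable] z]])
  then show ?thesis by (simp add: m_def)
qed

lemma far_pole:
  assumes "3 * T \<le> cmod z" "t \<in> {-T..T}"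
  shows "2 / 3 * cmod z \<le> cmod (of_real t - z)"
proof -
  have "cmod z \<le> cmod (of_real t - z) + cmod (complex_of_real t)"
    using norm_triangle_ineq4[of "of_real t" "of_real t - z"] by (simp add: add.commute)
  moreover have "cmod (complex_of_real t) \<le> T" unfolding norm_of_real using assms(2) by (simp add: abs_le_iff)
  ultimately show ?thesis using assms(1) by linarith
qed

text \<open>Let mu be the mass of the central part. For c = 0 the transform is close to -mu/z: z/(t
  - z) + 1 = t/(t - z) has modulus at most 1/2 for |t| <= T <= |z|/3. For c nonzero the constant
  dominates, the transform being at most 3 mu/(2 |z|) <= |c|/2.\<close>

lemma cin_lower:
  assumes T: "0 < T" and z: "Im z \<noteq> 0" and zT: "3 * T \<le> cmod z"
    and cz: "c = 0 \<or> 3 * (LINT t|lborel. vin T t) \<le> \<bar>c\<bar> * cmod z"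
  shows "(LINT t|lborel. vin T t) / (2 * cmod z) \<le> cmod (of_real c + cin T z)"
proof -
  let ?\<mu> = "LINT t|lborel. vin T t"
  have z0: "0 < cmod z" using T zT by linarith
  note i = cin_integrable[OF z, of T]
  show ?thesis
  proof (cases "c = 0")
    case True
    have ui: "integrable lborel (\<lambda>t. complex_of_real (vin T t))" by (rule integrable_of_real[OF vin_integrable])
    have "z * cin T z + of_real ?\<mu> = (LINT t|lborel. z * (of_real (vin T t) / (of_real t - z)) + of_real (vin T t))"
      unfolding Bochner_Integration.integral_add[OF integrable_mult_right[OF i] ui] integral_mult_right_zero integral_complex_of_real ctrans_def ..
    then have "cmod (z * cin T z + of_real ?\<mu>) \<le> (LINT t|lborel. vin T t * (1 / 2))"
    proof (simp only:, intro norm_integral_le)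
      show "integrable lborel (\<lambda>t. z * (of_real (vin T t) / (of_real t - z)) + of_real (vin T t))"
        by (rule Bochner_Integration.integrable_add[OF integrable_mult_right[OF i] ui])
      show "integrable lborel (\<lambda>t. vin T t * (1 / 2))" by (rule integrable_mult_left[OF vin_integrable])
      fix t
      show "cmod (z * (of_real (vin T t) / (of_real t - z)) + of_real (vin T t)) \<le> vin T t * (1 / 2)"
      proof (cases "t \<in> {-T..T}")
        case False
        then have "vin T t = 0" by (simp add: vin_def)
        then show ?thesis by simp
      next
        case True
        have p: "2 / 3 * cmod z \<le> cmod (of_real t - z)" by (rule far_pole[OF zT True])
        then have p0: "0 < cmod (of_real t - z)" using z0 by linarith
        then have n: "of_real t - z \<noteq> 0" by auto
        have e: "z * (of_real (vin T t) / (of_real t - z)) + of_real (vin T t) = of_real (vin T t) * (of_real t / (of_real t - z))"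
          using n by (simp add: field_simps)
        have "cmod (complex_of_real t) \<le> T" unfolding norm_of_real using True by (simp add: abs_le_iff)
        then have "cmod (complex_of_real t) \<le> 1 / 2 * cmod (of_real t - z)" using p zT by linarith
        then have "cmod (of_real t / (of_real t - z)) \<le> 1 / 2" unfolding norm_divide using p0 by (simp only: pos_divide_le_eq)
        then have "\<bar>vin T t\<bar> * cmod (of_real t / (of_real t - z)) \<le> \<bar>vin T t\<bar> * (1 / 2)" by (rule mult_left_mono) simp
        then show ?thesis unfolding e norm_mult norm_of_real using vin_nonneg[of T t] by simp
      qed
    qed
    then have "cmod (z * cin T z + of_real ?\<mu>) \<le> ?\<mu> / 2" by simp
    moreover have "?\<mu> \<le> cmod (of_real ?\<mu> :: complex)" by simp
    moreover have "cmod (of_real ?\<mu> :: complex) \<le> cmod (z * cin T z + of_real ?\<mu>) + cmod (z * cin T z)"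
      using norm_triangle_ineq4[of "z * cin T z + of_real ?\<mu>" "z * cin T z"] by simp
    ultimately have "?\<mu> / 2 \<le> cmod z * cmod (cin T z)" unfolding norm_mult[symmetric] by linarith
    then show ?thesis using z0 True by (simp add: field_simps)
  next
    case False
    then have cc: "3 * ?\<mu> \<le> \<bar>c\<bar> * cmod z" using cz by blast
    have "cmod (cin T z) \<le> (LINT t|lborel. vin T t * (3 / (2 * cmod z)))"
      unfolding ctrans_def
    proof (rule norm_integral_le[OF i integrable_mult_left[OF vin_integrable]])
      fix t
      show "cmod (of_real (vin T t) / (of_real t - z)) \<le> vin T t * (3 / (2 * cmod z))"
      proof (cases "t \<in> {-T..T}")
        case False
        then have "vin T t = 0" by (simp add: vin_def)
        then show ?thesis by simp
      next
        case True
        have p: "2 / 3 * cmod z \<le> cmod (of_real t - z)" by (rule far_pole[OF zT True])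
        have "vin T t / cmod (of_real t - z) \<le> vin T t / (2 / 3 * cmod z)"
          by (rule divide_left_mono[OF p vin_nonneg]) (use p z0 in \<open>intro mult_pos_pos, linarith+\<close>)
        then show ?thesis unfolding norm_divide norm_of_real using vin_nonneg[of T t] by simp
      qed
    qed
    then have "cmod (cin T z) \<le> 3 * ?\<mu> / (2 * cmod z)" by simp
    then have "cmod (cin T z) * cmod z \<le> 3 * ?\<mu> / (2 * cmod z) * cmod z" by (rule mult_right_mono) simp
    then have a: "cmod (cin T z) * cmod z \<le> 3 * ?\<mu> / 2" using z0 by simp
    have "\<bar>c\<bar> \<le> cmod (of_real c + cin T z) + cmod (cin T z)"
      using norm_triangle_ineq4[of "of_real c + cin T z" "cin T z"] by simp
    then have "\<bar>c\<bar> * cmod z \<le> (cmod (of_real c + cin T z) + cmod (cin T z)) * cmod z" by (rule mult_right_mono) simp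
    moreover have "0 \<le> ?\<mu>" by (intro integral_nonneg_AE AE_I2 vin_nonneg)
    ultimately have "?\<mu> / 2 \<le> cmod (of_real c + cin T z) * cmod z" using a cc unfolding distrib_right by linarith
    then show ?thesis using z0 by (simp add: field_simps)
  qed
qed

text \<open>9/4 is the square of 3/2, from |t - z| >= 2/3 |z| on the support of
  \<open>vin T\<close>.\<close>

lemma cin_Im:
  assumes T: "0 < T" and z: "0 < Im z" and zT: "3 * T \<le> cmod z"
  shows "Im (cin T z) \<le> 9 / 4 * (Im z * (LINT t|lborel. vin T t) / (cmod z)\<^sup>2)"
proof -
  have z0: "0 < cmod z" using T zT by linarith
  have zn: "Im z \<noteq> 0" using z by simp
  note i = cin_integrable[OF zn, of T]
  have "Im (cin T z) = (LINT t|lborel. Im (of_real (vin T t) / (of_real t - z)))"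
    unfolding ctrans_def integral_Im[OF i] ..
  also have "\<dots> \<le> (LINT t|lborel. vin T t * (9 / 4 * (Im z / (cmod z)\<^sup>2)))"
  proof (rule integral_mono[OF integrable_Im[OF i] integrable_mult_left[OF vin_integrable]])
    fix t
    have e: "Im (of_real (vin T t) / (of_real t - z)) = vin T t * (Im z / (cmod (of_real t - z))\<^sup>2)"
      unfolding cmod_sq_of_real_diff by (simp add: Im_divide)
    show "Im (of_real (vin T t) / (of_real t - z)) \<le> vin T t * (9 / 4 * (Im z / (cmod z)\<^sup>2))"
    proof (cases "t \<in> {-T..T}")
      case False
      then have "vin T t = 0" by (simp add: vin_def)
      then show ?thesis by simp
    next
      case True
      have p: "2 / 3 * cmod z \<le> cmod (of_real t - z)" by (rule far_pole[OF zT True])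
      then have "(2 / 3 * cmod z)\<^sup>2 \<le> (cmod (of_real t - z))\<^sup>2" by (rule power_mono) simp
      moreover have q: "0 < (2 / 3 * cmod z)\<^sup>2" using z0 by simp
      ultimately have "Im z / (cmod (of_real t - z))\<^sup>2 \<le> Im z / (2 / 3 * cmod z)\<^sup>2"
        using z by (intro divide_left_mono mult_pos_pos) (linarith+)
      also have "\<dots> = 9 / 4 * (Im z / (cmod z)\<^sup>2)" by (simp add: power2_eq_square)
      finally show ?thesis unfolding e by (rule mult_left_mono[OF _ vin_nonneg])
    qed
  qed
  also have "\<dots> = 9 / 4 * (Im z * (LINT t|lborel. vin T t) / (cmod z)\<^sup>2)"
    unfolding integral_mult_left_zero by simp
  finally show ?thesis .
qed

text \<open>At $z=x+is$ with $x\in X$ the function $m$ is dominated by its imaginary part, whereas the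
  part of the measure near the origin contributes an almost real value of size $1/|z|$. Hence the
  tail of the measure must cancel it.\<close>

lemma cout_lower:
  assumes x: "x \<in> X" and s: "0 < s" and d: "0 < d" and sd: "4 * s * d \<le> pi"
    and le: "\<And>t. \<bar>t - x\<bar> \<le> s \<Longrightarrow> \<phi>' t \<le> d"
    and T: "0 < T" and zT: "3 * T \<le> \<bar>x\<bar>" and xs: "100 * s \<le> \<bar>x\<bar>"
    and cx: "c = 0 \<or> 3 * (LINT t|lborel. vin T t) \<le> \<bar>c\<bar> * \<bar>x\<bar>"
  shows "(LINT t|lborel. vin T t) / (20 * \<bar>x\<bar>) \<le> cmod (cout T (Complex x s))"
proof -
  let ?z = "Complex x s" let ?\<mu> = "LINT t|lborel. vin T t"
  have x0: "0 < \<bar>x\<bar>" using T zT by linarith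
  have zx: "\<bar>x\<bar> \<le> cmod ?z" using abs_Re_le_cmod[of ?z] by simp
  have "cmod ?z \<le> \<bar>x\<bar> + s" using cmod_le[of ?z] s by simp
  then have zx2: "cmod ?z \<le> 2 * \<bar>x\<bar>" using xs s by linarith
  have \<mu>0: "0 \<le> ?\<mu>" by (intro integral_nonneg_AE AE_I2 vin_nonneg)
  have zi: "Im ?z \<noteq> 0" "0 < Im ?z" using s by auto
  have z3: "3 * T \<le> cmod ?z" using zx zT by linarith
  have "\<bar>c\<bar> * \<bar>x\<bar> \<le> \<bar>c\<bar> * cmod ?z" by (rule mult_left_mono[OF zx]) simp
  then have cz: "c = 0 \<or> 3 * ?\<mu> \<le> \<bar>c\<bar> * cmod ?z" using cx by linarith
  let ?A = "of_real c + cin T ?z" let ?f = "cout T ?z"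
  define q where "q = ?\<mu> / cmod ?z"
  have q0: "0 \<le> q" using \<mu>0 by (simp add: q_def)
  have A: "q / 2 \<le> cmod ?A" using cin_lower[OF T zi(1) z3 cz] by (simp add: q_def)
  have "Im ?A \<le> 9 / 4 * (s * ?\<mu> / (cmod ?z)\<^sup>2)" using cin_Im[OF T zi(2) z3] by simp
  also have "\<dots> = 9 / 4 * (s / cmod ?z * q)" by (simp add: q_def power2_eq_square)
  also have "\<dots> \<le> 9 / 4 * (1 / 100 * q)"
  proof -
    have "s / cmod ?z \<le> 1 / 100" using xs zx x0 by (simp add: divide_le_eq)
    then show ?thesis using q0 by (intro mult_left_mono mult_right_mono) auto
  qed
  finally have I: "Im ?A \<le> 9 / 400 * q" by simp
  have "cmod (?A + ?f) \<le> 5 / 2 * Im (?A + ?f)" using m_local[OF x s d sd le] unfolding m_split[OF zi(1), of T] .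
  moreover have "Im ?f \<le> cmod ?f" using abs_Im_le_cmod[of ?f] by linarith
  moreover have "cmod ?A \<le> cmod (?A + ?f) + cmod ?f" using norm_triangle_ineq4[of "?A + ?f" ?f] by simp
  moreover have "Im (?A + ?f) = Im ?A + Im ?f" by simp
  \<comment> \<open>q/2 <= |A| <= |A + f| + |f| <= 5/2 (9/400 q + |f|) + |f|, which leaves |f| at
    least q/10.\<close>
  ultimately have "q / 10 \<le> cmod ?f" using A I q0 by linarith
  moreover have "?\<mu> / (20 * \<bar>x\<bar>) \<le> q / 10"
  proof -
    have "?\<mu> / (2 * \<bar>x\<bar>) \<le> ?\<mu> / cmod ?z" by (rule divide_left_mono[OF zx2 \<mu>0]) (use zx x0 in \<open>intro mult_pos_pos, linarith+\<close>)
    then show ?thesis by (simp add: q_def)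
  qed
  ultimately show ?thesis by linarith
qed

lemma phase_increment:
  assumes "a < b" "\<And>t. a \<le> t \<Longrightarrow> t \<le> b \<Longrightarrow> \<phi>' t \<le> d"
  shows "\<phi> b - \<phi> a \<le> d * (b - a)"
proof -
  obtain z where z: "a < z" "z < b" "\<phi> b - \<phi> a = (b - a) * \<phi>' z"
    using MVT2[OF assms(1), of \<phi> \<phi>'] phase_deriv by blast
  have "(b - a) * \<phi>' z \<le> (b - a) * d" using assms z by (intro mult_left_mono) auto
  then show ?thesis using z(3) by (simp add: mult.commute)
qed

lemma finite_X_Icc: "finite (X \<inter> {\<alpha>..\<beta>})"
  by (rule finite_subset[OF _ finite_X[of 0 "\<bar>\<alpha>\<bar> + \<bar>\<beta>\<bar>"]]) auto

text \<open>In a window where phi' <= d, points of X are 1/(3 d) apart and the tail transform is at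
  least mu/(20 r) at a height of order 1/d. The weak type bound then leaves at most (3600 pi
  \<epsilon>/mu) d r points, with mu and \<epsilon> controlling the masses of the central part and
  the tail.\<close>

lemma X_sparse:
  assumes \<eta>: "0 < \<eta>" "\<eta> \<le> 1" and \<kappa>: "0 < \<kappa>"
  shows "\<exists>T0>0. \<forall>r\<ge>T0. \<forall>\<alpha> \<beta> d. \<beta> - \<alpha> \<le> r \<longrightarrow> (\<forall>x\<in>{\<alpha>..\<beta>}. \<eta> * r \<le> \<bar>x\<bar> \<and> \<bar>x\<bar> \<le> r) \<longrightarrow>
    (\<forall>t. \<alpha> - \<eta> * r / 2 \<le> t \<and> t \<le> \<beta> + \<eta> * r / 2 \<longrightarrow> \<phi>' t \<le> d) \<longrightarrow> 100 \<le> \<eta> * r * d \<longrightarrow>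
    real (card (X \<inter> {\<alpha>..\<beta>})) \<le> \<kappa> * d * r"
proof -
  let ?H = "sqn h"
  \<comment> \<open>The second entry keeps \<mu> at least half of \<open>sqn h\<close>; with this
    the first makes 3600 pi \<epsilon>/\<mu> at most \<kappa>.\<close>
  define \<epsilon> where "\<epsilon> = min (\<kappa> * ?H / (7200 * pi)) (?H / 2)"
  have "0 < \<epsilon>" using \<kappa> sqn_h_pos by (simp add: \<epsilon>_def)
  then obtain T where T: "0 < T" and tail: "(LINT t|lborel. vout T t) \<le> \<epsilon>" using vout_small by blast
  define \<mu> where "\<mu> = (LINT t|lborel. vin T t)"
  have \<mu>: "?H / 2 \<le> \<mu>" "\<mu> \<le> ?H" using tail vout_integral_nonneg[of T] by (auto simp: \<mu>_def vin_integral \<epsilon>_def)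
  then have \<mu>0: "0 < \<mu>" using sqn_h_pos by linarith
  \<comment> \<open>The summands secure 3 T <= \<eta> r and, for c nonzero, 3 \<open>sqn h\<close>
    <= |c| \<eta> r. For c = 0 the second summand is 0 by the convention for division.\<close>
  define T0 where "T0 = 3 * T / \<eta> + 3 * ?H / (\<bar>c\<bar> * \<eta>)"
  have p1: "0 < 3 * T / \<eta>" using T \<eta> by simp
  have p2: "0 \<le> 3 * ?H / (\<bar>c\<bar> * \<eta>)" using \<eta> sqn_h_pos by simp
  have "real (card (X \<inter> {\<alpha>..\<beta>})) \<le> \<kappa> * d * r"
    if r: "T0 \<le> r" and ab: "\<beta> - \<alpha> \<le> r" and box: "\<And>x. x \<in> {\<alpha>..\<beta>} \<Longrightarrow> \<eta> * r \<le> \<bar>x\<bar> \<and> \<bar>x\<bar> \<le> r"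
      and dd: "\<And>t. \<alpha> - \<eta> * r / 2 \<le> t \<Longrightarrow> t \<le> \<beta> + \<eta> * r / 2 \<Longrightarrow> \<phi>' t \<le> d" and big: "100 \<le> \<eta> * r * d" for r \<alpha> \<beta> d
  proof -
    have r0: "0 < r" using r p1 p2 by (simp add: T0_def)
    have er: "0 < \<eta> * r" using r0 \<eta> by simp
    have d0: "0 < d"
    proof (rule ccontr)
      assume "\<not> 0 < d"
      then have "\<eta> * r * d \<le> 0" using er by (intro mult_nonneg_nonpos) auto
      then show False using big by linarith
    qed
    have "3 * T / \<eta> \<le> r" using r p2 by (simp add: T0_def)
    then have rT: "3 * T \<le> \<eta> * r" using \<eta> by (simp add: pos_divide_le_eq mult.commute)
    have rc: "c = 0 \<or> 3 * ?H \<le> \<bar>c\<bar> * (\<eta> * r)"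
    proof (cases "c = 0")
      case False
      have "3 * ?H / (\<bar>c\<bar> * \<eta>) \<le> r" using r p1 by (simp add: T0_def)
      moreover have "0 < \<bar>c\<bar> * \<eta>" using False \<eta> by simp
      ultimately show ?thesis by (simp add: pos_divide_le_eq mult_ac)
    qed simp
    \<comment> \<open>The largest height allowed by 4 s d <= pi. The next constant is the spacing
      forced by \<open>X_spacing\<close>: around two points of X the phase increases by at least 1
      over three times their distance, at rate at most d.\<close>
    define s where "s = pi / (4 * d)"
    define \<delta> where "\<delta> = 1 / (3 * d)"
    have s0: "0 < s" and \<delta>0: "0 < \<delta>" using d0 by (auto simp: s_def \<delta>_def)
    have sd: "4 * s * d \<le> pi" using d0 by (simp add: s_def)
    have \<delta>s: "2 * \<delta> \<le> s" using d0 pi_gt3 by (simp add: s_def \<delta>_def field_simps)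
    have "pi * 25 \<le> \<eta> * r * d" using big pi_less_4 by linarith
    then have s100: "100 * s \<le> \<eta> * r" using d0 by (simp add: s_def field_simps)
    have "\<eta> * r \<le> 1 * r" using \<eta> r0 by (intro mult_right_mono) auto
    then have sr: "s \<le> r" using s100 s0 by linarith
    let ?S = "X \<inter> {\<alpha>..\<beta>}"
    have sep1: "\<delta> \<le> y - x" if xy: "x \<in> ?S" "y \<in> ?S" "x < y" for x y
    proof (rule ccontr)
      assume n: "\<not> \<delta> \<le> y - x"
      let ?d = "y - x"
      have "1 \<le> \<phi> (y + ?d) - \<phi> (x - ?d)" using xy by (intro X_spacing[of x y]) auto
      also have "\<dots> \<le> d * ((y + ?d) - (x - ?d))"
      proof (rule phase_increment)
        show "x - ?d < y + ?d" using xy by simp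
        show "\<phi>' t \<le> d" if "x - ?d \<le> t" "t \<le> y + ?d" for t
          by (rule dd) (use that xy n \<delta>s s100 er in auto)
      qed
      also have "\<dots> = 3 * d * ?d" by (simp add: algebra_simps)
      also have "\<dots> < 3 * d * \<delta>" using n d0 by (intro mult_strict_left_mono) auto
      also have "\<dots> = 1" using d0 by (simp add: \<delta>_def)
      finally show False by simp
    qed
    have "real (card ?S) * \<delta> \<le> 60 * pi * \<epsilon> / (\<mu> / (20 * r))"
    proof (rule ctrans_weak_type[OF vout_integrable vout_nonneg tail finite_X_Icc _ ab _ \<delta>0 \<delta>s sr])
      show "?S \<subseteq> {\<alpha>..\<beta>}" by blast
      show "\<delta> \<le> \<bar>x - y\<bar>" if "x \<in> ?S" "y \<in> ?S" "x \<noteq> y" for x y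
        using sep1[of x y] sep1[of y x] that by (cases "x < y") auto
      show "0 < \<mu> / (20 * r)" using \<mu>0 r0 by simp
      show "\<mu> / (20 * r) \<le> cmod (cout T (Complex x s))" if x: "x \<in> ?S" for x
      proof -
        have xb: "\<eta> * r \<le> \<bar>x\<bar>" "\<bar>x\<bar> \<le> r" using box[of x] x by auto
        have "\<mu> / (20 * \<bar>x\<bar>) \<le> cmod (cout T (Complex x s))"
          unfolding \<mu>_def
        proof (rule cout_lower[OF _ s0 d0 sd _ T])
          show "x \<in> X" using x by blast
          show "\<phi>' t \<le> d" if "\<bar>t - x\<bar> \<le> s" for t
            by (rule dd) (use that x s100 er s0 in \<open>auto simp: abs_le_iff\<close>)
          show "3 * T \<le> \<bar>x\<bar>" "100 * s \<le> \<bar>x\<bar>" using xb rT s100 by auto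
          have "\<bar>c\<bar> * (\<eta> * r) \<le> \<bar>c\<bar> * \<bar>x\<bar>" using xb by (intro mult_left_mono) auto
          then show "c = 0 \<or> 3 * (LINT t|lborel. vin T t) \<le> \<bar>c\<bar> * \<bar>x\<bar>"
            using rc \<mu>(2) unfolding \<mu>_def[symmetric] by linarith
        qed
        moreover have "\<mu> / (20 * r) \<le> \<mu> / (20 * \<bar>x\<bar>)"
          by (rule divide_left_mono) (use xb er r0 \<mu>0 in \<open>auto intro!: mult_pos_pos\<close>)
        ultimately show ?thesis by linarith
      qed
    qed
    then have "real (card ?S) \<le> 60 * pi * \<epsilon> / (\<mu> / (20 * r)) / \<delta>" using \<delta>0 by (simp only: pos_le_divide_eq)
    also have "\<dots> = 3600 * pi * \<epsilon> / \<mu> * (d * r)" using d0 r0 \<mu>0 by (simp add: \<delta>_def field_simps)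
    also have "\<dots> \<le> \<kappa> * (d * r)"
    proof (rule mult_right_mono)
      have "\<epsilon> \<le> \<kappa> * ?H / (7200 * pi)" by (simp add: \<epsilon>_def)
      then have "3600 * pi * \<epsilon> \<le> 3600 * pi * (\<kappa> * ?H / (7200 * pi))" by (intro mult_left_mono) auto
      also have "\<dots> = \<kappa> * (?H / 2)" by simp
      also have "\<dots> \<le> \<kappa> * \<mu>" using \<kappa> \<mu> by (intro mult_left_mono) auto
      finally show "3600 * pi * \<epsilon> / \<mu> \<le> \<kappa>" using \<mu>0 by (simp add: pos_divide_le_eq)
    qed (use d0 r0 in simp)
    finally show ?thesis by (simp add: mult.assoc)
  qed
  moreover have "0 < T0" using p1 p2 by (simp add: T0_def)
  ultimately show ?thesis by blast
qed

end

section \<open>Growth of the phase\<close>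

text \<open>Divergence to infinity at infinity, spelled out with a positive threshold, the form in
  which such statements are combined below.\<close>

definition tends_up :: "(real \<Rightarrow> real) \<Rightarrow> bool" where
  "tends_up f \<longleftrightarrow> (\<forall>N. \<exists>T>0. \<forall>t\<ge>T. N \<le> f t)"

text \<open>D at least doubles in each step, so the errors \<kappa> D form a sum dominated by twice
  its last term. Radii up to B r0 are covered by the constant S (B r0).\<close>

lemma doubling_recursion:
  fixes S D :: "real \<Rightarrow> real"
  assumes mono: "\<And>r s. r \<le> s \<Longrightarrow> S r \<le> S s" and B: "1 < B" and r0: "0 < r0" and \<kappa>: "0 \<le> \<kappa>"
    and step: "\<And>r. r0 \<le> r \<Longrightarrow> S (B * r) \<le> S r + \<kappa> * D (B * r)"
    and D2: "\<And>r. r0 \<le> r \<Longrightarrow> 2 * D r \<le> D (B * r)" and D0: "\<And>r. r0 \<le> r \<Longrightarrow> 0 \<le> D r"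
  shows "\<exists>c0. \<forall>r\<ge>r0. S r \<le> 2 * \<kappa> * D r + c0"
proof -
  have small: "S r \<le> 2 * \<kappa> * D r + S (B * r0)" if "r0 \<le> r" "r \<le> B * r0" for r
  proof -
    have "0 \<le> \<kappa> * D r" using \<kappa> D0[OF that(1)] by simp
    with mono[OF that(2)] show ?thesis by linarith
  qed
  have ind: "r0 \<le> r \<Longrightarrow> r \<le> B ^ n * r0 \<Longrightarrow> S r \<le> 2 * \<kappa> * D r + S (B * r0)" for n r
  proof (induction n arbitrary: r)
    case 0
    have "r0 \<le> B * r0" using B r0 by simp
    then have "r \<le> B * r0" using 0(2) by simp
    with small 0 show ?case by blast
  next
    case (Suc n)
    show ?case
    proof (cases "r \<le> B * r0")
      case True
      with small Suc.prems show ?thesis by blast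
    next
      case False
      define q where "q = r / B"
      have rq: "r = B * q" using B by (simp add: q_def)
      have "B * r0 \<le> B * q" using False rq by simp
      then have q1: "r0 \<le> q" using B by simp
      have "B * q \<le> B * (B ^ n * r0)" using Suc.prems(2) rq by (simp add: mult.assoc)
      then have q2: "q \<le> B ^ n * r0" using B by simp
      have "\<kappa> * (2 * D q) \<le> \<kappa> * D r" unfolding rq by (rule mult_left_mono[OF D2[OF q1] \<kappa>])
      with Suc.IH[OF q1 q2] step[OF q1] show ?thesis unfolding rq by linarith
    qed
  qed
  have "S r \<le> 2 * \<kappa> * D r + S (B * r0)" if r: "r0 \<le> r" for r
  proof -
    obtain n where "r / r0 < B ^ n" using real_arch_pow[OF B] by blast
    then have "r \<le> B ^ n * r0" using r0 by (simp add: divide_less_eq)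
    with ind r show ?thesis by blast
  qed
  then show ?thesis by blast
qed

text \<open>One end of the real line at a time: a statement about +infinity gives one about
  -infinity through the reflection -phi(-x), which satisfies the same hypotheses
  (\<open>flip\<close>) and has the same \<open>Delta\<close>.\<close>

locale phase_side =
  fixes \<phi> \<phi>' :: "real \<Rightarrow> real" and c K :: real
  assumes deriv: "(\<phi> has_real_derivative \<phi>' t) (at t)" and pos: "0 < \<phi>' t"
    and c1: "1 \<le> c" and K1: "1 \<le> K"
    and doubling: "\<bar>\<phi> (2 * x)\<bar> \<le> K * (\<bar>\<phi> x\<bar> + 1)"
    and ratio: "1/2 \<le> \<phi> a / \<phi> b \<Longrightarrow> \<phi> a / \<phi> b \<le> 2 \<Longrightarrow> \<phi>' a \<le> c * \<phi>' b"
begin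

definition Delta :: "real \<Rightarrow> real" where "Delta r = \<phi> r - \<phi> (- r)"

lemma flip: "phase_side (\<lambda>x. - \<phi> (- x)) (\<lambda>x. \<phi>' (- x)) c K"
proof
  fix t
  have "((\<lambda>x. \<phi> (- x)) has_real_derivative \<phi>' (- t) * - 1) (at t)"
    by (rule DERIV_chain2[OF deriv]) (auto intro!: derivative_eq_intros)
  from DERIV_minus[OF this] show "((\<lambda>x. - \<phi> (- x)) has_real_derivative \<phi>' (- t)) (at t)" by simp
  show "0 < \<phi>' (- t)" by (rule pos)
  show "1 \<le> c" "1 \<le> K" by (rule c1, rule K1)
  show "\<bar>- \<phi> (- (2 * t))\<bar> \<le> K * (\<bar>- \<phi> (- t)\<bar> + 1)" using doubling[of "- t"] by simp
next
  fix a b assume "1/2 \<le> - \<phi> (- a) / - \<phi> (- b)" "- \<phi> (- a) / - \<phi> (- b) \<le> 2"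
  then show "\<phi>' (- a) \<le> c * \<phi>' (- b)" using ratio[of "- a" "- b"] by simp
qed

lemma flip_Delta: "phase_side.Delta (\<lambda>x. - \<phi> (- x)) = Delta"
  by (simp add: fun_eq_iff phase_side.Delta_def[OF flip] Delta_def)

lemma mvt: "a < b \<Longrightarrow> \<exists>z. a < z \<and> z < b \<and> \<phi> b - \<phi> a = (b - a) * \<phi>' z"
  by (rule MVT2) (simp_all add: deriv)

lemma less: "a < b \<Longrightarrow> \<phi> a < \<phi> b"
proof -
  assume ab: "a < b"
  then obtain z where "\<phi> b - \<phi> a = (b - a) * \<phi>' z" using mvt by blast
  moreover have "0 < (b - a) * \<phi>' z" using ab pos by simp
  ultimately show ?thesis by linarith
qed

lemma le: "a \<le> b \<Longrightarrow> \<phi> a \<le> \<phi> b"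
  using less[of a b] by (cases "a = b") auto

lemma ivt:
  assumes "a \<le> b" "\<phi> a \<le> y" "y \<le> \<phi> b"
  shows "\<exists>x. a \<le> x \<and> x \<le> b \<and> \<phi> x = y"
  using IVT'[OF assms(2,3,1) DERIV_continuous_on[OF has_field_derivative_at_within[OF deriv]]] by blast

lemma cmp:
  assumes "0 < \<phi> a" "a \<le> b" "\<phi> b \<le> 2 * \<phi> a"
  shows "\<phi>' a \<le> c * \<phi>' b" "\<phi>' b \<le> c * \<phi>' a"
proof -
  have ab: "\<phi> a \<le> \<phi> b" by (rule le[OF assms(2)])
  then have b: "0 < \<phi> b" using assms(1) by linarith
  show "\<phi>' a \<le> c * \<phi>' b" by (rule ratio) (use ab b assms in \<open>simp_all add: field_simps\<close>)
  show "\<phi>' b \<le> c * \<phi>' a" by (rule ratio) (use ab b assms in \<open>simp_all add: field_simps\<close>)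
qed

text \<open>If phi were bounded above with positive supremum L, its values beyond some T would lie
  in (L/2, L], and by the ratio hypothesis phi' would stay above phi'(T)/c: linear growth, a
  contradiction.\<close>

lemma bounded_neg:
  assumes b: "\<And>t. \<phi> t \<le> b"
  shows "\<phi> t < 0"
proof (rule ccontr)
  assume "\<not> \<phi> t < 0"
  then have t1: "0 < \<phi> (t + 1)" using less[of t "t + 1"] by linarith
  define L where "L = (SUP s. \<phi> s)"
  have bdd: "bdd_above (range \<phi>)" using b by (auto simp: bdd_above_def)
  have L: "\<phi> s \<le> L" for s unfolding L_def by (rule cSUP_upper[OF UNIV_I bdd])
  have L0: "0 < L" using L[of "t + 1"] t1 by linarith
  then have "L / 2 < L" by simp
  then obtain T where T: "L / 2 < \<phi> T"
    unfolding L_def using less_cSUP_iff[OF _ bdd] by blast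
  \<comment> \<open>Over a length c L/phi'(T) a slope of at least phi'(T)/c raises phi by L.\<close>
  define s where "s = T + c * L / \<phi>' T"
  have st: "T < s" using c1 L0 pos[of T] by (simp add: s_def)
  then obtain z where z: "T < z" "z < s" "\<phi> s - \<phi> T = (s - T) * \<phi>' z" using mvt by blast
  have "\<phi>' T \<le> c * \<phi>' z" by (rule cmp(1)) (use z T L[of z] L0 in linarith)+
  then have "(s - T) * \<phi>' T \<le> (s - T) * (c * \<phi>' z)" using st by (intro mult_left_mono) auto
  moreover have "(s - T) * \<phi>' T = c * L" using pos[of T] by (simp add: s_def)
  ultimately have "c * L \<le> c * (\<phi> s - \<phi> T)" unfolding z(3) by (simp only: mult_ac)
  then have "L \<le> \<phi> s - \<phi> T" using c1 by simp
  then show False using L[of s] T L0 by linarith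
qed

lemma not_tends_up:
  assumes "\<not> tends_up \<phi>"
  shows "\<exists>b. \<forall>t. \<phi> t \<le> b"
proof -
  obtain N where N: "\<And>T. 0 < T \<Longrightarrow> \<exists>t\<ge>T. \<phi> t < N" using assms by (auto simp: tends_up_def not_le)
  have "\<phi> t \<le> N" for t
  proof -
    have "0 < \<bar>t\<bar> + 1" by simp
    then obtain s where "\<bar>t\<bar> + 1 \<le> s" "\<phi> s < N" using N by blast
    then show ?thesis using le[of t s] by linarith
  qed
  then show ?thesis by blast
qed

text \<open>Bounded at both ends, phi would be negative at 0 by \<open>bounded_neg\<close>, and so
  would its reflection.\<close>

lemma tends_up_cases: "tends_up \<phi> \<or> tends_up (\<lambda>x. - \<phi> (- x))"
proof (rule ccontr)
  assume a: "\<not> ?thesis"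
  then obtain b where "\<And>t. \<phi> t \<le> b" using not_tends_up by blast
  then have "\<phi> 0 < 0" by (rule bounded_neg)
  moreover obtain b' where "\<And>t. - \<phi> (- t) \<le> b'" using phase_side.not_tends_up[OF flip] a by blast
  then have "- \<phi> (- 0) < 0" by (rule phase_side.bounded_neg[OF flip])
  ultimately show False by simp
qed

text \<open>At a bounded end the remaining increase of phi is eventually below 1, whereas
  \<open>X_spacing\<close> asks for at least 1; this will keep extra zeros far apart there.\<close>

lemma bounded_variation_small:
  assumes "\<not> tends_up \<phi>"
  shows "\<exists>T>0. \<forall>a\<ge>T. \<forall>b. \<phi> b - \<phi> a < 1"
proof -
  obtain b where b: "\<And>t. \<phi> t \<le> b" using not_tends_up[OF assms] by blast
  define L where "L = (SUP s. \<phi> s)"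
  have bdd: "bdd_above (range \<phi>)" using b by (auto simp: bdd_above_def)
  have L: "\<phi> s \<le> L" for s unfolding L_def by (rule cSUP_upper[OF UNIV_I bdd])
  have "L - 1 < L" by simp
  then obtain T where T: "L - 1 < \<phi> T" unfolding L_def using less_cSUP_iff[OF _ bdd] by blast
  have "\<phi> y - \<phi> a < 1" if "\<bar>T\<bar> + 1 \<le> a" for a y
    using le[of T a] L[of y] T that by linarith
  moreover have "0 < \<bar>T\<bar> + 1" by simp
  ultimately show ?thesis by blast
qed

text \<open>Let B = 1 + 2 c^2 and suppose phi(B t) < 2 phi(t). The rise by phi(t)/2 before t forces
  phi(t)/2 <= c t phi'(t). On [t, B t] the slope is at least phi'(t)/c, and over the length 2 c^2 t
  this yields a rise of at least 2 c t phi'(t) >= phi(t).\<close>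

lemma growth:
  assumes "tends_up \<phi>"
  shows "\<exists>T>0. \<forall>t\<ge>T. 2 * \<phi> t \<le> \<phi> ((1 + 2 * c\<^sup>2) * t)"
proof -
  obtain T where T: "0 < T" "\<And>t. T \<le> t \<Longrightarrow> 2 * \<bar>\<phi> 0\<bar> + 1 \<le> \<phi> t"
    using assms unfolding tends_up_def by blast
  have "2 * \<phi> t \<le> \<phi> ((1 + 2 * c\<^sup>2) * t)" if t: "T \<le> t" for t
  proof (rule ccontr)
    let ?B = "1 + 2 * c\<^sup>2"
    assume a: "\<not> 2 * \<phi> t \<le> \<phi> (?B * t)"
    have t0: "0 < t" using T(1) t by linarith
    have p: "2 * \<bar>\<phi> 0\<bar> + 1 \<le> \<phi> t" by (rule T(2)[OF t])
    have "\<exists>x. 0 \<le> x \<and> x \<le> t \<and> \<phi> x = \<phi> t / 2" by (rule ivt) (use t0 p in linarith)+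
    then obtain x where x: "0 \<le> x" "x \<le> t" "\<phi> x = \<phi> t / 2" by blast
    have "x \<noteq> t" using x(3) p by auto
    then have "x < t" using x(2) by simp
    then obtain z where z: "x < z" "z < t" "\<phi> t - \<phi> x = (t - x) * \<phi>' z" using mvt by blast
    have "\<phi>' z \<le> c * \<phi>' t"
      by (rule cmp(1)) (use z less[OF z(1)] x p in linarith)+
    then have "(t - x) * \<phi>' z \<le> t * (c * \<phi>' t)"
      using x z t0 pos[of z] by (intro mult_mono) auto
    then have k1: "\<phi> t / 2 \<le> t * (c * \<phi>' t)" using z(3) x(3) by simp
    have c2: "0 < c\<^sup>2" using c1 by simp
    then have "t < ?B * t" using t0 by (simp add: distrib_right)
    then obtain y where y: "t < y" "y < ?B * t" "\<phi> (?B * t) - \<phi> t = (?B * t - t) * \<phi>' y" using mvt by blast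
    have "\<phi>' t \<le> c * \<phi>' y"
      by (rule cmp(1)) (use y less[OF y(2)] a p in linarith)+
    then have "(2 * c * t) * \<phi>' t \<le> (2 * c * t) * (c * \<phi>' y)"
      using c1 t0 by (intro mult_left_mono) auto
    also have "\<dots> = \<phi> (?B * t) - \<phi> t" unfolding y(3) by (simp add: power2_eq_square algebra_simps)
    finally have "2 * (t * (c * \<phi>' t)) \<le> \<phi> (?B * t) - \<phi> t" by (simp add: mult_ac)
    then show False using k1 a by linarith
  qed
  then show ?thesis using T(1) by blast
qed

text \<open>A factor 4 instead of 2 leaves room for the contribution of the other end in
  \<open>Delta_growth_aux\<close>.\<close>

lemma quadruple:
  assumes up: "tends_up \<phi>" and Q: "(1 + 2 * c\<^sup>2)\<^sup>2 \<le> Q"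
  shows "\<exists>T>0. \<forall>r\<ge>T. 4 * \<phi> r \<le> \<phi> (Q * r)"
proof -
  let ?B = "1 + 2 * c\<^sup>2"
  obtain T where T: "0 < T" "\<And>t. T \<le> t \<Longrightarrow> 2 * \<phi> t \<le> \<phi> (?B * t)" using growth[OF up] by blast
  have "4 * \<phi> r \<le> \<phi> (Q * r)" if r: "T \<le> r" for r
  proof -
    have r0: "0 < r" using r T by linarith
    have "0 \<le> 2 * c\<^sup>2 * r" using r0 by simp
    moreover have "?B * r = r + 2 * c\<^sup>2 * r" by (simp add: distrib_right)
    ultimately have "T \<le> ?B * r" using r by linarith
    from T(2)[OF this] T(2)[OF r] have "4 * \<phi> r \<le> \<phi> (?B * (?B * r))" by linarith
    also have "\<dots> \<le> \<phi> (Q * r)"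
      using mult_right_mono[OF Q, of r] r0 by (intro le) (simp add: power2_eq_square mult.assoc)
    finally show ?thesis .
  qed
  then show ?thesis using T(1) by blast
qed

text \<open>Each halving of phi(b) costs one factor c.\<close>

lemma chain:
  assumes "0 < \<phi> a"
  shows "a \<le> b \<Longrightarrow> \<phi> b \<le> 2 ^ n * \<phi> a \<Longrightarrow> \<phi>' b \<le> c ^ n * \<phi>' a"
proof (induction n arbitrary: b)
  case 0
  then have "a = b" using less[of a b] by (cases "a = b") auto
  then show ?case by simp
next
  case (Suc n)
  show ?case
  proof (cases "\<phi> b \<le> 2 * \<phi> a")
    case True
    have "1 \<le> c ^ n" using c1 by simp
    then have "c * 1 \<le> c * c ^ n" using c1 by (intro mult_left_mono) auto
    then have "c * \<phi>' a \<le> c * c ^ n * \<phi>' a" using pos[of a] by (intro mult_right_mono) auto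
    then show ?thesis using cmp(2)[OF assms Suc.prems(1) True] by simp
  next
    case False
    have "\<exists>x. a \<le> x \<and> x \<le> b \<and> \<phi> x = \<phi> b / 2" by (rule ivt) (use False Suc.prems assms in linarith)+
    then obtain x where x: "a \<le> x" "x \<le> b" "\<phi> x = \<phi> b / 2" by blast
    have "\<phi> x \<le> 2 ^ n * \<phi> a" using Suc.prems(2) x(3) by simp
    from Suc.IH[OF x(1) this] have "c * \<phi>' x \<le> c * (c ^ n * \<phi>' a)" using c1 by (intro mult_left_mono) auto
    moreover have "\<phi>' b \<le> c * \<phi>' x" by (rule cmp(2)) (use x False assms in linarith)+
    ultimately show ?thesis by simp
  qed
qed

text \<open>Doubling gives phi(t) <= 2^n phi(t/2), so by \<open>chain\<close> phi'(t) is at most c^n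
  times phi' at any point of [t/2, t]. At the point supplied by the mean value theorem phi' is at
  most phi(t)/(t/2).\<close>

lemma deriv_upper:
  assumes "tends_up \<phi>"
  shows "\<exists>D>0. \<exists>T>0. \<forall>t\<ge>T. \<phi>' t \<le> D * \<phi> t / t"
proof -
  obtain T where T: "0 < T" "\<And>t. T \<le> t \<Longrightarrow> 1 \<le> \<phi> t" using assms unfolding tends_up_def by blast
  obtain n where n: "2 * K < 2 ^ n" using real_arch_pow[of 2 "2 * K"] by auto
  have cn: "0 < c ^ n" using c1 by simp
  have "\<phi>' t \<le> 2 * c ^ n * \<phi> t / t" if t: "2 * T \<le> t" for t
  proof -
    have t0: "0 < t" using t T by linarith
    have h1: "1 \<le> \<phi> (t / 2)" by (rule T(2)) (use t in simp)
    have "\<phi> t \<le> K * (\<bar>\<phi> (t / 2)\<bar> + 1)" using doubling[of "t / 2"] by simp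
    also have "\<dots> \<le> K * (2 * \<phi> (t / 2))" using h1 K1 by (intro mult_left_mono) auto
    also have "\<dots> \<le> 2 ^ n * \<phi> (t / 2)" using mult_right_mono[of "2 * K" "2 ^ n" "\<phi> (t / 2)"] n h1 by simp
    finally have k: "\<phi> t \<le> 2 ^ n * \<phi> (t / 2)" .
    obtain z where z: "t / 2 < z" "z < t" "\<phi> t - \<phi> (t / 2) = (t - t / 2) * \<phi>' z" using mvt[of "t / 2" t] t0 by auto
    have zz: "\<phi> (t / 2) < \<phi> z" by (rule less[OF z(1)])
    then have "2 ^ n * \<phi> (t / 2) \<le> 2 ^ n * \<phi> z" by simp
    then have "\<phi>' t \<le> c ^ n * \<phi>' z" by (intro chain) (use zz h1 k z in linarith)+
    then have "(t / 2) * \<phi>' t \<le> (t / 2) * (c ^ n * \<phi>' z)" using t0 by (intro mult_left_mono) auto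
    also have "\<dots> = c ^ n * (\<phi> t - \<phi> (t / 2))" unfolding z(3) by simp
    also have "\<dots> \<le> c ^ n * \<phi> t" using cn h1 by (intro mult_left_mono) auto
    finally show ?thesis using t0 by (simp add: field_simps)
  qed
  moreover have "0 < 2 * c ^ n" "0 < 2 * T" using cn T by auto
  ultimately show ?thesis by blast
qed

text \<open>Supplies the bound d of \<open>X_sparse\<close> as a multiple of Delta r/r, so that d r
  is a multiple of Delta r. The range up to 2 r leaves a margin around the annulus.\<close>

lemma side_Delta:
  assumes up: "tends_up \<phi>" and \<eta>: "0 < \<eta>"
  shows "\<exists>C0>0. \<exists>T>0. \<forall>r\<ge>T. \<forall>t. \<eta> * r \<le> t \<and> t \<le> 2 * r \<longrightarrow> \<phi>' t \<le> C0 * Delta r / r"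
proof -
  obtain D T1 where D: "0 < D" "0 < T1" "\<And>t. T1 \<le> t \<Longrightarrow> \<phi>' t \<le> D * \<phi> t / t" using deriv_upper[OF up] by blast
  obtain T2 where T2: "0 < T2" "\<And>t. T2 \<le> t \<Longrightarrow> 2 * \<bar>\<phi> 0\<bar> + 1 \<le> \<phi> t" using up unfolding tends_up_def by blast
  define T where "T = max (T1 / \<eta>) T2"
  have "\<phi>' t \<le> (4 * D * K / \<eta>) * Delta r / r" if r: "T \<le> r" and t: "\<eta> * r \<le> t" "t \<le> 2 * r" for r t
  proof -
    have r2: "T2 \<le> r" and "T1 / \<eta> \<le> r" using r by (auto simp: T_def)
    then have "T1 \<le> \<eta> * r" using \<eta> by (simp add: field_simps)
    then have t1: "T1 \<le> t" using t by linarith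
    have r0: "0 < r" using r2 T2 by linarith
    have er: "0 < \<eta> * r" using r0 \<eta> by simp
    have pr: "2 * \<bar>\<phi> 0\<bar> + 1 \<le> \<phi> r" by (rule T2(2)[OF r2])
    have "\<phi> (- r) \<le> \<phi> 0" by (rule le) (use r0 in simp)
    then have d: "\<phi> r \<le> 2 * Delta r" using pr by (simp add: Delta_def)
    have "\<phi> t \<le> \<phi> (2 * r)" by (rule le[OF t(2)])
    also have "\<dots> \<le> K * (\<bar>\<phi> r\<bar> + 1)" using doubling[of r] by linarith
    also have "\<dots> \<le> K * (2 * \<phi> r)" using pr K1 by (intro mult_left_mono) auto
    also have "\<dots> \<le> K * (4 * Delta r)" using d K1 by (intro mult_left_mono) auto
    finally have pt: "\<phi> t \<le> K * (4 * Delta r)" .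
    have d0: "0 \<le> K * (4 * Delta r)" using d pr K1 by simp
    have "\<phi>' t \<le> D * \<phi> t / t" by (rule D(3)[OF t1])
    also have "\<dots> \<le> D * (K * (4 * Delta r)) / t"
      using pt D(1) D(2) t1 by (intro divide_right_mono mult_left_mono) auto
    also have "\<dots> \<le> D * (K * (4 * Delta r)) / (\<eta> * r)"
      by (rule divide_left_mono[OF t(1) mult_nonneg_nonneg[OF less_imp_le[OF D(1)] d0]])
        (rule mult_pos_pos[OF less_le_trans[OF er t(1)] er])
    finally show ?thesis by (simp add: mult_ac)
  qed
  moreover have "0 < 4 * D * K / \<eta>" using D K1 \<eta> by simp
  moreover have "0 < T" using T2 by (simp add: T_def less_max_iff_disj)
  ultimately show ?thesis by blast
qed

text \<open>The hypothesis controls phi(2 r) and phi(-2 r) by |phi(r)| + 1 and |phi(-r)| + 1; both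
  are at most Delta r + |phi(0)| + 1, as phi(0) lies between phi(-r) and phi(r).\<close>

lemma Delta_doubling: "\<exists>C>0. \<forall>r. 0 \<le> r \<longrightarrow> 1 \<le> Delta r \<longrightarrow> Delta (2 * r) \<le> C * Delta r"
proof -
  let ?C = "2 * K * (\<bar>\<phi> 0\<bar> + 2)"
  have "Delta (2 * r) \<le> ?C * Delta r" if r: "0 \<le> r" "1 \<le> Delta r" for r
  proof -
    have m: "\<phi> (- r) \<le> \<phi> 0" "\<phi> 0 \<le> \<phi> r" using r by (auto intro: le)
    then have b: "\<bar>\<phi> r\<bar> \<le> Delta r + \<bar>\<phi> 0\<bar>" "\<bar>\<phi> (- r)\<bar> \<le> Delta r + \<bar>\<phi> 0\<bar>"
      by (auto simp: Delta_def)
    have "\<bar>\<phi> 0\<bar> * 1 \<le> \<bar>\<phi> 0\<bar> * Delta r" using r by (intro mult_left_mono) auto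
    then have q: "Delta r + \<bar>\<phi> 0\<bar> + 1 \<le> (\<bar>\<phi> 0\<bar> + 2) * Delta r" using r by (simp add: distrib_right)
    have "K * (\<bar>\<phi> r\<bar> + 1) \<le> K * ((\<bar>\<phi> 0\<bar> + 2) * Delta r)" "K * (\<bar>\<phi> (- r)\<bar> + 1) \<le> K * ((\<bar>\<phi> 0\<bar> + 2) * Delta r)"
      using b q K1 by (auto intro!: mult_left_mono)
    then have "\<phi> (2 * r) \<le> K * ((\<bar>\<phi> 0\<bar> + 2) * Delta r)" "- \<phi> (- (2 * r)) \<le> K * ((\<bar>\<phi> 0\<bar> + 2) * Delta r)"
      using doubling[of r] doubling[of "- r"] by auto
    then show ?thesis by (simp add: Delta_def)
  qed
  moreover have "0 < ?C" using K1 by (intro mult_pos_pos) auto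
  ultimately show ?thesis by blast
qed

lemma Delta_tends_up: "tends_up Delta"
proof -
  have a: "tends_up (phase_side.Delta f)" if ps: "phase_side f f' c K" and fu: "tends_up f" for f f'
    unfolding tends_up_def
  proof
    interpret s: phase_side f f' c K by (rule ps)
    fix N
    obtain T where T: "0 < T" "\<And>t. T \<le> t \<Longrightarrow> N + f 0 \<le> f t" using fu unfolding tends_up_def by blast
    have "N \<le> s.Delta t" if "T \<le> t" for t
    proof -
      have "f (- t) \<le> f 0" by (rule s.le) (use that T in simp)
      then show ?thesis using T(2)[OF that] by (simp add: s.Delta_def)
    qed
    then show "\<exists>T>0. \<forall>t\<ge>T. N \<le> s.Delta t" using T(1) by blast
  qed
  have s: "phase_side \<phi> \<phi>' c K" by (rule phase_side_axioms)
  show ?thesis using tends_up_cases a[OF s] a[OF flip] unfolding flip_Delta by blast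
qed

text \<open>If the other end is bounded, its part of Delta is eventually at most phi and does not
  decrease; so 4 phi pays for 2 phi and for the missing copy of the other part.\<close>

lemma Delta_growth_aux:
  assumes up: "tends_up \<phi>" and Q: "(1 + 2 * c\<^sup>2)\<^sup>2 \<le> Q"
  shows "\<exists>T>0. \<forall>r\<ge>T. 2 * Delta r \<le> Delta (Q * r)"
proof -
  let ?\<psi> = "\<lambda>x. - \<phi> (- x)"
  interpret n: phase_side ?\<psi> "\<lambda>x. \<phi>' (- x)" c K by (rule flip)
  have De: "Delta r = \<phi> r + ?\<psi> r" for r by (simp add: Delta_def)
  obtain T where T: "0 < T" "\<And>r. T \<le> r \<Longrightarrow> 4 * \<phi> r \<le> \<phi> (Q * r)" using quadruple[OF up Q] by blast
  have "1 \<le> 1 + 2 * c\<^sup>2" by simp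
  then have "1 \<le> (1 + 2 * c\<^sup>2)\<^sup>2" by (rule one_le_power)
  then have Q1: "1 \<le> Q" using Q by linarith
  show ?thesis
  proof (cases "tends_up ?\<psi>")
    case True
    obtain T' where T': "0 < T'" "\<And>r. T' \<le> r \<Longrightarrow> 4 * ?\<psi> r \<le> ?\<psi> (Q * r)" using n.quadruple[OF True Q] by blast
    have "2 * Delta r \<le> Delta (Q * r)" if "max T T' \<le> r" for r
    proof -
      have "0 \<le> Delta r" unfolding Delta_def using le[of "- r" r] that T by simp
      then show ?thesis using T(2)[of r] T'(2)[of r] that unfolding De by simp
    qed
    moreover have "0 < max T T'" using T by simp
    ultimately show ?thesis by blast
  next
    case False
    then obtain b where b: "\<And>t. ?\<psi> t \<le> b" using n.not_tends_up by blast
    obtain T' where T': "0 < T'" "\<And>r. T' \<le> r \<Longrightarrow> \<bar>b\<bar> \<le> \<phi> r" using up unfolding tends_up_def by blast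
    have "2 * Delta r \<le> Delta (Q * r)" if r: "max T T' \<le> r" for r
    proof -
      have "1 * r \<le> Q * r" using Q1 r T by (intro mult_right_mono) auto
      then have "?\<psi> r \<le> ?\<psi> (Q * r)" by (intro n.le) simp
      moreover have "4 * \<phi> r \<le> \<phi> (Q * r)" "\<bar>b\<bar> \<le> \<phi> r" using r T(2) T'(2) by auto
      ultimately show ?thesis using b[of r] abs_ge_self[of b] abs_ge_zero[of b] unfolding De distrib_left by linarith
    qed
    moreover have "0 < max T T'" using T by simp
    ultimately show ?thesis by blast
  qed
qed

lemma Delta_growth: "\<exists>k\<ge>1. \<exists>T>0. \<forall>r\<ge>T. 2 * Delta r \<le> Delta (2 ^ k * r)"
proof -
  obtain k where k: "(1 + 2 * c\<^sup>2)\<^sup>2 < 2 ^ k" using real_arch_pow[of 2 "(1 + 2 * c\<^sup>2)\<^sup>2"] by auto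
  have "k \<noteq> 0"
  proof
    assume "k = 0"
    moreover have "1 \<le> (1 + 2 * c\<^sup>2)\<^sup>2" by (rule one_le_power) simp
    ultimately show False using k by (simp only: power_0)
  qed
  moreover have "\<exists>T>0. \<forall>r\<ge>T. 2 * Delta r \<le> Delta (2 ^ k * r)"
    using tends_up_cases Delta_growth_aux[of "2 ^ k"] phase_side.Delta_growth_aux[OF flip, of "2 ^ k"] k
    unfolding flip_Delta by fastforce
  ultimately show ?thesis by (intro exI[of _ k]) simp
qed

end

section \<open>Counting the extra zeros\<close>

text \<open>Points \<delta> apart fall into different cells of length \<delta>.\<close>

lemma card_separated:
  fixes S :: "real set"
  assumes S: "finite S" "S \<subseteq> {\<alpha>..\<beta>}" and \<delta>: "0 < \<delta>"
    and sep: "\<And>x y. x \<in> S \<Longrightarrow> y \<in> S \<Longrightarrow> x < y \<Longrightarrow> \<delta> \<le> y - x" and ab: "\<alpha> \<le> \<beta>"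
  shows "real (card S) \<le> (\<beta> - \<alpha>) / \<delta> + 1"
proof -
  let ?f = "\<lambda>x. nat \<lfloor>(x - \<alpha>) / \<delta>\<rfloor>"
  have neq: "?f x \<noteq> ?f y" if "x \<in> S" "y \<in> S" "x < y" for x y
  proof -
    have "(x - \<alpha>) / \<delta> + 1 = (x - \<alpha> + \<delta>) / \<delta>" using \<delta> by (simp add: add_divide_distrib)
    also have "\<dots> \<le> (y - \<alpha>) / \<delta>" using sep[OF that] \<delta> by (intro divide_right_mono) auto
    finally have "\<lfloor>(x - \<alpha>) / \<delta>\<rfloor> + 1 \<le> \<lfloor>(y - \<alpha>) / \<delta>\<rfloor>" by (simp only: le_floor_iff) (simp, linarith)
    moreover have "0 \<le> \<lfloor>(x - \<alpha>) / \<delta>\<rfloor>" using that S(2) \<delta> by auto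
    ultimately show ?thesis by linarith
  qed
  have inj: "inj_on ?f S"
  proof (rule inj_onI)
    fix x y assume "x \<in> S" "y \<in> S" "?f x = ?f y"
    then show "x = y" using neq[of x y] neq[of y x] by (cases x y rule: linorder_cases) auto
  qed
  have "?f ` S \<subseteq> {..?f \<beta>}"
  proof (rule image_subsetI)
    fix x assume "x \<in> S"
    then have "(x - \<alpha>) / \<delta> \<le> (\<beta> - \<alpha>) / \<delta>" using S(2) \<delta> by (intro divide_right_mono) auto
    then show "?f x \<in> {..?f \<beta>}" by (simp only: atMost_iff) (intro nat_mono floor_mono)
  qed
  then have "card S \<le> card {..?f \<beta>}" by (rule card_inj_on_le[OF inj]) simp
  then have "real (card S) \<le> real (?f \<beta>) + 1" by simp
  moreover have "real (?f \<beta>) \<le> (\<beta> - \<alpha>) / \<delta>" using ab \<delta> by simp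
  ultimately show ?thesis by linarith
qed

context mixed_orthogonal
begin

text \<open>Points \<eta> r/2 apart in a window of length at most r number at most 2/\<eta> + 1, a
  constant that D eventually outgrows.\<close>

lemma X_bounded_side:
  assumes D: "tends_up D" and \<eta>: "0 < \<eta>" and \<kappa>: "0 < \<kappa>" and len: "\<And>r. 0 < r \<Longrightarrow> \<alpha> r \<le> \<beta> r \<and> \<beta> r - \<alpha> r \<le> r"
    and sep: "\<exists>T>0. \<forall>r\<ge>T. \<forall>x\<in>X \<inter> {\<alpha> r..\<beta> r}. \<forall>y\<in>X \<inter> {\<alpha> r..\<beta> r}. x < y \<longrightarrow> \<eta> * r / 2 \<le> y - x"
  shows "\<exists>T>0. \<forall>r\<ge>T. real (card (X \<inter> {\<alpha> r..\<beta> r})) \<le> \<kappa> * D r"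
proof -
  obtain T where T: "0 < T" "\<And>r x y. T \<le> r \<Longrightarrow> x \<in> X \<inter> {\<alpha> r..\<beta> r} \<Longrightarrow> y \<in> X \<inter> {\<alpha> r..\<beta> r} \<Longrightarrow> x < y \<Longrightarrow> \<eta> * r / 2 \<le> y - x"
    using sep by blast
  obtain T' where T': "0 < T'" "\<And>r. T' \<le> r \<Longrightarrow> (2 / \<eta> + 1) / \<kappa> \<le> D r" using D unfolding tends_up_def by blast
  have "real (card (X \<inter> {\<alpha> r..\<beta> r})) \<le> \<kappa> * D r" if r: "max T T' \<le> r" for r
  proof -
    have r0: "0 < r" using r T by simp
    have er: "0 < \<eta> * r / 2" using r0 \<eta> by simp
    have "real (card (X \<inter> {\<alpha> r..\<beta> r})) \<le> (\<beta> r - \<alpha> r) / (\<eta> * r / 2) + 1"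
      by (rule card_separated[OF finite_X_Icc _ er]) (use T(2)[of r] r len[OF r0] in auto)
    also have "(\<beta> r - \<alpha> r) / (\<eta> * r / 2) \<le> r / (\<eta> * r / 2)" using len[OF r0] er by (intro divide_right_mono) auto
    also have "r / (\<eta> * r / 2) = 2 / \<eta>" using r0 by simp
    finally have "real (card (X \<inter> {\<alpha> r..\<beta> r})) \<le> 2 / \<eta> + 1" by simp
    also have "\<dots> = \<kappa> * ((2 / \<eta> + 1) / \<kappa>)" using \<kappa> by simp
    also have "\<dots> \<le> \<kappa> * D r" using T'(2)[of r] r \<kappa> by (intro mult_left_mono) auto
    finally show ?thesis .
  qed
  moreover have "0 < max T T'" using T by simp
  ultimately show ?thesis by blast
qed

text \<open>With d = C0 D r/r the bound of \<open>X_sparse\<close> for \<kappa>/C0 becomes \<kappa>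
  D r, and its requirement 100 <= \<eta> r d becomes a lower bound for D.\<close>

lemma X_unbounded_side:
  assumes D: "tends_up D" and \<eta>: "0 < \<eta>" "\<eta> \<le> 1" and \<kappa>: "0 < \<kappa>" and len: "\<And>r. 0 < r \<Longrightarrow> \<beta> r - \<alpha> r \<le> r"
    and box: "\<And>r x. 0 < r \<Longrightarrow> x \<in> {\<alpha> r..\<beta> r} \<Longrightarrow> \<eta> * r \<le> \<bar>x\<bar> \<and> \<bar>x\<bar> \<le> r"
    and up: "\<exists>C0>0. \<exists>T>0. \<forall>r\<ge>T. \<forall>t. \<alpha> r - \<eta> * r / 2 \<le> t \<and> t \<le> \<beta> r + \<eta> * r / 2 \<longrightarrow> \<phi>' t \<le> C0 * D r / r"
  shows "\<exists>T>0. \<forall>r\<ge>T. real (card (X \<inter> {\<alpha> r..\<beta> r})) \<le> \<kappa> * D r"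
proof -
  obtain C0 T1 where C0: "0 < C0" and T1: "0 < T1"
    "\<And>r t. T1 \<le> r \<Longrightarrow> \<alpha> r - \<eta> * r / 2 \<le> t \<and> t \<le> \<beta> r + \<eta> * r / 2 \<Longrightarrow> \<phi>' t \<le> C0 * D r / r"
    using up by blast
  have "0 < \<kappa> / C0" using \<kappa> C0 by simp
  from X_sparse[OF \<eta> this] obtain T2 where T2: "0 < T2"
    "\<And>r \<alpha> \<beta> d. T2 \<le> r \<Longrightarrow> \<beta> - \<alpha> \<le> r \<Longrightarrow> (\<forall>x\<in>{\<alpha>..\<beta>}. \<eta> * r \<le> \<bar>x\<bar> \<and> \<bar>x\<bar> \<le> r) \<Longrightarrow>
      (\<forall>t. \<alpha> - \<eta> * r / 2 \<le> t \<and> t \<le> \<beta> + \<eta> * r / 2 \<longrightarrow> \<phi>' t \<le> d) \<Longrightarrow> 100 \<le> \<eta> * r * d \<Longrightarrow>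
      real (card (X \<inter> {\<alpha>..\<beta>})) \<le> \<kappa> / C0 * d * r" by blast
  obtain T3 where T3: "0 < T3" "\<And>r. T3 \<le> r \<Longrightarrow> 100 / (\<eta> * C0) \<le> D r" using D unfolding tends_up_def by blast
  have "real (card (X \<inter> {\<alpha> r..\<beta> r})) \<le> \<kappa> * D r" if r: "max T1 (max T2 T3) \<le> r" for r
  proof -
    have r0: "0 < r" using r T1 by simp
    have "100 / (\<eta> * C0) \<le> D r" using T3(2) r by simp
    then have "100 \<le> \<eta> * C0 * D r" using \<eta> C0 by (simp add: pos_divide_le_eq mult.commute)
    then have big: "100 \<le> \<eta> * r * (C0 * D r / r)" using r0 by (simp add: mult_ac)
    have "real (card (X \<inter> {\<alpha> r..\<beta> r})) \<le> \<kappa> / C0 * (C0 * D r / r) * r"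
      by (rule T2(2)[OF _ len[OF r0] _ _ big]) (use r T1(2)[of r] box[OF r0] in auto)
    also have "\<dots> = \<kappa> * D r" using r0 C0 by simp
    finally show ?thesis .
  qed
  moreover have "0 < max T1 (max T2 T3)" using T1 by simp
  ultimately show ?thesis by blast
qed

definition nX :: "real \<Rightarrow> real" where "nX r = real (card (X \<inter> {-r..r}))"

lemma nX_mono: "r \<le> s \<Longrightarrow> nX r \<le> nX s"
  unfolding nX_def by (intro of_nat_mono card_mono finite_X_Icc) auto

text \<open>Annuli \<eta> r <= |x| <= r with \<eta> = 1/2^k, matched to the ratio at which
  \<open>Delta\<close> doubles. Each half annulus eventually holds at most \<kappa>/4 Delta r
  points, whether its end is bounded or not, and \<open>doubling_recursion\<close> turns the
  resulting \<kappa>/2 into \<kappa>.\<close>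

lemma X_counting:
  assumes ps: "phase_side \<phi> \<phi>' c' K" and k: "1 \<le> k" and T: "0 < T"
    and grow: "\<And>r. T \<le> r \<Longrightarrow> 2 * phase_side.Delta \<phi> r \<le> phase_side.Delta \<phi> (2 ^ k * r)" and \<kappa>: "0 < \<kappa>"
  shows "\<exists>c0. \<exists>T1>0. \<forall>r\<ge>T1. nX r \<le> \<kappa> * phase_side.Delta \<phi> r + c0"
proof -
  interpret p: phase_side \<phi> \<phi>' c' K by (rule ps)
  let ?\<psi> = "\<lambda>x. - \<phi> (- x)"
  interpret n: phase_side ?\<psi> "\<lambda>x. \<phi>' (- x)" c' K by (rule p.flip)
  define \<eta> :: real where "\<eta> = 1 / 2 ^ k"
  have \<eta>: "0 < \<eta>" "\<eta> \<le> 1" by (simp_all add: \<eta>_def)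
  have D: "tends_up p.Delta" by (rule p.Delta_tends_up)
  have \<kappa>4: "0 < \<kappa> / 4" using \<kappa> by simp
  have eh: "0 < \<eta> / 2" using \<eta> by simp
  have er: "\<eta> * r \<le> r" if "0 < r" for r using \<eta> that mult_right_mono[of \<eta> 1 r] by simp
  have right: "\<exists>T>0. \<forall>r\<ge>T. real (card (X \<inter> {\<eta> * r..r})) \<le> \<kappa> / 4 * p.Delta r"
  proof (cases "tends_up \<phi>")
    case True
    show ?thesis
    proof (rule X_unbounded_side[OF D \<eta> \<kappa>4])
      show "r - \<eta> * r \<le> r" if "0 < r" for r using \<eta> that by simp
      show "\<eta> * r \<le> \<bar>x\<bar> \<and> \<bar>x\<bar> \<le> r" if "0 < r" "x \<in> {\<eta> * r..r}" for r x
      proof -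
        have "0 < \<eta> * r" using \<eta> that by simp
        then show ?thesis using that by auto
      qed
      obtain C0 T where C: "0 < C0" "0 < T" "\<And>r t. T \<le> r \<Longrightarrow> \<eta> / 2 * r \<le> t \<and> t \<le> 2 * r \<Longrightarrow> \<phi>' t \<le> C0 * p.Delta r / r"
        using p.side_Delta[OF True eh] by blast
      have "\<phi>' t \<le> C0 * p.Delta r / r" if "T \<le> r" "\<eta> * r - \<eta> * r / 2 \<le> t \<and> t \<le> r + \<eta> * r / 2" for r t
      proof (rule C(3)[OF that(1)])
        have r0: "0 < r" using that(1) C(2) by linarith
        have e: "\<eta> / 2 * r = \<eta> * r / 2" by simp
        show "\<eta> / 2 * r \<le> t \<and> t \<le> 2 * r"
          unfolding e by (rule conjI) (use conjunct1[OF that(2)] conjunct2[OF that(2)] er[OF r0] r0 in linarith)+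
      qed
      then show "\<exists>C0>0. \<exists>T>0. \<forall>r\<ge>T. \<forall>t. \<eta> * r - \<eta> * r / 2 \<le> t \<and> t \<le> r + \<eta> * r / 2 \<longrightarrow> \<phi>' t \<le> C0 * p.Delta r / r"
        using C(1,2) by blast
    qed
  next
    case False
    then obtain T1 where T1: "0 < T1" "\<And>a b. T1 \<le> a \<Longrightarrow> \<phi> b - \<phi> a < 1" using p.bounded_variation_small by blast
    show ?thesis
    proof (rule X_bounded_side[OF D \<eta>(1) \<kappa>4])
      show "\<eta> * r \<le> r \<and> r - \<eta> * r \<le> r" if "0 < r" for r using \<eta> that er by simp
      have "\<eta> * r / 2 \<le> y - x" if r: "2 * T1 / \<eta> \<le> r" and xy: "x \<in> X \<inter> {\<eta> * r..r}" "y \<in> X \<inter> {\<eta> * r..r}" "x < y" for r x y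
      proof (rule ccontr)
        \<comment> \<open>Two such points closer than \<eta> r/2 would keep the enlarged interval
          beyond T1, where phi increases by less than 1.\<close>
        assume nl: "\<not> \<eta> * r / 2 \<le> y - x"
        have "1 \<le> \<phi> (y + (y - x)) - \<phi> (x - (y - x))" using xy by (intro X_spacing[of x y]) auto
        moreover have "T1 \<le> x - (y - x)"
        proof -
          have "2 * T1 \<le> \<eta> * r" using r \<eta> by (simp add: pos_divide_le_eq mult.commute)
          moreover have "\<eta> * r \<le> x" using xy by simp
          ultimately show ?thesis using nl by linarith
        qed
        ultimately show False using T1(2)[of "x - (y - x)" "y + (y - x)"] by linarith
      qed
      moreover have "0 < 2 * T1 / \<eta>" using T1 \<eta> by simp
      ultimately show "\<exists>T>0. \<forall>r\<ge>T. \<forall>x\<in>X \<inter> {\<eta> * r..r}. \<forall>y\<in>X \<inter> {\<eta> * r..r}. x < y \<longrightarrow> \<eta> * r / 2 \<le> y - x" by blast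
    qed
  qed
  have left: "\<exists>T>0. \<forall>r\<ge>T. real (card (X \<inter> {- r..- (\<eta> * r)})) \<le> \<kappa> / 4 * p.Delta r"
  proof (cases "tends_up ?\<psi>")
    case True
    show ?thesis
    proof (rule X_unbounded_side[OF D \<eta> \<kappa>4])
      show "- (\<eta> * r) - - r \<le> r" if "0 < r" for r using \<eta> that by simp
      show "\<eta> * r \<le> \<bar>x\<bar> \<and> \<bar>x\<bar> \<le> r" if "0 < r" "x \<in> {- r..- (\<eta> * r)}" for r x
      proof -
        have "0 < \<eta> * r" using \<eta> that by simp
        then show ?thesis using that by auto
      qed
      obtain C0 T where C: "0 < C0" "0 < T" "\<And>r t. T \<le> r \<Longrightarrow> \<eta> / 2 * r \<le> t \<and> t \<le> 2 * r \<Longrightarrow> \<phi>' (- t) \<le> C0 * p.Delta r / r"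
        using n.side_Delta[OF True eh] unfolding p.flip_Delta by blast
      have "\<phi>' t \<le> C0 * p.Delta r / r" if "T \<le> r" "- r - \<eta> * r / 2 \<le> t \<and> t \<le> - (\<eta> * r) + \<eta> * r / 2" for r t
      proof -
        have r0: "0 < r" using that(1) C(2) by linarith
        have e: "\<eta> / 2 * r = \<eta> * r / 2" by simp
        have "\<eta> / 2 * r \<le> - t \<and> - t \<le> 2 * r"
          unfolding e by (rule conjI) (use conjunct1[OF that(2)] conjunct2[OF that(2)] er[OF r0] r0 in linarith)+
        from C(3)[OF that(1) this] show ?thesis by simp
      qed
      then show "\<exists>C0>0. \<exists>T>0. \<forall>r\<ge>T. \<forall>t. - r - \<eta> * r / 2 \<le> t \<and> t \<le> - (\<eta> * r) + \<eta> * r / 2 \<longrightarrow> \<phi>' t \<le> C0 * p.Delta r / r"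
        using C(1,2) by blast
    qed
  next
    case False
    then obtain T1 where T1: "0 < T1" "\<And>a b. T1 \<le> a \<Longrightarrow> ?\<psi> b - ?\<psi> a < 1" using n.bounded_variation_small by blast
    show ?thesis
    proof (rule X_bounded_side[OF D \<eta>(1) \<kappa>4])
      show "- r \<le> - (\<eta> * r) \<and> - (\<eta> * r) - - r \<le> r" if "0 < r" for r using \<eta> that er by simp
      have "\<eta> * r / 2 \<le> y - x" if r: "2 * T1 / \<eta> \<le> r" and xy: "x \<in> X \<inter> {- r..- (\<eta> * r)}" "y \<in> X \<inter> {- r..- (\<eta> * r)}" "x < y" for r x y
      proof (rule ccontr)
        assume nl: "\<not> \<eta> * r / 2 \<le> y - x"
        have "1 \<le> \<phi> (y + (y - x)) - \<phi> (x - (y - x))" using xy by (intro X_spacing[of x y]) auto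
        moreover have "T1 \<le> - (y + (y - x))"
        proof -
          have "2 * T1 \<le> \<eta> * r" using r \<eta> by (simp add: pos_divide_le_eq mult.commute)
          moreover have "y \<le> - (\<eta> * r)" using xy by simp
          ultimately show ?thesis using nl by linarith
        qed
        ultimately show False using T1(2)[of "- (y + (y - x))" "- (x - (y - x))"] by simp
      qed
      moreover have "0 < 2 * T1 / \<eta>" using T1 \<eta> by simp
      ultimately show "\<exists>T>0. \<forall>r\<ge>T. \<forall>x\<in>X \<inter> {- r..- (\<eta> * r)}. \<forall>y\<in>X \<inter> {- r..- (\<eta> * r)}. x < y \<longrightarrow> \<eta> * r / 2 \<le> y - x" by blast
    qed
  qed
  obtain Ta where Ta: "0 < Ta" "\<And>r. Ta \<le> r \<Longrightarrow> real (card (X \<inter> {\<eta> * r..r})) \<le> \<kappa> / 4 * p.Delta r" using right by blast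
  obtain Tb where Tb: "0 < Tb" "\<And>r. Tb \<le> r \<Longrightarrow> real (card (X \<inter> {- r..- (\<eta> * r)})) \<le> \<kappa> / 4 * p.Delta r" using left by blast
  obtain Tc where Tc: "0 < Tc" "\<And>r. Tc \<le> r \<Longrightarrow> 0 \<le> p.Delta r" using D unfolding tends_up_def by blast
  let ?T = "max (max Ta Tb) (max Tc T)"
  have T0: "0 < ?T" using T by simp
  have B: "(1 :: real) < 2 ^ k" using k by (intro one_less_power) auto
  have "\<exists>c0. \<forall>r\<ge>?T. nX r \<le> 2 * (\<kappa> / 2) * p.Delta r + c0"
  proof (rule doubling_recursion[OF nX_mono B T0])
    fix q assume q: "?T \<le> q"
    let ?r = "2 ^ k * q"
    have q0: "0 < q" using q T0 by linarith
    then have qr: "q \<le> ?r" using B mult_right_mono[of 1 "2 ^ k" q] by simp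
    have \<eta>r: "\<eta> * ?r = q" by (simp add: \<eta>_def)
    have "X \<inter> {- ?r..?r} \<subseteq> (X \<inter> {- q..q}) \<union> ((X \<inter> {q..?r}) \<union> (X \<inter> {- ?r..- q}))" by auto
    then have "card (X \<inter> {- ?r..?r}) \<le> card ((X \<inter> {- q..q}) \<union> ((X \<inter> {q..?r}) \<union> (X \<inter> {- ?r..- q})))"
      by (intro card_mono finite_UnI finite_X_Icc)
    also have "\<dots> \<le> card (X \<inter> {- q..q}) + (card (X \<inter> {q..?r}) + card (X \<inter> {- ?r..- q}))"
      by (intro order_trans[OF card_Un_le] add_left_mono card_Un_le)
    finally have *: "nX ?r \<le> nX q + (real (card (X \<inter> {q..?r})) + real (card (X \<inter> {- ?r..- q})))"
      unfolding nX_def by (simp only: of_nat_add[symmetric] of_nat_le_iff)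
    show "nX ?r \<le> nX q + \<kappa> / 2 * p.Delta ?r"
    proof -
      have qq: "Ta \<le> q" "Tb \<le> q" using q by auto
      show ?thesis using * Ta(2)[OF order_trans[OF qq(1) qr]] Tb(2)[OF order_trans[OF qq(2) qr]] unfolding \<eta>r by linarith
    qed
  qed (use \<kappa> grow Tc in auto)
  then obtain c0 where c0: "\<forall>r\<ge>?T. nX r \<le> 2 * (\<kappa> / 2) * p.Delta r + c0" by (rule exE)
  have k2: "2 * (\<kappa> / 2) = \<kappa>" by simp
  show ?thesis by (rule exI[of _ c0], rule exI[of _ ?T], rule conjI[OF T0], rule c0[unfolded k2])
qed

text \<open>The right-hand sum of the Jensen inequality; it is the integral of the counting function
  of X around x0 against dt/t up to R.\<close>

definition SX :: "real \<Rightarrow> real \<Rightarrow> real" where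
  "SX x0 R = (\<Sum>a | a \<in> X \<and> \<bar>a - x0\<bar> < R. ln (R / \<bar>a - x0\<bar>))"

lemma finite_X_open: "finite {a. a \<in> X \<and> \<bar>a - x0\<bar> < R}"
  by (rule finite_subset[OF _ finite_X[of x0 R]]) auto

lemma SX_mono:
  assumes h0: "h (of_real x0) \<noteq> 0" and rs: "r \<le> s"
  shows "SX x0 r \<le> SX x0 s"
proof -
  have ne: "a \<noteq> x0" if "a \<in> X" for a using that h0 by (auto simp: X_def)
  have "SX x0 r \<le> (\<Sum>a | a \<in> X \<and> \<bar>a - x0\<bar> < r. ln (s / \<bar>a - x0\<bar>))"
    unfolding SX_def
  proof (rule sum_mono)
    fix a assume "a \<in> {a. a \<in> X \<and> \<bar>a - x0\<bar> < r}"
    then have a: "0 < \<bar>a - x0\<bar>" "\<bar>a - x0\<bar> < r" using ne by auto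
    then have "0 < r / \<bar>a - x0\<bar>" "r / \<bar>a - x0\<bar> \<le> s / \<bar>a - x0\<bar>" using rs by (auto intro: divide_right_mono)
    then show "ln (r / \<bar>a - x0\<bar>) \<le> ln (s / \<bar>a - x0\<bar>)" by (intro ln_mono)
  qed
  also have "\<dots> \<le> SX x0 s"
    unfolding SX_def
  proof (rule sum_mono2[OF finite_X_open])
    fix a assume "a \<in> {a. a \<in> X \<and> \<bar>a - x0\<bar> < s} - {a. a \<in> X \<and> \<bar>a - x0\<bar> < r}"
    then have "0 < \<bar>a - x0\<bar>" "\<bar>a - x0\<bar> < s" using ne by auto
    then show "0 \<le> ln (s / \<bar>a - x0\<bar>)" by (intro ln_ge_zero) simp
  qed (use rs in auto)
  finally show ?thesis .
qed

text \<open>Enlarging R by the factor B adds ln B to every term; the terms with |a - x0| >= R would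
  be nonpositive without it and are dropped.\<close>

lemma SX_step:
  assumes h0: "h (of_real x0) \<noteq> 0" and B: "1 \<le> B" and R: "0 < R"
  shows "SX x0 (B * R) \<le> SX x0 R + ln B * nX (B * R + \<bar>x0\<bar>)"
proof -
  have ne: "a \<noteq> x0" if "a \<in> X" for a using that h0 by (auto simp: X_def)
  let ?S = "{a. a \<in> X \<and> \<bar>a - x0\<bar> < B * R}" and ?S1 = "{a. a \<in> X \<and> \<bar>a - x0\<bar> < R}"
  have RB: "R \<le> B * R" using mult_right_mono[OF B, of R] R by simp
  have "SX x0 (B * R) = (\<Sum>a\<in>?S. ln B + ln (R / \<bar>a - x0\<bar>))"
    unfolding SX_def
  proof (rule sum.cong[OF refl])
    fix a assume "a \<in> ?S"
    then have "0 < R / \<bar>a - x0\<bar>" using ne R by auto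
    then have "ln (B * (R / \<bar>a - x0\<bar>)) = ln B + ln (R / \<bar>a - x0\<bar>)" using B by (intro ln_mult_pos) auto
    then show "ln (B * R / \<bar>a - x0\<bar>) = ln B + ln (R / \<bar>a - x0\<bar>)" by simp
  qed
  also have "\<dots> = ln B * real (card ?S) + (\<Sum>a\<in>?S. ln (R / \<bar>a - x0\<bar>))" by (simp add: sum.distrib)
  also have "(\<Sum>a\<in>?S. ln (R / \<bar>a - x0\<bar>)) = (\<Sum>a\<in>?S1. ln (R / \<bar>a - x0\<bar>)) + (\<Sum>a\<in>?S - ?S1. ln (R / \<bar>a - x0\<bar>))"
    by (rule trans[OF sum.subset_diff[OF _ finite_X_open] add.commute]) (use RB in auto)
  also have "(\<Sum>a\<in>?S - ?S1. ln (R / \<bar>a - x0\<bar>)) \<le> 0"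
  proof (rule sum_nonpos)
    fix a assume "a \<in> ?S - ?S1"
    then have a: "R \<le> \<bar>a - x0\<bar>" by auto
    then have "R / \<bar>a - x0\<bar> \<le> 1" using R by simp
    moreover have "0 < R / \<bar>a - x0\<bar>" using a R by (intro divide_pos_pos) linarith+
    ultimately show "ln (R / \<bar>a - x0\<bar>) \<le> 0" by (simp only: ln_le_zero_iff)
  qed
  also have "ln B * real (card ?S) \<le> ln B * nX (B * R + \<bar>x0\<bar>)"
    unfolding nX_def using B by (intro mult_left_mono of_nat_mono card_mono finite_X_Icc) auto
  finally show ?thesis unfolding SX_def by simp
qed

lemma exists_base_point:
  assumes "entire F" "\<exists>z. F z \<noteq> 0" "entire G" "\<exists>z. G z \<noteq> 0" "a < b"
  shows "\<exists>x. a < x \<and> x < b \<and> F (complex_of_real x) \<noteq> 0 \<and> G (of_real x) \<noteq> 0"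
proof (rule ccontr)
  assume n: "\<not> ?thesis"
  let ?r = "\<bar>a\<bar> + \<bar>b\<bar>"
  have "{a<..<b} \<subseteq> {x. F (of_real x) = 0 \<and> \<bar>x - 0\<bar> \<le> ?r} \<union> {x. G (of_real x) = 0 \<and> \<bar>x - 0\<bar> \<le> ?r}"
    using n by auto
  moreover have "finite ({x. F (of_real x) = 0 \<and> \<bar>x - 0\<bar> \<le> ?r} \<union> {x. G (of_real x) = 0 \<and> \<bar>x - 0\<bar> \<le> ?r})"
    by (intro finite_UnI entire_finite_zeros assms)
  ultimately have "finite {a<..<b}" by (rule finite_subset)
  then show False using \<open>a < b\<close> by (simp add: infinite_Ioo)
qed

lemma exists_good_radius:
  assumes "a < b"
  shows "\<exists>R. a < R \<and> R < b \<and> (\<forall>x. \<bar>x - x0\<bar> = R \<longrightarrow> h (complex_of_real x) \<noteq> 0)"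
proof (rule ccontr)
  assume n: "\<not> ?thesis"
  have "{a<..<b} \<subseteq> (\<lambda>x. \<bar>x - x0\<bar>) ` {x. h (of_real x) = 0 \<and> \<bar>x - x0\<bar> \<le> b}"
  proof
    fix R assume R: "R \<in> {a<..<b}"
    then have "\<not> (\<forall>x. \<bar>x - x0\<bar> = R \<longrightarrow> h (complex_of_real x) \<noteq> 0)" using n by auto
    then obtain x where "\<bar>x - x0\<bar> = R" "h (complex_of_real x) = 0" by blast
    with R show "R \<in> (\<lambda>x. \<bar>x - x0\<bar>) ` {x. h (of_real x) = 0 \<and> \<bar>x - x0\<bar> \<le> b}" by (intro image_eqI[of _ _ x]) auto
  qed
  then have "finite {a<..<b}" by (rule finite_subset[OF _ finite_imageI[OF entire_finite_zeros[OF he h_nonzero]]])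
  then show False using assms by (simp add: infinite_Ioo)
qed

lemma finite_Lam1_abs: "finite {l \<in> Lam1. \<bar>l\<bar> \<le> r}"
  by (rule finite_subset[of _ "insert l0 {x \<in> Lam1 - {l0}. \<bar>x - 0\<bar> \<le> r}"]) (use finite_Lam1[of 0 r] in auto)

text \<open>At a radius R comparable with r every point of Lam1 in [-r, r] other than l0 contributes
  at least ln 2 to the left of the Jensen inequality, while the right is a small multiple of Delta r
  plus a constant. Positive density along a sequence of r makes these incompatible, as Delta is
  unbounded.\<close>

lemma positive_density_contradiction:
  assumes ps: "phase_side \<phi> \<phi>' c' K" and \<delta>: "0 < \<delta>"
    and dens: "\<And>N. \<exists>r\<ge>N. \<delta> * phase_side.Delta \<phi> r \<le> real (card {l \<in> Lam1. \<bar>l\<bar> \<le> r})"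
  shows False
proof -
  interpret p: phase_side \<phi> \<phi>' c' K by (rule ps)
  let ?D = p.Delta
  obtain x0 where h0: "h (of_real x0) \<noteq> 0" and g0: "g (of_real x0) \<noteq> 0"
    using exists_base_point[OF he h_nonzero ge g_nonzero zero_less_one] by blast
  obtain J where J: "\<And>R. 1 \<le> R \<Longrightarrow> (\<forall>x. \<bar>x - x0\<bar> = R \<longrightarrow> h (of_real x) \<noteq> 0) \<Longrightarrow>
      (\<Sum>l | l \<in> Lam1 - {l0} \<and> \<bar>l - x0\<bar> < R. ln (R / \<bar>l - x0\<bar>)) \<le> J + SX x0 R"
    using Jensen_inequality[OF h0 g0] unfolding SX_def by blast
  obtain k :: nat and T where k: "1 \<le> k" and T: "0 < T" and grow: "\<And>r. T \<le> r \<Longrightarrow> 2 * ?D r \<le> ?D (2 ^ k * r)"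
    using p.Delta_growth by blast
  obtain C where C: "0 < C" "\<And>r. 0 \<le> r \<Longrightarrow> 1 \<le> ?D r \<Longrightarrow> ?D (2 * r) \<le> C * ?D r" using p.Delta_doubling by blast
  define B :: real where "B = 2 ^ k"
  have B1: "1 < B" unfolding B_def using k by (intro one_less_power) auto
  have lnB: "0 < ln B" using B1 by simp
  \<comment> \<open>2 comes from \<open>doubling_recursion\<close>, ln B from
    \<open>SX_step\<close>, C from passing to the radius 2 B r, and 1 from absorbing
    \<open>c0\<close>.\<close>
  define Q where "Q = 2 * (ln B * (C + 1))"
  have Q0: "0 < Q" using lnB C by (simp add: Q_def)
  \<comment> \<open>C^3 accounts for the passage from r to 8 r; the choice makes the contribution of
    the extra zeros half of ln 2 \<delta> Delta r.\<close>
  define \<kappa> where "\<kappa> = ln 2 * \<delta> / (2 * Q * C ^ 3)"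
  have \<kappa>0: "0 < \<kappa>" using \<delta> Q0 C by (simp add: \<kappa>_def)
  obtain c0 T1 where nX: "0 < T1" "\<And>r. T1 \<le> r \<Longrightarrow> nX r \<le> \<kappa> * ?D r + c0"
    using X_counting[OF ps k T grow \<kappa>0] by blast
  obtain T2 where T2: "0 < T2" "\<And>r. T2 \<le> r \<Longrightarrow> max 1 (c0 / \<kappa>) \<le> ?D r" using p.Delta_tends_up unfolding tends_up_def by blast
  have D1: "1 \<le> ?D r" if "T2 \<le> r" for r using T2(2)[OF that] by simp
  let ?T = "max (max T T1) (max T2 (\<bar>x0\<bar> + 1))"
  have T0: "0 < ?T" using T by simp
  have "\<exists>c1. \<forall>r\<ge>?T. SX x0 r \<le> 2 * (\<kappa> * (ln B * (C + 1))) * ?D r + c1"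
  proof (rule doubling_recursion[OF SX_mono[OF h0] B1 T0])
    show "0 \<le> \<kappa> * (ln B * (C + 1))" using \<kappa>0 lnB C by simp
    fix r assume r: "?T \<le> r"
    then have r0: "0 < r" using T0 by linarith
    have rr: "T \<le> r" "T1 \<le> r" "T2 \<le> r" "\<bar>x0\<bar> + 1 \<le> r" using r by auto
    show "2 * ?D r \<le> ?D (B * r)" unfolding B_def by (rule grow) (use r in simp)
    show "0 \<le> ?D r" using D1[of r] r by simp
    have rB: "r \<le> B * r" using B1 r0 mult_right_mono[of 1 B r] by simp
    have "SX x0 (B * r) \<le> SX x0 r + ln B * nX (B * r + \<bar>x0\<bar>)" by (rule SX_step[OF h0 _ r0]) (use B1 in simp)
    also have "nX (B * r + \<bar>x0\<bar>) \<le> nX (2 * (B * r))" by (rule nX_mono) (use rB rr in linarith)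
    also have "\<dots> \<le> \<kappa> * ?D (2 * (B * r)) + c0" by (rule nX(2)) (use rB rr r0 in linarith)
    also have "\<dots> \<le> \<kappa> * (C * ?D (B * r)) + \<kappa> * ?D (B * r)"
    proof (rule add_mono)
      show "\<kappa> * ?D (2 * (B * r)) \<le> \<kappa> * (C * ?D (B * r))"
        by (intro mult_left_mono C(2) D1) (use rB rr r0 \<kappa>0 in linarith)+
      have "T2 \<le> B * r" using rB rr by linarith
      from T2(2)[OF this] have "c0 / \<kappa> \<le> ?D (B * r)" by simp
      then show "c0 \<le> \<kappa> * ?D (B * r)" using \<kappa>0 by (simp add: pos_divide_le_eq mult.commute)
    qed
    finally show "SX x0 (B * r) \<le> SX x0 r + \<kappa> * (ln B * (C + 1)) * ?D (B * r)"
      using lnB by (simp add: algebra_simps)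
  qed
  then obtain c1 where SX: "\<And>r. ?T \<le> r \<Longrightarrow> SX x0 r \<le> \<kappa> * Q * ?D r + c1" unfolding Q_def by (auto simp: mult_ac)
  \<comment> \<open>Once Delta r exceeds this value, the constants J and c1 and the ln 2 lost with
    l0 no longer matter.\<close>
  define N0 where "N0 = 2 * (J + c1 + ln 2) / (ln 2 * \<delta>) + 1"
  obtain T3 where T3: "0 < T3" "\<And>r. T3 \<le> r \<Longrightarrow> N0 \<le> ?D r" using p.Delta_tends_up unfolding tends_up_def by blast
  obtain r where r: "max T3 ?T \<le> r" "\<delta> * ?D r \<le> real (card {l \<in> Lam1. \<bar>l\<bar> \<le> r})" using dens by blast
  have r0: "0 < r" using r(1) T3 by simp
  have rx: "\<bar>x0\<bar> + 1 \<le> r" using r(1) by simp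
  have "2 * (r + \<bar>x0\<bar>) < 4 * (r + \<bar>x0\<bar>)" using r0 by simp
  \<comment> \<open>The lower end gives 2 |l - x0| <= R for |l| <= r, the upper end R <= 8 r; the
    freedom between them avoids zeros of h at x0 + R and x0 - R.\<close>
  then obtain R where R: "2 * (r + \<bar>x0\<bar>) < R" "R < 4 * (r + \<bar>x0\<bar>)" "\<forall>x. \<bar>x - x0\<bar> = R \<longrightarrow> h (complex_of_real x) \<noteq> 0"
    using exists_good_radius by blast
  have R1: "1 \<le> R" using R(1) rx abs_ge_zero[of x0] unfolding distrib_left by linarith
  have R8: "R \<le> 8 * r" using R(2) rx unfolding distrib_left by linarith
  let ?L = "{l. l \<in> Lam1 - {l0} \<and> \<bar>l - x0\<bar> < R}" and ?L1 = "{l \<in> Lam1. \<bar>l\<bar> \<le> r}"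
  have fL: "finite ?L" by (rule finite_subset[OF _ finite_Lam1[of x0 R]]) auto
  have sub: "?L1 - {l0} \<subseteq> ?L" using R rx by auto
  have ne: "l \<noteq> x0" if "l \<in> ?L" for l using that g0 by (auto simp: g_zero)
  have "ln 2 * (real (card ?L1) - 1) \<le> ln 2 * real (card (?L1 - {l0}))"
  proof (rule mult_left_mono)
    have "card ?L1 \<le> card (insert l0 (?L1 - {l0}))" by (rule card_mono) (use finite_Lam1_abs[of r] in auto)
    also have "\<dots> \<le> Suc (card (?L1 - {l0}))" by (rule card_insert_le_m1) auto
    finally show "real (card ?L1) - 1 \<le> real (card (?L1 - {l0}))" by simp
  qed simp
  also have "\<dots> = (\<Sum>l\<in>?L1 - {l0}. ln 2)" by simp
  also have "\<dots> \<le> (\<Sum>l\<in>?L1 - {l0}. ln (R / \<bar>l - x0\<bar>))"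
  proof (rule sum_mono)
    fix l assume l: "l \<in> ?L1 - {l0}"
    then have "0 < \<bar>l - x0\<bar>" using ne sub by auto
    moreover have "2 * \<bar>l - x0\<bar> \<le> R"
    proof -
      have gen: "2 * p \<le> R" if "q \<le> r" "2 * r + 2 * y < R" "p \<le> q + y" for p q y :: real using that by linarith
      have "\<bar>l\<bar> \<le> r" using l by simp
      then show ?thesis by (rule gen[OF _ R(1)[unfolded distrib_left] abs_triangle_ineq4])
    qed
    ultimately have "2 \<le> R / \<bar>l - x0\<bar>" by (simp only: pos_le_divide_eq)
    then show "ln 2 \<le> ln (R / \<bar>l - x0\<bar>)" by (intro ln_mono) auto
  qed
  also have "\<dots> \<le> (\<Sum>l\<in>?L. ln (R / \<bar>l - x0\<bar>))"
  proof (rule sum_mono2[OF fL sub])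
    fix l assume "l \<in> ?L - (?L1 - {l0})"
    then have "0 < \<bar>l - x0\<bar>" "\<bar>l - x0\<bar> < R" using ne by auto
    then show "0 \<le> ln (R / \<bar>l - x0\<bar>)" by (intro ln_ge_zero) simp
  qed
  also have "\<dots> \<le> J + SX x0 R" by (rule J[OF R1 R(3)])
  also have "SX x0 R \<le> SX x0 (8 * r)" by (rule SX_mono[OF h0 R8])
  also have "\<dots> \<le> \<kappa> * Q * ?D (8 * r) + c1" by (rule SX) (use r(1) r0 in auto)
  also have "\<kappa> * Q * ?D (8 * r) \<le> \<kappa> * Q * (C ^ 3 * ?D r)"
  proof (rule mult_left_mono)
    have d: "1 \<le> ?D r" "1 \<le> ?D (2 * r)" "1 \<le> ?D (2 * (2 * r))" by (rule D1, use r(1) r0 in simp)+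
    have "?D (2 * (2 * (2 * r))) \<le> C * ?D (2 * (2 * r))" by (rule C(2)) (use d r0 in auto)
    also have "\<dots> \<le> C * (C * ?D (2 * r))" by (rule mult_left_mono[OF C(2)]) (use d r0 C(1) in auto)
    also have "\<dots> \<le> C * (C * (C * ?D r))" by (intro mult_left_mono C(2)) (use d r0 C(1) in auto)
    finally show "?D (8 * r) \<le> C ^ 3 * ?D r" by (simp add: power3_eq_cube mult.assoc)
  qed (use \<kappa>0 Q0 in simp)
  also have "\<kappa> * Q * (C ^ 3 * ?D r) = ln 2 * \<delta> / 2 * ?D r" unfolding \<kappa>_def using Q0 C(1) by simp
  finally have f: "ln 2 * (real (card ?L1) - 1) \<le> J + (ln 2 * \<delta> / 2 * ?D r + c1)" by simp
  have ld: "0 < ln 2 * \<delta>" using \<delta> by simp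
  have "ln 2 * (\<delta> * ?D r) \<le> ln 2 * real (card ?L1)" by (rule mult_left_mono[OF r(2)]) simp
  then have le: "ln 2 * (\<delta> * ?D r) \<le> ln 2 * real (card ?L1)" .
  have gen: "a \<le> 2 * (j + d + e)" if "a \<le> b" "b - e \<le> j + (a / 2 + d)" for a b d e j :: real
    using that unfolding distrib_left by linarith
  have e1: "ln 2 * (real (card ?L1) - 1) = ln 2 * real (card ?L1) - ln 2" by (simp add: right_diff_distrib)
  have e2: "ln 2 * \<delta> / 2 * ?D r = ln 2 * (\<delta> * ?D r) / 2" by simp
  have "ln 2 * (\<delta> * ?D r) \<le> 2 * (J + c1 + ln 2)" by (rule gen[OF le f[unfolded e1 e2]])
  then have "ln 2 * \<delta> * ?D r \<le> 2 * (J + c1 + ln 2)" by (simp only: mult.assoc)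
  then have "?D r \<le> 2 * (J + c1 + ln 2) / (ln 2 * \<delta>)" using ld by (simp only: pos_le_divide_eq) (simp add: mult_ac)
  moreover have "N0 \<le> ?D r" by (rule T3(2)) (use r(1) in simp)
  ultimately show False by (simp add: N0_def)
qed

end

section \<open>Completeness of the mixed system\<close>

context de_branges_phase
begin

lemma exact_interpolation:
  assumes c: "dB_complete E ((\<lambda>l. repkernel E (of_real l)) ` L)" and F: "F \<in> deBranges E" and H: "H \<in> deBranges E"
    and eq: "\<And>l. l \<in> L \<Longrightarrow> F (of_real l) = H (of_real l)"
  shows "F z = H z"
proof -
  have "(\<lambda>z. F z - H z) z = 0"
    by (rule complete_kernels_unique[OF c deBranges_diff[OF F H]]) (simp add: eq)
  then show ?thesis by simp
qed

text \<open>The sum of h and \<open>star h\<close>, and i times their difference, are real on the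
  real line, and they cannot both vanish at a point where h does not. Orthogonality survives because
  each \<open>G l\<close> is its own star, so that \<open>star h\<close> has the conjugate inner
  product with it.\<close>

lemma exists_real_orthogonal:
  assumes h: "h \<in> deBranges E" and nz: "\<exists>z. h z \<noteq> 0"
    and G: "\<And>l. l \<in> A \<Longrightarrow> G l \<in> deBranges E \<and> star (G l) = G l \<and> dB_inner E h (G l) = 0"
    and h0: "\<And>l. l \<in> B \<Longrightarrow> h (of_real l) = 0"
  shows "\<exists>k\<in>deBranges E. star k = k \<and> (\<exists>z. k z \<noteq> 0) \<and> (\<forall>l\<in>A. dB_inner E k (G l) = 0) \<and> (\<forall>l\<in>B. k (of_real l) = 0)"
proof -
  have hs: "star h \<in> deBranges E" by (rule deBranges_star[OF h])
  have si: "dB_inner E (star h) (G l) = 0" if "l \<in> A" for l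
  proof -
    have "dB_inner E (star h) (star (G l)) = 0" unfolding dB_inner_star using G[OF that] by simp
    then show ?thesis using G[OF that] by simp
  qed
  have wit: ?thesis
    if st: "star (\<lambda>z. a * h z + b * star h z) = (\<lambda>z. a * h z + b * star h z)" and ne: "a * h z + b * star h z \<noteq> 0"
    for a b z :: complex
  proof -
    let ?k = "\<lambda>z. a * h z + b * star h z"
    have 1: "?k \<in> deBranges E" by (rule deBranges_add[OF deBranges_cmult[OF h] deBranges_cmult[OF hs]])
    have 2: "dB_inner E ?k (G l) = 0" if l: "l \<in> A" for l
    proof -
      have Gl: "G l \<in> deBranges E" using G[OF l] by blast
      show ?thesis
        unfolding dB_inner_add_left[OF deBranges_cmult[OF h] deBranges_cmult[OF hs] Gl] dB_inner_cmult_left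
        using G[OF l] si[OF l] by simp
    qed
    have 3: "?k (of_real l) = 0" if "l \<in> B" for l using h0[OF that] by simp
    have 4: "\<exists>z. ?k z \<noteq> 0" by (rule exI[of _ z], rule ne)
    have W: "star ?k = ?k \<and> (\<exists>z. ?k z \<noteq> 0) \<and> (\<forall>l\<in>A. dB_inner E ?k (G l) = 0) \<and> (\<forall>l\<in>B. ?k (of_real l) = 0)"
      by (intro conjI ballI st 4 2 3)
    show ?thesis by (rule bexI[where x = ?k], rule W, rule 1)
  qed
  obtain z where z: "h z \<noteq> 0" using nz by blast
  show ?thesis
  proof (cases "h z + star h z = 0")
    case False
    have "star (\<lambda>z. 1 * h z + 1 * star h z) = (\<lambda>z. 1 * h z + 1 * star h z)"
      by (simp add: star_def fun_eq_iff add.commute)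
    moreover have "1 * h z + 1 * star h z \<noteq> 0" using False by simp
    ultimately show ?thesis by (rule wit)
  next
    case True
    have "star (\<lambda>z. \<i> * h z + (- \<i>) * star h z) = (\<lambda>z. \<i> * h z + (- \<i>) * star h z)"
      by (simp add: star_def fun_eq_iff add.commute)
    moreover have "\<i> * h z + (- \<i>) * star h z \<noteq> 0"
    proof -
      have "star h z = - h z" using True by (simp add: add_eq_0_iff)
      then show ?thesis using z by simp
    qed
    ultimately show ?thesis by (rule wit)
  qed
qed

text \<open>A biorthogonal function cannot have a zero outside the interpolation nodes, nor a double zero:
  moving such a zero $z$ to the omitted node $l_0$ would give a function vanishing on all nodes.\<close>

lemma biorthogonal_no_extra_zero:
  assumes c: "dB_complete E ((\<lambda>l. repkernel E (of_real l)) ` L)" and g: "g \<in> deBranges E"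
    and g0: "g (of_real l0) = 1" and gl: "\<And>l. l \<in> L - {l0} \<Longrightarrow> g (of_real l) = 0"
    and z: "g z = 0" and q: "\<And>l. l \<in> L - {l0} \<Longrightarrow> quot g z (of_real l) = 0"
  shows False
proof -
  let ?q = "quot g z" let ?l = "complex_of_real l0"
  have Q: "?q w = ?q ?l * g w" for w
  proof (rule exact_interpolation[OF c deBranges_quot[OF g z] deBranges_cmult[OF g]])
    fix l assume l: "l \<in> L"
    show "?q (of_real l) = ?q ?l * g (of_real l)"
    proof (cases "l = l0")
      case True
      then show ?thesis by (simp only: g0 mult_1_right)
    next
      case False
      then have l': "l \<in> L - {l0}" using l by blast
      show ?thesis unfolding q[OF l'] gl[OF l'] by simp
    qed
  qed
  have gw: "g w = (w - z) * (?q ?l * g w)" for w using quot_factor[of g z w, OF z] unfolding Q[of w] .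
  have one: "(?l - z) * ?q ?l = 1" using gw[of ?l] unfolding g0 by simp
  have "(0 :: complex) = (w - ?l) * g w" for w
  proof -
    have "(?l - z) * g w = (w - z) * (((?l - z) * ?q ?l) * g w)"
      using arg_cong[OF gw[of w], of "\<lambda>y. (?l - z) * y"] by (simp only: mult_ac)
    then have "(?l - z) * g w = (w - z) * g w" unfolding one by simp
    then show ?thesis by (simp add: algebra_simps)
  qed
  then have qg: "quot (\<lambda>_. 0) ?l = g" by (rule quot_eqI[OF deBranges_entire[OF g]])
  have q0: "quot (\<lambda>_. 0) ?l = (\<lambda>_. 0)" by (rule quot_eqI) (simp_all add: entire_def)
  have "g ?l = 0" by (rule fun_cong[OF trans[OF qg[symmetric] q0]])
  then show False using g0 by simp
qed

end

text \<open>For d strictly between 0 and the upper density, failure for all large r would bound the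
  quotient by d, and so the density. The failed inequality itself shows that phi(r) - phi(-r) is
  positive, so the extended quotient is an ordinary one.\<close>

lemma positive_upper_density:
  assumes pos: "0 < upper_phi_density \<phi> L" and fin: "\<And>r. finite {l \<in> L. \<bar>l\<bar> \<le> r}"
  shows "\<exists>\<delta>>0. \<forall>N. \<exists>r\<ge>N. \<delta> * (\<phi> r - \<phi> (- r)) \<le> real (card {l \<in> L. \<bar>l\<bar> \<le> r})"
proof -
  obtain d where d: "0 < ereal d" "ereal d < upper_phi_density \<phi> L" using ereal_dense2[OF pos] by blast
  have d0: "0 < d" using d(1) by simp
  have "\<exists>r\<ge>N. d * (\<phi> r - \<phi> (- r)) \<le> real (card {l \<in> L. \<bar>l\<bar> \<le> r})" for N
  proof (rule ccontr)
    assume n: "\<not> ?thesis"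
    have "counting L r / ereal (\<phi> r - \<phi> (- r)) \<le> ereal d" if r: "N \<le> r" for r
    proof -
      have lt: "real (card {l \<in> L. \<bar>l\<bar> \<le> r}) < d * (\<phi> r - \<phi> (- r))" using n r by auto
      then have "0 < d * (\<phi> r - \<phi> (- r))" by (rule le_less_trans[OF of_nat_0_le_iff])
      then have D: "0 < \<phi> r - \<phi> (- r)" using d0 by (simp only: zero_less_mult_iff) linarith
      then have "real (card {l \<in> L. \<bar>l\<bar> \<le> r}) / (\<phi> r - \<phi> (- r)) \<le> d" using lt by (simp only: pos_divide_le_eq)
      moreover have "counting L r = ereal (real (card {l \<in> L. \<bar>l\<bar> \<le> r}))" using fin by (simp add: counting_def)
      moreover have "\<phi> r - \<phi> (- r) \<noteq> 0" using D by linarith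
      ultimately show ?thesis by (simp only: ereal_divide if_False ereal_less_eq)
    qed
    then have "\<forall>\<^sub>F r in at_top. counting L r / ereal (\<phi> r - \<phi> (- r)) \<le> ereal d"
      unfolding eventually_at_top_linorder by blast
    then have "upper_phi_density \<phi> L \<le> ereal d" unfolding upper_phi_density_def by (rule Limsup_bounded)
    then show False using d(2) by simp
  qed
  then show ?thesis using d0 by blast
qed

text \<open>The maximum with 1 makes the powers of c in \<open>chain\<close> at least 1 and lets K
  absorb additive constants.\<close>

lemma phase_side_ratio:
  assumes deriv: "\<And>t. (\<phi> has_real_derivative \<phi>' t) (at t)" and pos: "\<And>t. 0 < \<phi>' t"
    and C: "\<forall>x. \<bar>\<phi> (2 * x)\<bar> / (\<bar>\<phi> x\<bar> + 1) \<le> C"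
    and c: "\<forall>a b. 1/2 \<le> \<phi> a / \<phi> b \<and> \<phi> a / \<phi> b \<le> 2 \<longrightarrow> \<bar>\<phi>' a / \<phi>' b\<bar> \<le> c"
  shows "phase_side \<phi> \<phi>' (max c 1) (max C 1)"
proof
  fix x a b t
  show "(\<phi> has_real_derivative \<phi>' t) (at t)" "0 < \<phi>' t" "1 \<le> max c 1" "1 \<le> max C 1" by (auto simp: deriv pos)
  have p: "0 < \<bar>\<phi> x\<bar> + 1" by linarith
  then have "\<bar>\<phi> (2 * x)\<bar> \<le> C * (\<bar>\<phi> x\<bar> + 1)" using C by (simp only: pos_divide_le_eq)
  also have "\<dots> \<le> max C 1 * (\<bar>\<phi> x\<bar> + 1)" using p by (intro mult_right_mono) auto
  finally show "\<bar>\<phi> (2 * x)\<bar> \<le> max C 1 * (\<bar>\<phi> x\<bar> + 1)" .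
  show "\<phi>' a \<le> max c 1 * \<phi>' b" if "1/2 \<le> \<phi> a / \<phi> b" "\<phi> a / \<phi> b \<le> 2"
  proof -
    have "\<bar>\<phi>' a / \<phi>' b\<bar> \<le> c" using c that by blast
    then have "\<phi>' a / \<phi>' b \<le> max c 1" by linarith
    then show ?thesis using pos[of b] by (simp only: pos_divide_le_eq)
  qed
qed

theorem theorem1p5:
  fixes E :: "complex \<Rightarrow> complex" and \<phi> \<phi>' :: "real \<Rightarrow> real"
    and L L1 L2 :: "real set" and g :: "real \<Rightarrow> complex \<Rightarrow> complex"
  assumes HB: "hermite_biehler E"
    and phase: "phase_function E \<phi> \<phi>'"
    and Linf: "\<exists>M. AE t in lborel. \<bar>\<phi>' t\<bar> \<le> M"
    and doubling: "\<exists>C. \<forall>x. \<bar>\<phi> (2 * x)\<bar> / (\<bar>\<phi> x\<bar> + 1) \<le> C"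
    and ratio: "\<exists>c>0. \<forall>a b. 1/2 \<le> \<phi> a / \<phi> b \<and> \<phi> a / \<phi> b \<le> 2 \<longrightarrow> \<bar>\<phi>' a / \<phi>' b\<bar> \<le> c"
    and exact: "kernels_exact E L"
    and biorth: "\<forall>l\<in>L. g l \<in> deBranges E \<and>
                   (\<forall>\<mu>\<in>L. dB_inner E (g l) (repkernel E (of_real \<mu>)) = (if l = \<mu> then 1 else 0))"
    and part: "L = L1 \<union> L2" "L1 \<inter> L2 = {}"
    and dens: "upper_phi_density \<phi> L1 > 0"
  shows "dB_complete E (g ` L1 \<union> (\<lambda>l. repkernel E (of_real l)) ` L2)"
proof (rule ccontr)
  assume nc: "\<not> dB_complete E (g ` L1 \<union> (\<lambda>l. repkernel E (of_real l)) ` L2)"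
  let ?S = "g ` L1 \<union> (\<lambda>l. repkernel E (of_real l)) ` L2"
  obtain M where M: "AE t in lborel. \<bar>\<phi>' t\<bar> \<le> M" using Linf by blast
  interpret de_branges_phase E \<phi> \<phi>' M by unfold_locales (use HB phase M in auto)
  obtain C where C: "\<forall>x. \<bar>\<phi> (2 * x)\<bar> / (\<bar>\<phi> x\<bar> + 1) \<le> C" using doubling by blast
  obtain c where c: "\<forall>a b. 1/2 \<le> \<phi> a / \<phi> b \<and> \<phi> a / \<phi> b \<le> 2 \<longrightarrow> \<bar>\<phi>' a / \<phi>' b\<bar> \<le> c"
    using ratio by blast
  have ps: "phase_side \<phi> \<phi>' (max c 1) (max C 1)" by (rule phase_side_ratio[OF phase_deriv phase_deriv_pos C c])
  have comp: "dB_complete E ((\<lambda>l. repkernel E (of_real l)) ` L)" using exact by (simp add: kernels_exact_def)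
  have gB: "g l \<in> deBranges E" if "l \<in> L" for l using biorth that by blast
  have gv: "g l (of_real \<mu>) = (if l = \<mu> then 1 else 0)" if "l \<in> L" "\<mu> \<in> L" for l \<mu>
    using biorth that reproducing_real[OF gB[OF that(1)], of \<mu>] by simp
  \<comment> \<open>\<open>star (g l)\<close> takes the same values at the real nodes, and a
    function of the space is determined by these.\<close>
  have gs: "star (g l) = g l" if l: "l \<in> L" for l
  proof
    show "star (g l) z = g l z" for z
      by (rule exact_interpolation[OF comp deBranges_star[OF gB[OF l]] gB[OF l]]) (simp add: gv[OF l])
  qed
  have SB: "?S \<subseteq> deBranges E" using gB part(1) repkernel_deBranges by auto
  obtain F where F: "F \<in> deBranges E" "\<not> in_closed_span E ?S F" using nc by (auto simp: dB_complete_def)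
  have "\<exists>k. k \<in> deBranges E \<and> (\<exists>z. k z \<noteq> 0) \<and> (\<forall>s\<in>?S. dB_inner E k s = 0)"
  proof (rule not_in_closed_span_orthogonal[OF SB F])
    fix k assume k: "k \<in> deBranges E" "\<exists>z. k z \<noteq> 0" "\<And>s. s \<in> ?S \<Longrightarrow> dB_inner E k s = 0"
    show ?thesis by (rule exI[of _ k], intro conjI ballI k)
  qed
  then obtain k where k: "k \<in> deBranges E" "\<exists>z. k z \<noteq> 0" "\<forall>s\<in>?S. dB_inner E k s = 0" by blast
  have "\<exists>h\<in>deBranges E. star h = h \<and> (\<exists>z. h z \<noteq> 0) \<and> (\<forall>l\<in>L1. dB_inner E h (g l) = 0) \<and> (\<forall>l\<in>L2. h (of_real l) = 0)"
  proof (rule exists_real_orthogonal[OF k(1,2)])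
    show "g l \<in> deBranges E \<and> star (g l) = g l \<and> dB_inner E k (g l) = 0" if "l \<in> L1" for l
      using that gB gs k(3) part(1) by blast
    show "k (of_real l) = 0" if "l \<in> L2" for l
      using bspec[OF k(3), of "repkernel E (of_real l)"] that reproducing_real[OF k(1), of l] by auto
  qed
  then obtain h where hB: "h \<in> deBranges E" and hs: "star h = h" and hn: "\<exists>z. h z \<noteq> 0"
    and hg: "\<And>l. l \<in> L1 \<Longrightarrow> dB_inner E h (g l) = 0" and h2: "\<And>l. l \<in> L2 \<Longrightarrow> h (of_real l) = 0"
    by blast
  have gh: "dB_inner E (g l) h = 0" if "l \<in> L1" for l
    using dB_inner_cnj[of h "g l"] hg[OF that] by simp
  \<comment> \<open>The node l0 has to come from L1; an empty L1 would have no positive density,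
    since phi(-r) < phi(r).\<close>
  have "L1 \<noteq> {}"
  proof
    assume "L1 = {}"
    then obtain d where "0 < d" "\<forall>N. \<exists>r\<ge>N. d * (\<phi> r - \<phi> (- r)) \<le> real (card {l \<in> L1. \<bar>l\<bar> \<le> r})"
      using positive_upper_density[OF dens] by auto
    then obtain r where r: "1 \<le> r" "d * (\<phi> r - \<phi> (- r)) \<le> 0" using \<open>L1 = {}\<close> by fastforce
    have "\<phi> (- r) < \<phi> r" by (rule phase_side.less[OF ps]) (use r in simp)
    then have "0 < d * (\<phi> r - \<phi> (- r))" using \<open>0 < d\<close> by simp
    then show False using r(2) by linarith
  qed
  then obtain l0 where l0: "l0 \<in> L1" by blast
  then have l0L: "l0 \<in> L" using part(1) by blast
  let ?g = "g l0"
  have g0: "?g (of_real l0) = 1" using gv[OF l0L l0L] by simp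
  have gl: "?g (of_real l) = 0" if "l \<in> L - {l0}" for l using gv[OF l0L, of l] that by auto
  interpret mixed_orthogonal E \<phi> \<phi>' M ?g h l0 L1 L2
  proof
    show "?g \<in> deBranges E" "h \<in> deBranges E" "star ?g = ?g" "star h = h" "?g (of_real l0) = 1" "l0 \<in> L1"
      "\<exists>z. h z \<noteq> 0" "L1 \<inter> L2 = {}"
      by (rule gB[OF l0L], rule hB, rule gs[OF l0L], rule hs, rule g0, rule l0, rule hn, rule part(2))
    show "h (of_real l) = 0" if "l \<in> L2" for l by (rule h2[OF that])
    have zero: "z \<in> of_real ` (L1 \<union> L2 - {l0})" if z: "?g z = 0" for z
    proof (rule ccontr)
      assume n: "z \<notin> of_real ` (L1 \<union> L2 - {l0})"
      show False
      proof (rule biorthogonal_no_extra_zero[OF comp gB[OF l0L] g0 gl z])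
        fix l assume l: "l \<in> L - {l0}"
        then have "of_real l \<noteq> z" using n part(1) by blast
        then show "quot ?g z (of_real l) = 0" using quot_factor[of ?g z "of_real l", OF z] gl[OF l] by simp
      qed
    qed
    show "?g z = 0 \<longleftrightarrow> z \<in> of_real ` (L1 \<union> L2 - {l0})" for z
      using zero gl part(1) by blast
    show "deriv ?g z \<noteq> 0" if z: "?g z = 0" for z
    proof
      assume d: "deriv ?g z = 0"
      show False
      proof (rule biorthogonal_no_extra_zero[OF comp gB[OF l0L] g0 gl z])
        fix l assume l: "l \<in> L - {l0}"
        show "quot ?g z (of_real l) = 0"
        proof (cases "of_real l = z")
          case True
          then show ?thesis using d by (simp add: quot_self)
        next
          case False
          then show ?thesis using quot_factor[of ?g z "of_real l", OF z] gl[OF l] by simp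
        qed
      qed
    qed
    \<comment> \<open>Interpolation at the nodes: the divided function vanishes at every node except
      possibly l0 and l, so it is a combination of the biorthogonal functions of these two, both
      orthogonal to h.\<close>
    show "dB_inner E (quot ?g (of_real l)) h = 0" if l: "l \<in> L1" "l \<noteq> l0" for l
    proof -
      let ?q = "quot ?g (of_real l)"
      have lL: "l \<in> L" using l part(1) by blast
      have gz: "?g (of_real l) = 0" using gl lL l by blast
      let ?a = "?q (of_real l0)" and ?d = "?q (of_real l)"
      have qB: "?q \<in> deBranges E" by (rule deBranges_quot[OF gB[OF l0L] gz])
      have c1: "(\<lambda>z. ?a * ?g z) \<in> deBranges E" and c2: "(\<lambda>z. ?d * g l z) \<in> deBranges E"
        by (rule deBranges_cmult[OF gB[OF l0L]], rule deBranges_cmult[OF gB[OF lL]])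
      have "?q z = ?a * ?g z + ?d * g l z" for z
      proof (rule exact_interpolation[OF comp qB deBranges_add[OF c1 c2]])
        fix \<mu> assume \<mu>: "\<mu> \<in> L"
        show "?q (of_real \<mu>) = ?a * ?g (of_real \<mu>) + ?d * g l (of_real \<mu>)"
        proof (cases "\<mu> = l0 \<or> \<mu> = l")
          case True
          then show ?thesis using gv[OF l0L \<mu>] gv[OF lL \<mu>] l by auto
        next
          case False
          have "?q (of_real \<mu>) = 0"
            using quot_factor[of ?g "of_real l" "of_real \<mu>", OF gz] gl[of \<mu>] False \<mu> by simp
          then show ?thesis using gv[OF l0L \<mu>] gv[OF lL \<mu>] False by auto
        qed
      qed
      then have "?q = (\<lambda>z. ?a * ?g z + ?d * g l z)" by blast
      then have "dB_inner E ?q h = dB_inner E (\<lambda>z. ?a * ?g z + ?d * g l z) h" by (rule arg_cong)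
      also have "\<dots> = 0"
        unfolding dB_inner_add_left[OF c1 c2 hB] dB_inner_cmult_left gh[OF l0] gh[OF l(1)] by simp
      finally show ?thesis .
    qed
    show "F z = F (of_real l0) * ?g z"
      if "F \<in> deBranges E" "\<And>l. l \<in> L1 \<union> L2 - {l0} \<Longrightarrow> F (of_real l) = 0" for F z
    proof (rule exact_interpolation[OF comp that(1) deBranges_cmult[OF gB[OF l0L]]])
      fix l assume l: "l \<in> L"
      show "F (of_real l) = F (of_real l0) * ?g (of_real l)"
        using g0 gl[of l] that(2)[of l] l part(1) by (cases "l = l0") auto
    qed
  qed
  obtain d where d: "0 < d" "\<And>N. \<exists>r\<ge>N. d * (\<phi> r - \<phi> (- r)) \<le> real (card {l \<in> L1. \<bar>l\<bar> \<le> r})"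
    using positive_upper_density[OF dens finite_Lam1_abs] by blast
  show False
    by (rule positive_density_contradiction[OF ps d(1)]) (use d(2) in \<open>simp add: phase_side.Delta_def[OF ps]\<close>)
qed

end
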